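(* Let $E\to(X,\omega)$ be a holomorphic vector bundle over a compact K\"ahler manifold with a Hermitian metric $h$, let $Z$ be a polynomial central charge with $Z(E)\neq0$ and fixed representatives $\omega,\tilde U$, let $\mathcal{A}(h)$ be the space of integrable $h$-unitary (Chern) connections, and let $\mathcal{A}(h)^Z\subset\mathcal{A}(h)$ be the locus of subsolutions of the $Z$-critical equation. Then on $\mathcal{A}(h)^Z$ the $Z$-critical equation is elliptic and arises from an infinite-dimensional moment map construction with respect to the action of the gauge group; precisely: (1) for every $A\in\mathcal{A}(h)^Z$, the $Z$-critical operator $D_Z$ is elliptic at $A$, i.e. the linearisation at $V=0$ of $V\mapsto D_Z(\exp(V)\cdot A)$ on Hermitian endomorphisms $V$ is a linear elliptic operator; (2) the two-form $\Omega_Z$ is closed, non-degenerate and invariant under the unitary gauge group $\mathcal{G}(h)$ on $\mathcal{A}(h)^Z$, and the map $A\mapsto 2\pi i\,D_Z(A)$ is a moment map for the action of $\mathcal{G}(h)$ on $(\mathcal{A}(h)^Z,\Omega_Z)$: it is $\mathcal{G}(h)$-equivariant, and for every skew-Hermitian endomorphism $\phi$ of $E$ and every $b\in T_A\mathcal{A}(h)^Z$, $$d\big(\langle 2\pi i\, D_Z,\phi\rangle\big)_A(b)=-\Omega_Z(A)(d_A\phi,b).$$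
   Context: Let $n=\dim X$. A stability vector is $\rho=(\rho_0,\dots,\rho_n)\in(\mathbb{C}^* )^{n+1}$ with $\mathrm{Im}(\rho_n)>0$ and $\mathrm{Im}(\rho_d/\rho_{d+1})>0$ for $d<n$. A polynomial central charge is given by such $\rho$, the K\"ahler class $[\omega]$ and a real class $U=1+N$, $N\in H^{>0}(X,\mathbb{R})$, with $Z(E)=\int_X\big(\sum_d\rho_d[\omega]^d\big)\cdot\mathrm{Ch}(E)\cdot U$; put $\varphi(E)=\arg Z(E)$. Fix $\omega$ and any (closed) real differential form $\tilde U$ representing $U$, with degree $2\ell$ component $\tilde U_\ell$. With $F_A$ the curvature of $A$, set $\tilde Z(A)=\sum_{d+j+\ell=n}\rho_d\,\omega^d\wedge\frac1{j!}\big(\tfrac{i}{2\pi}F_A\big)^j\wedge\tilde U_\ell$, and let $\tilde Z'(A)$ be the $\mathrm{End}(E)$-valued $(n-1,n-1)$-form given by its formal derivative with respect to $\tfrac{i}{2\pi}F_A$: $\tilde Z'(A)=\sum_{d+j+\ell=n,\,j\ge1}\rho_d\,\omega^d\wedge\frac{1}{(j-1)!}\big(\tfrac{i}{2\pi}F_A\big)^{j-1}\wedge\tilde U_\ell$. $\mathrm{Im}(T)=(T-T^* )/(2i)$ with respect to $h$. The $Z$-critical operator is $D_Z(A)=\mathrm{Im}\big(e^{-i\varphi(E)}\tilde Z(A)\big)$; $A$ is $Z$-critical if $D_Z(A)=0$. Graded symmetrisation: for $\mathrm{End}(E)$-valued forms $B_1,\dots,B_m$, $[B_1\wedge\cdots\wedge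 B_m]_{\mathrm{sym}}=\frac1{m!}\sum_{\sigma\in S_m}(-1)^{\mathrm{grsgn}\,\sigma}B_{\sigma(1)}\wedge\cdots\wedge B_{\sigma(m)}$, where an adjacent transposition of $B_i,B_{i+1}$ contributes $\deg B_i\deg B_{i+1}$ mod 2 to $\mathrm{grsgn}$. In products $F_A^{j}$ each factor $F_A$ is treated as a separate endomorphism, and scalar forms simply multiply; the symmetrisation of a sum of such products is extended linearly. $A$ is a subsolution if $\mathrm{Im}(e^{-i\varphi(E)}\tilde Z'(A))>0$, meaning that for every $x\in X$ and non-zero $u\in T^*_{0,1}X_x\otimes\mathrm{End}(E)_x$ one has $\mathrm{tr}\, i\big[\mathrm{Im}(e^{-i\varphi(E)}\tilde Z'(A))\wedge u^*\wedge u\big]_{\mathrm{sym}}>0$ as an $(n,n)$-form at $x$, where $(\xi\otimes V)^*=\bar\xi\otimes V^*$. Hermitian endomorphisms act on Chern connections by $g\cdot d_A=g\circ\bar\partial_A\circ g^{-1}+g^{-1}\circ\partial_A\circ g$ with $g=\exp(V)$. Tangent vectors to $\mathcal{A}(h)$ are $\mathrm{End}_{SH}(E,h)$-valued (skew-Hermitian) one-forms $a$ with $\bar\partial_Aa^{0,1}=0$. The infinitesimal gauge action of $\phi$ is $d_A\phi$. The two-form is $$\Omega_Z(A)(a,b)=\int_X\mathrm{tr}\big[a\wedge b\wedge\mathrm{Im}(e^{-i\varphi(E)}\tilde Z'(A))\big]_{\mathrm{sym}}.$$ The space of $\mathrm{End}_{SH}(E,h)$-valued $(n,n)$-forms $\psi$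 is identified with the dual of $\mathrm{Lie}\,\mathcal{G}(h)=\Omega^0(\mathrm{End}_{SH}(E,h))$ via $\langle\psi,\phi\rangle=-\int_X\mathrm{tr}(\phi\psi)$. *)

theory Defs
  imports "HOL-Analysis.Analysis"
begin

section \<open>Matrices\<close>

type_synonym 'r cmat = "complex^'r^'r"

definition csm :: "complex \<Rightarrow> 'r::finite cmat \<Rightarrow> 'r cmat" where
  "csm c M = (\<chi> a b. c * M$a$b)"

definition ctransp :: "'r::finite cmat \<Rightarrow> 'r cmat" where
  "ctransp M = (\<chi> a b. cnj (M$b$a))"

text \<open>The Gram matrix \<open>H\<close> of a Hermitian metric in a local frame means
  \<open>h(s,t) = t\<^sup>* H s\<close>; \<open>hadj H M\<close> is the adjoint of \<open>M\<close> with respect to \<open>h\<close>.\<close>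

definition hadj :: "'r::finite cmat \<Rightarrow> 'r cmat \<Rightarrow> 'r cmat" where
  "hadj H M = matrix_inv H ** ctransp M ** H"

definition pos_def_herm :: "'r::finite cmat \<Rightarrow> bool" where
  "pos_def_herm H \<longleftrightarrow> ctransp H = H \<and>
     (\<forall>v. v \<noteq> 0 \<longrightarrow> Re (\<Sum>a\<in>UNIV. cnj (v$a) * (H *v v)$a) > 0)"

fun mpow :: "'r::finite cmat \<Rightarrow> nat \<Rightarrow> 'r cmat" where
  "mpow M 0 = mat 1"
| "mpow M (Suc k) = M ** mpow M k"

definition mexp :: "'r::finite cmat \<Rightarrow> 'r cmat" where
  "mexp M = (\<Sum>k. (1 / fact k) *\<^sub>R mpow M k)"

section \<open>Smooth and holomorphic functions on open subsets of complex coordinate space\<close>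

fun Ck_on :: "nat \<Rightarrow> 'a::euclidean_space set \<Rightarrow> ('a \<Rightarrow> 'b::real_normed_vector) \<Rightarrow> bool" where
  "Ck_on 0 S f \<longleftrightarrow> continuous_on S f"
| "Ck_on (Suc k) S f \<longleftrightarrow> (\<forall>y\<in>S. f differentiable (at y)) \<and>
     (\<forall>v. Ck_on k S (\<lambda>y. frechet_derivative f (at y) v))"

definition smooth_fun_on :: "'a::euclidean_space set \<Rightarrow> ('a \<Rightarrow> 'b::real_normed_vector) \<Rightarrow> bool" where
  "smooth_fun_on S f \<longleftrightarrow> (\<forall>k. Ck_on k S f)"

definition chol_on :: "(complex^'n::finite) set \<Rightarrow> (complex^'n \<Rightarrow> complex) \<Rightarrow> bool" where
  "chol_on S f \<longleftrightarrow> smooth_fun_on S f \<and>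
     (\<forall>y\<in>S. \<forall>c v. frechet_derivative f (at y) (c *s v) = c * frechet_derivative f (at y) v)"

section \<open>Exterior algebra at a point\<close>

text \<open>An exterior form at a point, possibly of mixed degree, is a function on lists of real tangent
  vectors; its degree \<open>k\<close> part is its restriction to lists of length \<open>k\<close>.  The real tangent
  space of a complex \<open>n\<close>-manifold is \<open>complex^'n\<close>, with complex structure \<open>v \<mapsto> \<i> *s v\<close>.\<close>

type_synonym ('n, 'a) alt = "(complex^'n) list \<Rightarrow> 'a"

definition altform :: "nat \<Rightarrow> ('n::finite, 'a::real_vector) alt \<Rightarrow> bool" where
  "altform k f \<longleftrightarrow>
     (\<forall>vs. length vs \<noteq> k \<longrightarrow> f vs = 0) \<and>
     (\<forall>vs m. length vs = k \<and> m < k \<longrightarrow> linear (\<lambda>v. f (vs[m := v]))) \<and>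
     (\<forall>vs. length vs = k \<and> \<not> distinct vs \<longrightarrow> f vs = 0)"

definition comp_deg :: "nat \<Rightarrow> ('n::finite, 'a::zero) alt \<Rightarrow> ('n, 'a) alt" where
  "comp_deg k f = (\<lambda>vs. if length vs = k then f vs else 0)"

definition form0 :: "'a::zero \<Rightarrow> ('n::finite, 'a) alt" where
  "form0 c = (\<lambda>vs. if vs = [] then c else 0)"

text \<open>Wedge product relative to a product \<open>bm\<close> of the values, as a sum over shuffles: \<open>S\<close> is the
  set of positions of the vectors inserted into the first factor.  The convention is the one with
  \<open>(\<alpha> \<and> \<beta>)(v, w) = \<alpha>(v) \<beta>(w) - \<alpha>(w) \<beta>(v)\<close> for one-forms.\<close>

definition wedge :: "('a \<Rightarrow> 'b \<Rightarrow> 'c) \<Rightarrow> ('n::finite, 'a) alt \<Rightarrow> ('n, 'b) alt \<Rightarrow> ('n, 'c::real_vector) alt" where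
  "wedge bm f g = (\<lambda>vs. \<Sum>S\<in>Pow {..<length vs}.
     ((-1) ^ card {(a, b). a < b \<and> b < length vs \<and> b \<in> S \<and> a \<notin> S}) *\<^sub>R
       bm (f (nths vs S)) (g (nths vs (- S))))"

abbreviation wedge_cc :: "('n::finite, complex) alt \<Rightarrow> ('n, complex) alt \<Rightarrow> ('n, complex) alt"
  where "wedge_cc \<equiv> wedge (*)"

abbreviation wedge_cm :: "('n::finite, complex) alt \<Rightarrow> ('n, 'r::finite cmat) alt \<Rightarrow> ('n, 'r cmat) alt"
  where "wedge_cm \<equiv> wedge csm"

abbreviation wedge_mm :: "('n::finite, 'r::finite cmat) alt \<Rightarrow> ('n, 'r cmat) alt \<Rightarrow> ('n, 'r cmat) alt"
  where "wedge_mm \<equiv> wedge (**)"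

fun wpow :: "('n::finite, complex) alt \<Rightarrow> nat \<Rightarrow> ('n, complex) alt" where
  "wpow f 0 = form0 1"
| "wpow f (Suc k) = wedge_cc f (wpow f k)"

definition mprod :: "('n::finite, 'r::finite cmat) alt list \<Rightarrow> ('n, 'r cmat) alt" where
  "mprod Bs = foldr wedge_mm Bs (form0 (mat 1))"

definition part10 :: "('n::finite, 'r::finite cmat) alt \<Rightarrow> ('n, 'r cmat) alt" where
  "part10 f = (\<lambda>vs. csm (1/2) (f vs - csm \<i> (f (map (\<lambda>v. \<i> *s v) vs))))"

definition part01 :: "('n::finite, 'r::finite cmat) alt \<Rightarrow> ('n, 'r cmat) alt" where
  "part01 f = (\<lambda>vs. csm (1/2) (f vs + csm \<i> (f (map (\<lambda>v. \<i> *s v) vs))))"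

text \<open>The \<open>(0,2)\<close>-part of a two-form: apply the projection \<open>v \<mapsto> (v + \<i> J v) / 2\<close> onto
  vectors of type \<open>(0,1)\<close> in each slot.\<close>

definition part02 :: "('n::finite, 'r::finite cmat) alt \<Rightarrow> complex^'n \<Rightarrow> complex^'n \<Rightarrow> 'r cmat" where
  "part02 f v w = csm (1/4)
     (f [v, w] + csm \<i> (f [\<i> *s v, w]) + csm \<i> (f [v, \<i> *s w]) - f [\<i> *s v, \<i> *s w])"

definition adj_form :: "'r::finite cmat \<Rightarrow> ('n::finite, 'r cmat) alt \<Rightarrow> ('n, 'r cmat) alt" where
  "adj_form H f = (\<lambda>vs. hadj H (f vs))"

definition im_form :: "'r::finite cmat \<Rightarrow> ('n::finite, 'r cmat) alt \<Rightarrow> ('n, 'r cmat) alt" where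
  "im_form H f = (\<lambda>vs. csm (1 / (2 * \<i>)) (f vs - adj_form H f vs))"

text \<open>A positively oriented real frame \<open>e\<^sub>1, \<i> e\<^sub>1, \<dots>, e\<^sub>n, \<i> e\<^sub>n\<close>.  The enumeration of the
  index type is immaterial, since the vectors are permuted in pairs.\<close>

definition std_frame :: "(complex^'n::finite) list" where
  "std_frame = concat (map (\<lambda>k. [axis k 1, axis k \<i>])
     (SOME ks. distinct ks \<and> set ks = UNIV))"

section \<open>Formal sums of products and graded symmetrisation\<close>

text \<open>A term \<open>(c, [(p\<^sub>1, B\<^sub>1), \<dots>, (p\<^sub>m, B\<^sub>m)])\<close> stands for the formal product
  \<open>c \<and> B\<^sub>1 \<and> \<dots> \<and> B\<^sub>m\<close> of a scalar form \<open>c\<close> and endomorphism-valued forms \<open>B\<^sub>q\<close> of degree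
  \<open>p\<^sub>q\<close>; a list of terms is a formal sum.  Keeping the factors apart is needed because the
  symmetrisation treats each curvature factor as a separate endomorphism.\<close>

type_synonym ('n, 'r) fterm = "('n, complex) alt \<times> (nat \<times> ('n, 'r cmat) alt) list"

text \<open>Parity of the degrees exchanged by reordering: each inversion of \<open>\<sigma>\<close> contributes the product of
  the two degrees.\<close>

definition grsgn :: "nat list \<Rightarrow> (nat \<Rightarrow> nat) \<Rightarrow> nat" where
  "grsgn ps \<sigma> = (\<Sum>(a, b)\<in>{(a, b). a < b \<and> b < length ps \<and> \<sigma> b < \<sigma> a}. ps ! \<sigma> a * ps ! \<sigma> b)"

definition gsym :: "(nat \<times> ('n::finite, 'r::finite cmat) alt) list \<Rightarrow> ('n, 'r cmat) alt" where
  "gsym Bs = (\<lambda>vs. (1 / fact (length Bs)) *\<^sub>R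
     (\<Sum>\<sigma>\<in>{\<sigma>. \<sigma> permutes {..<length Bs}}.
        (-1) ^ grsgn (map fst Bs) \<sigma> *\<^sub>R mprod (map (\<lambda>q. snd (Bs ! \<sigma> q)) [0..<length Bs]) vs))"

definition fsym :: "('n::finite, 'r::finite) fterm list \<Rightarrow> ('n, 'r cmat) alt" where
  "fsym P = (\<lambda>vs. \<Sum>(c, Bs)\<leftarrow>P. wedge_cm c (gsym Bs) vs)"

definition fval :: "('n::finite, 'r::finite) fterm list \<Rightarrow> ('n, 'r cmat) alt" where
  "fval P = (\<lambda>vs. \<Sum>(c, Bs)\<leftarrow>P. wedge_cm c (mprod (map snd Bs)) vs)"

definition fscale :: "complex \<Rightarrow> ('n::finite, 'r::finite) fterm list \<Rightarrow> ('n, 'r) fterm list" where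
  "fscale z P = map (\<lambda>(c, Bs). (\<lambda>vs. z * c vs, Bs)) P"

text \<open>The formal adjoint, by \<open>(B\<^sub>1 \<and> B\<^sub>2)\<^sup>* = (-1)\<^bsup>p\<^sub>1 p\<^sub>2\<^esup> B\<^sub>2\<^sup>* \<and> B\<^sub>1\<^sup>*\<close>.\<close>

definition fadj :: "'r::finite cmat \<Rightarrow> ('n::finite, 'r) fterm list \<Rightarrow> ('n, 'r) fterm list" where
  "fadj H P = map (\<lambda>(c, Bs).
     (\<lambda>vs. (-1) ^ grsgn (map fst Bs) (\<lambda>q. length Bs - 1 - q) * cnj (c vs),
      rev (map (\<lambda>(p, B). (p, adj_form H B)) Bs))) P"

definition fim :: "'r::finite cmat \<Rightarrow> ('n::finite, 'r) fterm list \<Rightarrow> ('n, 'r) fterm list" where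
  "fim H P = fscale (1 / (2 * \<i>)) P @ fscale (- 1 / (2 * \<i>)) (fadj H P)"

definition fpre :: "(nat \<times> ('n::finite, 'r::finite cmat) alt) list \<Rightarrow> ('n, 'r) fterm list \<Rightarrow> ('n, 'r) fterm list"
  where "fpre Cs P = map (\<lambda>(c, Bs). (c, Cs @ Bs)) P"

definition fpost :: "('n::finite, 'r::finite) fterm list \<Rightarrow> (nat \<times> ('n, 'r cmat) alt) list \<Rightarrow> ('n, 'r) fterm list"
  where "fpost P Cs = map (\<lambda>(c, Bs). (c, Bs @ Cs)) P"

section \<open>Complex manifolds and Hermitian holomorphic vector bundles\<close>

text \<open>The manifold is the whole (Hausdorff) type \<open>'x\<close>, of complex dimension \<open>CARD('n)\<close>, with a
  holomorphic atlas indexed by \<open>idx\<close>.  The bundle, of rank \<open>CARD('r)\<close>, is given over the same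
  charts by a holomorphic cocycle: local coordinates of a section satisfy \<open>s\<^sub>i = trn i j \<cdot> s\<^sub>j\<close>.
  Requiring the bundle to be trivial over each chart is no restriction, since the atlas
  can be refined.  \<open>met i\<close> is the Gram matrix of the Hermitian metric in the frame over chart \<open>i\<close>,
  as a function of the coordinates.\<close>

record ('i, 'x, 'n::finite) cplx_atlas =
  idx :: "'i set"
  cdom :: "'i \<Rightarrow> 'x set"
  crd :: "'i \<Rightarrow> 'x \<Rightarrow> complex^'n"

record ('i, 'x, 'n::finite, 'r::finite) herm_bundle = "('i, 'x, 'n::finite) cplx_atlas" +
  trn :: "'i \<Rightarrow> 'i \<Rightarrow> 'x \<Rightarrow> complex^'r^'r"
  met :: "'i \<Rightarrow> complex^'n \<Rightarrow> complex^'r^'r"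

definition patch :: "('i, 'x, 'n::finite, 'z) cplx_atlas_scheme \<Rightarrow> 'i \<Rightarrow> (complex^'n) set" where
  "patch X i = crd X i ` cdom X i"

definition pt :: "('i, 'x, 'n::finite, 'z) cplx_atlas_scheme \<Rightarrow> 'i \<Rightarrow> complex^'n \<Rightarrow> 'x" where
  "pt X i = inv_into (cdom X i) (crd X i)"

definition overlap :: "('i, 'x, 'n::finite, 'z) cplx_atlas_scheme \<Rightarrow> 'i \<Rightarrow> 'i \<Rightarrow> (complex^'n) set" where
  "overlap X i j = crd X i ` (cdom X i \<inter> cdom X j)"

definition chg :: "('i, 'x, 'n::finite, 'z) cplx_atlas_scheme \<Rightarrow> 'i \<Rightarrow> 'i \<Rightarrow> complex^'n \<Rightarrow> complex^'n" where
  "chg X i j y = crd X j (pt X i y)"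

definition compact_complex_manifold ::
  "('i, 'x::t2_space, 'n::finite, 'z) cplx_atlas_scheme \<Rightarrow> bool" where
  "compact_complex_manifold X \<longleftrightarrow>
     compact (UNIV :: 'x set) \<and>
     (\<Union>i\<in>idx X. cdom X i) = UNIV \<and>
     (\<forall>i\<in>idx X. open (cdom X i) \<and> open (patch X i) \<and>
        homeomorphism (cdom X i) (patch X i) (crd X i) (pt X i)) \<and>
     (\<forall>i\<in>idx X. \<forall>j\<in>idx X. \<forall>a. chol_on (overlap X i j) (\<lambda>y. chg X i j y $ a))"

definition holomorphic_cocycle ::
  "('i, 'x::t2_space, 'n::finite, 'r::finite, 'z) herm_bundle_scheme \<Rightarrow> bool" where
  "holomorphic_cocycle E \<longleftrightarrow>
     (\<forall>i\<in>idx E. \<forall>x\<in>cdom E i. trn E i i x = mat 1) \<and>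
     (\<forall>i\<in>idx E. \<forall>j\<in>idx E. \<forall>k\<in>idx E. \<forall>x\<in>cdom E i \<inter> cdom E j \<inter> cdom E k.
        trn E i j x ** trn E j k x = trn E i k x) \<and>
     (\<forall>i\<in>idx E. \<forall>j\<in>idx E. \<forall>a b. chol_on (overlap E i j) (\<lambda>y. trn E i j (pt E i y) $ a $ b))"

definition hermitian_metric ::
  "('i, 'x::t2_space, 'n::finite, 'r::finite, 'z) herm_bundle_scheme \<Rightarrow> bool" where
  "hermitian_metric E \<longleftrightarrow>
     (\<forall>i\<in>idx E. smooth_fun_on (patch E i) (met E i) \<and> (\<forall>y\<in>patch E i. pos_def_herm (met E i y))) \<and>
     (\<forall>i\<in>idx E. \<forall>j\<in>idx E. \<forall>y\<in>overlap E i j.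
        met E j (chg E i j y) =
          ctransp (trn E i j (pt E i y)) ** met E i y ** trn E i j (pt E i y))"

definition hermitian_holomorphic_bundle ::
  "('i, 'x::t2_space, 'n::finite, 'r::finite, 'z) herm_bundle_scheme \<Rightarrow> bool" where
  "hermitian_holomorphic_bundle E \<longleftrightarrow>
     compact_complex_manifold E \<and> holomorphic_cocycle E \<and> hermitian_metric E"

section \<open>Differential forms\<close>

text \<open>A differential form is the family of its local representatives, in the coordinates of each
  chart; values off the coordinate patches are irrelevant.\<close>

type_synonym ('i, 'n, 'a) lform = "'i \<Rightarrow> complex^'n \<Rightarrow> ('n, 'a) alt"

definition ext_d :: "(complex^'n::finite \<Rightarrow> ('n, 'a::real_normed_vector) alt) \<Rightarrow>
    complex^'n \<Rightarrow> ('n, 'a) alt" where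
  "ext_d f y vs = (\<Sum>m<length vs. (-1) ^ m *\<^sub>R
     frechet_derivative (\<lambda>z. f z (take m vs @ drop (Suc m) vs)) (at y) (vs ! m))"

definition pull :: "('i, 'x, 'n::finite, 'z) cplx_atlas_scheme \<Rightarrow> ('i, 'n, 'a) lform \<Rightarrow>
    'i \<Rightarrow> 'i \<Rightarrow> complex^'n \<Rightarrow> ('n, 'a) alt" where
  "pull X f i j y vs = f j (chg X i j y) (map (frechet_derivative (chg X i j) (at y)) vs)"

definition real_form :: "('i, 'x, 'n::finite, 'z) cplx_atlas_scheme \<Rightarrow> ('i, 'n, real) lform \<Rightarrow> bool" where
  "real_form X f \<longleftrightarrow>
     (\<forall>i\<in>idx X. (\<forall>vs. smooth_fun_on (patch X i) (\<lambda>y. f i y vs)) \<and>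
        (\<forall>y\<in>patch X i. \<forall>k. altform k (comp_deg k (f i y)))) \<and>
     (\<forall>i\<in>idx X. \<forall>j\<in>idx X. \<forall>y\<in>overlap X i j. \<forall>vs. f i y vs = pull X f i j y vs)"

definition closed_form :: "('i, 'x, 'n::finite, 'z) cplx_atlas_scheme \<Rightarrow> ('i, 'n, real) lform \<Rightarrow> bool" where
  "closed_form X f \<longleftrightarrow> (\<forall>i\<in>idx X. \<forall>y\<in>patch X i. \<forall>vs. ext_d (f i) y vs = 0)"

definition kaehler_form :: "('i, 'x, 'n::finite, 'z) cplx_atlas_scheme \<Rightarrow> ('i, 'n, real) lform \<Rightarrow> bool" where
  "kaehler_form X \<omega> \<longleftrightarrow> real_form X \<omega> \<and> closed_form X \<omega> \<and>
     (\<forall>i\<in>idx X. \<forall>y\<in>patch X i. altform 2 (\<omega> i y) \<and>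
        (\<forall>v w. \<omega> i y [\<i> *s v, \<i> *s w] = \<omega> i y [v, w]) \<and>
        (\<forall>v. v \<noteq> 0 \<longrightarrow> \<omega> i y [v, \<i> *s v] > 0))"

definition end_form :: "('i, 'x, 'n::finite, 'r::finite, 'z) herm_bundle_scheme \<Rightarrow> nat \<Rightarrow>
    ('i, 'n, 'r cmat) lform \<Rightarrow> bool" where
  "end_form E k B \<longleftrightarrow>
     (\<forall>i\<in>idx E. (\<forall>vs. smooth_fun_on (patch E i) (\<lambda>y. B i y vs)) \<and>
        (\<forall>y\<in>patch E i. altform k (B i y))) \<and>
     (\<forall>i\<in>idx E. \<forall>j\<in>idx E. \<forall>y\<in>overlap E i j. \<forall>vs.
        B i y vs = trn E i j (pt E i y) ** pull E B i j y vs ** matrix_inv (trn E i j (pt E i y)))"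

definition form_eq :: "('i, 'x, 'n::finite, 'z) cplx_atlas_scheme \<Rightarrow>
    ('i, 'n, 'a) lform \<Rightarrow> ('i, 'n, 'a) lform \<Rightarrow> bool" where
  "form_eq X f g \<longleftrightarrow> (\<forall>i\<in>idx X. \<forall>y\<in>patch X i. \<forall>vs. f i y vs = g i y vs)"

text \<open>Integral of the degree \<open>2n\<close> part over the compact manifold: choose finitely many charts covering it
  and split it into the Borel pieces \<open>cdom i\<^sub>m - (\<Union>k<m. cdom i\<^sub>k)\<close>.  A continuous
  top-degree form is absolutely integrable over each piece, and the sum does not depend on the choice.\<close>

definition mint :: "('i, 'x, 'n::finite, 'z) cplx_atlas_scheme \<Rightarrow> ('i, 'n, complex) lform \<Rightarrow> complex" where
  "mint X f = (let js = (SOME js. set js \<subseteq> idx X \<and> (\<Union>j\<in>set js. cdom X j) = UNIV) in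
     \<Sum>m<length js. LINT y:crd X (js ! m) ` (cdom X (js ! m) - (\<Union>k<m. cdom X (js ! k)))|lborel.
        f (js ! m) y std_frame)"

section \<open>Sections and connections\<close>

type_synonym ('i, 'n, 'r) endsec = "'i \<Rightarrow> complex^'n \<Rightarrow> 'r cmat"

definition end_section :: "('i, 'x, 'n::finite, 'r::finite, 'z) herm_bundle_scheme \<Rightarrow> ('i, 'n, 'r) endsec \<Rightarrow> bool" where
  "end_section E s \<longleftrightarrow> end_form E 0 (\<lambda>i y. form0 (s i y))"

definition herm_section :: "('i, 'x, 'n::finite, 'r::finite, 'z) herm_bundle_scheme \<Rightarrow> ('i, 'n, 'r) endsec \<Rightarrow> bool" where
  "herm_section E V \<longleftrightarrow> end_section E V \<and>
     (\<forall>i\<in>idx E. \<forall>y\<in>patch E i. hadj (met E i y) (V i y) = V i y)"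

definition skew_section :: "('i, 'x, 'n::finite, 'r::finite, 'z) herm_bundle_scheme \<Rightarrow> ('i, 'n, 'r) endsec \<Rightarrow> bool" where
  "skew_section E \<phi> \<longleftrightarrow> end_section E \<phi> \<and>
     (\<forall>i\<in>idx E. \<forall>y\<in>patch E i. hadj (met E i y) (\<phi> i y) = - \<phi> i y)"

definition gauge_group :: "('i, 'x, 'n::finite, 'r::finite, 'z) herm_bundle_scheme \<Rightarrow> ('i, 'n, 'r) endsec set" where
  "gauge_group E = {g. end_section E g \<and>
     (\<forall>i\<in>idx E. \<forall>y\<in>patch E i. hadj (met E i y) (g i y) ** g i y = mat 1)}"

text \<open>A connection is the family of its matrices \<open>A\<^sub>i\<close> in the local frames, \<open>d\<^sub>A s = d s + A\<^sub>i s\<close>.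
  Compatibility with the metric reads \<open>d H = H A + A\<^sup>* H\<close>.\<close>

definition connection :: "('i, 'x, 'n::finite, 'r::finite, 'z) herm_bundle_scheme \<Rightarrow> ('i, 'n, 'r cmat) lform \<Rightarrow> bool" where
  "connection E A \<longleftrightarrow>
     (\<forall>i\<in>idx E. (\<forall>vs. smooth_fun_on (patch E i) (\<lambda>y. A i y vs)) \<and>
        (\<forall>y\<in>patch E i. altform 1 (A i y))) \<and>
     (\<forall>i\<in>idx E. \<forall>j\<in>idx E. \<forall>y\<in>overlap E i j. \<forall>vs.
        A i y vs = trn E i j (pt E i y) ** pull E A i j y vs ** matrix_inv (trn E i j (pt E i y))
          - ext_d (\<lambda>z. form0 (trn E i j (pt E i z))) y vs ** matrix_inv (trn E i j (pt E i y)))"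

definition unitary_connection :: "('i, 'x, 'n::finite, 'r::finite, 'z) herm_bundle_scheme \<Rightarrow> ('i, 'n, 'r cmat) lform \<Rightarrow> bool" where
  "unitary_connection E A \<longleftrightarrow> connection E A \<and>
     (\<forall>i\<in>idx E. \<forall>y\<in>patch E i. \<forall>v.
        ext_d (\<lambda>z. form0 (met E i z)) y [v] = met E i y ** A i y [v] + ctransp (A i y [v]) ** met E i y)"

definition curv :: "('i, 'n::finite, 'r::finite cmat) lform \<Rightarrow> ('i, 'n, 'r cmat) lform" where
  "curv A i y = (\<lambda>vs. ext_d (A i) y vs + wedge_mm (A i y) (A i y) vs)"

text \<open>The covariant exterior derivative of an endomorphism-valued \<open>k\<close>-form.\<close>

definition cov_d :: "('i, 'n::finite, 'r::finite cmat) lform \<Rightarrow> nat \<Rightarrow> ('i, 'n, 'r cmat) lform \<Rightarrow> ('i, 'n, 'r cmat) lform" where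
  "cov_d A k B i y = (\<lambda>vs. ext_d (B i) y vs + wedge_mm (A i y) (B i y) vs
     - (-1) ^ k *\<^sub>R wedge_mm (B i y) (A i y) vs)"

definition chern_space :: "('i, 'x, 'n::finite, 'r::finite, 'z) herm_bundle_scheme \<Rightarrow> ('i, 'n, 'r cmat) lform set" where
  "chern_space E = {A. unitary_connection E A \<and>
     (\<forall>i\<in>idx E. \<forall>y\<in>patch E i. \<forall>v w. part02 (curv A i y) v w = 0)}"

text \<open>Tangent vectors: skew-Hermitian one-forms \<open>a\<close> with \<open>\<partial>bar\<^sub>A a\<^bsup>0,1\<^esup> = 0\<close>, where \<open>\<partial>bar\<^sub>A\<close> of a
  \<open>(0,1)\<close>-form is the \<open>(0,2)\<close>-part of its covariant derivative.\<close>

definition tangent_space :: "('i, 'x, 'n::finite, 'r::finite, 'z) herm_bundle_scheme \<Rightarrow>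
    ('i, 'n, 'r cmat) lform \<Rightarrow> ('i, 'n, 'r cmat) lform set" where
  "tangent_space E A = {a. end_form E 1 a \<and>
     (\<forall>i\<in>idx E. \<forall>y\<in>patch E i. \<forall>v. adj_form (met E i y) (a i y) [v] = - a i y [v]) \<and>
     (\<forall>i\<in>idx E. \<forall>y\<in>patch E i. \<forall>v w.
        part02 (cov_d A 1 (\<lambda>j z. part01 (a j z)) i y) v w = 0)}"

text \<open>\<open>conn_add A t a = A + t a\<close>, in the affine space of all connections.\<close>

definition conn_add :: "('i, 'n::finite, 'r::finite cmat) lform \<Rightarrow> real \<Rightarrow> ('i, 'n, 'r cmat) lform \<Rightarrow> ('i, 'n, 'r cmat) lform" where
  "conn_add A t a i y = (\<lambda>vs. A i y vs + t *\<^sub>R a i y vs)"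

text \<open>\<open>gauge_act g A\<close> is \<open>g \<circ> d\<^sub>A \<circ> g\<^sup>-\<^sup>1\<close>, and \<open>herm_act g A\<close> is
  \<open>g \<circ> \<partial>bar\<^sub>A \<circ> g\<^sup>-\<^sup>1 + g\<^sup>-\<^sup>1 \<circ> \<partial>\<^sub>A \<circ> g\<close>, in terms of connection matrices.\<close>

definition conj_form :: "('i, 'n, 'r) endsec \<Rightarrow> ('i, 'n::finite, 'r::finite cmat) lform \<Rightarrow> ('i, 'n, 'r cmat) lform" where
  "conj_form g B i y = (\<lambda>vs. g i y ** B i y vs ** matrix_inv (g i y))"

definition gauge_act :: "('i, 'n, 'r) endsec \<Rightarrow> ('i, 'n::finite, 'r::finite cmat) lform \<Rightarrow> ('i, 'n, 'r cmat) lform" where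
  "gauge_act g A i y = (\<lambda>vs. conj_form g A i y vs
     + g i y ** ext_d (\<lambda>z. form0 (matrix_inv (g i z))) y vs)"

definition herm_act :: "('i, 'n, 'r) endsec \<Rightarrow> ('i, 'n::finite, 'r::finite cmat) lform \<Rightarrow> ('i, 'n, 'r cmat) lform" where
  "herm_act g A i y = (\<lambda>vs.
     g i y ** part01 (A i y) vs ** matrix_inv (g i y)
     + g i y ** part01 (ext_d (\<lambda>z. form0 (matrix_inv (g i z))) y) vs
     + matrix_inv (g i y) ** part10 (A i y) vs ** g i y
     + matrix_inv (g i y) ** part10 (ext_d (\<lambda>z. form0 (g i z)) y) vs)"

definition sec_exp :: "real \<Rightarrow> ('i, 'n::finite, 'r::finite) endsec \<Rightarrow> ('i, 'n, 'r) endsec" where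
  "sec_exp t V i y = mexp (t *\<^sub>R V i y)"

section \<open>Polynomial central charges\<close>

text \<open>The components are the stability vector, the fixed Kaehler form in the class \<open>[\<omega>]\<close>, and the fixed
  closed form representing \<open>U\<close>.\<close>

record ('i, 'n::finite) pcharge =
  rho :: "nat \<Rightarrow> complex"
  kfm :: "'i \<Rightarrow> complex^'n \<Rightarrow> (complex^'n) list \<Rightarrow> real"
  ufm :: "'i \<Rightarrow> complex^'n \<Rightarrow> (complex^'n) list \<Rightarrow> real"

definition stability_vector :: "nat \<Rightarrow> (nat \<Rightarrow> complex) \<Rightarrow> bool" where
  "stability_vector n \<rho> \<longleftrightarrow> (\<forall>d\<le>n. \<rho> d \<noteq> 0) \<and> Im (\<rho> n) > 0 \<and> (\<forall>d<n. Im (\<rho> d / \<rho> (Suc d)) > 0)"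

text \<open>A closed form represents a class \<open>1 + N\<close> with \<open>N\<close> of positive degree if and only if its degree \<open>0\<close>
  component is the constant \<open>1\<close>.\<close>

definition polynomial_charge :: "('i, 'x, 'n::finite, 'z) cplx_atlas_scheme \<Rightarrow> ('i, 'n) pcharge \<Rightarrow> bool" where
  "polynomial_charge X Z \<longleftrightarrow> stability_vector CARD('n) (rho Z) \<and> kaehler_form X (kfm Z) \<and>
     real_form X (ufm Z) \<and> closed_form X (ufm Z) \<and>
     (\<forall>i\<in>idx X. \<forall>y\<in>patch X i. ufm Z i y [] = 1)"

definition kfm_c :: "('i, 'n::finite) pcharge \<Rightarrow> ('i, 'n, complex) lform" where
  "kfm_c Z i y = (\<lambda>vs. complex_of_real (kfm Z i y vs))"

definition ufm_c :: "('i, 'n::finite) pcharge \<Rightarrow> ('i, 'n, complex) lform" where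
  "ufm_c Z i y = (\<lambda>vs. complex_of_real (ufm Z i y vs))"

definition curvN :: "('i, 'n::finite, 'r::finite cmat) lform \<Rightarrow> ('i, 'n, 'r cmat) lform" where
  "curvN A i y = (\<lambda>vs. csm (\<i> / (2 * pi)) (curv A i y vs))"

text \<open>The Chern connection \<open>H\<^sup>-\<^sup>1 \<partial> H\<close> of the given holomorphic structure and metric.\<close>

definition chern_conn :: "('i, 'x, 'n::finite, 'r::finite, 'z) herm_bundle_scheme \<Rightarrow> ('i, 'n, 'r cmat) lform" where
  "chern_conn E i y = (\<lambda>vs. matrix_inv (met E i y) ** part10 (ext_d (\<lambda>z. form0 (met E i z)) y) vs)"

text \<open>The Chern-Weil representative \<open>tr exp (\<i> F / 2\<pi>)\<close> of the Chern character; the terms with \<open>j > n\<close>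
  vanish for degree reasons.\<close>

definition chern_char :: "('i, 'x, 'n::finite, 'r::finite, 'z) herm_bundle_scheme \<Rightarrow> ('i, 'n, complex) lform" where
  "chern_char E i y = (\<lambda>vs. \<Sum>j\<le>CARD('n).
     trace (mprod (replicate j (curvN (chern_conn E) i y)) vs) / fact j)"

definition central_charge :: "('i, 'x, 'n::finite, 'r::finite, 'z) herm_bundle_scheme \<Rightarrow> ('i, 'n) pcharge \<Rightarrow> complex" where
  "central_charge E Z = mint E (\<lambda>i y vs. \<Sum>d\<le>CARD('n).
     rho Z d * wedge_cc (wpow (kfm_c Z i y) d) (wedge_cc (chern_char E i y) (ufm_c Z i y)) vs)"

definition phase_factor :: "('i, 'x, 'n::finite, 'r::finite, 'z) herm_bundle_scheme \<Rightarrow> ('i, 'n) pcharge \<Rightarrow> complex" where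
  "phase_factor E Z = exp (- \<i> * complex_of_real (Arg (central_charge E Z)))"

section \<open>The \<open>Z\<close>-critical equation\<close>

definition Ztilde_terms :: "('i, 'n::finite) pcharge \<Rightarrow> ('i, 'n, 'r::finite cmat) lform \<Rightarrow>
    'i \<Rightarrow> complex^'n \<Rightarrow> ('n, 'r) fterm list" where
  "Ztilde_terms Z A i y =
     [(\<lambda>vs. rho Z d / fact j *
          wedge_cc (wpow (kfm_c Z i y) d) (comp_deg (2 * l) (ufm_c Z i y)) vs,
       replicate j (2, curvN A i y)).
      d \<leftarrow> [0..<Suc CARD('n)], j \<leftarrow> [0..<Suc CARD('n)], l \<leftarrow> [0..<Suc CARD('n)],
      d + j + l = CARD('n)]"

definition Zprime_terms :: "('i, 'n::finite) pcharge \<Rightarrow> ('i, 'n, 'r::finite cmat) lform \<Rightarrow>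
    'i \<Rightarrow> complex^'n \<Rightarrow> ('n, 'r) fterm list" where
  "Zprime_terms Z A i y =
     [(\<lambda>vs. rho Z d / fact (j - 1) *
          wedge_cc (wpow (kfm_c Z i y) d) (comp_deg (2 * l) (ufm_c Z i y)) vs,
       replicate (j - 1) (2, curvN A i y)).
      d \<leftarrow> [0..<Suc CARD('n)], j \<leftarrow> [1..<Suc CARD('n)], l \<leftarrow> [0..<Suc CARD('n)],
      d + j + l = CARD('n)]"

definition D_Z :: "('i, 'x, 'n::finite, 'r::finite, 'z) herm_bundle_scheme \<Rightarrow> ('i, 'n) pcharge \<Rightarrow>
    ('i, 'n, 'r cmat) lform \<Rightarrow> ('i, 'n, 'r cmat) lform" where
  "D_Z E Z A i y =
     im_form (met E i y) (\<lambda>vs. csm (phase_factor E Z) (fval (Ztilde_terms Z A i y) vs))"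

definition Im_Zprime :: "('i, 'x, 'n::finite, 'r::finite, 'z) herm_bundle_scheme \<Rightarrow> ('i, 'n) pcharge \<Rightarrow>
    ('i, 'n, 'r cmat) lform \<Rightarrow> 'i \<Rightarrow> complex^'n \<Rightarrow> ('n, 'r) fterm list" where
  "Im_Zprime E Z A i y = fim (met E i y) (fscale (phase_factor E Z) (Zprime_terms Z A i y))"

definition subsolution :: "('i, 'x, 'n::finite, 'r::finite, 'z) herm_bundle_scheme \<Rightarrow> ('i, 'n) pcharge \<Rightarrow>
    ('i, 'n, 'r cmat) lform \<Rightarrow> bool" where
  "subsolution E Z A \<longleftrightarrow>
     (\<forall>i\<in>idx E. \<forall>y\<in>patch E i. \<forall>u.
        altform 1 u \<and> (\<forall>v. u [\<i> *s v] = csm (- \<i>) (u [v])) \<and> (\<exists>v. u [v] \<noteq> 0) \<longrightarrow>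
        (let T = trace (csm \<i> (fsym (fpost (Im_Zprime E Z A i y)
                    [(1, adj_form (met E i y) u), (1, u)]) std_frame))
         in T \<in> \<real> \<and> Re T > 0))"

definition subsolution_space :: "('i, 'x, 'n::finite, 'r::finite, 'z) herm_bundle_scheme \<Rightarrow> ('i, 'n) pcharge \<Rightarrow>
    ('i, 'n, 'r cmat) lform set" where
  "subsolution_space E Z = {A \<in> chern_space E. subsolution E Z A}"

definition Omega_Z :: "('i, 'x, 'n::finite, 'r::finite, 'z) herm_bundle_scheme \<Rightarrow> ('i, 'n) pcharge \<Rightarrow>
    ('i, 'n, 'r cmat) lform \<Rightarrow> ('i, 'n, 'r cmat) lform \<Rightarrow> ('i, 'n, 'r cmat) lform \<Rightarrow> complex" where
  "Omega_Z E Z A a b = mint E (\<lambda>i y vs.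
     trace (fsym (fpre [(1, a i y), (1, b i y)] (Im_Zprime E Z A i y)) vs))"

definition pairing :: "('i, 'x, 'n::finite, 'r::finite, 'z) herm_bundle_scheme \<Rightarrow>
    ('i, 'n, 'r cmat) lform \<Rightarrow> ('i, 'n, 'r) endsec \<Rightarrow> complex" where
  "pairing E \<psi> \<phi> = - mint E (\<lambda>i y vs. trace (\<phi> i y ** \<psi> i y vs))"

definition moment_map :: "('i, 'x, 'n::finite, 'r::finite, 'z) herm_bundle_scheme \<Rightarrow> ('i, 'n) pcharge \<Rightarrow>
    ('i, 'n, 'r cmat) lform \<Rightarrow> ('i, 'n, 'r cmat) lform" where
  "moment_map E Z A i y = (\<lambda>vs. csm (2 * pi * \<i>) (D_Z E Z A i y vs))"

section \<open>Ellipticity\<close>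

fun iter_deriv :: "'a::euclidean_space list \<Rightarrow> ('a \<Rightarrow> 'b::real_normed_vector) \<Rightarrow> 'a \<Rightarrow> 'b" where
  "iter_deriv [] f = f"
| "iter_deriv (k # ks) f = (\<lambda>y. frechet_derivative (iter_deriv ks f) (at y) k)"

text \<open>\<open>L\<close> maps Hermitian endomorphisms to top-degree forms with values in Hermitian endomorphisms.  In
  each chart it is given by \<open>\<Sum> c\<^bsub>ks\<^esub> \<partial>\<^bsub>ks\<^esub>\<close> over lists \<open>ks\<close> of at most \<open>m\<close> real coordinate
  directions, with smooth coefficients, top-degree forms being identified with functions
  by evaluation on the coordinate frame.  The principal symbol at each non-zero real
  covector \<open>\<xi>\<close> must be invertible on the fibre of Hermitian endomorphisms.\<close>

definition symbol :: "nat \<Rightarrow> ((complex^'n::finite) list \<Rightarrow> 'r::finite cmat \<Rightarrow> 'r cmat) \<Rightarrow>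
    complex^'n \<Rightarrow> 'r cmat \<Rightarrow> 'r cmat" where
  "symbol m c \<xi> M = (\<Sum>ks\<in>{ks. set ks \<subseteq> Basis \<and> length ks = m}. (\<Prod>k\<leftarrow>ks. \<xi> \<bullet> k) *\<^sub>R c ks M)"

definition linear_elliptic_operator :: "('i, 'x, 'n::finite, 'r::finite, 'z) herm_bundle_scheme \<Rightarrow>
    (('i, 'n, 'r) endsec \<Rightarrow> ('i, 'n, 'r cmat) lform) \<Rightarrow> bool" where
  "linear_elliptic_operator E L \<longleftrightarrow> (\<exists>m c. \<forall>i\<in>idx E.
     (\<forall>ks M. smooth_fun_on (patch E i) (\<lambda>y. c i y ks M)) \<and>
     (\<forall>y\<in>patch E i.
        (\<forall>ks. linear (c i y ks)) \<and>
        (\<forall>V. herm_section E V \<longrightarrow>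
           L V i y std_frame =
             (\<Sum>ks\<in>{ks. set ks \<subseteq> Basis \<and> length ks \<le> m}. c i y ks (iter_deriv ks (V i) y))) \<and>
        (\<forall>\<xi>. \<xi> \<noteq> 0 \<longrightarrow>
           bij_betw (symbol m (c i y) \<xi>)
             {M. hadj (met E i y) M = M} {M. hadj (met E i y) M = M})))"

definition linearisation_D_Z :: "('i, 'x, 'n::finite, 'r::finite, 'z) herm_bundle_scheme \<Rightarrow> ('i, 'n) pcharge \<Rightarrow>
    ('i, 'n, 'r cmat) lform \<Rightarrow> (('i, 'n, 'r) endsec \<Rightarrow> ('i, 'n, 'r cmat) lform) \<Rightarrow> bool" where
  "linearisation_D_Z E Z A L \<longleftrightarrow> (\<forall>V. herm_section E V \<longrightarrow>
     (\<forall>i\<in>idx E. \<forall>y\<in>patch E i. \<forall>vs.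
        ((\<lambda>t. D_Z E Z (herm_act (sec_exp t V) A) i y vs) has_vector_derivative L V i y vs) (at 0)))"

section \<open>Forms on the space of connections\<close>

text \<open>Closedness at \<open>A\<close>: \<open>d\<Omega>(a, b, c) = 0\<close> for tangent vectors \<open>a, b, c\<close>, extended to constant vector
  fields on the affine space of connections (so that all brackets vanish).\<close>

definition closed_two_form_at ::
  "(('i, 'n::finite, 'r::finite cmat) lform \<Rightarrow> ('i, 'n, 'r cmat) lform \<Rightarrow> ('i, 'n, 'r cmat) lform \<Rightarrow> complex) \<Rightarrow>
    ('i, 'n, 'r cmat) lform \<Rightarrow> ('i, 'n, 'r cmat) lform set \<Rightarrow> bool" where
  "closed_two_form_at \<Omega> A T \<longleftrightarrow> (\<forall>a\<in>T. \<forall>b\<in>T. \<forall>c\<in>T. \<exists>p q r.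
     ((\<lambda>t. \<Omega> (conn_add A t a) b c) has_vector_derivative p) (at 0) \<and>
     ((\<lambda>t. \<Omega> (conn_add A t b) a c) has_vector_derivative q) (at 0) \<and>
     ((\<lambda>t. \<Omega> (conn_add A t c) a b) has_vector_derivative r) (at 0) \<and>
     p - q + r = 0)"

end

theory Submission
  imports Defs "HOL-Computational_Algebra.Polynomial"
begin

text \<open>The trace of a graded symmetrisation with two distinguished one-forms \<open>a\<close>, \<open>b\<close> is the average of the cyclic words
 \<open>tr (a \<and> F\<^sup>s \<and> b \<and> F\<^sup>t)\<close> with \<open>s + t\<close> fixed, so \<open>\<Omega>\<^sub>Z\<close> and the subsolution condition reduce to such words.
 By the Leibniz rule and the Bianchi identity, the integrands of \<open>d\<Omega>\<^sub>Z\<close> and of the moment map identity are exact, and Stokes applies.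
 For non-degeneracy, \<open>\<Omega>\<^sub>Z(a, Ja)\<close> is the integral of twice the subsolution expression at \<open>u = a\<^sup>0\<^sup>,\<^sup>1\<close>, hence positive unless \<open>a = 0\<close>.
 Along \<open>exp(tV)\<close> the connection moves in the direction \<open>-\<i> J(d\<^sub>A V)\<close>; the principal symbol of the linearisation at \<open>\<xi>\<close>, applied to a
 Hermitian \<open>M\<close> and paired with \<open>M\<close>, is a non-zero multiple of the subsolution expression at \<open>u = \<xi>\<^sup>0\<^sup>,\<^sup>1 \<otimes> M\<close>. So the symbol
 is injective, hence bijective, on Hermitian endomorphisms.\<close>

text \<open>Forms are functions on lists and the wedge product is a signed sum over shuffles, so the
  multilinear algebra is reduced to one recursion on the leading vector: contraction is a graded
  derivation, and Cartan's formula for constant vector fields gives the same recursion for the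
  exterior derivative. The average over j cyclic words turns the coefficient 1/(j-1)! of the
  derivative of the operator into the 1/j! of the operator itself, which is why the two-form and the
  moment map share their coefficients. A tangent vector b keeps A + t b integrable only to first
  order, so derivatives are taken along unitary connections; there the curvature is polynomial in t
  and differentiation under the integral is algebraic. The path exp(tV) is not polynomial:
  exchanging its t-derivative with the space derivatives in the curvature rests on uniform bounds
  for the exponential series. The integral is defined by an arbitrary Borel dissection; a partition
  of unity and the positive Jacobians of holomorphic coordinate changes make it computable one chart
  at a time, as Stokes and the positivity argument require.\<close>

abbreviation "dfb f y \<equiv> f differentiable (at y)"
abbreviation "hvd f d t \<equiv> (f has_vector_derivative d) (at t)"
abbreviation fd :: "('a::real_normed_vector => 'b::real_normed_vector) => 'a => 'a => 'b" where
 "fd f y v \<equiv> frechet_derivative f (at y) v"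

section \<open>Algebra of list-indexed forms\<close>

text \<open>The grading involution. It supplies the sign in the Leibniz rules for contraction and
  for the exterior derivative without fixing a degree, so these rules hold for forms of mixed
  degree.\<close>

definition hatf :: "('n::finite, 'a::real_vector) alt => ('n, 'a) alt" where
 "hatf f = (%us. (-1) ^ length us *\<^sub>R f us)"

text \<open>The interior product with \<open>v\<close>.\<close>

definition insf :: "complex^'n => ('n::finite, 'a) alt => ('n, 'a) alt" where
 "insf v f = (%us. f (v # us))"

definition homog :: "nat => ('n::finite, 'a::zero) alt => bool" where
 "homog k f \<longleftrightarrow> (\<forall>us. length us ~= k --> f us = 0)"

text \<open>Prepares the recursion for the wedge product: a shuffle is classified by whether
  position 0, that of the leading vector, goes to the first factor.\<close>

lemma sum_Pow_lessThan_Suc: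
 fixes F :: "nat set => 'b::comm_monoid_add"
 shows "(\<Sum>S\<in>Pow {..<Suc n}. F S)
  = (\<Sum>T\<in>Pow {..<n}. F (insert 0 (Suc ` T))) + (\<Sum>T\<in>Pow {..<n}. F (Suc ` T))"
proof -
 have eq: "Pow {..<Suc n} = (%T. insert 0 (Suc ` T)) ` Pow {..<n} \<union> (%T. Suc ` T) ` Pow {..<n}"
 proof -
  have "Pow (Suc ` {..<n}) = (%T. Suc ` T) ` Pow {..<n}" by (simp add: image_Pow_surj)
  then show ?thesis by (simp add: lessThan_Suc_eq_insert_0 Pow_insert image_image Un_commute)
 qed
 have i1: "inj_on (%T. insert 0 (Suc ` T)) (Pow {..<n})"
 proof (rule inj_onI)
  fix S T assume "insert 0 (Suc ` S) = insert 0 (Suc ` T)"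
  then have "Suc ` S = Suc ` T" by (metis Diff_insert_absorb image_iff nat.distinct(1))
  then show "S = T" by (simp add: inj_image_eq_iff)
 qed
 have i2: "inj_on (%T. Suc ` T) (Pow {..<n})"
  by (rule inj_onI) (simp add: inj_image_eq_iff)
 show ?thesis unfolding eq
  by (subst sum.union_disjoint) (auto simp: sum.reindex[OF i1] sum.reindex[OF i2])
qed

lemma wedge_Nil: "wedge bm f g [] = bm (f []) (g [])"
proof -
 have "{(a::nat, b::nat). False} = {}" by simp
 then show ?thesis by (simp add: wedge_def)
qed

lemma length_nths_subset: "T \<subseteq> {..<length ws} ==> length (nths ws T) = card T"
 unfolding length_nths by (rule arg_cong[where f=card]) auto

text \<open>Contraction is a graded derivation of the wedge product. The leading vector goes either
  to the first factor, which creates no inversion, or to the second, where it is preceded in the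
  shuffle by all vectors of the first factor; their number is the degree that \<open>hatf\<close>
  sees. The further algebra of the wedge product is induction by this rule.\<close>

lemma wedge_Cons:
 assumes bb: "bounded_bilinear bm"
 shows "wedge bm f g (v # ws) = wedge bm (insf v f) g ws + wedge bm (hatf f) (insf v g) ws"
proof -
 let ?inv = "%N S. {(a, b). a < b & b < N & b \<in> S & a \<notin> (S::nat set)}"
 let ?n = "length ws"
 have fin: "finite (?inv N S)" for N S
  by (rule finite_subset[of _ "{..<N} \<times> {..<N}"]) auto
 have inj: "inj_on (map_prod Suc Suc) A" for A by (auto simp: inj_on_def)
 have e1: "?inv (Suc ?n) (insert 0 (Suc ` T)) = map_prod Suc Suc ` ?inv ?n T" for T
 proof (intro set_eqI iffI)
  fix p assume "p \<in> ?inv (Suc ?n) (insert 0 (Suc ` T))"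
  then obtain a b where p: "p = (a, b)" "a < b" "b < Suc ?n" "b \<in> insert 0 (Suc ` T)" "a \<notin> insert 0 (Suc ` T)"
   by auto
  then obtain a' b' where "a = Suc a'" "b = Suc b'" by (metis insertI1 not0_implies_Suc not_less0)
  with p have "(a', b') \<in> ?inv ?n T" "p = map_prod Suc Suc (a', b')" by auto
  then show "p \<in> map_prod Suc Suc ` ?inv ?n T" by blast
 qed auto
 \<comment> \<open>Position 0 now belongs to the second factor and lies before every position of the
   first, which gives one additional inversion for each element of \<open>T\<close>.\<close>
 have e2: "?inv (Suc ?n) (Suc ` T) = map_prod Suc Suc ` ?inv ?n T \<union> {0} \<times> (Suc ` T)"
  if "T \<subseteq> {..<?n}" for T
 proof (intro set_eqI iffI)
  fix p assume "p \<in> ?inv (Suc ?n) (Suc ` T)"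
  then obtain a b where p: "p = (a, b)" "a < b" "b < Suc ?n" "b \<in> Suc ` T" "a \<notin> Suc ` T" by auto
  then obtain b' where b: "b = Suc b'" by auto
  show "p \<in> map_prod Suc Suc ` ?inv ?n T \<union> {0} \<times> (Suc ` T)"
  proof (cases a)
   case 0 then show ?thesis using p by auto
  next
   case (Suc a')
   with p b have "(a', b') \<in> ?inv ?n T" "p = map_prod Suc Suc (a', b')" by auto
   then show ?thesis by blast
  qed
 qed (use that in auto)
 have c1: "card (?inv (Suc ?n) (insert 0 (Suc ` T))) = card (?inv ?n T)" for T
  unfolding e1 by (rule card_image[OF inj])
 have c2: "card (?inv (Suc ?n) (Suc ` T)) = card (?inv ?n T) + card T" if "T \<subseteq> {..<?n}" for T
 proof -
  have "finite T" using that finite_subset by blast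
  then have "card ({0::nat} \<times> (Suc ` T)) = card T"
   by (simp add: card_cartesian_product card_image)
  moreover have "card (?inv (Suc ?n) (Suc ` T)) = card (map_prod Suc Suc ` ?inv ?n T) + card ({0::nat} \<times> (Suc ` T))"
   unfolding e2[OF that] by (rule card_Un_disjoint) (use fin \<open>finite T\<close> in auto)
  ultimately show ?thesis by (simp add: card_image[OF inj])
 qed
 have k1: "{j. Suc j \<in> insert 0 (Suc ` T)} = T" "{j. Suc j \<in> - insert 0 (Suc ` T)} = - T"
  "{j. Suc j \<in> Suc ` T} = T" "{j. Suc j \<in> - (Suc ` T)} = - T" for T by auto
 have s1: "nths (v # ws) (insert 0 (Suc ` T)) = v # nths ws T"
  "nths (v # ws) (- insert 0 (Suc ` T)) = nths ws (- T)"
  "nths (v # ws) (Suc ` T) = nths ws T"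
  "nths (v # ws) (- (Suc ` T)) = v # nths ws (- T)" for T
  unfolding nths_Cons k1 by auto
 have "wedge bm f g (v # ws) =
   (\<Sum>T\<in>Pow {..<?n}. (-1) ^ card (?inv ?n T) *\<^sub>R bm (f (v # nths ws T)) (g (nths ws (- T))))
  + (\<Sum>T\<in>Pow {..<?n}. (-1) ^ card (?inv (Suc ?n) (Suc ` T)) *\<^sub>R bm (f (nths ws T)) (g (v # nths ws (- T))))"
  unfolding wedge_def length_Cons sum_Pow_lessThan_Suc s1 c1 by (rule refl)
 moreover have "(\<Sum>T\<in>Pow {..<?n}. (-1) ^ card (?inv (Suc ?n) (Suc ` T)) *\<^sub>R bm (f (nths ws T)) (g (v # nths ws (- T))))
   = wedge bm (hatf f) (insf v g) ws"
  unfolding wedge_def hatf_def insf_def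
 proof (intro sum.cong refl)
  fix T assume "T \<in> Pow {..<?n}"
  then have T: "T \<subseteq> {..<?n}" by simp
  show "(-1) ^ card (?inv (Suc ?n) (Suc ` T)) *\<^sub>R bm (f (nths ws T)) (g (v # nths ws (- T)))
   = (-1) ^ card (?inv ?n T) *\<^sub>R bm ((-1) ^ length (nths ws T) *\<^sub>R f (nths ws T)) (g (v # nths ws (- T)))"
   unfolding c2[OF T] length_nths_subset[OF T] bounded_bilinear.scaleR_left[OF bb] power_add scaleR_scaleR ..
 qed
 moreover have "(\<Sum>T\<in>Pow {..<?n}. (-1) ^ card (?inv ?n T) *\<^sub>R bm (f (v # nths ws T)) (g (nths ws (- T))))
   = wedge bm (insf v f) g ws"
  unfolding wedge_def insf_def ..
 ultimately show ?thesis by (simp only:)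
qed

lemma bb_add: assumes "bounded_bilinear bm"
 shows "bm (x + x') y = bm x y + bm x' y" "bm x (y + y') = bm x y + bm x y'"
 using bounded_bilinear.add_left[OF assms] bounded_bilinear.add_right[OF assms] by auto

lemma bb_scale: assumes "bounded_bilinear bm"
 shows "bm (r *\<^sub>R x) y = r *\<^sub>R bm x y" "bm x (r *\<^sub>R y) = r *\<^sub>R bm x y"
 using bounded_bilinear.scaleR_left[OF assms] bounded_bilinear.scaleR_right[OF assms] by auto

lemma bb_zero: assumes "bounded_bilinear bm"
 shows "bm 0 y = 0" "bm x 0 = 0"
 using bounded_bilinear.zero_left[OF assms] bounded_bilinear.zero_right[OF assms] by auto

lemma wedge_add_left: "bounded_bilinear bm ==>
  wedge bm (%us. f us + f' us) g vs = wedge bm f g vs + wedge bm f' g vs"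
 by (simp add: wedge_def bb_add scaleR_add_right sum.distrib)

lemma wedge_add_right: "bounded_bilinear bm ==>
  wedge bm f (%us. g us + g' us) vs = wedge bm f g vs + wedge bm f g' vs"
 by (simp add: wedge_def bb_add scaleR_add_right sum.distrib)

lemma wedge_scale_left: "bounded_bilinear bm ==> wedge bm (%us. r *\<^sub>R f us) g vs = r *\<^sub>R wedge bm f g vs"
 by (simp add: wedge_def bb_scale scaleR_sum_right mult.commute)

lemma wedge_scale_right: "bounded_bilinear bm ==> wedge bm f (%us. r *\<^sub>R g us) vs = r *\<^sub>R wedge bm f g vs"
 by (simp add: wedge_def bb_scale scaleR_sum_right mult.commute)

lemma wedge_zero_left: "bounded_bilinear bm ==> wedge bm (%us. 0) g vs = 0"
 by (simp add: wedge_def bb_zero)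

lemma wedge_zero_right: "bounded_bilinear bm ==> wedge bm f (%us. 0) vs = 0"
 by (simp add: wedge_def bb_zero)

lemma wedge_neg_left: "bounded_bilinear bm ==> wedge bm (%us. - f us) g vs = - wedge bm f g vs"
 using wedge_scale_left[of bm "-1" f g vs] by simp

lemma wedge_neg_right: "bounded_bilinear bm ==> wedge bm f (%us. - g us) vs = - wedge bm f g vs"
 using wedge_scale_right[of bm f "-1" g vs] by simp

lemma wedge_diff_left: "bounded_bilinear bm ==>
  wedge bm (%us. f us - f' us) g vs = wedge bm f g vs - wedge bm f' g vs"
 using wedge_add_left[of bm f "%us. - f' us" g vs] by (simp add: wedge_neg_left)

lemma wedge_diff_right: "bounded_bilinear bm ==>
  wedge bm f (%us. g us - g' us) vs = wedge bm f g vs - wedge bm f g' vs"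
 using wedge_add_right[of bm f g "%us. - g' us" vs] by (simp add: wedge_neg_right)

lemma wedge_sum_left: "bounded_bilinear bm ==>
  wedge bm (%us. \<Sum>k\<in>K. f k us) g vs = (\<Sum>k\<in>K. wedge bm (f k) g vs)"
 by (induction K rule: infinite_finite_induct) (simp_all add: wedge_zero_left wedge_add_left)

lemma wedge_sum_right: "bounded_bilinear bm ==>
  wedge bm f (%us. \<Sum>k\<in>K. g k us) vs = (\<Sum>k\<in>K. wedge bm f (g k) vs)"
 by (induction K rule: infinite_finite_induct) (simp_all add: wedge_zero_right wedge_add_right)

lemma length_nths_split: "length (nths vs S) + length (nths vs (- S)) = length vs"
proof (induction vs arbitrary: S)
 case (Cons v vs)
 have "{j. Suc j \<in> - S} = - {j. Suc j \<in> S}" by auto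
 then show ?case using Cons[of "{j. Suc j \<in> S}"] by (auto simp: nths_Cons)
qed simp

lemma wedge_cong:
 assumes "!!us. length us <= length vs ==> f us = f' us" "!!us. length us <= length vs ==> g us = g' us"
 shows "wedge bm f g vs = wedge bm f' g' vs"
 unfolding wedge_def
 by (intro sum.cong refl arg_cong2[where f=scaleR] arg_cong2[where f=bm] assms)
   (metis le_add1 le_add2 length_nths_split)+

lemma wedge_linear_out:
 assumes "linear T"
 shows "T (wedge bm f g vs) = wedge (%x y. T (bm x y)) f g vs"
 by (simp add: wedge_def linear_sum[OF assms] linear_scale[OF assms])

lemma insf_wedge: "bounded_bilinear bm ==>
  insf v (wedge bm f g) = (%us. wedge bm (insf v f) g us + wedge bm (hatf f) (insf v g) us)"
 by (simp add: insf_def[of v "wedge bm f g"] wedge_Cons)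

lemma hatf_wedge:
 assumes bb: "bounded_bilinear bm" shows "hatf (wedge bm f g) = wedge bm (hatf f) (hatf g)"
proof
 fix us
 have e: "(-1) ^ length us *\<^sub>R c *\<^sub>R bm (f (nths us S)) (g (nths us (- S))) =
   c *\<^sub>R bm ((-1) ^ length (nths us S) *\<^sub>R f (nths us S)) ((-1) ^ length (nths us (- S)) *\<^sub>R g (nths us (- S)))"
  for c S
  unfolding bb_scale[OF bb] scaleR_scaleR
  by (subst length_nths_split[of us S, symmetric]) (simp only: power_add ac_simps)
 show "hatf (wedge bm f g) us = wedge bm (hatf f) (hatf g) us"
  unfolding wedge_def hatf_def scaleR_sum_right e ..
qed

lemma hatf_hatf [simp]: "hatf (hatf f) = f"
 by (simp add: hatf_def flip: power_add)

lemma insf_hatf: "insf v (hatf f) = (%us. - hatf (insf v f) us)"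
 by (simp add: insf_def hatf_def)

lemma wedge_assoc:
 assumes "bounded_bilinear b1" "bounded_bilinear b2" "bounded_bilinear b3" "bounded_bilinear b4"
  and "!!x y z. b1 (b2 x y) z = b3 x (b4 y z)"
 shows "wedge b1 (wedge b2 f g) h vs = wedge b3 f (wedge b4 g h) vs"
proof (induction vs arbitrary: f g h)
 case Nil
 then show ?case by (simp add: wedge_Nil assms(5))
next
 case (Cons v vs)
 show ?case
  by (simp add: wedge_Cons assms(1-4) insf_wedge hatf_wedge wedge_add_left wedge_add_right Cons)
qed

lemma homog_insf: "homog (Suc k) f ==> homog k (insf v f)"
 by (simp add: homog_def insf_def)

lemma homog_insf0: "homog 0 f ==> insf v f = (%us. 0)"
 by (auto simp: homog_def insf_def)

lemma homog_hatf: "homog k f ==> hatf f = (%us. (-1) ^ k *\<^sub>R f us)"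
proof
 fix us assume "homog k f"
 then show "hatf f us = (-1) ^ k *\<^sub>R f us"
  by (cases "length us = k") (auto simp: homog_def hatf_def)
qed

lemma homog_wedge:
 fixes f :: "('n::finite, 'a::real_normed_vector) alt" and g :: "('n, 'b::real_normed_vector) alt"
 assumes "bounded_bilinear bm" "homog p f" "homog q g"
 shows "homog (p + q) (wedge bm f g)"
 unfolding homog_def wedge_def
proof (intro allI impI sum.neutral ballI)
 fix us :: "(complex^'n) list" and S
 assume "length us ~= p + q"
 then have "length (nths us S) ~= p \<or> length (nths us (- S)) ~= q"
  by (metis length_nths_split)
 then show "((-1) ^ card {(a, b). a < b & b < length us & b \<in> S & a \<notin> S}) *\<^sub>R
    bm (f (nths us S)) (g (nths us (- S))) = 0"
  using assms by (auto simp: homog_def bb_zero)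
qed

lemma wedge_commute:
 assumes bb: "bounded_bilinear b1" "bounded_bilinear b2" and com: "!!x y. b1 x y = b2 y x"
  and "homog p f" "homog q g"
 shows "wedge b1 f g vs = (-1) ^ (p * q) *\<^sub>R wedge b2 g f vs"
 using assms(4,5)
proof (induction vs arbitrary: f g p q)
 case Nil
 then show ?case
  by (cases "p = 0"; cases "q = 0") (auto simp: wedge_Nil com homog_def bb_zero[OF bb(1)] bb_zero[OF bb(2)])
next
 case (Cons v vs)
 have A: "wedge b1 (insf v f) g vs = (-1) ^ (p * q + q) *\<^sub>R wedge b2 g (insf v f) vs"
 proof (cases p)
  case 0
  then show ?thesis using Cons.prems homog_insf0[of f v] by (simp add: wedge_zero_left wedge_zero_right bb)
 next
  case (Suc p')
  then have "wedge b1 (insf v f) g vs = (-1) ^ (p' * q) *\<^sub>R wedge b2 g (insf v f) vs"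
   using Cons.IH[OF homog_insf[of p' f v] Cons.prems(2)] Cons.prems(1) by simp
  moreover have "(-1::real) ^ (p * q + q) = (-1) ^ (p' * q)"
   unfolding Suc by (simp add: power_add flip: mult.assoc)
  ultimately show ?thesis by simp
 qed
 have B: "wedge b1 f (insf v g) vs = (-1) ^ (p * q + p) *\<^sub>R wedge b2 (insf v g) f vs"
 proof (cases q)
  case 0
  then show ?thesis using Cons.prems homog_insf0[of g v] by (simp add: wedge_zero_left wedge_zero_right bb)
 next
  case (Suc q')
  then have "wedge b1 f (insf v g) vs = (-1) ^ (p * q') *\<^sub>R wedge b2 (insf v g) f vs"
   using Cons.IH[OF Cons.prems(1) homog_insf[of q' g v]] Cons.prems(2) by simp
  moreover have "(-1::real) ^ (p * q + p) = (-1) ^ (p * q')"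
   unfolding Suc by (simp add: power_add flip: mult.assoc)
  ultimately show ?thesis by simp
 qed
 have hf: "hatf f = (%us. (-1) ^ p *\<^sub>R f us)" "hatf g = (%us. (-1) ^ q *\<^sub>R g us)"
  using Cons.prems homog_hatf by blast+
 have "wedge b1 f g (v # vs) = (-1) ^ (p * q + q) *\<^sub>R wedge b2 g (insf v f) vs
   + (-1) ^ p *\<^sub>R (-1) ^ (p * q + p) *\<^sub>R wedge b2 (insf v g) f vs"
  by (simp add: wedge_Cons[OF bb(1)] hf wedge_scale_left[OF bb(1)] A B)
 moreover have "(-1) ^ p *\<^sub>R (-1) ^ (p * q + p) *\<^sub>R x = (-1) ^ (p * q) *\<^sub>R (x::'c)" for x
  by (simp add: power_add flip: mult_2)
 ultimately show ?case
  by (simp add: wedge_Cons[OF bb(2)] hf wedge_scale_left[OF bb(2)] scaleR_add_right power_add add.commute mult.commute)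
qed

section \<open>Alternating forms of mixed degree\<close>

text \<open>Multilinear and alternating in all degrees at once. Testing only adjacent equal vectors
  is stable under contraction and suits induction on lists; \<open>altform_iff\<close> connects it
  with the notion in a fixed degree.\<close>

definition AltF :: "('n::finite, 'a::real_vector) alt => bool" where
 "AltF f \<longleftrightarrow> (\<forall>xs ys. linear (%v. f (xs @ v # ys))) & (\<forall>xs v ys. f (xs @ v # v # ys) = 0)"

lemma AltFD: assumes "AltF f"
 shows "linear (%v. f (xs @ v # ys))" "f (xs @ v # v # ys) = 0"
 using assms unfolding AltF_def by blast+

lemma AltFI: assumes "!!xs ys. linear (%v. f (xs @ v # ys))" "!!xs v ys. f (xs @ v # v # ys) = 0"
 shows "AltF f"
 using assms unfolding AltF_def by blast

lemma AltF_plus: "AltF f ==> f (xs @ (v + w) # ys) = f (xs @ v # ys) + f (xs @ w # ys)"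
 using linear_add[OF AltFD(1)] by blast

lemma AltF_scaleR: "AltF f ==> f (xs @ (r *\<^sub>R v) # ys) = r *\<^sub>R f (xs @ v # ys)"
 using linear_scale[OF AltFD(1)] by blast

lemma AltF_insf: assumes "AltF f" shows "AltF (insf v f)"
 using AltFD(1)[OF assms, of "v # _"] AltFD(2)[OF assms, of "v # _"]
 by (intro AltFI) (simp_all add: insf_def)

lemma AltF_scale: "AltF f ==> AltF (%us. c *\<^sub>R f us)"
 by (auto simp: AltF_def intro: linear_compose_scale_right)

lemma AltF_hatf: "AltF f ==> AltF (hatf f)"
 unfolding AltF_def hatf_def by (auto simp del: power_Suc intro!: linear_compose_scale_right)

lemma AltF_add: "AltF f ==> AltF g ==> AltF (%us. f us + g us)"
 by (auto simp: AltF_def intro: linear_compose_add)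

lemma AltF_zero: "AltF (%us. 0)"
 by (auto simp: AltF_def linear_iff)

lemma AltF_linear: "AltF f ==> linear T ==> AltF (%us. T (f us))"
 by (intro AltFI) (auto simp: AltFD linear_0 intro: linear_compose[unfolded o_def] AltFD)

lemma AltF_insf_add: "AltF f ==> insf (v + w) f = (%us. insf v f us + insf w f us)"
proof
 fix us assume "AltF f"
 then have "linear (%v. f ([] @ v # us))" unfolding AltF_def by blast
 from linear_add[OF this] show "insf (v + w) f us = insf v f us + insf w f us" by (simp add: insf_def)
qed

lemma AltF_insf_scale: "AltF f ==> insf (r *\<^sub>R v) f = (%us. r *\<^sub>R insf v f us)"
proof
 fix us assume "AltF f"
 then have "linear (%v. f ([] @ v # us))" unfolding AltF_def by blast
 from linear_scale[OF this] show "insf (r *\<^sub>R v) f us = r *\<^sub>R insf v f us" by (simp add: insf_def)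
qed

lemma AltF_insf_insf: assumes "AltF f" shows "insf v (insf v f) = (%us. 0)"
 using AltFD(2)[OF assms, of "[]"] by (simp add: insf_def)

text \<open>The recursion in the leading vector removes the prefix. At the repeated vector the
  double contractions of a single factor vanish, and the two mixed terms cancel because contraction
  anticommutes with the grading involution.\<close>

lemma AltF_wedge:
 assumes bb: "bounded_bilinear bm" and "AltF f" "AltF g"
 shows "AltF (wedge bm f g)"
proof -
 have lin: "linear (%v. wedge bm f g (xs @ v # ys))" if "AltF f" "AltF g" for f g xs ys
  using that
 proof (induction xs arbitrary: f g)
  case Nil
  then show ?case
   by (intro linearI) (simp_all add: wedge_Cons[OF bb] AltF_insf_add AltF_insf_scale wedge_add_left[OF bb]
     wedge_add_right[OF bb] wedge_scale_left[OF bb] wedge_scale_right[OF bb] scaleR_add_right)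
 next
  case (Cons x xs)
  then show ?case
   by (auto simp: wedge_Cons[OF bb] intro!: linear_compose_add Cons.IH AltF_insf AltF_hatf)
 qed
 have alt: "wedge bm f g (xs @ v # v # ys) = 0" if "AltF f" "AltF g" for f g xs v ys
  using that
 proof (induction xs arbitrary: f g)
  case Nil
  then show ?case
   by (simp add: wedge_Cons[OF bb] AltF_insf_insf insf_hatf wedge_zero_left[OF bb]
     wedge_zero_right[OF bb] wedge_neg_left[OF bb])
 next
  case (Cons x xs)
  then show ?case
   by (simp add: wedge_Cons[OF bb] AltF_insf AltF_hatf)
 qed
 show ?thesis using lin alt assms(2,3) unfolding AltF_def by blast
qed

lemma AltF_swap:
 assumes "AltF f" shows "f (xs @ v # w # ys) = - f (xs @ w # v # ys)"
proof -
 have l: "linear (%v. f (xs @ v # ys))" for xs ys using assms unfolding AltF_def by blast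
 have z: "f (xs @ v # v # ys) = 0" for v using assms unfolding AltF_def by blast
 have a1: "f (xs @ (v + w) # u # ys) = f (xs @ v # u # ys) + f (xs @ w # u # ys)" for u
  using linear_add[OF l[of xs "u # ys"]] by simp
 have a2: "f (xs @ u # (v + w) # ys) = f (xs @ u # v # ys) + f (xs @ u # w # ys)" for u
  using linear_add[OF l[of "xs @ [u]" ys]] by simp
 have "0 = f (xs @ (v + w) # (v + w) # ys)" by (simp add: z)
 also have "... = f (xs @ v # w # ys) + f (xs @ w # v # ys)"
  unfolding a1 a2 by (simp add: z)
 finally show ?thesis by (simp add: eq_neg_iff_add_eq_0)
qed

lemma AltF_not_distinct:
 assumes "AltF f" "\<not> distinct vs" shows "f vs = 0"
proof -
 obtain xs ys zs y where vs: "vs = xs @ y # ys @ y # zs"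
  using not_distinct_decomp[OF assms(2)] by auto
 have "f (xs @ y # ys @ y # zs) = 0"
 proof (induction ys arbitrary: xs)
  case Nil
  then show ?case using assms(1) by (simp add: AltF_def)
 next
  case (Cons u ys)
  have "f (xs @ y # u # ys @ y # zs) = - f ((xs @ [u]) @ y # ys @ y # zs)"
   using AltF_swap[OF assms(1), of xs y u "ys @ y # zs"] by simp
  then show ?case using Cons[of "xs @ [u]"] by simp
 qed
 then show ?thesis using vs by simp
qed

lemma altform_iff: "altform k f \<longleftrightarrow> homog k f & AltF f"
proof
 assume a: "altform k f"
 then have h: "homog k f" by (simp add: altform_def homog_def)
 have "linear (%v. f (xs @ v # ys))" for xs ys
 proof (cases "length (xs @ 0 # ys) = k")
  case True
  then have "linear (%v. f ((xs @ 0 # ys)[length xs := v]))"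
   using a unfolding altform_def by (metis add_less_cancel_left length_append length_greater_0_conv list.distinct(1) nat_arith.rule0)
  then show ?thesis by simp
 next
  case False
  then have "f (xs @ v # ys) = 0" for v using h by (simp add: homog_def)
  then show ?thesis by (simp add: linear_iff)
 qed
 moreover have "f (xs @ v # v # ys) = 0" for xs v ys
  using a unfolding altform_def by (metis distinct_length_2_or_more not_distinct_conv_prefix distinct_append)
 ultimately show "homog k f & AltF f" using h by (simp add: AltF_def)
next
 assume "homog k f & AltF f"
 then show "altform k f"
  unfolding altform_def homog_def using AltF_not_distinct
  by (auto simp: AltF_def upd_conv_take_nth_drop)
qed

section \<open>The exterior derivative\<close>

lemma ext_d_Nil [simp]: "ext_d f y [] = 0"
 by (simp add: ext_d_def)

lemma fd_neg:
 "fd (%z. - f z) y v = - fd f y v"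
 if "dfb f y"
 using that frechet_derivative_at[of "%z. - f z" _ y] frechet_derivative_works
 by (metis has_derivative_minus)

text \<open>Cartan's formula for the constant vector field \<open>v\<close>, whose Lie derivative is
  the directional derivative.\<close>

lemma ext_d_Cons: "ext_d f y (v # ws) =
  fd (%z. f z ws) y v - ext_d (%z. insf v (f z)) y ws"
 unfolding ext_d_def
 by (simp only: list.size add_Suc_right add_0_right sum.lessThan_Suc_shift)
   (simp add: insf_def sum_negf)

lemma fd_add:
 assumes "dfb f y" "dfb g y"
 shows "fd (%z. f z + g z) y v = fd f y v + fd g y v"
 using assms frechet_derivative_at[of "%z. f z + g z" _ y] frechet_derivative_works
 by (metis has_derivative_add)

lemma fd_linear:
 assumes "dfb f y" "bounded_linear T"
 shows "fd (%z. T (f z)) y v = T (fd f y v)"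
 using assms frechet_derivative_at[of "%z. T (f z)" _ y] frechet_derivative_works
 by (metis bounded_linear.has_derivative)

lemma fd_scaleR:
 assumes "dfb f y"
 shows "fd (%z. r *\<^sub>R f z) y v = r *\<^sub>R fd f y v"
 by (rule fd_linear[OF assms bounded_linear_scaleR_right])

lemma fd_sum:
 assumes "!!k. k \<in> K ==> dfb (f k) y"
 shows "fd (%z. \<Sum>k\<in>K. f k z) y v = (\<Sum>k\<in>K. fd (f k) y v)"
proof -
 have "((%z. \<Sum>k\<in>K. f k z) has_derivative (%v. \<Sum>k\<in>K. fd (f k) y v)) (at y)"
  by (intro has_derivative_sum) (use assms frechet_derivative_works in blast)
 then show ?thesis by (metis frechet_derivative_at)
qed

lemma fd_bilinear:
 assumes "bounded_bilinear bm" "dfb f y" "dfb g y"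
 shows "fd (%z. bm (f z) (g z)) y v =
  bm (fd f y v) (g y) + bm (f y) (fd g y v)"
proof -
 have "((%z. bm (f z) (g z)) has_derivative
   (%v. bm (f y) (fd g y v) + bm (fd f y v) (g y))) (at y)"
  using bounded_bilinear.FDERIV[OF assms(1)] assms(2,3)[unfolded frechet_derivative_works] by blast
 then show ?thesis by (metis add.commute frechet_derivative_at)
qed

lemma diff_bilinear:
 assumes "bounded_bilinear bm" "dfb f y" "dfb g y"
 shows "dfb (%z. bm (f z) (g z)) y"
 using assms bounded_bilinear.FDERIV unfolding differentiable_def by blast

lemma diff_linear:
 assumes "bounded_linear T" "dfb f y"
 shows "dfb (%z. T (f z)) y"
 using assms bounded_linear.has_derivative unfolding differentiable_def by blast

lemma differentiable_wedge:
 assumes bb: "bounded_bilinear bm"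
  and "!!us. dfb (%z. f z us) y" "!!us. dfb (%z. g z us) y"
 shows "dfb (%z. wedge bm (f z) (g z) vs) y"
 unfolding wedge_def
 by (intro differentiable_sum ballI diff_linear[OF bounded_linear_scaleR_right]
   diff_bilinear[OF bb] assms) auto

lemma fd_wedge:
 assumes bb: "bounded_bilinear bm"
  and d: "!!us. dfb (%z. f z us) y" "!!us. dfb (%z. g z us) y"
 shows "fd (%z. wedge bm (f z) (g z) vs) y v =
   wedge bm (%us. fd (%z. f z us) y v) (g y) vs
   + wedge bm (f y) (%us. fd (%z. g z us) y v) vs"
 unfolding wedge_def
 by (simp add: fd_sum diff_linear[OF bounded_linear_scaleR_right]
   diff_bilinear[OF bb] d fd_linear[OF _ bounded_linear_scaleR_right]
   fd_bilinear[OF bb] scaleR_add_right sum.distrib)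

lemma ext_d_add:
 assumes "!!us. dfb (%z. f z us) y" "!!us. dfb (%z. g z us) y"
 shows "ext_d (%z us. f z us + g z us) y vs = ext_d f y vs + ext_d g y vs"
 by (simp add: ext_d_def fd_add assms scaleR_add_right sum.distrib)

lemma ext_d_linear:
 assumes "!!us. dfb (%z. f z us) y" "bounded_linear T"
 shows "ext_d (%z us. T (f z us)) y vs = T (ext_d f y vs)"
 using assms(2)
 by (simp add: ext_d_def fd_linear[OF assms] linear_sum linear_scale[OF bounded_linear.linear[OF assms(2)]]
   bounded_linear.linear)

text \<open>The exterior derivative raises the degree by one and therefore anticommutes with the
  grading involution.\<close>

lemma ext_d_hatf:
 assumes "!!us. dfb (%z. f z us) y"
 shows "ext_d (%z. hatf (f z)) y vs = - hatf (ext_d f y) vs"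
proof -
 have "ext_d (%z. hatf (f z)) y vs = (\<Sum>m<length vs. (-1) ^ m *\<^sub>R (-1) ^ (length vs - 1) *\<^sub>R
   fd (%z. f z (take m vs @ drop (Suc m) vs)) y (vs ! m))"
  unfolding ext_d_def hatf_def
  by (intro sum.cong refl arg_cong2[where f=scaleR])
    (auto simp: fd_linear[OF assms bounded_linear_scaleR_right] min_def)
 also have "... = (-1) ^ (length vs - 1) *\<^sub>R ext_d f y vs"
  by (simp add: ext_d_def scaleR_sum_right mult.commute)
 also have "... = - hatf (ext_d f y) vs"
  by (cases vs) (auto simp: hatf_def)
 finally show ?thesis .
qed

text \<open>Induction by Cartan's formula: the directional derivative obeys the ordinary product
  rule, and the induction hypothesis applies to products with one contracted factor.\<close>

lemma ext_d_wedge: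
 assumes bb: "bounded_bilinear bm"
  and d: "!!us. dfb (%z. f z us) y" "!!us. dfb (%z. g z us) y"
 shows "ext_d (%z. wedge bm (f z) (g z)) y vs =
   wedge bm (ext_d f y) (g y) vs + wedge bm (hatf (f y)) (ext_d g y) vs"
 using d
proof (induction vs arbitrary: f g)
 case Nil
 then show ?case by (simp add: wedge_Nil bb_zero[OF bb])
next
 case (Cons v vs)
 note d = Cons.prems
 have di: "dfb (%z. insf v (f z) us) y" "dfb (%z. insf v (g z) us) y"
  "dfb (%z. hatf (f z) us) y" for us
  using d by (auto simp: insf_def hatf_def intro: diff_linear[OF bounded_linear_scaleR_right])
 let ?Df = "%us. fd (%z. f z us) y v"
 let ?Dg = "%us. fd (%z. g z us) y v"
 have i: "insf v (ext_d f y) = (%us. ?Df us - ext_d (%z. insf v (f z)) y us)"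
  "insf v (ext_d g y) = (%us. ?Dg us - ext_d (%z. insf v (g z)) y us)"
  by (auto simp: insf_def[of v "ext_d _ y"] ext_d_Cons)
 have h: "ext_d (%z. hatf (f z)) y = (%us. - hatf (ext_d f y) us)"
  using ext_d_hatf[OF d(1)] by auto
 show ?case
  unfolding ext_d_Cons fd_wedge[OF bb d] insf_wedge[OF bb]
  apply (subst ext_d_add)
  apply (intro differentiable_wedge bb di d)+
  unfolding Cons.IH[OF di(1) d(2)] Cons.IH[OF di(3) di(2)] wedge_Cons[OF bb] i insf_hatf h hatf_hatf
  by (simp add: wedge_add_left[OF bb] wedge_add_right[OF bb] wedge_neg_left[OF bb] wedge_neg_right[OF bb]
    wedge_diff_left[OF bb] wedge_diff_right[OF bb])
qed

lemma has_derivative_cong_nhds: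
 assumes "eventually (%z. a z = b z) (nhds y)"
 shows "(a has_derivative D) (at y) \<longleftrightarrow> (b has_derivative D) (at y)"
proof -
 have 1: "a y = b y" "eventually (%z. a z = b z) (at y)"
  using assms eventually_nhds_x_imp_x eventually_nhds_conv_at by (blast, metis)
 have 2: "b y = a y" "eventually (%z. b z = a z) (at y)"
  using 1 by (auto elim: eventually_mono)
 show ?thesis
  using has_derivative_transform_eventually[OF _ 1(2,1)] has_derivative_transform_eventually[OF _ 2(2,1)] by blast
qed

lemma fd_cong_nhds:
 assumes "eventually (%z. a z = b z) (nhds y)"
 shows "frechet_derivative a (at y) = frechet_derivative b (at y)"
 using has_derivative_cong_nhds[OF assms] by (simp add: frechet_derivative_def)

lemma diff_cong_nhds:
 assumes "eventually (%z. a z = b z) (nhds y)"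
 shows "dfb a y \<longleftrightarrow> dfb b y"
 using has_derivative_cong_nhds[OF assms] by (simp add: differentiable_def)

lemma fd_cong_open: "open S ==> y \<in> S ==> (!!y. y \<in> S ==> f y = g y) ==> fd f y v = fd g y v"
 using fd_cong_nhds[of f g y] unfolding eventually_nhds by metis

lemma differentiable_cong_open: "open S ==> y \<in> S ==> (!!y. y \<in> S ==> f y = g y) ==> dfb f y \<longleftrightarrow> dfb g y"
 using diff_cong_nhds[of f g y] unfolding eventually_nhds by metis

lemma AltF_fd:
 assumes d: "!!us. dfb (%z. f z us) y" and e: "eventually (%z. AltF (f z)) (nhds y)"
 shows "AltF (%us. fd (%z. f z us) y u)"
proof -
 have c: "fd (%z. f z us) y u = fd g y u" if "!!z. AltF (f z) ==> f z us = g z" for us g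
  by (rule fun_cong[OF fd_cong_nhds], rule eventually_mono[OF e that])
 show ?thesis
 proof (intro AltFI linearI)
  fix xs ys v w and r :: real
  have "fd (%z. f z (xs @ (v + w) # ys)) y u = fd (%z. f z (xs @ v # ys) + f z (xs @ w # ys)) y u"
   by (rule c) (rule AltF_plus)
  then show "fd (%z. f z (xs @ (v + w) # ys)) y u = fd (%z. f z (xs @ v # ys)) y u + fd (%z. f z (xs @ w # ys)) y u"
   by (simp add: fd_add d)
  have "fd (%z. f z (xs @ (r *\<^sub>R v) # ys)) y u = fd (%z. r *\<^sub>R f z (xs @ v # ys)) y u"
   by (rule c) (rule AltF_scaleR)
  then show "fd (%z. f z (xs @ (r *\<^sub>R v) # ys)) y u = r *\<^sub>R fd (%z. f z (xs @ v # ys)) y u"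
   by (simp add: fd_scaleR d)
  have "fd (%z. f z (xs @ v # v # ys)) y u = fd (%z. 0) y u"
   by (rule c) (rule AltFD(2))
  then show "fd (%z. f z (xs @ v # v # ys)) y u = 0" by (simp add: frechet_derivative_const)
 qed
qed

text \<open>At two equal leading vectors, Cartan's formula used twice leaves equal directional
  derivatives with opposite signs and the derivative of a double contraction, which is zero.\<close>

lemma AltF_ext_d:
 assumes "!!us. dfb (%z. f z us) y" and "eventually (%z. AltF (f z)) (nhds y)"
 shows "AltF (ext_d f y)"
proof -
 have i: "dfb (%z. insf x (f z) us) y" "eventually (%z. AltF (insf x (f z))) (nhds y)"
  if "!!us. dfb (%z. f z us) y" "eventually (%z. AltF (f z)) (nhds y)"
  for f :: "complex^'a => ('a,'b) alt" and x us
  using that by (auto simp: insf_def elim!: eventually_mono intro: AltF_insf[unfolded insf_def])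
 have L: "linear (%v. ext_d f y (xs @ v # ys))"
  if "!!us. dfb (%z. f z us) y" "eventually (%z. AltF (f z)) (nhds y)"
  for f :: "complex^'a => ('a,'b) alt" and xs ys
  using that
 proof (induction xs arbitrary: f)
  case Nil
  have "linear (%v. ext_d (%z. insf v (f z)) y ys)"
   unfolding ext_d_def insf_def
   by (intro linear_compose_sum linear_compose_scale_right ballI AltFD(1)[OF AltF_fd[OF Nil], of "[]", simplified])
  with linear_frechet_derivative[OF Nil(1)] show ?case
   unfolding append_Nil ext_d_Cons by (rule linear_compose_sub)
 next
  case (Cons x xs)
  show ?case unfolding append_Cons ext_d_Cons
   by (rule linear_compose_sub[OF AltFD(1)[OF AltF_fd[OF Cons(2,3)]] Cons.IH[OF i[OF Cons(2,3)]]])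
 qed
 have Z: "ext_d f y (xs @ v # v # ys) = 0"
  if "!!us. dfb (%z. f z us) y" "eventually (%z. AltF (f z)) (nhds y)"
  for f :: "complex^'a => ('a,'b) alt" and xs v ys
  using that
 proof (induction xs arbitrary: f)
  case Nil
  have "ext_d (%z. insf v (insf v (f z))) y ys = 0"
   unfolding ext_d_def insf_def using AltFD(2)[OF AltF_fd[OF Nil], of "[]" v] by simp
  then show ?case by (simp add: ext_d_Cons) (simp add: insf_def)
 next
  case (Cons x xs)
  show ?case using AltFD(2)[OF AltF_fd[OF Cons(2,3)]] Cons.IH[OF i[OF Cons(2,3)]] by (simp add: ext_d_Cons)
 qed
 show ?thesis unfolding AltF_def using L Z assms by blast
qed

section \<open>Matrices\<close>

lemma csm_nth [simp]: "csm c M $ a $ b = c * M $ a $ b" by (simp add: csm_def)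
lemma ctransp_nth [simp]: "ctransp M $ a $ b = cnj (M $ b $ a)" by (simp add: ctransp_def)

lemma mat_eqI: "(!!a b. M $ a $ b = N $ a $ b) ==> M = N"
 by (simp add: vec_eq_iff)

lemma bb_csm: "bounded_bilinear (csm :: complex => 'r::finite cmat => _)"
 unfolding bilinear_conv_bounded_bilinear[symmetric] bilinear_def
 by (auto intro!: linearI mat_eqI simp: algebra_simps)

lemma bb_mm: "bounded_bilinear ((**) :: 'r::finite cmat => 'r cmat => _)"
 unfolding bilinear_conv_bounded_bilinear[symmetric] bilinear_def
 by (auto intro!: linearI mat_eqI simp: matrix_matrix_mult_def algebra_simps sum.distrib scaleR_sum_right)

lemma bb_cc: "bounded_bilinear ((*) :: complex => complex => _)"
 by (rule bounded_bilinear_mult)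

lemma bl_trace: "bounded_linear (trace :: 'r::finite cmat => complex)"
 unfolding linear_conv_bounded_linear[symmetric]
 by (auto intro!: linearI simp: trace_def sum.distrib scaleR_sum_right)

lemma bl_ctransp: "bounded_linear (ctransp :: 'r::finite cmat => _)"
 unfolding linear_conv_bounded_linear[symmetric]
 by (auto intro!: linearI mat_eqI)

lemma bl_csm: "bounded_linear (csm c :: 'r::finite cmat => _)"
 by (rule bounded_bilinear.bounded_linear_right[OF bb_csm])

lemma csm_csm [simp]: "csm c (csm d M) = csm (c * d) M" by (auto intro!: mat_eqI)
lemma csm_1 [simp]: "csm 1 M = M" by (auto intro!: mat_eqI)
lemma csm_0 [simp]: "csm 0 M = 0" "csm c 0 = 0" by (auto intro!: mat_eqI)
lemma csm_add: "csm c (M + N) = csm c M + csm c N" "csm (c + d) M = csm c M + csm d M"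
 by (auto intro!: mat_eqI simp: algebra_simps)
lemma csm_diff: "csm c (M - N) = csm c M - csm c N" "csm (c - d) M = csm c M - csm d M"
 by (auto intro!: mat_eqI simp: algebra_simps)
lemma csm_minus [simp]: "csm c (- M) = - csm c M" "csm (- c) M = - csm c M"
 by (auto intro!: mat_eqI)
lemma scaleR_csm: "r *\<^sub>R M = csm (complex_of_real r) M"
proof (rule mat_eqI)
 fix a b
 show "(r *\<^sub>R M) $ a $ b = csm (complex_of_real r) M $ a $ b"
  using scaleR_conv_of_real[of r "M $ a $ b"] by simp
qed
lemma csm_sum: "csm c (\<Sum>k\<in>K. f k) = (\<Sum>k\<in>K. csm c (f k))"
 by (induction K rule: infinite_finite_induct) (auto simp: csm_add)
lemma csm_mm: "csm c M ** N = csm c (M ** N)" "M ** csm c N = csm c (M ** N)"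
 by (auto intro!: mat_eqI simp: matrix_matrix_mult_def sum_distrib_left mult.left_commute mult.assoc)
lemma trace_csm [simp]: "trace (csm c M) = c * trace M"
 by (simp add: trace_def sum_distrib_left)
lemma trace_add_c: "trace (M + N) = trace M + trace (N :: 'r::finite cmat)"
 by (simp add: trace_def sum.distrib)
lemma trace_scaleR [simp]: "trace (r *\<^sub>R M) = r *\<^sub>R trace (M :: 'r::finite cmat)"
 by (simp add: trace_def scaleR_sum_right)
lemma trace_zero [simp]: "trace (0 :: 'r::finite cmat) = 0"
 by (simp add: trace_def)
lemma trace_minus [simp]: "trace (- M) = - trace (M :: 'r::finite cmat)"
 by (simp add: trace_def sum_negf)
lemma trace_sum: "trace (\<Sum>k\<in>K. f k) = (\<Sum>k\<in>K. trace (f k :: 'r::finite cmat))"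
 by (induction K rule: infinite_finite_induct) (auto simp: trace_add_c)

lemma mm_minus: "(- M) ** N = - (M ** N)" "M ** (- N) = - (M ** N :: 'r::finite cmat)"
 by (auto intro!: mat_eqI simp: matrix_matrix_mult_def sum_negf)
lemma mm_add: "(M + M') ** N = M ** N + M' ** N" "M ** (N + N') = M ** N + M ** (N' :: 'r::finite cmat)"
 by (auto intro!: mat_eqI simp: matrix_matrix_mult_def sum.distrib algebra_simps)
lemma mm_diff: "(M - M') ** N = M ** N - M' ** N" "M ** (N - N') = M ** N - M ** (N' :: 'r::finite cmat)"
 by (auto intro!: mat_eqI simp: matrix_matrix_mult_def sum_subtractf algebra_simps)
lemma mm_zero [simp]: "0 ** N = 0" "M ** 0 = (0 :: 'r::finite cmat)"
 by (auto intro!: mat_eqI simp: matrix_matrix_mult_def)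
lemma mm_scaleR:
 fixes M N :: "'r::finite cmat"
 shows "(r *\<^sub>R M) ** N = r *\<^sub>R (M ** N)" "M ** (r *\<^sub>R N) = r *\<^sub>R (M ** N)"
 unfolding scaleR_csm csm_mm by (rule refl)+

lemma ctransp_mm: "ctransp (M ** N) = ctransp N ** ctransp M"
 by (auto intro!: mat_eqI simp: matrix_matrix_mult_def mult.commute)
lemma ctransp_ctransp [simp]: "ctransp (ctransp M) = M" by (auto intro!: mat_eqI)
lemma ctransp_csm: "ctransp (csm c M) = csm (cnj c) (ctransp M)" by (auto intro!: mat_eqI)
lemma ctransp_add: "ctransp (M + N) = ctransp M + ctransp N" by (auto intro!: mat_eqI)
lemma ctransp_diff: "ctransp (M - N) = ctransp M - ctransp N" by (auto intro!: mat_eqI)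
lemma ctransp_mat1 [simp]: "ctransp (mat 1) = mat 1" by (auto intro!: mat_eqI simp: mat_def)
lemma matrix_inv_works:
 assumes "invertible (M :: 'r::finite cmat)"
 shows "M ** matrix_inv M = mat 1" "matrix_inv M ** M = mat 1"
 using someI_ex[OF assms[unfolded invertible_def]] unfolding matrix_inv_def by auto

lemma invertibleI_right: "M ** N = mat 1 ==> invertible (M :: 'r::finite cmat)"
 using invertible_right_inverse by blast

lemma matrix_inv_eqI:
 assumes "M ** N = mat 1" shows "matrix_inv (M :: 'r::finite cmat) = N"
proof -
 have "matrix_inv M ** (M ** N) = N"
  unfolding matrix_mul_assoc matrix_inv_works(2)[OF invertibleI_right[OF assms]] by simp
 then show ?thesis by (simp add: assms)
qed

lemma pos_def_herm_invertible:
 assumes "pos_def_herm (H :: 'r::finite cmat)" shows "invertible H"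
proof -
 have "v = 0" if "H *v v = 0" for v
 proof (rule ccontr)
  assume "v ~= 0"
  then have "Re (\<Sum>a\<in>UNIV. cnj (v$a) * (H *v v)$a) > 0" using assms by (auto simp: pos_def_herm_def)
  with that show False by simp
 qed
 then show ?thesis by (simp add: invertible_left_inverse matrix_left_invertible_ker)
qed

lemma pos_def_inv:
 assumes "pos_def_herm H"
 shows "H ** matrix_inv H = mat 1" "matrix_inv H ** H = mat 1" "ctransp H = H"
 using assms pos_def_herm_invertible matrix_inv_works by (auto simp: pos_def_herm_def)

lemma mm_cancel:
 assumes "A ** B = mat 1"
 shows "A ** (B ** M) = (M :: 'r::finite cmat)" "(M ** A) ** B = M"
 using assms by (simp_all add: matrix_mul_assoc flip: matrix_mul_assoc[of M])

lemma ctransp_matrix_inv: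
 assumes "pos_def_herm H" shows "ctransp (matrix_inv H) = matrix_inv H"
proof -
 have "ctransp (matrix_inv H ** H) = ctransp (mat 1)" using pos_def_inv[OF assms] by simp
 then have "H ** ctransp (matrix_inv H) = mat 1"
  unfolding ctransp_mm pos_def_inv(3)[OF assms] by simp
 then show ?thesis using matrix_inv_eqI by metis
qed

lemma hadj_hadj [simp]:
 assumes "pos_def_herm H" shows "hadj H (hadj H M) = M"
 by (simp add: hadj_def ctransp_mm pos_def_inv[OF assms] ctransp_matrix_inv[OF assms] matrix_mul_assoc
   mm_cancel[OF pos_def_inv(2)[OF assms]] mm_cancel[OF pos_def_inv(1)[OF assms]])

lemma hadj_mm:
 assumes "pos_def_herm H" shows "hadj H (M ** N) = hadj H N ** hadj H M"
 by (simp add: hadj_def ctransp_mm matrix_mul_assoc mm_cancel[OF pos_def_inv(1)[OF assms]])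

lemma hadj_mat1: assumes "pos_def_herm H" shows "hadj H (mat 1) = mat 1"
 by (simp add: hadj_def pos_def_inv[OF assms])

lemma hadj_csm: "hadj H (csm c M) = csm (cnj c) (hadj H M)"
 by (simp add: hadj_def ctransp_csm csm_mm)
lemma hadj_add: "hadj H (M + N) = hadj H M + hadj H N"
 by (simp add: hadj_def ctransp_add mm_add)
lemma hadj_diff: "hadj H (M - N) = hadj H M - hadj H N"
 by (simp add: hadj_def ctransp_diff mm_diff)
lemma hadj_zero [simp]: "hadj H 0 = 0"
 using hadj_diff[of H 0 0] by simp
lemma hadj_scaleR: "hadj H (r *\<^sub>R M) = r *\<^sub>R hadj H M"
 by (simp add: scaleR_csm hadj_csm)
lemma hadj_sum: "hadj H (\<Sum>k\<in>K. f k) = (\<Sum>k\<in>K. hadj H (f k))"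
 by (induction K rule: infinite_finite_induct) (auto simp: hadj_add)

lemma bl_hadj: "bounded_linear (hadj H)"
 unfolding linear_conv_bounded_linear[symmetric] by (auto intro!: linearI simp: hadj_add hadj_scaleR)

section \<open>Products of endomorphism-valued forms\<close>

lemma form0_wedge:
 fixes g :: "('n::finite, 'a::real_normed_vector) alt" and c :: "'b::real_normed_vector"
 assumes bb: "bounded_bilinear bm"
 shows "wedge bm (form0 c) g vs = bm c (g vs)"
proof (induction vs arbitrary: g)
 case Nil
 then show ?case by (simp add: wedge_Nil form0_def)
next
 case (Cons v vs)
 have "insf v (form0 c :: ('n, 'b) alt) = (%us. 0)" "hatf (form0 c :: ('n, 'b) alt) = form0 c" by (auto simp: insf_def form0_def hatf_def)
 then show ?case by (simp add: wedge_Cons[OF bb] Cons wedge_zero_left[OF bb]) (simp add: insf_def[of v g])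
qed

lemma wedge_form0:
 assumes bb: "bounded_bilinear bm"
 shows "wedge bm f (form0 c) vs = bm (f vs) c"
proof (induction vs arbitrary: f)
 case Nil
 then show ?case by (simp add: wedge_Nil form0_def)
next
 case (Cons v vs)
 have "insf v (form0 c) = (%us. 0)" by (auto simp: insf_def form0_def)
 then show ?case by (simp add: wedge_Cons[OF bb] Cons wedge_zero_right[OF bb]) (simp add: insf_def)
qed

lemma wedge_mm_assoc: "wedge_mm (wedge_mm f g) h = wedge_mm f (wedge_mm g h)"
 by (rule ext, rule wedge_assoc[OF bb_mm bb_mm bb_mm bb_mm])
   (simp add: matrix_mul_assoc)

lemma wedge_cm_mm: "wedge_mm (wedge_cm c f) g = wedge_cm c (wedge_mm f g)"
 by (rule ext, rule wedge_assoc[OF bb_mm bb_csm bb_csm bb_mm])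
   (simp add: csm_mm)


lemma wedge_mm_csm:
 "wedge_mm (%us. csm k (f us)) g us = csm k (wedge_mm f g us)" "wedge_mm f (%us. csm k (g us)) us = csm k (wedge_mm f g us)"
 unfolding wedge_def csm_sum by (simp_all add: csm_mm scaleR_csm mult.commute)

lemma mprod_Nil [simp]: "mprod [] = form0 (mat 1)" by (simp add: mprod_def)
lemma mprod_Cons [simp]: "mprod (B # Bs) = wedge_mm B (mprod Bs)" by (simp add: mprod_def)

lemma wedge_mm_form0 [simp]: "wedge_mm (form0 (mat 1)) f = f" "wedge_mm f (form0 (mat 1)) = f"
 by (auto simp: form0_wedge wedge_form0 bb_mm)

lemma mprod_append: "mprod (Bs @ Cs) = wedge_mm (mprod Bs) (mprod Cs)"
 by (induction Bs) (simp_all add: wedge_mm_assoc)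

lemma homog_form0: "homog 0 (form0 c)" by (simp add: homog_def form0_def)

lemma homog_mprod: "list_all2 homog ps Bs ==> homog (sum_list ps) (mprod Bs)"
 by (induction rule: list_all2_induct) (auto simp: homog_form0 intro: homog_wedge bb_mm)

text \<open>The pairing by the trace of a product is symmetric, so graded commutativity applies to
  it although the matrix product itself does not commute.\<close>

lemma trace_wedge_commute:
 assumes "homog p f" "homog q g"
 shows "trace (wedge_mm f g vs) = (-1) ^ (p * q) *\<^sub>R trace (wedge_mm g f vs)"
proof -
 have l: "linear (trace :: 'b cmat => complex)" using bl_trace bounded_linear.linear by blast
 have bb: "bounded_bilinear (%x y :: 'b cmat. trace (x ** y))"
  unfolding bilinear_conv_bounded_bilinear[symmetric] bilinear_def
  by (auto intro!: linearI simp: mm_add mm_scaleR trace_add_c)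
 show ?thesis unfolding wedge_linear_out[OF l]
  by (rule wedge_commute[OF bb bb _ assms]) (rule trace_mul_sym)
qed

lemma trace_mprod_rotate:
 assumes "homog p (mprod Xs)" "homog q (mprod Ys)"
 shows "trace (mprod (Xs @ Ys) vs) = (-1) ^ (p * q) *\<^sub>R trace (mprod (Ys @ Xs) vs)"
 unfolding mprod_append by (rule trace_wedge_commute[OF assms])

lemma trace_wedge_cm: "trace (wedge_cm c f vs) = wedge_cc c (%us. trace (f us)) vs"
 by (simp add: wedge_def trace_sum)

section \<open>The trace of a graded symmetrisation with two distinguished factors\<close>

text \<open>Composition with a fixed permutation carrying \<open>i\<close> to \<open>a\<close> and
  \<open>j\<close> to \<open>b\<close> identifies these permutations with those of the set without
  \<open>i\<close> and \<open>j\<close>.\<close>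

lemma card_permutes_two:
 assumes "finite S" "a \<in> S" "b \<in> S" "a ~= b" "i \<in> S" "j \<in> S" "i ~= j"
 shows "card {\<sigma>. \<sigma> permutes S & \<sigma> a = i & \<sigma> b = j} = fact (card S - 2)"
proof -
 obtain \<rho> where r: "\<rho> permutes S" "\<rho> i = a" "\<rho> j = b"
 proof -
  let ?t = "Transposition.transpose i a"
  let ?j = "?t j"
  have t: "?t permutes S" using assms by (simp add: permutes_swap_id)
  have tj: "?j \<in> S" using permutes_in_image[OF t] assms by simp
  have t2: "Transposition.transpose ?j b permutes S" using tj assms by (simp add: permutes_swap_id)
  have ne: "?j ~= a" using assms(7) by (metis transpose_apply_first transpose_eq_imp_eq)
  have "(Transposition.transpose ?j b \<circ> ?t) permutes S" using t t2 permutes_compose by blast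
  moreover have "(Transposition.transpose ?j b \<circ> ?t) i = a" using ne assms(4) by (simp add: Transposition.transpose_def)
  moreover have "(Transposition.transpose ?j b \<circ> ?t) j = b" by simp
  ultimately show ?thesis using that by blast
 qed
 let ?A = "{\<sigma>. \<sigma> permutes S & \<sigma> a = i & \<sigma> b = j}"
 let ?B = "{\<tau>. \<tau> permutes (S - {i, j})}"
 have "bij_betw (%\<sigma>. \<sigma> \<circ> \<rho>) ?A ?B"
 proof (rule bij_betwI[where g="%\<tau>. \<tau> \<circ> inv \<rho>"])
  show "(%\<sigma>. \<sigma> \<circ> \<rho>) \<in> ?A \<rightarrow> ?B"
  proof
   fix \<sigma> assume s: "\<sigma> \<in> ?A"
   then have p: "(\<sigma> \<circ> \<rho>) permutes S" using r permutes_compose by blast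
   have "(\<sigma> \<circ> \<rho>) permutes (S - {i, j})"
    by (rule permutes_superset[OF p]) (use s r in auto)
   then show "\<sigma> \<circ> \<rho> \<in> ?B" by simp
  qed
  show "(%\<tau>. \<tau> \<circ> inv \<rho>) \<in> ?B \<rightarrow> ?A"
  proof
   fix \<tau> assume "\<tau> \<in> ?B"
   then have t: "\<tau> permutes (S - {i, j})" by simp
   then have "\<tau> permutes S" by (rule permutes_subset) auto
   then have "(\<tau> \<circ> inv \<rho>) permutes S" using r permutes_compose permutes_inv by blast
   moreover have "inv \<rho> a = i" "inv \<rho> b = j" using r permutes_inv_eq by metis+
   moreover have "\<tau> i = i" "\<tau> j = j" using t by (auto simp: permutes_def)
   ultimately show "\<tau> \<circ> inv \<rho> \<in> ?A" by simp
  qed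
 qed (use permutes_inv_o[OF r(1)] in \<open>auto simp: o_assoc[symmetric]\<close>)
 then have "card ?A = card ?B" by (rule bij_betw_same_card)
 also have "... = fact (card S - 2)"
  by (rule card_permutations) (use assms in \<open>auto simp: card_Diff_subset\<close>)
 finally show ?thesis .
qed

text \<open>Among \<open>m + 2\<close> positions there are \<open>m + 1 - s\<close> pairs enclosing
  exactly \<open>s\<close> others.\<close>

lemma sum_pairs_less:
 fixes w :: "nat => 'a::real_vector"
 shows "(\<Sum>(a, b)\<in>{(a, b). a < b & b < m + 2}. w (b - a - 1)) = (\<Sum>s\<le>m. real (m + 1 - s) *\<^sub>R w s)"
proof -
 have "(\<Sum>(a, b)\<in>{(a, b). a < b & b < m + 2}. w (b - a - 1)) = (\<Sum>(s, a)\<in>(SIGMA s:{..m}. {..m - s}). w s)"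
  by (rule sum.reindex_bij_witness[of _ "%(s, a). (a, a + s + 1)" "%(a, b). (b - a - 1, a)"]) auto
 also have "... = (\<Sum>s\<le>m. \<Sum>a\<le>m - s. w s)"
  by (subst sum.Sigma) auto
 also have "... = (\<Sum>s\<le>m. real (m + 1 - s) *\<^sub>R w s)"
  by (intro sum.cong refl) (auto simp: sum_constant_scaleR Suc_diff_le)
 finally show ?thesis .
qed

lemma homog_replicate: "homog 2 F ==> homog (2 * s) (mprod (replicate s F))"
 using homog_mprod[of "replicate s 2" "replicate s F"] by (simp add: list_all2_conv_all_nth sum_list_replicate mult.commute)

lemma map_two_marked:
 assumes "a < b" "b < N" "f a = x" "f b = y" "!!q. q < N ==> q ~= a ==> q ~= b ==> f q = z"
 shows "map f [0..<N] = replicate a z @ x # replicate (b - a - 1) z @ y # replicate (N - 1 - b) z"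
proof -
 have z: "map f [k..<l] = replicate (l - k) z" if "!!q. k <= q ==> q < l ==> f q = z" for k l
  using that by (intro replicate_eqI) auto
 have "[0..<N] = [0..<a] @ a # [Suc a..<b] @ b # [Suc b..<N]"
  using upt_add_eq_append[of 0 a "N - a"] upt_add_eq_append[of "Suc a" b "N - b"] upt_conv_Cons[of a N] upt_conv_Cons[of b N] assms(1,2) by simp
 then show ?thesis using assms by (simp add: z)
qed

text \<open>A permutation enters only through the positions \<open>a\<close> and \<open>b\<close> of
  the two marked factors. Cyclic rotation brings \<open>B1\<close> to the front; the even factors
  \<open>F\<close> move without sign, and if the marked factors stand in reverse order, the sign of
  their inversion cancels that of the rotation. The contribution thus depends only on the cyclic
  gap. Each pair of positions comes from m! permutations and each gap from m + 2 ordered pairs, and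
  m! (m + 2) / (m + 2)! = 1 / (m + 1).\<close>

theorem trace_gsym_two:
 fixes Bs :: "(nat \<times> ('n::finite, 'r::finite cmat) alt) list"
 assumes len: "length Bs = m + 2" and ij: "i < j" "j < m + 2"
  and B1: "Bs ! i = (p, B1)" and B2: "Bs ! j = (q, B2)"
  and Fk: "!!k. k < m + 2 ==> k ~= i ==> k ~= j ==> Bs ! k = (2, F)"
  and h: "homog p B1" "homog q B2" "homog 2 F"
 shows "trace (gsym Bs vs) = (1 / real (m + 1)) *\<^sub>R
   (\<Sum>s\<le>m. trace (mprod (B1 # replicate s F @ B2 # replicate (m - s) F) vs))"
proof -
 define N where "N = m + 2"
 define w where "w s = trace (mprod (B1 # replicate s F @ B2 # replicate (m - s) F) vs)" for s
 define ps where "ps = map fst Bs"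
 define word where "word \<sigma> = map (%k. snd (Bs ! \<sigma> k)) [0..<N]" for \<sigma> :: "nat => nat"
 define G where "G a b = (if a < b then w (b - a - 1) else w (m - (a - b - 1)))" for a b
 have hF: "homog (2 * s) (mprod (replicate s F))" for s using homog_replicate h(3) by blast
 have key: "(-1) ^ grsgn ps \<sigma> *\<^sub>R trace (mprod (word \<sigma>) vs) = G a b"
  if s: "\<sigma> permutes {..<N}" and a: "\<sigma> a = i" and b: "\<sigma> b = j" for \<sigma> a b
 proof -
  have inj: "\<sigma> k = \<sigma> l \<longleftrightarrow> k = l" for k l using permutes_inj[OF s] by (auto dest: injD)
  have ab: "a < N" "b < N" "a ~= b"
   using permutes_in_image[OF s, of a] permutes_in_image[OF s, of b] a b ij N_def by auto
  have in_N: "k < N ==> \<sigma> k < N" for k using permutes_in_image[OF s, of k] by simp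
  have oth: "Bs ! \<sigma> k = (2, F)" if "k < N" "k ~= a" "k ~= b" for k
   using Fk[of "\<sigma> k"] in_N[OF that(1)] that a b inj[of k a] inj[of k b] N_def by auto
  have psl: "ps ! \<sigma> k = fst (Bs ! \<sigma> k)" if "k < N" for k
   using in_N[OF that] len N_def by (simp add: ps_def)
  define I where "I = {(k, l). k < l & l < length ps & \<sigma> l < \<sigma> k}"
  have lps: "length ps = N" by (simp add: ps_def len N_def)
  have fI: "finite I" unfolding I_def by (rule finite_subset[of _ "{..<length ps} \<times> {..<length ps}"]) auto
  have sg: "(-1::real) ^ grsgn ps \<sigma> = (\<Prod>(k, l)\<in>I. (-1) ^ (ps ! \<sigma> k * ps ! \<sigma> l))"
   unfolding grsgn_def I_def[symmetric] by (simp add: power_sum case_prod_beta)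
  \<comment> \<open>Every inversion other than that of the marked pair involves a factor of degree
    2.\<close>
  have ev: "(-1::real) ^ (ps ! \<sigma> k * ps ! \<sigma> l) = 1" if "(k, l) \<in> I" "{k, l} ~= {a, b}" for k l
  proof -
   have "k < N" "l < N" "k ~= l" using that(1) lps by (auto simp: I_def)
   then have "ps ! \<sigma> k = 2 \<or> ps ! \<sigma> l = 2" using that(2) psl oth by (metis fst_conv insert_commute)
   then show ?thesis by auto
  qed
  show ?thesis
  proof (cases "a < b")
   case True
   have "(-1::real) ^ grsgn ps \<sigma> = 1"
    unfolding sg
   proof (rule prod.neutral, clarify)
    fix k l assume kl: "(k, l) \<in> I"
    have "{k, l} ~= {a, b}" using kl True a b ij by (auto simp: I_def doubleton_eq_iff)
    then show "(-1::real) ^ (ps ! \<sigma> k * ps ! \<sigma> l) = 1" using ev kl by blast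
   qed
   moreover have "word \<sigma> = replicate a F @ B1 # replicate (b - a - 1) F @ B2 # replicate (N - 1 - b) F"
    unfolding word_def by (rule map_two_marked) (use True ab a b B1 B2 oth in auto)
   moreover have "trace (mprod (replicate a F @ (B1 # replicate (b - a - 1) F @ B2 # replicate (N - 1 - b) F)) vs)
     = trace (mprod ((B1 # replicate (b - a - 1) F @ B2 # replicate (N - 1 - b) F) @ replicate a F) vs)"
   proof -
    have "homog (p + (2 * (b - a - 1) + (q + 2 * (N - 1 - b)))) (mprod (B1 # replicate (b - a - 1) F @ B2 # replicate (N - 1 - b) F))"
     unfolding mprod_Cons mprod_append by (intro homog_wedge bb_mm h hF)
    from trace_mprod_rotate[OF hF this, of a vs] show ?thesis by simp
   qed
   moreover have "N - 1 - b + a = m - (b - a - 1)" using True ab N_def by auto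
   ultimately show ?thesis using True
    by (simp add: G_def w_def flip: replicate_add)
  next
   case False
   then have ba: "b < a" using ab by simp
   have "(b, a) \<in> I" using ba ab lps a b ij by (auto simp: I_def)
   then have "(-1::real) ^ grsgn ps \<sigma> = (-1) ^ (ps ! \<sigma> b * ps ! \<sigma> a) * (\<Prod>(k, l)\<in>I - {(b, a)}. (-1) ^ (ps ! \<sigma> k * ps ! \<sigma> l))"
    unfolding sg by (subst prod.remove[OF fI]) auto
   also have "(\<Prod>(k, l)\<in>I - {(b, a)}. (-1) ^ (ps ! \<sigma> k * ps ! \<sigma> l)) = (1::real)"
   proof (rule prod.neutral, rule ballI)
    fix x assume "x \<in> I - {(b, a)}"
    then obtain k l where kl: "x = (k, l)" "(k, l) \<in> I" "(k, l) ~= (b, a)" by (cases x) auto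
    have "{k, l} ~= {a, b}" using kl ba by (auto simp: I_def doubleton_eq_iff)
    then show "(case x of (k, l) => (-1::real) ^ (ps ! \<sigma> k * ps ! \<sigma> l)) = 1"
     using ev[OF kl(2)] kl(1) by simp
   qed
   finally have sg': "(-1::real) ^ grsgn ps \<sigma> = (-1) ^ (q * p)"
    using psl[OF ab(1)] psl[OF ab(2)] a b B1 B2 by simp
   let ?X = "replicate b F @ B2 # replicate (a - b - 1) F"
   let ?Y = "B1 # replicate (N - 1 - a) F"
   have wd: "word \<sigma> = ?X @ ?Y"
    unfolding word_def append_assoc append_Cons by (rule map_two_marked) (use ba ab a b B1 B2 oth in auto)
   have hX: "homog (2 * b + (q + 2 * (a - b - 1))) (mprod ?X)" "homog (p + 2 * (N - 1 - a)) (mprod ?Y)"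
    unfolding mprod_Cons mprod_append by (intro homog_wedge bb_mm h hF)+
   \<comment> \<open>Modulo 2 only the degrees of the marked factors survive, so the rotation has
     the same sign as the inversion of the marked pair.\<close>
   have par: "(-1::real) ^ ((2 * b + (q + 2 * (a - b - 1))) * (p + 2 * (N - 1 - a))) = (-1) ^ (q * p)"
    by (simp add: minus_one_power_iff)
   have "(-1) ^ grsgn ps \<sigma> *\<^sub>R trace (mprod (word \<sigma>) vs) = trace (mprod (?Y @ ?X) vs)"
    unfolding wd trace_mprod_rotate[OF hX] par sg' by (simp flip: power_add)
   moreover have "?Y @ ?X = B1 # replicate (m - (a - b - 1)) F @ B2 # replicate (m - (m - (a - b - 1))) F"
   proof -
    have "N - 1 - a + b = m - (a - b - 1)" and 2: "m - (m - (a - b - 1)) = a - b - 1"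
     using ba ab N_def by auto
    then have 1: "replicate (m - (a - b - 1)) F = replicate (N - 1 - a) F @ replicate b F"
     by (metis replicate_add)
    show ?thesis unfolding 1 2 by simp
   qed
   ultimately show ?thesis using False by (simp only: G_def w_def if_False)
  qed
 qed
 let ?P = "{\<sigma>. \<sigma> permutes {..<N}}"
 let ?S = "%\<sigma>. (-1) ^ grsgn ps \<sigma> *\<^sub>R trace (mprod (word \<sigma>) vs)"
 let ?AB = "{(a, b). a < N & b < N & a ~= b}"
 have finAB: "finite ?AB" by (rule finite_subset[of _ "{..<N} \<times> {..<N}"]) auto
 have finP: "finite ?P" by (rule finite_permutations) simp
 have "(\<Sum>\<sigma>\<in>?P. ?S \<sigma>) = (\<Sum>ab\<in>?AB. \<Sum>\<sigma>\<in>{\<sigma>\<in>?P. (inv \<sigma> i, inv \<sigma> j) = ab}. ?S \<sigma>)"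
 proof (rule sum.group[OF finP finAB, symmetric])
  show "(%\<sigma>. (inv \<sigma> i, inv \<sigma> j)) ` ?P \<subseteq> ?AB"
  proof (rule image_subsetI)
   fix \<sigma> assume "\<sigma> \<in> ?P"
   then have s: "inv \<sigma> permutes {..<N}" using permutes_inv by blast
   then have "inv \<sigma> i ~= inv \<sigma> j" using permutes_inj[OF s] ij by (auto dest: injD)
   then show "(inv \<sigma> i, inv \<sigma> j) \<in> ?AB"
    using ij N_def permutes_in_image[OF s, of i] permutes_in_image[OF s, of j] by auto
  qed
 qed
 also have "... = (\<Sum>ab\<in>?AB. fact m *\<^sub>R G (fst ab) (snd ab))"
 proof (rule sum.cong[OF refl])
  fix ab assume "ab \<in> ?AB"
  then obtain a b where ab: "ab = (a, b)" "a < N" "b < N" "a ~= b" by auto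
  have eq: "{\<sigma>\<in>?P. (inv \<sigma> i, inv \<sigma> j) = ab} = {\<sigma>. \<sigma> permutes {..<N} & \<sigma> a = i & \<sigma> b = j}"
  proof -
   have "((inv \<sigma> i, inv \<sigma> j) = ab) = (\<sigma> a = i & \<sigma> b = j)" if "\<sigma> permutes {..<N}" for \<sigma>
    using permutes_inv_eq[OF that, of i a] permutes_inv_eq[OF that, of j b] ab(1) by auto
   then show ?thesis by blast
  qed
  have "(\<Sum>\<sigma>\<in>{\<sigma>\<in>?P. (inv \<sigma> i, inv \<sigma> j) = ab}. ?S \<sigma>) = (\<Sum>\<sigma>\<in>{\<sigma>. \<sigma> permutes {..<N} & \<sigma> a = i & \<sigma> b = j}. G a b)"
   unfolding eq by (rule sum.cong) (use key in auto)
  also have "... = fact m *\<^sub>R G a b"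
   using card_permutes_two[of "{..<N}" a b i j] ab ij N_def by (simp add: sum_constant_scaleR del: sum_constant)
  finally show "(\<Sum>\<sigma>\<in>{\<sigma>\<in>?P. (inv \<sigma> i, inv \<sigma> j) = ab}. ?S \<sigma>) = fact m *\<^sub>R G (fst ab) (snd ab)" using ab by simp
 qed
 also have "... = fact m *\<^sub>R (\<Sum>(a, b)\<in>?AB. G a b)"
  by (simp add: scaleR_sum_right case_prod_beta)
 \<comment> \<open>The gap \<open>s\<close> occurs \<open>m + 1 - s\<close> times with the marked
   factors in order and \<open>s + 1\<close> times in reverse order, where the complementary gap
   counts; the total does not depend on \<open>s\<close>.\<close>
 also have "(\<Sum>(a, b)\<in>?AB. G a b) = real (m + 2) *\<^sub>R (\<Sum>s\<le>m. w s)"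
 proof -
  let ?L = "{(a, b). a < b & b < m + 2}"
  have fL: "finite ?L" by (rule finite_subset[of _ "{..<m+2} \<times> {..<m+2}"]) auto
  have "?AB = ?L \<union> prod.swap ` ?L" unfolding N_def by (auto simp: image_iff)
  moreover have "?L \<inter> prod.swap ` ?L = {}" by auto
  ultimately have "(\<Sum>(a, b)\<in>?AB. G a b) = (\<Sum>(a, b)\<in>?L. G a b) + (\<Sum>(a, b)\<in>prod.swap ` ?L. G a b)"
   using fL by (simp add: sum.union_disjoint)
  also have "(\<Sum>(a, b)\<in>prod.swap ` ?L. G a b) = (\<Sum>(a, b)\<in>?L. G b a)"
   by (subst sum.reindex) (auto simp: case_prod_beta inj_on_def)
  also have "... = (\<Sum>(a, b)\<in>?L. w (m - (b - a - 1)))"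
   by (rule sum.cong) (auto simp: G_def)
  also have "... = (\<Sum>s\<le>m. real (m + 1 - s) *\<^sub>R w (m - s))"
   by (rule sum_pairs_less[of "%s. w (m - s)"])
  also have "... = (\<Sum>s\<le>m. real (s + 1) *\<^sub>R w s)"
   by (rule sum.reindex_bij_witness[of _ "%s. m - s" "%s. m - s"]) auto
  also have "(\<Sum>(a, b)\<in>?L. G a b) = (\<Sum>(a, b)\<in>?L. w (b - a - 1))"
   by (rule sum.cong) (auto simp: G_def)
  also have "... = (\<Sum>s\<le>m. real (m + 1 - s) *\<^sub>R w s)" by (rule sum_pairs_less)
  also have "... + (\<Sum>s\<le>m. real (s + 1) *\<^sub>R w s) = (\<Sum>s\<le>m. real (m + 2) *\<^sub>R w s)"
   unfolding sum.distrib[symmetric] scaleR_add_left[symmetric]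
   by (intro sum.cong refl arg_cong2[where f=scaleR]) (auto simp: of_nat_diff)
  finally show ?thesis by (simp add: scaleR_sum_right)
 qed
 finally have "(\<Sum>\<sigma>\<in>?P. ?S \<sigma>) = (fact m * real (m + 2)) *\<^sub>R (\<Sum>s\<le>m. w s)" by simp
 moreover have "trace (gsym Bs vs) = (1 / fact N) *\<^sub>R (\<Sum>\<sigma>\<in>?P. ?S \<sigma>)"
  unfolding gsym_def len N_def[symmetric] ps_def word_def by (simp add: trace_sum)
 moreover have "1 / fact N * (fact m * real (m + 2)) = 1 / real (m + 1)"
  by (simp add: N_def divide_simps)
 ultimately show ?thesis by (simp only: scaleR_scaleR w_def)
qed

section \<open>Smooth functions\<close>

lemma Ck_on_cong:
 assumes "open S" "!!y. y \<in> S ==> f y = g y" "Ck_on k S f"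
 shows "Ck_on k S g"
 using assms(2,3)
proof (induction k arbitrary: f g)
 case 0
 then show ?case by (simp cong: continuous_on_cong)
next
 case (Suc k)
 have ev: "eventually (%z. f z = g z) (nhds y)" if "y \<in> S" for y
  using eventually_nhds_in_open[OF assms(1) that] Suc.prems(1) by (auto elim: eventually_mono)
 have "\<forall>y\<in>S. dfb g y"
  using Suc.prems(2) diff_cong_nhds[OF ev] by auto
 moreover have "Ck_on k S (%y. fd g y v)" for v
  by (rule Suc.IH[of "%y. fd f y v"])
    (use Suc.prems(2) fd_cong_nhds[OF ev] in auto)
 ultimately show ?case by simp
qed

lemma Ck_on_subset: "Ck_on k S f ==> T \<subseteq> S ==> Ck_on k T f"
 by (induction k arbitrary: f) (auto intro: continuous_on_subset)

lemma differentiable_imp_continuous_on: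
 assumes "!!y. y \<in> S ==> dfb f y" shows "continuous_on S f"
 by (rule continuous_at_imp_continuous_on) (use assms differentiable_imp_continuous_within in blast)

lemma Ck_on_Suc_continuous: "Ck_on (Suc k) S f ==> continuous_on S f"
 by (rule differentiable_imp_continuous_on) simp

lemma Ck_on_SucD: "Ck_on (Suc k) S f ==> Ck_on k S f"
proof (induction k arbitrary: f)
 case 0 then show ?case using Ck_on_Suc_continuous[OF 0] by simp
next
 case (Suc k) then show ?case by auto
qed

lemma Ck_on_const: "Ck_on k S (%y. c)"
 by (induction k arbitrary: c) auto

lemma Ck_on_add:
 assumes "open S" shows "Ck_on k S f ==> Ck_on k S g ==> Ck_on k S (%y. f y + g y)"
proof (induction k arbitrary: f g)
 case (Suc k)
 have "Ck_on k S (%y. fd (%y. f y + g y) y v)" for v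
  by (rule Ck_on_cong[OF assms, of "%y. fd f y v + fd g y v"])
    (use Suc in \<open>auto simp: fd_add\<close>)
 then show ?case using Suc.prems by auto
qed (auto intro: continuous_on_add)

lemma Ck_on_linear:
 assumes "open S" "bounded_linear T" shows "Ck_on k S f ==> Ck_on k S (%y. T (f y))"
proof (induction k arbitrary: f)
 case 0
 then show ?case using bounded_linear.continuous_on[OF assms(2)] by auto
next
 case (Suc k)
 have "Ck_on k S (%y. fd (%y. T (f y)) y v)" for v
  by (rule Ck_on_cong[OF assms(1), of "%y. T (fd f y v)"])
    (use Suc in \<open>auto simp: fd_linear[OF _ assms(2)]\<close>)
 then show ?case using Suc.prems by (simp add: diff_linear[OF assms(2)])
qed

lemma Ck_on_bilinear:
 assumes "open S" "bounded_bilinear bm"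
 shows "Ck_on k S f ==> Ck_on k S g ==> Ck_on k S (%y. bm (f y) (g y))"
proof (induction k arbitrary: f g)
 case 0
 then show ?case using bounded_bilinear.continuous_on[OF assms(2)] by auto
next
 case (Suc k)
 have fg: "Ck_on k S f" "Ck_on k S g" using Suc.prems Ck_on_SucD by blast+
 have "Ck_on k S (%y. fd (%y. bm (f y) (g y)) y v)" for v
  by (rule Ck_on_cong[OF assms(1), of "%y. bm (fd f y v) (g y) + bm (f y) (fd g y v)"])
    (use Suc fg in \<open>auto simp: fd_bilinear[OF assms(2)] intro!: Ck_on_add[OF assms(1)]\<close>)
 then show ?case using Suc.prems by (simp add: diff_bilinear[OF assms(2)])
qed

lemma smooth_cong: "open S ==> smooth_fun_on S f ==> (!!y. y \<in> S ==> f y = g y) ==> smooth_fun_on S g"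
 unfolding smooth_fun_on_def using Ck_on_cong by blast
lemma smooth_subset: "smooth_fun_on S f ==> T \<subseteq> S ==> smooth_fun_on T f"
 unfolding smooth_fun_on_def using Ck_on_subset by blast
lemma smooth_const: "smooth_fun_on S (%y. c)"
 unfolding smooth_fun_on_def using Ck_on_const by blast
lemma smooth_add: "open S ==> smooth_fun_on S f ==> smooth_fun_on S g ==> smooth_fun_on S (%y. f y + g y)"
 unfolding smooth_fun_on_def using Ck_on_add by blast
lemma smooth_linear: "open S ==> bounded_linear T ==> smooth_fun_on S f ==> smooth_fun_on S (%y. T (f y))"
 unfolding smooth_fun_on_def using Ck_on_linear by blast
lemma smooth_bilinear: "open S ==> bounded_bilinear bm ==> smooth_fun_on S f ==> smooth_fun_on S g
  ==> smooth_fun_on S (%y. bm (f y) (g y))"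
 unfolding smooth_fun_on_def using Ck_on_bilinear by blast
lemma smooth_scaleR: "open S ==> smooth_fun_on S f ==> smooth_fun_on S (%y. r *\<^sub>R f y)"
 by (rule smooth_linear[OF _ bounded_linear_scaleR_right])
lemma smooth_minus: "open S ==> smooth_fun_on S f ==> smooth_fun_on S (%y. - f y)"
 by (rule smooth_linear[OF _ bounded_linear_minus[OF bounded_linear_ident]])
lemma smooth_diff: "open S ==> smooth_fun_on S f ==> smooth_fun_on S g ==> smooth_fun_on S (%y. f y - g y)"
 using smooth_add[of S f "%y. - g y"] smooth_minus by fastforce
lemma smooth_sum: "open S ==> (!!k. k \<in> K ==> smooth_fun_on S (f k)) ==> smooth_fun_on S (%y. \<Sum>k\<in>K. f k y)"
 by (induction K rule: infinite_finite_induct) (auto simp: smooth_const intro: smooth_add)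
lemma smooth_deriv: "smooth_fun_on S f ==> smooth_fun_on S (%y. fd f y v)"
 unfolding smooth_fun_on_def by (metis Ck_on.simps(2))
lemma smooth_diff_at: "smooth_fun_on S f ==> y \<in> S ==> dfb f y"
 unfolding smooth_fun_on_def by (metis Ck_on.simps(2))
lemma smooth_continuous: "smooth_fun_on S f ==> continuous_on S f"
 unfolding smooth_fun_on_def by (metis Ck_on.simps(1))
lemmas smooth_csm = smooth_linear[OF _ bl_csm]
lemmas smooth_mm = smooth_bilinear[OF _ bb_mm]

lemma smooth_wedge:
 assumes "open S" "bounded_bilinear bm" "!!us. smooth_fun_on S (%y. f y us)" "!!us. smooth_fun_on S (%y. g y us)"
 shows "smooth_fun_on S (%y. wedge bm (f y) (g y) vs)"
 unfolding wedge_def by (intro smooth_sum smooth_scaleR smooth_bilinear[OF assms(1,2)] assms)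

lemma smooth_ext_d:
 assumes "open S" "!!us. smooth_fun_on S (%y. f y us)"
 shows "smooth_fun_on S (%y. ext_d f y vs)"
 unfolding ext_d_def by (intro smooth_sum smooth_scaleR smooth_deriv assms)

lemma smooth_form0: "smooth_fun_on S f ==> smooth_fun_on S (%y. form0 (f y) vs)"
 by (cases vs) (auto simp: form0_def smooth_const)

lemma smooth_vecI:
 fixes f :: "'a::euclidean_space => complex^'n::finite"
 assumes S: "open S" and f: "!!a. smooth_fun_on S (%y. f y $ a)" shows "smooth_fun_on S f"
proof -
 have "bounded_linear (axis a :: complex => complex^'n)" for a
  unfolding linear_conv_bounded_linear[symmetric] by (rule linearI) (auto simp: axis_def vec_eq_iff)
 then have "smooth_fun_on S (%y. \<Sum>a\<in>UNIV. axis a (f y $ a))"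
  by (intro smooth_sum[OF S] smooth_linear[OF S _ f])
 moreover have "(\<Sum>a\<in>UNIV. axis a (v $ a)) = v" for v :: "complex^'n"
  by (simp add: vec_eq_iff axis_def if_distrib cong: if_cong)
 ultimately show ?thesis by simp
qed

subsection \<open>Inverse matrices\<close>

definition munit :: "'r => 'r => 'r::finite cmat" where
 "munit a b = (\<chi> i j. if i = a & j = b then 1 else 0)"

lemma mat_expand: "M = (\<Sum>a\<in>UNIV. \<Sum>b\<in>UNIV. csm (M $ a $ b) (munit a b))"
proof (rule mat_eqI)
 fix i j
 have "(\<Sum>a\<in>UNIV. \<Sum>b\<in>UNIV. csm (M $ a $ b) (munit a b)) $ i $ j
   = (\<Sum>a\<in>UNIV. \<Sum>b\<in>UNIV. if a = i then (if b = j then M $ a $ b else 0) else 0)"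
  by (auto simp: munit_def intro!: sum.cong)
 also have "... = (\<Sum>a\<in>UNIV. if a = i then (\<Sum>b\<in>UNIV. if b = j then M $ a $ b else 0) else 0)"
  by (intro sum.cong) auto
 also have "... = M $ i $ j" by simp
 finally show "M $ i $ j = (\<Sum>a\<in>UNIV. \<Sum>b\<in>UNIV. csm (M $ a $ b) (munit a b)) $ i $ j" by simp
qed

lemma bounded_linear_entry: "bounded_linear (%M :: 'r::finite cmat. M $ a $ b)"
 by (rule bounded_linear_compose[OF bounded_linear_vec_nth bounded_linear_vec_nth])

lemma differentiable_cmatI:
 assumes "!!a b. dfb (%z. M z $ a $ b) y"
 shows "dfb (M :: _ => 'r::finite cmat) y"
proof -
 have "dfb (%z. \<Sum>a\<in>UNIV. \<Sum>b\<in>UNIV. csm (M z $ a $ b) (munit a b)) y"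
  by (intro differentiable_sum ballI diff_bilinear[OF bb_csm] assms) auto
 then show ?thesis unfolding mat_expand[symmetric] .
qed

lemma differentiable_prod_at:
 fixes f :: "'k => _ => 'a::real_normed_field"
 assumes "!!k. k \<in> K ==> dfb (f k) y"
 shows "dfb (%z. \<Prod>k\<in>K. f k z) y"
 using assms by (induction K rule: infinite_finite_induct) (auto intro: differentiable_mult)

lemma differentiable_det:
 assumes "!!a b. dfb (%z. (M z :: 'r::finite cmat) $ a $ b) y"
 shows "dfb (%z. det (M z)) y"
 unfolding det_def
 by (intro differentiable_sum ballI differentiable_mult differentiable_prod_at assms differentiable_const)
   (auto simp: finite_permutations)

text \<open>Cramer's rule. It exhibits the entries of the inverse as rational functions of those of
  \<open>M\<close>, which is the source of differentiability.\<close>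

lemma matrix_inv_entry:
 assumes "invertible (M :: 'r::finite cmat)"
 shows "matrix_inv M $ k $ l = det (\<chi> i j. if j = k then mat 1 $ i $ l else M $ i $ j) / det M"
proof -
 have d: "det M ~= 0" using assms invertible_det_nz by blast
 define b where "b = (\<chi> i. (mat 1 :: 'r cmat) $ i $ l)"
 have "M *v column l (matrix_inv M) = b"
  using matrix_inv_works(1)[OF assms]
  by (simp add: vec_eq_iff b_def matrix_vector_mult_def column_def matrix_matrix_mult_def)
 then have "column l (matrix_inv M) = (\<chi> k. det (\<chi> i j. if j = k then b $ i else M $ i $ j) / det M)"
  using cramer[OF d] by blast
 then have "column l (matrix_inv M) $ k = det (\<chi> i j. if j = k then b $ i else M $ i $ j) / det M" by simp
 moreover have "b $ i = (mat 1 :: 'r cmat) $ i $ l" for i by (simp add: b_def)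
 ultimately show ?thesis by (simp add: column_def cong: if_cong)
qed

lemma differentiable_matrix_inv:
 assumes "dfb M y" "eventually (%z. invertible (M z)) (nhds y)"
 shows "dfb (%z. matrix_inv (M z :: 'r::finite cmat)) y"
proof (rule differentiable_cmatI)
 fix k l
 have c: "dfb (%z. M z $ a $ b) y" for a b
  by (rule diff_linear[OF bounded_linear_entry assms(1)])
 have "dfb (%z. det (\<chi> i j. if j = k then mat 1 $ i $ l else M z $ i $ j) / det (M z)) y"
 proof (intro differentiable_divide differentiable_det)
  show "dfb (%z. (\<chi> i j. if j = k then mat 1 $ i $ l else M z $ i $ j) $ a $ b) y" for a b
   using c by (cases "b = k") auto
  show "det (M y) ~= 0" using eventually_nhds_x_imp_x[OF assms(2)] invertible_det_nz by blast
 qed (rule c)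
 then show "dfb (%z. matrix_inv (M z) $ k $ l) y"
  by (rule diff_cong_nhds[THEN iffD1, rotated])
    (use assms(2) in \<open>auto elim!: eventually_mono simp: matrix_inv_entry\<close>)
qed

lemma fd_matrix_inv:
 assumes "dfb M y" "eventually (%z. invertible (M z)) (nhds y)"
 shows "fd (%z. matrix_inv (M z :: 'r::finite cmat)) y v =
  - (matrix_inv (M y) ** fd M y v ** matrix_inv (M y))"
proof -
 note di = differentiable_matrix_inv[OF assms]
 have i: "invertible (M y)" using eventually_nhds_x_imp_x[OF assms(2)] .
 let ?N = "matrix_inv (M y)"
 let ?D = "fd (%z. matrix_inv (M z)) y v"
 have "fd (%z. matrix_inv (M z) ** M z) y v = fd (%z. mat 1 :: 'r cmat) y v"
  by (rule fun_cong[OF fd_cong_nhds])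
    (use assms(2) in \<open>auto elim!: eventually_mono simp: matrix_inv_works\<close>)
 then have "?D ** M y + ?N ** fd M y v = 0"
  by (simp add: fd_bilinear[OF bb_mm di assms(1)] frechet_derivative_const)
 then have "(?D ** M y + ?N ** fd M y v) ** ?N = 0" by simp
 then have "?D ** (M y ** ?N) + ?N ** fd M y v ** ?N = 0"
  by (simp add: mm_add matrix_mul_assoc)
 then show ?thesis by (simp add: matrix_inv_works[OF i] eq_neg_iff_add_eq_0)
qed

text \<open>Induction on the order: the derivative of the inverse is again a product of the inverse
  with a derivative of \<open>M\<close>.\<close>

lemma smooth_matrix_inv:
 assumes S: "open S" and M: "smooth_fun_on S M" and inv: "!!y. y \<in> S ==> invertible (M y :: 'r::finite cmat)"
 shows "smooth_fun_on S (%y. matrix_inv (M y))"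
proof -
 have ev: "eventually (%z. invertible (M z)) (nhds y)" if "y \<in> S" for y
  using eventually_nhds_in_open[OF S that] inv by (auto elim: eventually_mono)
 have di: "dfb (%y. matrix_inv (M y)) y" if "y \<in> S" for y
  by (rule differentiable_matrix_inv[OF smooth_diff_at[OF M that] ev[OF that]])
 have "Ck_on k S (%y. matrix_inv (M y))" for k
 proof (induction k)
  case 0
  then show ?case using di by (simp add: differentiable_imp_continuous_on)
 next
  case (Suc k)
  have "Ck_on k S (%y. fd M y v)" for v
   using smooth_deriv[OF M] by (simp add: smooth_fun_on_def)
  then have "Ck_on k S (%y. - (matrix_inv (M y) ** fd M y v ** matrix_inv (M y)))" for v
   by (intro Ck_on_linear[OF S bounded_linear_minus[OF bounded_linear_ident]] Ck_on_bilinear[OF S bb_mm] Suc)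
  then have "Ck_on k S (%y. fd (%y. matrix_inv (M y)) y v)" for v
   by (rule Ck_on_cong[OF S, rotated])
     (simp add: fd_matrix_inv[OF smooth_diff_at[OF M] ev])
  then show ?case using di by simp
 qed
 then show ?thesis by (simp add: smooth_fun_on_def)
qed

subsection \<open>Symmetry of second derivatives\<close>

lemma line_derivative:
 assumes "dfb f (p + s *\<^sub>R u)"
 shows "hvd (%s. f (p + s *\<^sub>R u)) (fd f (p + s *\<^sub>R u) u) s"
proof -
 have "((%s. p + s *\<^sub>R u) has_derivative (%h. h *\<^sub>R u)) (at s)" by (auto intro!: derivative_eq_intros)
 from has_derivative_compose[OF this assms[unfolded frechet_derivative_works]]
 show ?thesis unfolding has_vector_derivative_def
  using linear_frechet_derivative[OF assms] by (simp add: linear_scale)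
qed

text \<open>The mean value theorem, used once in each direction. The second difference on the left
  is symmetric in \<open>v\<close> and \<open>w\<close>, which is what the exchange of derivatives
  exploits.\<close>

lemma second_difference_mvt:
 fixes f :: "'a::euclidean_space => real"
 assumes t: "0 < t" and d: "!!a b. a \<in> {0..t} ==> b \<in> {0..t} ==> dfb f (y + b *\<^sub>R w + a *\<^sub>R v)"
  "!!a b. a \<in> {0..t} ==> b \<in> {0..t} ==> dfb (%z. fd f z v) (y + a *\<^sub>R v + b *\<^sub>R w)"
 shows "\<exists>a\<in>{0..t}. \<exists>b\<in>{0..t}. f (y + t *\<^sub>R v + t *\<^sub>R w) - f (y + t *\<^sub>R v) - f (y + t *\<^sub>R w) + f y
  = t\<^sup>2 * fd (%z. fd f z v) (y + a *\<^sub>R v + b *\<^sub>R w) w"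
proof -
 have r: "((%s. g (p + s *\<^sub>R u)) has_real_derivative fd g (p + s *\<^sub>R u) u) (at s)"
  if "dfb g (p + s *\<^sub>R u)" for g :: "'a => real" and p u s
  using line_derivative[OF that] unfolding has_real_derivative_iff_has_vector_derivative .
 have "\<exists>a. 0 < a & a < t & (%a. f (y + t *\<^sub>R w + a *\<^sub>R v) - f (y + 0 *\<^sub>R w + a *\<^sub>R v)) t
   - (%a. f (y + t *\<^sub>R w + a *\<^sub>R v) - f (y + 0 *\<^sub>R w + a *\<^sub>R v)) 0
   = (t - 0) * (fd f (y + t *\<^sub>R w + a *\<^sub>R v) v - fd f (y + 0 *\<^sub>R w + a *\<^sub>R v) v)"
  by (rule MVT2[OF t], intro DERIV_diff r d(1)) (use t in auto)
 then obtain a where a: "0 < a" "a < t" and 1: "f (y + t *\<^sub>R v + t *\<^sub>R w) - f (y + t *\<^sub>R v) - f (y + t *\<^sub>R w) + f y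
   = t * (fd f (y + a *\<^sub>R v + t *\<^sub>R w) v - fd f (y + a *\<^sub>R v + 0 *\<^sub>R w) v)"
  by (auto simp: algebra_simps)
 have "\<exists>b. 0 < b & b < t & fd f (y + a *\<^sub>R v + t *\<^sub>R w) v - fd f (y + a *\<^sub>R v + 0 *\<^sub>R w) v
   = (t - 0) * fd (%z. fd f z v) (y + a *\<^sub>R v + b *\<^sub>R w) w"
  by (rule MVT2[OF t], intro r d(2)) (use a in auto)
 then show ?thesis using a by (fastforce simp: 1 power2_eq_square)
qed

text \<open>Pairing with a vector \<open>c\<close> reduces the claim to real values, where the mean
  value theorem is available. Near \<open>y\<close> both mixed derivatives take the value of one and
  the same second difference quotient, and continuity lets the parallelogram shrink.\<close>

lemma symmetric_second_derivative:
 fixes f :: "'a::euclidean_space => 'b::real_inner"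
 assumes S: "open S" "y \<in> S" and f: "Ck_on 2 S f"
 shows "fd (%z. fd f z v) y w = fd (%z. fd f z w) y v"
proof -
 have df: "dfb f z" and dfv: "dfb (%z. fd f z v) z"
  if "z \<in> S" for z v
  using f that by (auto simp: numeral_2_eq_2)
 have "c \<bullet> fd (%z. fd f z v) y w = c \<bullet> fd (%z. fd f z w) y v" for c
 proof -
  let ?g = "%z. c \<bullet> f z"
  let ?h = "%v w z. fd (%z. fd ?g z v) z w"
  have bl: "bounded_linear (%x. c \<bullet> x)" by (rule bounded_linear_inner_right)
  have g: "Ck_on 2 S ?g" by (rule Ck_on_linear[OF S(1) bl f])
  have e: "?h v w y = c \<bullet> fd (%z. fd f z v) y w" for v w
  proof -
   have "?h v w y = fd (%z. c \<bullet> fd f z v) y w"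
    by (rule fun_cong[OF fd_cong_nhds])
      (use eventually_nhds_in_open[OF S] df in \<open>auto elim!: eventually_mono simp: fd_linear[OF _ bl]\<close>)
   also have "... = c \<bullet> fd (%z. fd f z v) y w"
    by (rule fd_linear[OF dfv[OF S(2)] bl])
   finally show ?thesis .
  qed
  have "dist (?h v w y) (?h w v y) < d" if "d > 0" for d
  proof -
   have "isCont (?h v w) y" for v w
    using g S continuous_on_eq_continuous_at by (fastforce simp: numeral_2_eq_2)
   then have "eventually (%z. dist (?h v w z) (?h v w y) < d / 2) (nhds y)" for v w
    using that tendsto_at_iff_tendsto_nhds[of "?h v w" y] by (intro tendstoD) (auto simp: isCont_def)
   from eventually_conj[OF eventually_nhds_in_open[OF S] eventually_conj[OF this this]]
   obtain e where e: "e > 0" "!!z. dist z y < e ==> z \<in> S & dist (?h v w z) (?h v w y) < d / 2 & dist (?h w v z) (?h w v y) < d / 2"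
    unfolding eventually_nhds_metric by metis
   \<comment> \<open>With this factor the whole parallelogram with sides
     \<open>t *\<^sub>R v\<close> and \<open>t *\<^sub>R w\<close> stays in the ball of radius
     \<open>e\<close>, where both mixed derivatives deviate by less than
     \<open>d / 2\<close>.\<close>
   define t where "t = e / (norm v + norm w + 1)"
   have n: "norm v + norm w + 1 > 0" by (simp add: add_nonneg_pos)
   have t: "t > 0" using e(1) n by (simp add: t_def)
   have near: "dist (y + a *\<^sub>R v + b *\<^sub>R w) y < e" if "a \<in> {0..t}" "b \<in> {0..t}" for a b
   proof -
    have "norm (a *\<^sub>R v + b *\<^sub>R w) <= a * norm v + b * norm w"
     using norm_triangle_ineq[of "a *\<^sub>R v" "b *\<^sub>R w"] that by simp
    also have "... <= t * norm v + t * norm w" using that by (intro add_mono mult_right_mono) auto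
    also have "... < t * (norm v + norm w + 1)" using t by (simp add: algebra_simps)
    also have "... = e" using n by (simp add: t_def)
    finally show ?thesis by (simp add: dist_norm add.assoc)
   qed
   have near': "dist (y + b *\<^sub>R w + a *\<^sub>R v) y < e" if "a \<in> {0..t}" "b \<in> {0..t}" for a b
    using near[OF that] by (simp add: algebra_simps)
   have D: "dfb ?g z" "dfb (%z. fd ?g z v) z" if "dist z y < e" for z v
    using g e(2)[OF that] by (auto simp: numeral_2_eq_2)
   obtain a b where 1: "a \<in> {0..t}" "b \<in> {0..t}" "?g (y + t *\<^sub>R v + t *\<^sub>R w) - ?g (y + t *\<^sub>R v) - ?g (y + t *\<^sub>R w) + ?g y
     = t\<^sup>2 * ?h v w (y + a *\<^sub>R v + b *\<^sub>R w)"
    using second_difference_mvt[of t ?g y w v, OF t D(1)[OF near'] D(2)[OF near]] by blast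
   obtain a' b' where 2: "a' \<in> {0..t}" "b' \<in> {0..t}" "?g (y + t *\<^sub>R w + t *\<^sub>R v) - ?g (y + t *\<^sub>R w) - ?g (y + t *\<^sub>R v) + ?g y
     = t\<^sup>2 * ?h w v (y + b' *\<^sub>R w + a' *\<^sub>R v)"
    using second_difference_mvt[of t ?g y v w, OF t D(1)[OF near] D(2)[OF near']] by blast
   have "?g (y + t *\<^sub>R w + t *\<^sub>R v) = ?g (y + t *\<^sub>R v + t *\<^sub>R w)" by (simp add: add.assoc add.commute[of "t *\<^sub>R w"])
   with 1(3) 2(3) have "t\<^sup>2 * ?h v w (y + a *\<^sub>R v + b *\<^sub>R w) = t\<^sup>2 * ?h w v (y + b' *\<^sub>R w + a' *\<^sub>R v)" by argo
   with t have "?h v w (y + a *\<^sub>R v + b *\<^sub>R w) = ?h w v (y + b' *\<^sub>R w + a' *\<^sub>R v)" by simp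
   then show ?thesis using e(2)[OF near[OF 1(1,2)]] e(2)[OF near'[OF 2(1,2)]]
    by (simp add: dist_real_def abs_if split: if_splits)
  qed
  from this[of "dist (?h v w y) (?h w v y)"] show ?thesis unfolding e by auto
 qed
 then have "(u - u') \<bullet> (u - u') = 0"
  if "u = fd (%z. fd f z v) y w" "u' = fd (%z. fd f z w) y v" for u u'
  using that by (simp add: inner_diff_right)
 then show ?thesis by simp
qed

section \<open>Complex coordinate space as a real coordinate space\<close>

text \<open>The change of variables theorem of the library is stated for \<open>real^'m\<close> with a well-ordered index type;
 the type \<open>'n bit0\<close> has \<open>2 * CARD('n)\<close> elements and is well-ordered.\<close>

definition basis_idx :: "complex^'n::finite => 'n bit0" where
 "basis_idx = (SOME \<beta>. bij_betw \<beta> Basis UNIV)"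

definition basis_vec :: "'n bit0 => complex^'n::finite" where
 "basis_vec j = inv_into Basis basis_idx j"

definition toR :: "complex^'n::finite => real^('n bit0)" where
 "toR v = (\<chi> j. v \<bullet> basis_vec j)"

definition fromR :: "real^('n bit0) => complex^'n::finite" where
 "fromR w = (\<Sum>j\<in>UNIV. w $ j *\<^sub>R basis_vec j)"

text \<open>The determinant of an endomorphism of the real tangent space; for the derivative of a
  coordinate change it is the Jacobian.\<close>

definition Rdet :: "(complex^'n::finite => complex^'n) => real" where
 "Rdet g = det (matrix (toR \<circ> g \<circ> fromR))"

lemma basis_idx_bij: "bij_betw basis_idx (Basis :: (complex^'n::finite) set) UNIV"
proof -
 have "card (Basis :: (complex^'n) set) = CARD('n bit0)" by simp
 then have "\<exists>\<beta>. bij_betw \<beta> (Basis :: (complex^'n) set) (UNIV :: 'n bit0 set)"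
  by (intro finite_same_card_bij) auto
 then show ?thesis unfolding basis_idx_def by (rule someI_ex)
qed

lemma basis_vec_bij: "bij_betw basis_vec UNIV (Basis :: (complex^'n::finite) set)"
 using bij_betw_inv_into[OF basis_idx_bij] by (simp add: basis_vec_def[abs_def])

lemma basis_vec_in: "basis_vec j \<in> Basis"
 using basis_vec_bij by (auto simp: bij_betw_def)

lemma basis_vec_inj: "basis_vec i = basis_vec j \<longleftrightarrow> i = j"
 using basis_vec_bij by (auto simp: bij_betw_def dest: injD)

lemma inner_basis_vec: "basis_vec i \<bullet> basis_vec j = (if i = j then 1 else 0)"
 using inner_Basis[OF basis_vec_in basis_vec_in] basis_vec_inj by metis

lemma toR_fromR [simp]: "toR (fromR w) = w"
 by (simp add: toR_def fromR_def inner_sum_left inner_basis_vec vec_eq_iff if_distrib cong: if_cong)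

lemma fromR_toR [simp]: "fromR (toR v) = v"
proof -
 have "fromR (toR v) = (\<Sum>j\<in>UNIV. (v \<bullet> basis_vec j) *\<^sub>R basis_vec j)" by (simp add: fromR_def toR_def)
 also have "... = (\<Sum>b\<in>Basis. (v \<bullet> b) *\<^sub>R b)" by (rule sum.reindex_bij_betw[OF basis_vec_bij])
 finally show ?thesis by (simp add: euclidean_representation)
qed

lemma linear_toR: "linear toR" by (rule linearI) (simp_all add: toR_def vec_eq_iff inner_add_left)
lemma linear_fromR: "linear fromR"
 by (rule linearI) (simp_all add: fromR_def scaleR_add_left sum.distrib scaleR_sum_right)
lemma bounded_linear_toR: "bounded_linear toR" using linear_toR linear_conv_bounded_linear by blast
lemma bounded_linear_fromR: "bounded_linear fromR" using linear_fromR linear_conv_bounded_linear by blast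

lemma fromR_axis: "fromR (axis j 1) = basis_vec j"
 by (simp add: fromR_def axis_def if_distrib[of "%c. c *\<^sub>R _"] cong: if_cong)

lemma toR_measurable [measurable]: "toR \<in> borel_measurable borel"
 using linear_continuous_on[OF bounded_linear_toR] by (rule borel_measurable_continuous_onI)

lemma fromR_measurable [measurable]: "fromR \<in> borel_measurable borel"
 using linear_continuous_on[OF bounded_linear_fromR] by (rule borel_measurable_continuous_onI)

text \<open>\<open>toR\<close> merely renames the vectors of an orthonormal basis, so boxes
  correspond to boxes with the same side lengths.\<close>

lemma lborel_distr_toR: "distr lborel borel (toR :: complex^'n::finite => _) = lborel"
proof (rule lborel_eqI[symmetric])
 fix l u :: "real^('n bit0)"
 assume le: "!!b. b \<in> Basis ==> l \<bullet> b <= u \<bullet> b"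
 have le': "l $ j <= u $ j" for j using le[of "axis j 1"] by (simp add: inner_axis)
 have comp: "fromR w \<bullet> basis_vec j = w $ j" for w :: "real^('n bit0)" and j
  by (simp add: fromR_def inner_sum_left inner_basis_vec if_distrib cong: if_cong)
 have all: "(\<forall>b\<in>(Basis :: (complex^'n) set). P b) \<longleftrightarrow> (\<forall>j. P (basis_vec j))" for P
  using basis_vec_bij by (metis UNIV_I basis_vec_in bij_betw_def imageE)
 have "toR -` box l u = (box (fromR l) (fromR u) :: (complex^'n) set)"
  by (auto simp: mem_box_cart mem_box all comp toR_def)
 then have "emeasure (distr lborel borel (toR :: complex^'n => _)) (box l u) = emeasure lborel (box (fromR l) (fromR u) :: (complex^'n) set)"
  by (subst emeasure_distr) auto
 also have "... = ennreal (\<Prod>b\<in>Basis. (fromR u - fromR l) \<bullet> b)"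
 proof (rule emeasure_lborel_box)
  have "\<forall>b\<in>(Basis :: (complex^'n) set). fromR l \<bullet> b <= fromR u \<bullet> b" by (simp add: all comp le')
  then show "!!b :: complex^'n. b \<in> Basis ==> fromR l \<bullet> b <= fromR u \<bullet> b" by blast
 qed
 also have "... = ennreal (\<Prod>j\<in>UNIV. (fromR u - fromR l :: complex^'n) \<bullet> basis_vec j)"
  using prod.reindex_bij_betw[OF basis_vec_bij, of "%b. (fromR u - fromR l) \<bullet> b"] by simp
 also have "... = ennreal (\<Prod>j\<in>UNIV. (u - l) $ j)" by (simp add: inner_diff_left comp)
 also have "... = ennreal (\<Prod>b\<in>Basis. (u - l) \<bullet> b)"
 proof -
  have B: "(Basis :: (real^('n bit0)) set) = (%j. axis j 1) ` UNIV" by (auto simp: Basis_vec_def)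
  have "inj (%j :: 'n bit0. axis j (1::real))" by (simp add: inj_on_def axis_eq_axis)
  then show ?thesis unfolding B by (simp add: prod.reindex inner_axis)
 qed
 finally show "emeasure (distr lborel borel (toR :: complex^'n => _)) (box l u) = (\<Prod>b\<in>Basis. (u - l) \<bullet> b)" .
qed simp

lemma set_borel_transfer:
 fixes f :: "complex^'n::finite => 'b::{banach, second_countable_topology}"
 assumes f: "set_borel_measurable borel S f"
 shows "set_integrable lborel S f \<longleftrightarrow> set_integrable lborel (toR ` S) (f \<circ> fromR)"
  and "(LINT x:S|lborel. f x) = (LINT x:toR ` S|lborel. (f \<circ> fromR) x)"
proof -
 let ?g = "%w. indicator (toR ` S) w *\<^sub>R (f \<circ> fromR) w"
 have ind: "indicator (toR ` S) (toR x) = (indicator S x :: real)" for x :: "complex^'n"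
  by (metis fromR_toR image_iff indicator_simps)
 have m: "?g \<in> borel_measurable borel"
 proof -
  have "?g = (%x. indicator S x *\<^sub>R f x) \<circ> fromR"
  proof
   fix w
   have "indicator (toR ` S) w = (indicator S (fromR w) :: real)" using ind[of "fromR w"] by simp
   then show "?g w = ((%x. indicator S x *\<^sub>R f x) \<circ> fromR) w" by simp
  qed
  then show ?thesis using f fromR_measurable measurable_comp unfolding set_borel_measurable_def by metis
 qed
 have e: "(%x. ?g (toR x)) = (%x. indicator S x *\<^sub>R f x)" by (simp add: ind)
 have tm: "toR \<in> (lborel :: (complex^'n) measure) \<rightarrow>\<^sub>M borel" by simp
 have "integrable (distr lborel borel (toR :: complex^'n => _)) ?g = integrable lborel (%x. ?g (toR x))"
  by (rule integrable_distr_eq[OF tm m])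
 then show "set_integrable lborel S f \<longleftrightarrow> set_integrable lborel (toR ` S) (f \<circ> fromR)"
  unfolding set_integrable_def e lborel_distr_toR by simp
 have "integral\<^sup>L (distr lborel borel (toR :: complex^'n => _)) ?g = integral\<^sup>L lborel (%x. ?g (toR x))"
  by (rule integral_distr[OF tm m])
 then show "(LINT x:S|lborel. f x) = (LINT x:toR ` S|lborel. (f \<circ> fromR) x)"
  unfolding set_lebesgue_integral_def e lborel_distr_toR by simp
qed

lemma set_integral_lborel_lebesgue:
 fixes f :: "'a::euclidean_space => 'b::{banach, second_countable_topology}"
 assumes "set_borel_measurable borel S f"
 shows "set_integrable lborel S f \<longleftrightarrow> f absolutely_integrable_on S"
  and "(LINT x:S|lborel. f x) = (LINT x:S|lebesgue. f x)"
 using assms unfolding set_integrable_def set_borel_measurable_def set_lebesgue_integral_def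
 by (simp_all add: integrable_completion integral_completion)

text \<open>The complex values are carried to \<open>real^2\<close> by the linear isomorphism
  \<open>\<iota>\<close> and back by \<open>\<kappa>\<close>; integrals commute with both.\<close>

lemma change_of_variables_real:
 fixes f :: "real^'m::{finite,wellorder} => complex" and g :: "real^'m::_ => real^'m::_"
 assumes S: "S \<in> sets lebesgue"
  and der: "!!x. x \<in> S ==> (g has_derivative g' x) (at x within S)" and inj: "inj_on g S"
 shows "(%x. \<bar>det (matrix (g' x))\<bar> *\<^sub>R f (g x)) absolutely_integrable_on S \<longleftrightarrow> f absolutely_integrable_on (g ` S)"
  and "f absolutely_integrable_on (g ` S) ==>
   integral S (%x. \<bar>det (matrix (g' x))\<bar> *\<^sub>R f (g x)) = integral (g ` S) f"
proof -
 define \<iota> :: "complex => real^2" where "\<iota> z = vector [Re z, Im z]" for z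
 define \<kappa> :: "real^2 => complex" where "\<kappa> w = Complex (w $ 1) (w $ 2)" for w
 have blr: "bounded_linear \<iota>"
  unfolding linear_conv_bounded_linear[symmetric] \<iota>_def
  by (rule linearI) (simp_all add: vec_eq_iff forall_2)
 have blk: "bounded_linear \<kappa>"
  unfolding linear_conv_bounded_linear[symmetric] \<kappa>_def
  by (rule linearI) (simp_all add: complex_eq_iff)
 have ki: "\<kappa> (\<iota> z) = z" for z by (simp add: \<kappa>_def \<iota>_def)
 let ?F = "%x. \<bar>det (matrix (g' x))\<bar> *\<^sub>R f (g x)"
 let ?G = "%x. \<bar>det (matrix (g' x))\<bar> *\<^sub>R (\<iota> \<circ> f) (g x)"
 have G: "?G = \<iota> \<circ> ?F" using blr by (auto simp: linear_simps)
 have F: "?F = \<kappa> \<circ> ?G" "f = \<kappa> \<circ> (\<iota> \<circ> f)" unfolding G by (auto simp: ki)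
 note cv = has_absolute_integral_change_of_variables[OF S der inj, where f="\<iota> \<circ> f"]
 have 1: "?F absolutely_integrable_on S \<longleftrightarrow> ?G absolutely_integrable_on S"
  using absolutely_integrable_linear[OF _ blr, of S ?F] absolutely_integrable_linear[OF _ blk, of S ?G]
  unfolding G[symmetric] F(1)[symmetric] by blast
 have 2: "f absolutely_integrable_on (g ` S) \<longleftrightarrow> (\<iota> \<circ> f) absolutely_integrable_on (g ` S)"
  using absolutely_integrable_linear[OF _ blr, of "g ` S" f] absolutely_integrable_linear[OF _ blk, of "g ` S" "\<iota> \<circ> f"]
  unfolding F(2)[symmetric] by blast
 show eqv: "?F absolutely_integrable_on S \<longleftrightarrow> f absolutely_integrable_on (g ` S)"
  unfolding 1 2 using cv by blast
 assume f: "f absolutely_integrable_on (g ` S)"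
 have a: "(\<iota> \<circ> f) integrable_on (g ` S)" "?G integrable_on S"
  using f eqv 1 2 set_lebesgue_integral_eq_integral(1) by blast+
 have "integral S ?G = integral (g ` S) (\<iota> \<circ> f)" using cv f 2 by blast
 then have "\<kappa> (integral S ?G) = \<kappa> (integral (g ` S) (\<iota> \<circ> f))" by simp
 then show "integral S ?F = integral (g ` S) f"
  unfolding integral_linear[OF a(1) blk, symmetric] integral_linear[OF a(2) blk, symmetric]
   F[symmetric] .
qed

lemma change_of_variables_complex:
 fixes f F :: "complex^'n::finite => complex" and g :: "complex^'n => complex^'n"
 assumes S: "S \<in> sets borel"
  and der: "!!x. x \<in> S ==> (g has_derivative g' x) (at x)" and inj: "inj_on g S"
  and F: "!!x. x \<in> S ==> F x = \<bar>Rdet (g' x)\<bar> *\<^sub>R f (g x)"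
  and mf: "set_borel_measurable borel (g ` S) f" and mF: "set_borel_measurable borel S F"
 shows "set_integrable lborel S F \<longleftrightarrow> set_integrable lborel (g ` S) f"
  and "(LINT x:S|lborel. F x) = (LINT x:g ` S|lborel. f x)"
proof -
 let ?h = "toR \<circ> g \<circ> fromR" and ?S = "toR ` S"
 have hS: "?h ` ?S = toR ` g ` S" by (auto simp: image_image)
 have "?S = fromR -` S" by (auto simp: image_iff) (metis toR_fromR)
 then have mS: "?S \<in> sets borel"
  using measurable_sets[OF fromR_measurable S] by simp
 have der': "(?h has_derivative (toR \<circ> g' (fromR x) \<circ> fromR)) (at x within ?S)" if "x \<in> ?S" for x
 proof -
  have "(g has_derivative g' (fromR x)) (at (fromR x))" using that der by auto
  moreover have "(fromR has_derivative fromR) (at x within ?S)" "(toR has_derivative toR) (at (g (fromR x)))"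
   using bounded_linear_fromR bounded_linear_toR bounded_linear_imp_has_derivative by blast+
  ultimately show ?thesis
   unfolding o_def by (metis has_derivative_compose)
 qed
 have inj': "inj_on ?h ?S"
  using inj by (auto simp: inj_on_def) (metis fromR_toR)
 let ?f = "f \<circ> fromR" and ?F = "F \<circ> fromR"
 have Feq: "?F x = \<bar>det (matrix (toR \<circ> g' (fromR x) \<circ> fromR))\<bar> *\<^sub>R ?f (?h x)" if "x \<in> ?S" for x
  using that F by (auto simp: Rdet_def)
 note cv = change_of_variables_real[OF _ der' inj', where f="?f"]
 have Sl: "?S \<in> sets lebesgue" using mS by simp
 have mF': "set_borel_measurable borel ?S ?F"
 proof -
  have "(%w. indicator ?S w *\<^sub>R ?F w) = (%x. indicator S x *\<^sub>R F x) \<circ> fromR"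
   by (auto simp: indicator_def fun_eq_iff image_iff) (metis toR_fromR)
  then show ?thesis using mF fromR_measurable measurable_comp unfolding set_borel_measurable_def by metis
 qed
 have mf': "set_borel_measurable borel (toR ` g ` S) ?f"
 proof -
  have "(%w. indicator (toR ` g ` S) w *\<^sub>R ?f w) = (%x. indicator (g ` S) x *\<^sub>R f x) \<circ> fromR"
   by (auto simp: indicator_def fun_eq_iff image_iff) (metis toR_fromR)
  then show ?thesis using mf fromR_measurable measurable_comp unfolding set_borel_measurable_def by metis
 qed
 have c1: "?F absolutely_integrable_on ?S \<longleftrightarrow> (%x. \<bar>det (matrix (toR \<circ> g' (fromR x) \<circ> fromR))\<bar> *\<^sub>R ?f (?h x)) absolutely_integrable_on ?S"
  by (rule set_integrable_cong) (use Feq in auto)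
 have c2: "integral ?S ?F = integral ?S (%x. \<bar>det (matrix (toR \<circ> g' (fromR x) \<circ> fromR))\<bar> *\<^sub>R ?f (?h x))"
  by (rule integral_cong) (use Feq in auto)
 have I: "?F absolutely_integrable_on ?S \<longleftrightarrow> ?f absolutely_integrable_on (toR ` g ` S)"
  unfolding c1 hS[symmetric] by (rule cv(1)[OF Sl])
 show *: "set_integrable lborel S F \<longleftrightarrow> set_integrable lborel (g ` S) f"
  unfolding set_borel_transfer(1)[OF mF] set_borel_transfer(1)[OF mf]
   set_integral_lborel_lebesgue(1)[OF mF'] set_integral_lborel_lebesgue(1)[OF mf'] by (rule I)
 show "(LINT x:S|lborel. F x) = (LINT x:g ` S|lborel. f x)"
 proof (cases "set_integrable lborel S F")
  case True
  then have t: "?F absolutely_integrable_on ?S"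
   using set_borel_transfer(1)[OF mF] set_integral_lborel_lebesgue(1)[OF mF'] by blast
  then have t': "?f absolutely_integrable_on (toR ` g ` S)" using I by blast
  then have "?f absolutely_integrable_on (?h ` ?S)" unfolding hS .
  then show ?thesis
   unfolding set_borel_transfer(2)[OF mF] set_borel_transfer(2)[OF mf]
    set_integral_lborel_lebesgue(2)[OF mF'] set_integral_lborel_lebesgue(2)[OF mf']
    set_lebesgue_integral_eq_integral(2)[OF t] set_lebesgue_integral_eq_integral(2)[OF t'] c2
   using cv(2)[OF Sl] unfolding hS by blast
 next
  \<comment> \<open>Neither side is integrable, and both integrals take the default value 0.\<close>
  case False
  then show ?thesis using * unfolding set_lebesgue_integral_def set_integrable_def
   by (metis not_integrable_integral_eq)
 qed
qed

section \<open>Top-degree forms\<close>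

lemma AltF_swap_far:
 assumes "AltF f" shows "f (xs @ a # ys @ b # zs) = - f (xs @ b # ys @ a # zs)"
proof -
 have z: "f (xs @ v # ys @ v # zs) = 0" for v
  by (rule AltF_not_distinct[OF assms]) auto
 have p: "f (xs @ (v + w) # us) = f (xs @ v # us) + f (xs @ w # us)" for v w us xs
  by (rule AltF_plus[OF assms])
 have q: "f (xs @ u # ys @ (v + w) # zs) = f (xs @ u # ys @ v # zs) + f (xs @ u # ys @ w # zs)" for u v w
  using p[of "xs @ u # ys" v w zs] by simp
 have "0 = f (xs @ (a + b) # ys @ (a + b) # zs)" by (simp add: z)
 also have "... = f (xs @ a # ys @ b # zs) + f (xs @ b # ys @ a # zs)"
  unfolding p q by (simp add: z)
 finally show ?thesis by (simp add: eq_neg_iff_add_eq_0)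
qed

lemma AltF_span:
 assumes "AltF f" "v \<in> span (set xs \<union> set ys)" shows "f (xs @ v # ys) = 0"
 using assms(2)
proof (induction rule: span_induct_alt)
 case base
 then show ?case using linear_0[OF AltFD(1)[OF assms(1)]] by blast
next
 case (step c x y)
 have "f (xs @ x # ys) = 0" by (rule AltF_not_distinct[OF assms(1)]) (use step in auto)
 then show ?case using step by (simp add: AltF_plus[OF assms(1)] AltF_scaleR[OF assms(1)])
qed

lemma AltF_dependent:
 assumes "AltF f" "distinct vs ==> dependent (set vs)" shows "f vs = 0"
proof (cases "distinct vs")
 case True
 then obtain v where v: "v \<in> set vs" "v \<in> span (set vs - {v})"
  using assms(2) unfolding dependent_def by blast
 obtain xs ys where vs: "vs = xs @ v # ys" using v(1) split_list by metis
 then have "set vs - {v} = set xs \<union> set ys" using True by auto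
 then show ?thesis using AltF_span[OF assms(1)] v(2) vs by metis
qed (use AltF_not_distinct[OF assms(1)] in blast)

lemma AltF_pullback: assumes "AltF f" "linear g" shows "AltF (%us. f (map g us))"
 by (rule AltFI)
   (use linear_compose[OF assms(2) AltFD(1)[OF assms(1)], unfolded o_def] AltFD(2)[OF assms(1)] in simp_all)

lemma AltF_scale_list:
 assumes "AltF f" shows "f (xs @ map (%j. c j *\<^sub>R e j) js) = (\<Prod>j\<leftarrow>js. c j) *\<^sub>R f (xs @ map e js)"
proof (induction js arbitrary: xs)
 case (Cons j js)
 have "f (xs @ map (%j. c j *\<^sub>R e j) (j # js)) = c j *\<^sub>R f ((xs @ [e j]) @ map (%j. c j *\<^sub>R e j) js)"
  by (simp add: AltF_scaleR[OF assms])
 then show ?case unfolding Cons by simp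
qed simp

text \<open>Linear maps are generated by elementary ones under composition. The form stays arbitrary
  in the induction so that the outer map of a composition can be absorbed into it.\<close>

lemma Rdet_linear_frame:
 fixes f :: "('n::finite, 'a::real_vector) alt"
 assumes js: "distinct js" "set js = UNIV"
  and h: "linear h" and f: "AltF f"
 shows "f (map (%j. fromR (h (axis j 1))) js) = det (matrix h) *\<^sub>R f (map basis_vec js)"
 using f
proof (induction h arbitrary: f rule: induct_linear_elementary)
 case 1 show ?case by (rule h)
next
 case (2 h1 h2)
 let ?f = "%us. f (map (fromR \<circ> h1 \<circ> toR) us)"
 have "linear (fromR \<circ> h1 \<circ> toR)" by (intro linear_compose linear_fromR linear_toR 2(1))
 then have F: "AltF ?f" by (rule AltF_pullback[OF 2(5)])
 have "f (map (%j. fromR ((h1 \<circ> h2) (axis j 1))) js) = ?f (map (%j. fromR (h2 (axis j 1))) js)"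
  by (simp add: o_def)
 also have "... = det (matrix h2) *\<^sub>R ?f (map basis_vec js)" by (rule 2(4)[OF F])
 also have "?f (map basis_vec js) = f (map (%j. fromR (h1 (axis j 1))) js)"
  by (simp add: o_def flip: fromR_axis)
 also have "... = det (matrix h1) *\<^sub>R f (map basis_vec js)" by (rule 2(3)[OF 2(5)])
 finally show ?case
  unfolding matrix_compose[OF 2(2) 2(1)] det_mul by (simp add: mult.commute)
next
 case (3 h i)
 \<comment> \<open>A coordinate that vanishes on all values excludes surjectivity. The image vectors
   are then linearly dependent, and both sides are zero.\<close>
 have ni: "\<not> inj h"
 proof
  assume "inj h"
  then have "surj h" using linear_injective_imp_surjective[OF 3(1)] by blast
  then obtain x where "h x = axis i 1" by (metis surjD)
  then show False using 3(2)[of x] by (simp add: axis_def)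
 qed
 then have d: "det (matrix h) = 0" using det_nz_iff_inj[OF 3(1)] by blast
 let ?vs = "map (%j. fromR (h (axis j 1))) js"
 have "f ?vs = 0"
 proof (rule AltF_dependent[OF 3(3)])
  assume dis: "distinct ?vs"
  have "set ?vs \<subseteq> range (fromR \<circ> h)" by auto
  moreover have "dim (range (fromR \<circ> h)) < card (set ?vs)"
  proof -
   have "card (set ?vs) = length js" using dis distinct_card by fastforce
   also have "... = CARD('n bit0)" using js distinct_card by metis
   finally have c: "card (set ?vs) = CARD('n bit0)" .
   have "dim (range (fromR \<circ> h)) <= dim (range h)"
    unfolding image_comp[symmetric] by (rule dim_image_le[OF linear_fromR])
   moreover have "dim (range h) < DIM(real^('n bit0))"
   proof -
    have "range h ~= UNIV" using linear_surjective_imp_injective[OF 3(1)] ni by blast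
    moreover have "subspace (range h)" using 3(1) linear_subspace_image subspace_UNIV by blast
    ultimately show ?thesis using dim_eq_full[of "range h"] span_eq_iff dim_subset_UNIV[of "range h"]
     by (metis le_neq_implies_less)
   qed
   ultimately show ?thesis using c by simp
  qed
  ultimately show "dependent (set ?vs)"
   using independent_card_le_dim[of "set ?vs" "range (fromR \<circ> h)"] by linarith
 qed
 then show ?case by (simp add: d)
next
 case (4 c)
 have a: "(\<chi> i. c i * axis j 1 $ i) = c j *\<^sub>R axis j (1::real)" for j
  by (simp add: vec_eq_iff axis_def)
 have m: "det (matrix (%x :: real^('n bit0). \<chi> i. c i * x $ i)) = prod c UNIV"
  by (subst det_diagonal) (auto simp: matrix_def axis_def)
 have "(%j. fromR (\<chi> i. c i * axis j 1 $ i)) = (%j. c j *\<^sub>R basis_vec j)"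
  unfolding a by (simp add: linear_scale[OF linear_fromR] fromR_axis)
 then show ?case
  using AltF_scale_list[OF 4, of "[]" c basis_vec js] m prod.distinct_set_conv_list[OF js(1), of c] js(2) by simp
next
 case (5 m n)
 let ?t = "Transposition.transpose m n"
 have a: "(\<chi> i. axis j 1 $ ?t i) = axis (?t j) (1::real)" for j
  by (auto simp: vec_eq_iff axis_def transpose_eq_iff)
 have w: "f (map (%j. basis_vec (?t j)) js) = - f (map basis_vec js)"
 proof -
  have gen: "f (map (%j. basis_vec (?t j)) js) = - f (map basis_vec js)"
   if mn: "js = xs @ p # ys @ q # zs" "{p, q} = {m, n}" for xs ys zs p q
  proof -
   have tp: "?t p = q" "?t q = p" using mn(2) by (auto simp: doubleton_eq_iff)
   have out: "map (%j. basis_vec (?t j)) us = map basis_vec us" if "p \<notin> set us" "q \<notin> set us" for us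
    using that mn(2) by (auto simp: doubleton_eq_iff intro!: arg_cong[where f=basis_vec] transpose_apply_other)
   have "p \<notin> set xs" "q \<notin> set xs" "p \<notin> set ys" "q \<notin> set ys" "p \<notin> set zs" "q \<notin> set zs"
    using js(1) mn(1) by auto
   then show ?thesis unfolding mn(1) map_append list.map tp using out AltF_swap_far[OF 5(2)] by metis
  qed
  obtain xs ys where x: "js = xs @ m # ys" using js(2) by (metis UNIV_I split_list)
  have "n \<in> set xs \<or> n \<in> set ys" using x js(2) 5(1) by (metis UNIV_I UnE set_ConsD set_append)
  then show ?thesis
  proof
   assume "n \<in> set xs"
   then obtain us vs where "xs = us @ n # vs" by (metis split_list)
   then show ?thesis using gen[of us n vs m ys] x by (simp add: insert_commute)
  next
   assume "n \<in> set ys"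
   then obtain us vs where "ys = us @ n # vs" by (metis split_list)
   then show ?thesis using gen[of xs m us n vs] x by simp
  qed
 qed
 have "(\<chi> i j. if ?t i = j then 1 else 0) = (\<chi> i j. if j = ?t i then 1 else (0::real))"
  by (auto intro!: Cart_lambda_cong)
 then have "matrix (%x::real^('n bit0). \<chi> i. x $ ?t i) = Finite_Cartesian_Product.transpose (\<chi> i j. mat 1 $ i $ ?t j)"
  by (auto simp: matrix_eq transpose_def axis_def mat_def matrix_def)
 then have "det (matrix (%x::real^('n bit0). \<chi> i. x $ ?t i)) = -1"
  using 5(1) by (simp add: det_permute_columns permutes_swap_id sign_swap_id)
 then show ?case by (simp add: a fromR_axis w)
next
 case (6 m n)
 let ?h = "%x :: real^('n bit0). \<chi> i. if i = m then x $ m + x $ n else x $ i"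
 have "matrix ?h = (\<chi> k. if k = m then row m (mat 1) + 1 *s row n (mat 1) else row k (mat 1))"
  by (auto simp: vec_eq_iff matrix_def row_def mat_def axis_def)
 then have d: "det (matrix ?h) = 1"
  using det_row_operation[OF 6(1), of "mat 1 :: real^('n bit0)^('n bit0)" 1] by simp
 have hn: "?h (axis n 1) = axis n 1 + axis m 1" using 6(1) by (auto simp: vec_eq_iff axis_def)
 have ho: "?h (axis j 1) = axis j 1" if "j ~= n" for j using that by (auto simp: vec_eq_iff axis_def)
 obtain xs ys where x: "js = xs @ n # ys" using js(2) by (metis UNIV_I split_list)
 have nn: "n \<notin> set xs" "n \<notin> set ys" using x js(1) by auto
 have m_in: "m \<in> set xs \<or> m \<in> set ys" using x js(2) 6(1) by (metis UNIV_I UnE set_ConsD set_append)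
 have o: "map (%j. fromR (?h (axis j 1))) us = map basis_vec us" if "n \<notin> set us" for us
 proof (rule list.map_cong0)
  fix j assume "j \<in> set us"
  then have "j ~= n" using that by blast
  show "fromR (?h (axis j 1)) = basis_vec j" unfolding ho[OF \<open>j ~= n\<close>] by (rule fromR_axis)
 qed
 \<comment> \<open>The shear changes only the argument that belongs to \<open>n\<close>: it adds
   \<open>basis_vec m\<close>, which already occurs elsewhere in the list.\<close>
 have "f (map (%j. fromR (?h (axis j 1))) js) = f (map basis_vec xs @ (basis_vec n + basis_vec m) # map basis_vec ys)"
  unfolding x map_append list.map o[OF nn(1)] o[OF nn(2)] hn by (simp add: linear_add[OF linear_fromR] fromR_axis)
 also have "... = f (map basis_vec js) + f (map basis_vec xs @ basis_vec m # map basis_vec ys)"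
  unfolding AltF_plus[OF 6(2)] x by simp
 also have "f (map basis_vec xs @ basis_vec m # map basis_vec ys) = 0"
  by (rule AltF_not_distinct[OF 6(2)]) (use m_in in auto)
 finally show ?case by (simp add: d)
qed

lemma std_frame_props:
 "distinct (std_frame :: (complex^'n::finite) list)" "set (std_frame :: (complex^'n) list) = Basis"
 "length (std_frame :: (complex^'n) list) = 2 * CARD('n)"
proof -
 define ks :: "'n list" where "ks = (SOME ks. distinct ks & set ks = UNIV)"
 have ks: "distinct ks" "set ks = UNIV"
  using someI_ex[of "%ks :: 'n list. distinct ks & set ks = UNIV"] finite_distinct_list[of "UNIV :: 'n set"]
  unfolding ks_def by auto
 have sf: "std_frame = concat (map (%k. [axis k 1, axis k \<i>]) ks)" by (simp add: std_frame_def ks_def)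
 show s: "set (std_frame :: (complex^'n) list) = Basis"
  unfolding sf by (auto simp: ks Basis_vec_def Basis_complex_def)
 have "length (concat (map (%k. [axis k (1::complex), axis k \<i>]) us)) = 2 * length us" for us :: "'n list"
  by (induction us) auto
 then show l: "length (std_frame :: (complex^'n) list) = 2 * CARD('n)"
  unfolding sf using ks distinct_card by metis
 have "card (set (std_frame :: (complex^'n) list)) = 2 * CARD('n)"
  unfolding s by simp
 then show "distinct (std_frame :: (complex^'n) list)" using l card_distinct by metis
qed

theorem AltF_std_frame:
 fixes f :: "('n::finite, 'a::real_vector) alt"
 assumes "AltF f" "linear g"
 shows "f (map g std_frame) = Rdet g *\<^sub>R f std_frame"
proof -
 define js where "js = map basis_idx (std_frame :: (complex^'n) list)"
 have inv: "basis_vec (basis_idx b) = b" if "b \<in> Basis" for b :: "complex^'n"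
  unfolding basis_vec_def using bij_betw_inv_into_left[OF basis_idx_bij that] .
 have js: "distinct js" "set js = UNIV" "map basis_vec js = std_frame"
  unfolding js_def using std_frame_props[where 'n='n] basis_idx_bij[where 'n='n]
  by (auto simp: distinct_map bij_betw_def inv intro!: map_idI)
 have l: "linear (toR \<circ> g \<circ> fromR)" by (intro linear_compose linear_fromR linear_toR assms(2))
 show ?thesis
  using Rdet_linear_frame[OF js(1,2) l assms(1)]
  by (simp add: fromR_axis Rdet_def o_def flip: js(3))
qed

text \<open>A complex-linear bijection preserves the orientation: the segment \<open>(1 - z) I + z G\<close> meets
 non-invertible maps only for finitely many complex parameters \<open>z\<close>, and the complement of a finite set of
 points in the plane is connected.\<close>

lemma Rdet_complex_pos:
 fixes G :: "complex^'n::finite => complex^'n"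
 assumes lin: "linear G" and clin: "!!c v. G (c *s v) = c *s G v" and inj: "inj G"
 shows "Rdet G > 0"
proof -
 define Gz where "Gz z v = (1 - z) *s v + z *s G v" for z :: complex and v
 define M where "M = matrix G"
 have GM: "G v = M *v v" for v
 proof -
  have "Vector_Spaces.linear (*s) (*s) G"
   by unfold_locales (use clin linear_add[OF lin] in \<open>auto simp: algebra_simps vec_eq_iff\<close>)
  then show ?thesis unfolding M_def by (simp add: matrix_works)
 qed
 define Mz where "Mz z = (\<chi> i j. (1 - z) * (mat 1 $ i $ j) + z * M $ i $ j)" for z
 have GzM: "Gz z v = Mz z *v v" for z v
 proof -
  have "((1 - z) *s v + z *s (M *v v)) $ i = (Mz z *v v) $ i" for i
  proof -
   have "(Mz z *v v) $ i = (\<Sum>j\<in>UNIV. (1 - z) * (mat 1 $ i $ j * v $ j) + z * (M $ i $ j * v $ j))"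
    by (simp add: matrix_vector_mult_def Mz_def algebra_simps)
   also have "... = (1 - z) * ((mat 1 *v v) $ i) + z * ((M *v v) $ i)"
    by (simp add: sum.distrib sum_distrib_left matrix_vector_mult_def)
   finally show ?thesis by (simp add: left_diff_distrib)
  qed
  then show ?thesis by (simp add: Gz_def GM vec_eq_iff)
 qed
 define P where "P = det (\<chi> i j. [: mat 1 $ i $ j, M $ i $ j - mat 1 $ i $ j :])"
 have detP: "det (Mz z) = poly P z" for z
  unfolding P_def det_def by (simp add: poly_sum poly_prod Mz_def algebra_simps)
 have "poly P 0 = 1"
 proof -
  have "Mz 0 = mat 1" by (simp add: Mz_def vec_eq_iff)
  then show ?thesis using detP[of 0] by simp
 qed
 then have "P ~= 0" by auto
 define R where "R = {z. poly P z = 0}"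
 have fR: "finite R" unfolding R_def by (rule poly_roots_finite) fact
 have lz: "linear (Gz z)" for z
 proof -
  have "linear (%v. Mz z *v v)" by simp
  then show ?thesis unfolding GzM .
 qed
 have injz: "inj (Gz z) \<longleftrightarrow> z \<notin> R" for z
 proof -
  have "inj ((*v) (Mz z)) \<longleftrightarrow> invertible (Mz z)"
   by (metis invertible_left_inverse matrix_left_invertible_injective)
  then show ?thesis unfolding R_def by (simp add: GzM[abs_def] invertible_det_nz detP)
 qed
 define d where "d z = Rdet (Gz z)" for z
 have l2: "linear (toR \<circ> Gz z \<circ> fromR)" for z by (intro linear_compose linear_fromR linear_toR lz)
 have nz: "d z ~= 0" if "z \<notin> R" for z
 proof -
  have "inj toR" "inj fromR" by (metis injI fromR_toR, metis injI toR_fromR)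
  then have "inj (toR \<circ> Gz z \<circ> fromR)" using injz that by (intro inj_compose) auto
  then show ?thesis unfolding d_def Rdet_def using det_nz_iff_inj[OF l2] by blast
 qed
 have cont: "continuous_on UNIV d"
 proof -
  have c: "continuous_on UNIV (%z. toR (Gz z v) $ i)" for v i
  proof -
   have "linear (%z. toR (z *s (G v - v)) $ i)"
   proof (rule linearI)
    show "toR ((a + b) *s (G v - v)) $ i = toR (a *s (G v - v)) $ i + toR (b *s (G v - v)) $ i" for a b
    proof -
     have "(a + b) *s (G v - v) = a *s (G v - v) + b *s (G v - v)" by (simp add: vec_eq_iff algebra_simps)
     then show ?thesis by (simp only: linear_add[OF linear_toR] vector_add_component)
    qed
    show "toR ((r *\<^sub>R a) *s (G v - v)) $ i = r *\<^sub>R toR (a *s (G v - v)) $ i" for a r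
    proof -
     have "(r *\<^sub>R a) *s (G v - v) = r *\<^sub>R (a *s (G v - v))" by (simp add: vec_eq_iff scaleR_diff_right)
     then show ?thesis by (simp only: linear_scale[OF linear_toR] vector_scaleR_component)
    qed
   qed
   then have "continuous_on UNIV (%z. toR v $ i + toR (z *s (G v - v)) $ i)"
    by (intro continuous_intros linear_continuous_on) (simp add: linear_conv_bounded_linear)
   moreover have "Gz z v = v + z *s (G v - v)" for z by (simp add: Gz_def vec_eq_iff algebra_simps)
   ultimately show ?thesis by (simp only: linear_add[OF linear_toR] vector_add_component)
  qed
  have "d z = (\<Sum>p | p permutes UNIV. of_int (sign p) * (\<Prod>i\<in>UNIV. toR (Gz z (basis_vec (p i))) $ i))" for z
   unfolding d_def Rdet_def det_def matrix_def by (simp add: fromR_axis)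
  then have de: "d = (%z. \<Sum>p | p permutes UNIV. of_int (sign p) * (\<Prod>i\<in>UNIV. toR (Gz z (basis_vec (p i))) $ i))" by blast
  show ?thesis
   by (subst de) (intro continuous_on_sum continuous_on_mult continuous_on_const continuous_on_prod c)
 qed
 have "connected (- R)"
  using path_connected_complement_countable[of R] countable_finite[OF fR] path_connected_imp_connected by simp
 then have conn: "connected (d ` (- R))"
  using connected_continuous_image continuous_on_subset[OF cont] by blast
 have "d 0 = 1"
 proof -
  have "toR \<circ> Gz 0 \<circ> fromR = id" by (auto simp: Gz_def)
  moreover have "matrix id = (mat 1 :: real^('n bit0)^('n bit0))"
   by (simp add: matrix_def mat_def axis_def vec_eq_iff)
  ultimately show ?thesis unfolding d_def Rdet_def by (simp only: det_I)
 qed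
 moreover have "0 \<notin> R" using \<open>poly P 0 = 1\<close> by (simp add: R_def)
 ultimately have 1: "1 \<in> d ` (- R)" by (metis ComplI image_eqI)
 have G1: "Gz 1 = G" by (auto simp: Gz_def)
 then have "1 \<notin> R" using injz[of 1] inj by simp
 then have "Rdet G \<in> d ` (- R)" unfolding d_def using G1 by (metis ComplI image_eqI)
 moreover have "0 \<notin> d ` (- R)" using nz by auto
 ultimately show ?thesis
  using connectedD_interval[OF conn _ 1, of "Rdet G" 0] by force
qed

lemma integral_translate:
 fixes g :: "'a::euclidean_space => 'b::{banach, second_countable_topology}"
 assumes "integrable lborel g"
 shows "integrable lborel (%x. g (x + v))" "(LINT x|lborel. g (x + v)) = (LINT x|lborel. g x)"
proof -
 have m: "(+) v \<in> (lborel :: 'a measure) \<rightarrow>\<^sub>M borel" by simp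
 have g: "g \<in> borel_measurable borel" using assms by simp
 show "integrable lborel (%x. g (x + v))"
  using integrable_distr_eq[OF m g] assms unfolding lborel_distr_plus by (simp add: add.commute)
 show "(LINT x|lborel. g (x + v)) = (LINT x|lborel. g x)"
  using integral_distr[OF m g] unfolding lborel_distr_plus by (simp add: add.commute)
qed

text \<open>No iterated integral is used: the difference quotients in the direction \<open>v\<close>
  have integral zero by translation invariance of Lebesgue measure, and they converge to the
  derivative under a common integrable bound.\<close>

lemma integral_derivative_compact_support:
 fixes g :: "'a::euclidean_space => complex"
 assumes d: "!!x. dfb g x"
  and c: "continuous_on UNIV (%x. fd g x v)"
  and K: "compact K" and z: "!!x. x \<notin> K ==> g x = 0"
 shows "(LINT x|lborel. fd g x v) = 0"
proof -
 let ?D = "%x. fd g x v"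
 have oK: "open (- K)" using compact_imp_closed[OF K] by blast
 have Dz: "?D x = 0" if "x \<notin> K" for x
 proof -
  have "frechet_derivative g (at x) = frechet_derivative (%x. 0) (at x)"
   by (rule fd_cong_nhds, rule eventually_mono[OF eventually_nhds_in_open[OF oK]])
     (use that z in auto)
  then show ?thesis by (simp add: frechet_derivative_const)
 qed
 have "compact (?D ` K)" by (rule compact_continuous_image[OF continuous_on_subset[OF c subset_UNIV] K])
 then obtain B0 where "\<forall>y\<in>?D ` K. norm y <= B0"
  using compact_imp_bounded[of "?D ` K"] unfolding bounded_iff by blast
 then have B0: "!!x. x \<in> K ==> norm (?D x) <= B0" by blast
 define B where "B = max B0 0"
 have B: "norm (?D x) <= B" for x using B0[of x] Dz[of x] unfolding B_def by (cases "x \<in> K") auto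
 have B_nn: "B >= 0" by (simp add: B_def)
 \<comment> \<open>The points \<open>x\<close> for which some \<open>x + t *\<^sub>R v\<close> with
   \<open>t\<close> between 0 and 1 lies in \<open>K\<close>. This set is compact, and all
   difference quotients vanish outside it.\<close>
 let ?K' = "(%(x, t). x - t *\<^sub>R v) ` (K \<times> {0..1})"
 have K': "compact ?K'"
  by (intro compact_continuous_image compact_Times K) (auto simp: case_prod_beta intro!: continuous_intros)
 have cg: "continuous_on UNIV g" by (rule differentiable_imp_continuous_on) (rule d)
 have gint: "integrable lborel g"
 proof -
  have "integrable lborel (%x. indicator K x *\<^sub>R g x)"
   by (rule borel_integrable_compact[OF K]) (rule continuous_on_subset[OF cg], simp)
  moreover have "(%x. indicator K x *\<^sub>R g x) = g" using z by (auto simp: indicator_def)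
  ultimately show ?thesis by simp
 qed
 define s where "s n x = real (Suc n) *\<^sub>R (g (x + (1 / real (Suc n)) *\<^sub>R v) - g x)" for n x
 have hv: "hvd (%t. g (x + t *\<^sub>R v)) (?D (x + t *\<^sub>R v)) t" for x t
  by (rule line_derivative[OF d])
 have bnd: "norm (s n x) <= indicator ?K' x *\<^sub>R B" for n x
 proof (cases "x \<in> ?K'")
  case True
  have "norm (g (x + (1 / real (Suc n)) *\<^sub>R v) - g (x + 0 *\<^sub>R v)) <= B * norm (1 / real (Suc n) - 0)"
  proof (rule differentiable_bound[of UNIV "%t. g (x + t *\<^sub>R v)" "%t h. h *\<^sub>R ?D (x + t *\<^sub>R v)"])
   show "((%t. g (x + t *\<^sub>R v)) has_derivative (%h. h *\<^sub>R ?D (x + t *\<^sub>R v))) (at t within UNIV)" for t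
    using hv by (simp add: has_vector_derivative_def)
   show "onorm (%h. h *\<^sub>R ?D (x + t *\<^sub>R v)) <= B" for t
    by (rule onorm_le) (use B[of "x + t *\<^sub>R v"] in \<open>simp add: mult.commute[of B] mult_left_mono\<close>)
  qed auto
  then show ?thesis using True by (simp add: s_def divide_simps mult.commute)
 next
  case False
  have "x + t *\<^sub>R v \<notin> K" if "t \<in> {0..1}" for t
  proof
   assume "x + t *\<^sub>R v \<in> K"
   then have "(x + t *\<^sub>R v) - t *\<^sub>R v \<in> ?K'" using that by (auto simp: image_iff intro!: bexI[of _ "x + t *\<^sub>R v"] bexI[of _ t])
   then show False using False by simp
  qed
  from this[of 0] this[of "1 / real (Suc n)"] have "x \<notin> K" "x + (1 / real (Suc n)) *\<^sub>R v \<notin> K" by auto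
  then show ?thesis using False z by (simp add: s_def)
 qed
 have lim: "(%n. s n x) \<longlonglongrightarrow> ?D x" for x
 proof -
  have "((%h. norm (g (x + (0 + h) *\<^sub>R v) - g (x + 0 *\<^sub>R v) - h *\<^sub>R ?D (x + 0 *\<^sub>R v)) / norm h) \<longlongrightarrow> 0) (at 0)"
   using hv[of x 0] unfolding has_vector_derivative_def has_derivative_at by blast
  moreover have "filterlim (%n. 1 / real (Suc n)) (at 0) sequentially"
   by (rule filterlim_atI) (use LIMSEQ_Suc[OF lim_inverse_n'] in auto)
  ultimately have "(%n. norm (g (x + (0 + 1 / real (Suc n)) *\<^sub>R v) - g (x + 0 *\<^sub>R v)
    - (1 / real (Suc n)) *\<^sub>R ?D (x + 0 *\<^sub>R v)) / norm (1 / real (Suc n))) \<longlonglongrightarrow> 0"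
   by (rule filterlim_compose)
  moreover have "norm (g (x + (0 + 1 / real (Suc n)) *\<^sub>R v) - g (x + 0 *\<^sub>R v)
    - (1 / real (Suc n)) *\<^sub>R ?D (x + 0 *\<^sub>R v)) / norm (1 / real (Suc n)) = norm (s n x - ?D x)" for n
  proof -
   have "s n x - ?D x = real (Suc n) *\<^sub>R (g (x + (1 / real (Suc n)) *\<^sub>R v) - g x - (1 / real (Suc n)) *\<^sub>R ?D x)"
    by (simp add: s_def scaleR_diff_right)
   then show ?thesis by simp
  qed
  ultimately have "(%n. norm (s n x - ?D x)) \<longlonglongrightarrow> 0" by simp
  then have "(%n. s n x - ?D x) \<longlonglongrightarrow> 0" by (rule tendsto_norm_zero_cancel)
  then show ?thesis by (rule LIM_zero_cancel)
 qed
 have sint: "integrable lborel (s n)" and s0: "(LINT x|lborel. s n x) = 0" for n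
 proof -
  note t = integral_translate[OF gint, of "(1 / real (Suc n)) *\<^sub>R v"]
  show "integrable lborel (s n)" unfolding s_def[abs_def] using t(1) gint by simp
  show "(LINT x|lborel. s n x) = 0" unfolding s_def using t gint by simp
 qed
 have "(%n. LINT x|lborel. s n x) \<longlonglongrightarrow> (LINT x|lborel. ?D x)"
 proof (rule integral_dominated_convergence[where w="%x. indicator ?K' x *\<^sub>R B"])
  show "?D \<in> borel_measurable lborel" using borel_measurable_continuous_onI[OF c] by simp
  show "s n \<in> borel_measurable lborel" for n using sint by (rule borel_measurable_integrable)
  show "integrable lborel (%x. indicator ?K' x *\<^sub>R B)"
   by (rule borel_integrable_compact[OF K']) auto
  show "AE x in lborel. (%n. s n x) \<longlonglongrightarrow> ?D x" using lim by simp
  show "AE x in lborel. norm (s n x) <= indicator ?K' x *\<^sub>R B" for n using bnd by simp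
 qed
 then show ?thesis unfolding s0 by (simp add: LIMSEQ_const_iff)
qed

section \<open>Continuously differentiable functions\<close>

lemma Ck_on_1: "Ck_on 1 S f \<longleftrightarrow> (\<forall>y\<in>S. dfb f y) & (\<forall>v. continuous_on S (%y. fd f y v))"
 using Ck_on.simps(2)[of 0 S f] by simp

lemma smooth_C1: "smooth_fun_on S f ==> Ck_on 1 S f"
 by (simp add: smooth_fun_on_def)

lemma Ck_on_1_continuous: "Ck_on 1 S f ==> continuous_on S f"
 unfolding Ck_on_1 by (blast intro: differentiable_imp_continuous_on)

lemma fd_compose:
 assumes "dfb f y" "dfb g (f y)"
 shows "fd (%z. g (f z)) y v = fd g (f y) (fd f y v)"
  "dfb (%z. g (f z)) y"
proof -
 have "((%z. g (f z)) has_derivative (%v. fd g (f y) (fd f y v))) (at y)"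
  using has_derivative_compose[of f _ y UNIV g] assms[unfolded frechet_derivative_works] by blast
 then show "fd (%z. g (f z)) y v = fd g (f y) (fd f y v)"
  "dfb (%z. g (f z)) y"
  by (metis frechet_derivative_at, auto simp: differentiable_def)
qed

lemma C1_compose:
 fixes b :: "'b::euclidean_space => 'c::real_normed_vector" and \<phi> :: "'a::euclidean_space => 'b"
 assumes b: "Ck_on 1 T b" and \<phi>: "Ck_on 1 S \<phi>" and sub: "\<phi> ` S \<subseteq> T"
 shows "Ck_on 1 S (%y. b (\<phi> y))"
 unfolding Ck_on_1
proof (intro conjI ballI allI)
 fix y assume y: "y \<in> S"
 show "(%y. b (\<phi> y)) differentiable at y"
  by (rule fd_compose(2)) (use b \<phi> sub y in \<open>auto simp: Ck_on_1\<close>)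
next
 fix v
 have eq: "fd (%y. b (\<phi> y)) y v =
  (\<Sum>e\<in>Basis. (fd \<phi> y v \<bullet> e) *\<^sub>R fd b (\<phi> y) e)" if y: "y \<in> S" for y
 proof -
  have d: "dfb \<phi> y" "dfb b (\<phi> y)" using b \<phi> sub y by (auto simp: Ck_on_1)
  let ?w = "fd \<phi> y v"
  have l: "linear (frechet_derivative b (at (\<phi> y)))" by (rule linear_frechet_derivative[OF d(2)])
  have "fd b (\<phi> y) ?w = fd b (\<phi> y) (\<Sum>e\<in>Basis. (?w \<bullet> e) *\<^sub>R e)"
   by (simp add: euclidean_representation)
  also have "... = (\<Sum>e\<in>Basis. (?w \<bullet> e) *\<^sub>R fd b (\<phi> y) e)"
   by (simp add: linear_sum[OF l] linear_scale[OF l])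
  finally show ?thesis unfolding fd_compose(1)[OF d] .
 qed
 have "continuous_on S (%y. \<Sum>e\<in>Basis. (fd \<phi> y v \<bullet> e) *\<^sub>R fd b (\<phi> y) e)"
 proof (intro continuous_on_sum continuous_on_scaleR continuous_on_inner continuous_on_const)
  show "continuous_on S (%y. fd \<phi> y v)" using \<phi> by (auto simp: Ck_on_1)
  fix e
  have "continuous_on T (%z. fd b z e)" using b by (auto simp: Ck_on_1)
  then show "continuous_on S (%y. fd b (\<phi> y) e)"
   by (rule continuous_on_compose2[OF _ Ck_on_1_continuous[OF \<phi>] sub])
 qed
 then show "continuous_on S (%y. fd (%y. b (\<phi> y)) y v)"
  by (rule continuous_on_eq) (simp add: eq)
qed

lemma C1_inverse:
 fixes f :: "'a::euclidean_space => real"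
 assumes S: "open S" and f: "Ck_on 1 S f" and nz: "!!y. y \<in> S ==> f y ~= 0"
 shows "Ck_on 1 S (%y. inverse (f y))"
proof -
 have d: "dfb (%y. inverse (f y)) y" if "y \<in> S" for y
  using f nz that by (auto simp: Ck_on_1 intro!: differentiable_inverse)
 have D: "fd (%y. inverse (f y)) y v = - (inverse (f y) * fd f y v * inverse (f y))"
  if y: "y \<in> S" for y v
 proof -
  have "fd (%y. inverse (f y) * f y) y v = fd (%y. 1 :: real) y v"
   by (rule fun_cong[OF fd_cong_nhds], rule eventually_mono[OF eventually_nhds_in_open[OF S y]])
     (use nz in auto)
  then have "fd (%y. inverse (f y)) y v * f y + inverse (f y) * fd f y v = 0"
   using fd_bilinear[OF bounded_bilinear_mult d[OF y], of f] f y
   by (simp add: Ck_on_1 frechet_derivative_const)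
  then have "(fd (%y. inverse (f y)) y v * f y + inverse (f y) * fd f y v) * inverse (f y) = 0"
   by simp
  then show ?thesis using nz[OF y] by (simp add: field_simps)
 qed
 have "continuous_on S (%y. - (inverse (f y) * fd f y v * inverse (f y)))" for v
  using Ck_on_1_continuous[OF f] f nz by (auto simp: Ck_on_1 intro!: continuous_intros)
 then have "continuous_on S (%y. fd (%y. inverse (f y)) y v)" for v
  by (rule continuous_on_eq[of _ "%y. - (inverse (f y) * fd f y v * inverse (f y))"]) (simp add: D)
 then show ?thesis using d by (simp add: Ck_on_1)
qed

text \<open>The squared positive part of r^2 - |y - c|^2 is once continuously differentiable, which
  is the regularity that the partition of unity has to have for Stokes' theorem below.\<close>

definition bump :: "'a::euclidean_space => real => 'a => real" where
 "bump c r y = (max 0 (r\<^sup>2 - (y - c) \<bullet> (y - c)))\<^sup>2"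

lemma bump_C1: "Ck_on 1 UNIV (bump c r)"
proof -
 have m: "((%s::real. (max 0 s)\<^sup>2) has_derivative (%h. 2 * max 0 s * h)) (at s)" for s
 proof -
  consider "s > 0" | "s < 0" | "s = 0" by linarith
  then show ?thesis
  proof cases
   case 1
   have "((%s::real. s\<^sup>2) has_derivative (%h. 2 * max 0 s * h)) (at s)"
    using 1 by (auto intro!: derivative_eq_intros)
   then show ?thesis
    by (rule has_derivative_cong_nhds[THEN iffD1, rotated])
      (rule eventually_mono[OF eventually_nhds_in_open[of "{0<..}"]], use 1 in auto)
  next
   case 2
   have "((%s::real. 0::real) has_derivative (%h. 2 * max 0 s * h)) (at s)"
    using 2 by (auto intro!: derivative_eq_intros)
   then show ?thesis
    by (rule has_derivative_cong_nhds[THEN iffD1, rotated])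
      (rule eventually_mono[OF eventually_nhds_in_open[of "{..<0}"]], use 2 in auto)
  next
   case 3
   have "((%h::real. norm ((max 0 h)\<^sup>2) / norm h) \<longlongrightarrow> 0) (at 0)"
   proof (rule tendsto_sandwich[of "%_. 0" _ _ "%h::real. norm h"])
    show "((%h::real. norm h) \<longlongrightarrow> 0) (at 0)" by (rule tendsto_norm_zero) (rule tendsto_ident_at)
    show "\<forall>\<^sub>F h in at 0. norm ((max 0 h)\<^sup>2) / norm h <= norm (h :: real)"
     by (rule always_eventually) (auto simp: max_def power2_eq_square)
   qed auto
   then show ?thesis using 3 by (simp add: has_derivative_at)
  qed
 qed
 define u where "u y = r\<^sup>2 - (y - c) \<bullet> (y - c)" for y
 have du: "(u has_derivative (%h. - 2 * ((y - c) \<bullet> h))) (at y)" for y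
  unfolding u_def by (auto intro!: derivative_eq_intros simp: inner_commute)
 have hd: "(bump c r has_derivative (%h. 2 * max 0 (u y) * (- 2 * ((y - c) \<bullet> h)))) (at y)" for y
  using has_derivative_compose[OF du m] by (simp add: bump_def[abs_def] u_def)
 have cu: "continuous_on UNIV u" unfolding u_def by (intro continuous_intros)
 have "fd (bump c r) y v = 2 * max 0 (u y) * (- 2 * ((y - c) \<bullet> v))" for y v
  using frechet_derivative_at[OF hd] by metis
 moreover have "continuous_on UNIV (%y. 2 * max 0 (u y) * (- 2 * ((y - c) \<bullet> v)))" for v
  by (intro continuous_intros cu)
 moreover have "dfb (bump c r) y" for y
  using hd unfolding differentiable_def by blast
 ultimately show ?thesis unfolding Ck_on_1 by simp
qed

lemma bump_pos: "r > 0 ==> y \<in> ball c r ==> bump c r y > 0"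
proof -
 assume "r > 0" "y \<in> ball c r"
 then have "norm (y - c) < r" by (simp add: dist_norm norm_minus_commute)
 then have "(norm (y - c))\<^sup>2 < r\<^sup>2" by (rule power_strict_mono) auto
 then show ?thesis by (simp add: bump_def power2_norm_eq_inner)
qed

lemma bump_zero: "r > 0 ==> y \<notin> cball c r ==> bump c r y = 0"
proof -
 assume "r > 0" "y \<notin> cball c r"
 then have "r <= norm (y - c)" by (simp add: dist_norm norm_minus_commute)
 then have "r\<^sup>2 <= (norm (y - c))\<^sup>2" by (rule power_mono) (use \<open>r > 0\<close> in auto)
 then show ?thesis by (simp add: bump_def power2_norm_eq_inner)
qed

lemma bump_nonneg: "bump c r y >= 0" by (simp add: bump_def)

section \<open>Charts\<close>

locale cmfd =
 fixes X :: "('i, 'x::t2_space, 'n::finite, 'z) cplx_atlas_scheme"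
 assumes cm: "compact_complex_manifold X"
begin

lemma cover: "(\<Union>i\<in>idx X. cdom X i) = UNIV"
 and compact_X: "compact (UNIV :: 'x set)"
 using cm by (auto simp: compact_complex_manifold_def)

lemma chart:
 assumes "i \<in> idx X"
 shows "open (cdom X i)" "open (patch X i)" "homeomorphism (cdom X i) (patch X i) (crd X i) (pt X i)"
 using cm assms by (auto simp: compact_complex_manifold_def)

lemma pt_crd: "i \<in> idx X ==> x \<in> cdom X i ==> pt X i (crd X i x) = x"
 and crd_pt: "i \<in> idx X ==> y \<in> patch X i ==> crd X i (pt X i y) = y"
 and pt_in: "i \<in> idx X ==> y \<in> patch X i ==> pt X i y \<in> cdom X i"
 and crd_in: "i \<in> idx X ==> x \<in> cdom X i ==> crd X i x \<in> patch X i"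
 and cont_pt: "i \<in> idx X ==> continuous_on (patch X i) (pt X i)"
 using chart(3)[of i] by (auto simp: homeomorphism_def)

lemma crd_image: "i \<in> idx X ==> crd X i ` (U \<inter> cdom X i) = patch X i \<inter> pt X i -` U"
 by (auto simp: pt_crd crd_in pt_in) (metis IntI crd_pt image_eqI pt_in)

lemma open_pt_vimage: "i \<in> idx X ==> open U ==> open (patch X i \<inter> pt X i -` U)"
 by (rule continuous_open_preimage[OF cont_pt chart(2)])

lemma overlap_eq: "i \<in> idx X ==> overlap X i j = patch X i \<inter> pt X i -` cdom X j"
 unfolding overlap_def using crd_image[of i "cdom X j"] by (simp add: Int_commute)

lemma open_overlap: "i \<in> idx X ==> j \<in> idx X ==> open (overlap X i j)"
 by (simp add: overlap_eq open_pt_vimage chart)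

lemma overlap_patch: "y \<in> overlap X i j ==> y \<in> patch X i"
 by (auto simp: overlap_def patch_def)

lemma chg_props:
 assumes "i \<in> idx X" "j \<in> idx X" "y \<in> overlap X i j"
 shows "chg X i j y \<in> overlap X j i" "pt X j (chg X i j y) = pt X i y" "chg X j i (chg X i j y) = y"
  "chg X i j y \<in> patch X j"
 using assms by (auto simp: overlap_eq chg_def pt_crd crd_in crd_pt pt_in)

lemma chg_comp_smooth:
 assumes "i \<in> idx X" "j \<in> idx X"
 shows "smooth_fun_on (overlap X i j) (%y. chg X i j y $ a)"
  and "y \<in> overlap X i j ==> fd (%y. chg X i j y $ a) y (c *s v)
    = c * fd (%y. chg X i j y $ a) y v"
 using cm assms by (auto simp: compact_complex_manifold_def chol_on_def)

lemma chg_smooth: "i \<in> idx X ==> j \<in> idx X ==> smooth_fun_on (overlap X i j) (chg X i j)"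
 by (rule smooth_vecI[OF open_overlap chg_comp_smooth(1)])

lemma chg_differentiable: "i \<in> idx X ==> j \<in> idx X ==> y \<in> overlap X i j ==> dfb (chg X i j) y"
 by (rule smooth_diff_at[OF chg_smooth])

abbreviation "dchg i j y \<equiv> frechet_derivative (chg X i j) (at y)"

lemma dchg_nth:
 assumes "i \<in> idx X" "j \<in> idx X" "y \<in> overlap X i j"
 shows "dchg i j y v $ a = fd (%y. chg X i j y $ a) y v"
 using fd_linear[OF chg_differentiable[OF assms] bounded_linear_vec_nth] by simp

lemma dchg_linear:
 assumes "i \<in> idx X" "j \<in> idx X" "y \<in> overlap X i j"
 shows "linear (dchg i j y)" "dchg i j y (c *s v) = c *s dchg i j y v"
 using linear_frechet_derivative[OF chg_differentiable[OF assms]] chg_comp_smooth(2)[OF assms]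
 by (auto simp: vec_eq_iff dchg_nth[OF assms])

lemma dchg_inverse:
 assumes "i \<in> idx X" "j \<in> idx X" "y \<in> overlap X i j"
 shows "dchg j i (chg X i j y) (dchg i j y v) = v"
proof -
 have "fd (%z. chg X j i (chg X i j z)) y v = fd (%z. z) y v"
  by (rule fun_cong[OF fd_cong_nhds],
    rule eventually_mono[OF eventually_nhds_in_open[OF open_overlap[OF assms(1,2)] assms(3)]])
    (use chg_props assms in auto)
 then show ?thesis
  using fd_compose(1)[OF chg_differentiable[OF assms]
    chg_differentiable[OF assms(2,1) chg_props(1)[OF assms]]] by simp
qed

text \<open>The derivative is complex linear, and it is injective because the inverse coordinate
  change provides a left inverse. Positivity removes the absolute value from the change of variables
  formula.\<close>

lemma dchg_pos:
 assumes "i \<in> idx X" "j \<in> idx X" "y \<in> overlap X i j"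
 shows "Rdet (dchg i j y) > 0"
 by (rule Rdet_complex_pos[OF dchg_linear[OF assms]]) (metis dchg_inverse[OF assms] injI)

lemmas C1_chg = smooth_C1[OF chg_smooth]

end

section \<open>Integration of top-degree forms\<close>

lemma wedge_pullback:
 "wedge bm (%us. f (map L us)) (%us. g (map L us)) vs = wedge bm f g (map L vs)"
 by (simp add: wedge_def nths_map)

lemma ext_d_form0:
 fixes f :: "complex^'n::finite => 'b::real_normed_vector"
 shows "ext_d (%z. form0 (f z)) y vs =
  (case vs of [v] => fd f y v | _ => 0)"
proof (cases vs)
 case (Cons v ws)
 have i: "insf v (form0 c :: ('n, 'b) alt) = (%us. 0)" for v c by (auto simp: insf_def form0_def)
 have "ext_d (%z. %us :: (complex^'n) list. 0 :: 'b) y ws = 0"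
  by (simp add: ext_d_def frechet_derivative_const)
 then show ?thesis using Cons
  by (cases ws) (simp_all add: ext_d_Cons i, auto simp: form0_def frechet_derivative_const)
qed simp

lemma AltF_form0: "AltF (form0 c)"
 by (rule AltFI) (auto simp: form0_def linear_iff)

context cmfd begin

text \<open>What integration sees of a global top-degree form: a continuous density in each chart
  that transforms by the Jacobian. By \<open>gtopI\<close> it follows from alternation and the
  transformation law of forms.\<close>

definition gtop :: "('i, 'n, complex) lform => bool" where
 "gtop f \<longleftrightarrow> (\<forall>i\<in>idx X. continuous_on (patch X i) (%y. f i y std_frame)) &
   (\<forall>i\<in>idx X. \<forall>j\<in>idx X. \<forall>y\<in>overlap X i j.
    f i y std_frame = Rdet (dchg i j y) *\<^sub>R f j (chg X i j y) std_frame)"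

lemma gtopI:
 assumes "!!i. i \<in> idx X ==> continuous_on (patch X i) (%y. f i y std_frame)"
  and "!!i y. i \<in> idx X ==> y \<in> patch X i ==> AltF (f i y)"
  and "!!i j y us. i \<in> idx X ==> j \<in> idx X ==> y \<in> overlap X i j ==> f i y us = pull X f i j y us"
 shows "gtop f"
 unfolding gtop_def using assms AltF_std_frame[OF assms(2) dchg_linear(1)] chg_props(4)
 by (auto simp: pull_def)

text \<open>The very choice made inside the definition of the integral, named so that the integral
  can be unfolded to a sum over \<open>Q\<close>.\<close>

definition js :: "'i list" where
 "js = (SOME js. set js \<subseteq> idx X & (\<Union>j\<in>set js. cdom X j) = UNIV)"

lemma js: "set js \<subseteq> idx X" "(\<Union>j\<in>set js. cdom X j) = UNIV"
proof -
 obtain D where "D \<subseteq> idx X" "finite D" "UNIV \<subseteq> (\<Union>i\<in>D. cdom X i)"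
  using compactE_image[OF compact_X, of "idx X" "cdom X"] chart(1) cover by auto
 then have "\<exists>js. set js \<subseteq> idx X & (\<Union>j\<in>set js. cdom X j) = UNIV"
  using finite_list by (metis top.extremum_uniqueI)
 from someI_ex[OF this] show "set js \<subseteq> idx X" "(\<Union>j\<in>set js. cdom X j) = UNIV" unfolding js_def by auto
qed

definition Q :: "nat => 'x set" where "Q m = cdom X (js ! m) - (\<Union>k<m. cdom X (js ! k))"

lemma js_nth: "m < length js ==> js ! m \<in> idx X" using js(1) by auto

lemma Q_disjoint: "m ~= k ==> Q m \<inter> Q k = {}"
 by (cases m k rule: linorder_cases) (auto simp: Q_def)

lemma Q_cover: "\<exists>m<length js. x \<in> Q m"
proof -
 obtain m where "m < length js" "x \<in> cdom X (js ! m)" using js(2) by (metis UNIV_I UN_E in_set_conv_nth)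
 then have ex: "\<exists>m. m < length js & x \<in> cdom X (js ! m)" by blast
 define m where "m = (LEAST m. m < length js & x \<in> cdom X (js ! m))"
 have m: "m < length js" "x \<in> cdom X (js ! m)" using LeastI_ex[OF ex] by (auto simp: m_def)
 moreover have "x \<notin> cdom X (js ! k)" if "k < m" for k
  using not_less_Least[OF that[unfolded m_def]] that m(1) by auto
 ultimately show ?thesis by (auto simp: Q_def)
qed

lemma mint_eq: "mint X f = (\<Sum>m<length js. LINT y:crd X (js ! m) ` Q m|lborel. f (js ! m) y std_frame)"
 unfolding mint_def js_def[symmetric] Q_def Let_def by (rule refl)

lemma Q_image: "i \<in> idx X ==> crd X i ` (Q m \<inter> cdom X i) = patch X i \<inter> pt X i -` Q m"
 by (rule crd_image)

lemma Q_borel: assumes "i \<in> idx X" "m < length js" shows "crd X i ` (Q m \<inter> cdom X i) \<in> sets borel"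
proof -
 have "crd X i ` (Q m \<inter> cdom X i) = (patch X i \<inter> pt X i -` cdom X (js ! m)) - (\<Union>k<m. patch X i \<inter> pt X i -` cdom X (js ! k))"
  unfolding Q_image[OF assms(1)] by (auto simp: Q_def)
 moreover have "open (patch X i \<inter> pt X i -` cdom X (js ! k))" if "k <= m" for k
  using open_pt_vimage[OF assms(1) chart(1)[OF js_nth]] assms(2) that by auto
 ultimately show ?thesis by (simp only:) (intro sets.Diff sets.finite_UN borel_open, auto)
qed

lemma mint_cong:
 assumes "!!i y. i \<in> idx X ==> y \<in> patch X i ==> f i y std_frame = g i y std_frame"
 shows "mint X f = mint X g"
 unfolding mint_eq
proof (intro sum.cong refl)
 fix m assume m: "m \<in> {..<length js}"
 then have i: "js ! m \<in> idx X" using js_nth by auto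
 have "indicator (crd X (js ! m) ` Q m) y *\<^sub>R f (js ! m) y std_frame = indicator (crd X (js ! m) ` Q m) y *\<^sub>R g (js ! m) y std_frame" for y
  using assms[OF i, of y] by (auto simp: indicator_def Q_def crd_in[OF i])
 then show "(LINT y:crd X (js ! m) ` Q m|lborel. f (js ! m) y std_frame) = (LINT y:crd X (js ! m) ` Q m|lborel. g (js ! m) y std_frame)"
  unfolding set_lebesgue_integral_def by (simp only:)
qed

lemma compact_patch_integrable:
 assumes i: "i \<in> idx X" and K: "compact K" "K \<subseteq> patch X i"
  and c: "continuous_on (patch X i) (h :: _ => complex)" and z: "!!y. y \<in> patch X i ==> y \<notin> K ==> h y = 0"
 shows "set_integrable lborel (patch X i) h"
proof -
 have "integrable lborel (%x. indicator K x *\<^sub>R h x)"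
  by (rule borel_integrable_compact[OF K(1) continuous_on_subset[OF c K(2)]])
 moreover have "(%x. indicator K x *\<^sub>R h x) = (%x. indicator (patch X i) x *\<^sub>R h x)"
 proof
  fix x show "indicator K x *\<^sub>R h x = indicator (patch X i) x *\<^sub>R h x"
   using z[of x] K(2) by (cases "x \<in> K"; cases "x \<in> patch X i") auto
 qed
 ultimately show ?thesis by (simp add: set_integrable_def)
qed

text \<open>Coordinate changes transport the Borel pieces to chart \<open>i\<close>, where they tile
  the patch. The value therefore no longer refers to the chosen cover.\<close>

lemma mint_supported:
 assumes i: "i \<in> idx X" and K: "compact K" "K \<subseteq> patch X i" and f: "gtop f"
  and supp: "!!j y. j \<in> idx X ==> y \<in> patch X j ==> pt X j y \<notin> pt X i ` K ==> f j y std_frame = 0"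
 shows "m < length js ==> set_integrable lborel (crd X (js ! m) ` Q m) (%y. f (js ! m) y std_frame)"
  and "mint X f = (LINT y:patch X i|lborel. f i y std_frame)"
proof -
 have supp': "f i y std_frame = 0" if "y \<in> patch X i" "y \<notin> K" for y
 proof (rule supp[OF i that(1)])
  show "pt X i y \<notin> pt X i ` K" using that K crd_pt[OF i] by (auto) (metis subsetD)
 qed
 have ci: "continuous_on (patch X i) (%y. f i y std_frame)" using f i by (simp add: gtop_def)
 have int: "set_integrable lborel (patch X i) (%y. f i y std_frame)"
  by (rule compact_patch_integrable[OF i K ci supp'])
 define S where "S m = crd X i ` (Q m \<inter> cdom X i)" for m
 have Sb: "S m \<in> sets borel" if "m < length js" for m unfolding S_def by (rule Q_borel[OF i that])
 have Sp: "S m \<subseteq> patch X i" for m unfolding S_def using crd_in[OF i] by auto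
 have Sint: "set_integrable lborel (S m) (%y. f i y std_frame)" if "m < length js" for m
  by (rule set_integrable_subset[OF int _ Sp]) (use Sb[OF that] in simp)
 have key: "set_integrable lborel (crd X (js ! m) ` Q m) (%y. f (js ! m) y std_frame) &
  (LINT y:crd X (js ! m) ` Q m|lborel. f (js ! m) y std_frame) = (LINT y:S m|lborel. f i y std_frame)"
  if m: "m < length js" for m
 proof -
  let ?j = "js ! m"
  have j: "?j \<in> idx X" by (rule js_nth[OF m])
  let ?P1 = "crd X ?j ` (Q m \<inter> cdom X i)"
  have P1: "?P1 = crd X ?j ` (Q m \<inter> cdom X ?j) \<inter> (patch X ?j \<inter> pt X ?j -` cdom X i)"
  proof (intro set_eqI iffI)
   fix y assume "y \<in> ?P1"
   then obtain x where "y = crd X ?j x" "x \<in> Q m" "x \<in> cdom X i" by blast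
   moreover from this have "x \<in> cdom X ?j" by (simp add: Q_def)
   ultimately show "y \<in> crd X ?j ` (Q m \<inter> cdom X ?j) \<inter> (patch X ?j \<inter> pt X ?j -` cdom X i)"
    using pt_crd[OF j] crd_in[OF j] by auto
  next
   fix y assume "y \<in> crd X ?j ` (Q m \<inter> cdom X ?j) \<inter> (patch X ?j \<inter> pt X ?j -` cdom X i)"
   then obtain x where "y = crd X ?j x" "x \<in> Q m" "x \<in> cdom X ?j" "pt X ?j y \<in> cdom X i" by blast
   then show "y \<in> ?P1" using pt_crd[OF j] by auto
  qed
  have P1b: "?P1 \<in> sets borel"
   unfolding P1 using Q_borel[OF j m] open_pt_vimage[OF j chart(1)[OF i]] by auto
  have P1o: "?P1 \<subseteq> overlap X ?j i" unfolding P1 overlap_eq[OF j] by auto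
  have gi: "chg X ?j i ` ?P1 = S m"
  proof -
   have "x \<in> Q m ==> pt X ?j (crd X ?j x) = x" for x using pt_crd[OF j] by (auto simp: Q_def)
   then show ?thesis unfolding S_def chg_def image_image by (intro image_cong) auto
  qed
  have inj: "inj_on (chg X ?j i) ?P1"
   by (rule inj_on_inverseI[of _ "chg X i ?j"]) (use chg_props(3)[OF j i] P1o in blast)
  have der: "(chg X ?j i has_derivative dchg ?j i y) (at y)" if "y \<in> ?P1" for y
   using chg_differentiable[OF j i] P1o that frechet_derivative_works by blast
  have F: "f ?j y std_frame = \<bar>Rdet (dchg ?j i y)\<bar> *\<^sub>R f i (chg X ?j i y) std_frame" if "y \<in> ?P1" for y
  proof -
   have o: "y \<in> overlap X ?j i" using that P1o by blast
   then have "f ?j y std_frame = Rdet (dchg ?j i y) *\<^sub>R f i (chg X ?j i y) std_frame"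
    using f i j unfolding gtop_def by blast
   then show ?thesis using dchg_pos[OF j i o] by simp
  qed
  have cj: "continuous_on (patch X ?j) (%y. f ?j y std_frame)" using f j by (simp add: gtop_def)
  have m1: "set_borel_measurable borel ?P1 (%y. f ?j y std_frame)"
   unfolding set_borel_measurable_def
   by (rule borel_measurable_continuous_on_indicator[OF P1b continuous_on_subset[OF cj]])
     (use P1o overlap_patch in blast)
  have m2: "set_borel_measurable borel (chg X ?j i ` ?P1) (%y. f i y std_frame)"
   unfolding set_borel_measurable_def gi
   by (rule borel_measurable_continuous_on_indicator[OF Sb[OF m] continuous_on_subset[OF ci Sp]])
  note cv = change_of_variables_complex[where F="%y. f ?j y std_frame" and f="%y. f i y std_frame", OF P1b der inj F m2 m1, unfolded gi]
  \<comment> \<open>The piece may extend beyond chart \<open>i\<close>, but there the density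
    vanishes by the assumption on the support.\<close>
  have ind: "(%y. indicator (crd X ?j ` Q m) y *\<^sub>R f ?j y std_frame) = (%y. indicator ?P1 y *\<^sub>R f ?j y std_frame)"
  proof
   fix y
   show "indicator (crd X ?j ` Q m) y *\<^sub>R f ?j y std_frame = indicator ?P1 y *\<^sub>R f ?j y std_frame"
   proof (cases "y \<in> crd X ?j ` Q m & y \<notin> ?P1")
    case True
    then obtain x where x: "y = crd X ?j x" "x \<in> Q m" "x \<notin> cdom X i" by blast
    then have xj: "x \<in> cdom X ?j" by (simp add: Q_def)
    have "f ?j y std_frame = 0"
    proof (rule supp[OF j])
     show "y \<in> patch X ?j" using x xj crd_in[OF j] by simp
     show "pt X ?j y \<notin> pt X i ` K" using x pt_crd[OF j xj] K(2) pt_in[OF i] by auto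
    qed
    then show ?thesis by simp
   next
    case False
    then show ?thesis by (auto simp: indicator_def)
   qed
  qed
  show ?thesis
   unfolding set_integrable_def set_lebesgue_integral_def ind
   using cv Sint[OF m] unfolding set_integrable_def set_lebesgue_integral_def by blast
 qed
 show "m < length js ==> set_integrable lborel (crd X (js ! m) ` Q m) (%y. f (js ! m) y std_frame)"
  using key by blast
 have U: "(\<Union>m<length js. S m) = patch X i"
 proof
  show "patch X i \<subseteq> (\<Union>m<length js. S m)"
  proof
   fix y assume y: "y \<in> patch X i"
   obtain m where "m < length js" "pt X i y \<in> Q m" using Q_cover by blast
   then show "y \<in> (\<Union>m<length js. S m)" using y unfolding S_def Q_image[OF i] by auto
  qed
 qed (use Sp in auto)
 have "mint X f = (\<Sum>m<length js. LINT y:S m|lborel. f i y std_frame)"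
  unfolding mint_eq by (intro sum.cong refl) (use key in blast)
 also have "... = (LINT y:(\<Union>m<length js. S m)|lborel. f i y std_frame)"
 proof (rule set_integral_finite_Union[symmetric])
  show "disjoint_family_on S {..<length js}"
   unfolding disjoint_family_on_def S_def Q_image[OF i] using Q_disjoint by blast
 qed (use Sint Sb in auto)
 finally show "mint X f = (LINT y:patch X i|lborel. f i y std_frame)" unfolding U .
qed

definition pbump :: "'i \<times> (complex^'n) \<times> real => 'x => real" where
 "pbump p x = (case p of (i, c, r) => if x \<in> cdom X i then bump c r (crd X i x) else 0)"

definition good_ball :: "'i \<times> (complex^'n) \<times> real => bool" where
 "good_ball p \<longleftrightarrow> (case p of (i, c, r) => i \<in> idx X & r > 0 & cball c r \<subseteq> patch X i)"

lemma pbump_nonneg: "pbump p x >= 0"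
 by (auto simp: pbump_def bump_nonneg split: prod.split)

lemma pbump_support:
 assumes "good_ball (i, c, r)" "pbump (i, c, r) x ~= 0" shows "x \<in> pt X i ` cball c r"
proof -
 have i: "i \<in> idx X" "r > 0" using assms by (auto simp: good_ball_def)
 have x: "x \<in> cdom X i" "bump c r (crd X i x) ~= 0" using assms(2) by (auto simp: pbump_def split: if_splits)
 then have "crd X i x \<in> cball c r" using bump_zero[OF i(2)] by blast
 then show ?thesis using pt_crd[OF i(1) x(1)] by (metis image_eqI)
qed

lemma ball_compact:
 assumes "good_ball (i, c, r)" shows "compact (pt X i ` cball c r)" "pt X i ` cball c r \<subseteq> cdom X i"
 using assms compact_continuous_image[OF continuous_on_subset[OF cont_pt], of i "cball c r"] pt_in
 by (auto simp: good_ball_def)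

text \<open>Two open sets cover the patch: the overlap with the chart of the ball, where the
  function is a bump composed with a coordinate change, and the preimage of the complement of the
  closed ball, where it is zero. That complement is open since a compact subset of a Hausdorff space
  is closed.\<close>

lemma pbump_C1:
 assumes p: "good_ball p" and j: "j \<in> idx X"
 shows "Ck_on 1 (patch X j) (%y. pbump p (pt X j y))"
proof -
 obtain i c r where pe: "p = (i, c, r)" by (cases p)
 have g: "good_ball (i, c, r)" using p pe by simp
 then have i: "i \<in> idx X" by (simp add: good_ball_def)
 let ?f = "%y. pbump p (pt X j y)"
 let ?O1 = "overlap X j i" and ?O2 = "patch X j \<inter> pt X j -` (- pt X i ` cball c r)"
 have O1: "open ?O1" by (rule open_overlap[OF j i])
 have O2: "open ?O2" by (rule open_pt_vimage[OF j]) (use ball_compact(1)[OF g] compact_imp_closed in blast)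
 have U: "patch X j = ?O1 \<union> ?O2" using ball_compact(2)[OF g] unfolding overlap_eq[OF j] by blast
 have "Ck_on 1 ?O1 (%y. bump c r (chg X j i y))"
  by (rule C1_compose[OF bump_C1 C1_chg[OF j i]]) simp
 then have c1: "Ck_on 1 ?O1 ?f"
  by (rule Ck_on_cong[OF O1, rotated]) (auto simp: pbump_def pe overlap_eq[OF j] chg_def)
 have c2: "Ck_on 1 ?O2 ?f"
  by (rule Ck_on_cong[OF O2 _ Ck_on_const[of 1 _ 0]]) (use pbump_support[OF g] pe in auto)
 show ?thesis
  unfolding Ck_on_1
 proof (intro conjI allI ballI)
  fix y assume "y \<in> patch X j"
  then consider "y \<in> ?O1" | "y \<in> ?O2" using U by blast
  then show "?f differentiable at y"
  proof cases
   case 1 then show ?thesis by (rule bspec[OF conjunct1[OF c1[unfolded Ck_on_1]]])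
  next
   case 2 then show ?thesis by (rule bspec[OF conjunct1[OF c2[unfolded Ck_on_1]]])
  qed
 next
  show "continuous_on (patch X j) (%y. fd ?f y v)" for v
   by (subst U) (rule continuous_on_open_Un[OF O1 O2 spec[OF conjunct2[OF c1[unfolded Ck_on_1]]] spec[OF conjunct2[OF c2[unfolded Ck_on_1]]]])
 qed
qed

definition pballs :: "('i \<times> (complex^'n) \<times> real) set" where
 "pballs = (SOME P. finite P & (\<forall>p\<in>P. good_ball p) & (\<forall>x. \<exists>p\<in>P. pbump p x > 0))"

text \<open>Coordinate balls with closure inside a patch cover the manifold, and compactness leaves
  finitely many. At each point some bump is positive, so the sum of the bumps can serve as a
  denominator.\<close>

lemma pballs: "finite pballs" "p \<in> pballs ==> good_ball p" "\<exists>p\<in>pballs. pbump p x > 0"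
proof -
 define W where "W p = (case p of (i, c, r) => pt X i ` ball c r)" for p :: "'i \<times> (complex^'n) \<times> real"
 have oW: "open (W p)" if "good_ball p" for p
 proof -
  obtain i c r where pe: "p = (i, c, r)" by (cases p)
  have i: "i \<in> idx X" "ball c r \<subseteq> patch X i" using that by (auto simp: pe good_ball_def)
  have "homeomorphism (patch X i) (cdom X i) (pt X i) (crd X i)" using chart(3)[OF i(1)] homeomorphism_sym by blast
  then have "openin (top_of_set (cdom X i)) (pt X i ` ball c r)"
   by (rule homeomorphism_imp_open_map) (use i open_subset in blast)
  then show ?thesis using chart(1)[OF i(1)] openin_open_trans by (auto simp: W_def pe)
 qed
 have cov: "\<exists>p. good_ball p & x \<in> W p" for x
 proof -
  obtain i where i: "i \<in> idx X" "x \<in> cdom X i" using cover by blast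
  then obtain e where e: "e > 0" "ball (crd X i x) e \<subseteq> patch X i"
   using chart(2)[OF i(1)] crd_in[OF i] openE by blast
  have "cball (crd X i x) (e/2) \<subseteq> patch X i" using e by auto
  then have "good_ball (i, crd X i x, e/2)" using i e by (simp add: good_ball_def)
  moreover have "x \<in> W (i, crd X i x, e/2)"
   unfolding W_def using pt_crd[OF i] e(1) by (auto intro!: image_eqI[of _ _ "crd X i x"])
  ultimately show ?thesis by blast
 qed
 obtain P where P: "P \<subseteq> Collect good_ball" "finite P" "UNIV \<subseteq> (\<Union>p\<in>P. W p)"
 proof -
  have "UNIV \<subseteq> (\<Union>p\<in>Collect good_ball. W p)" using cov by blast
  then show ?thesis using compactE_image[OF compact_X, of "Collect good_ball" W] oW that by blast
 qed
 have "\<exists>p\<in>P. pbump p x > 0" for x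
 proof -
  obtain p where p: "p \<in> P" "x \<in> W p" using P(3) by blast
  obtain i c r where pe: "p = (i, c, r)" by (cases p)
  have g: "good_ball (i, c, r)" using p P pe by auto
  then have i: "i \<in> idx X" "r > 0" "ball c r \<subseteq> patch X i" by (auto simp: good_ball_def)
  obtain y where y: "y \<in> ball c r" "x = pt X i y" using p pe by (auto simp: W_def)
  then have "y \<in> patch X i" using i by blast
  then have "x \<in> cdom X i" "crd X i x = y" using y pt_in[OF i(1)] crd_pt[OF i(1)] by auto
  then have "pbump p x > 0" using bump_pos[OF i(2) y(1)] by (simp add: pbump_def pe)
  then show ?thesis using p by blast
 qed
 then have "\<exists>P. finite P & (\<forall>p\<in>P. good_ball p) & (\<forall>x. \<exists>p\<in>P. pbump p x > 0)" using P by blast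
 from someI_ex[OF this] show "finite pballs" "p \<in> pballs ==> good_ball p" "\<exists>p\<in>pballs. pbump p x > 0"
  unfolding pballs_def by auto
qed

definition punit :: "'i \<times> (complex^'n) \<times> real => 'x => real" where
 "punit p x = pbump p x * inverse (\<Sum>q\<in>pballs. pbump q x)"

lemma pbump_sum_pos: "(\<Sum>q\<in>pballs. pbump q x) > 0"
 using pballs(3)[of x] by (auto intro!: sum_pos2[OF pballs(1)] simp: pbump_nonneg)

lemma punit_sum: "(\<Sum>p\<in>pballs. punit p x) = 1"
 unfolding punit_def sum_distrib_right[symmetric] using pbump_sum_pos[of x] by simp

lemma punit_C1:
 assumes "p \<in> pballs" "j \<in> idx X" shows "Ck_on 1 (patch X j) (%y. punit p (pt X j y))"
proof -
 have "Ck_on 1 (patch X j) (%y. \<Sum>q\<in>P. pbump q (pt X j y))" if "P \<subseteq> pballs" for P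
  using finite_subset[OF that pballs(1)] that
  by (induction P rule: finite_induct)
    (auto simp: Ck_on_const intro!: Ck_on_add[OF chart(2)[OF assms(2)]] pbump_C1 pballs(2) assms(2)
     simp del: Ck_on.simps One_nat_def)
 then have "Ck_on 1 (patch X j) (%y. inverse (\<Sum>q\<in>pballs. pbump q (pt X j y)))"
  by (intro C1_inverse[OF chart(2)[OF assms(2)]]) (use pbump_sum_pos in \<open>auto simp: less_le simp del: Ck_on.simps One_nat_def\<close>)
 then show ?thesis unfolding punit_def
  by (rule Ck_on_bilinear[OF chart(2)[OF assms(2)] bounded_bilinear_mult pbump_C1[OF pballs(2)[OF assms(1)] assms(2)]])
qed

lemma punit_support:
 assumes "(i, c, r) \<in> pballs" "punit (i, c, r) x ~= 0" shows "x \<in> pt X i ` cball c r"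
 by (rule pbump_support) (use assms pballs(2) in \<open>auto simp: punit_def\<close>)

lemma gtop_add: "gtop f ==> gtop g ==> gtop (%i y vs. f i y vs + g i y vs)"
 unfolding gtop_def by (auto intro!: continuous_intros simp: scaleR_add_right)

lemma gtop_cmult: "gtop f ==> gtop (%i y vs. c * f i y vs)"
 unfolding gtop_def by (auto intro!: continuous_intros)

lemma gtop_zero: "gtop (%i y vs. 0)" by (simp add: gtop_def)

lemma gtop_punit:
 assumes "p \<in> pballs" "gtop f" shows "gtop (%i y vs. complex_of_real (punit p (pt X i y)) * f i y vs)"
 using assms Ck_on_1_continuous[OF punit_C1[OF assms(1)]] chg_props(2)
 unfolding gtop_def by (auto intro!: continuous_intros)

lemma gtop_punit_mint:
 assumes p: "(k, c, r) \<in> pballs" and f: "gtop f"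
  and z: "!!j y. j \<in> idx X ==> y \<in> patch X j ==> pt X j y \<notin> pt X k ` cball c r ==> f j y std_frame = 0"
 shows "m < length js ==> set_integrable lborel (crd X (js ! m) ` Q m) (%y. f (js ! m) y std_frame)"
  and "mint X f = (LINT y:patch X k|lborel. f k y std_frame)"
proof -
 have g: "k \<in> idx X" "cball c r \<subseteq> patch X k" using pballs(2)[OF p] by (auto simp: good_ball_def)
 note s = mint_supported[OF g(1) compact_cball g(2) f z]
 show "m < length js ==> set_integrable lborel (crd X (js ! m) ` Q m) (%y. f (js ! m) y std_frame)"
  "mint X f = (LINT y:patch X k|lborel. f k y std_frame)" using s by blast+
qed

text \<open>The pieces need not be relatively compact in their patches, so continuity is not enough.
  The partition of unity splits the density into parts with compact support in one chart.\<close>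

lemma gtop_integrable:
 assumes f: "gtop f" and m: "m < length js"
 shows "set_integrable lborel (crd X (js ! m) ` Q m) (%y. f (js ! m) y std_frame)"
proof -
 have each: "set_integrable lborel (crd X (js ! m) ` Q m) (%y. complex_of_real (punit p (pt X (js ! m) y)) * f (js ! m) y std_frame)"
  if p: "p \<in> pballs" for p
 proof -
  obtain k c r where pe: "p = (k, c, r)" by (cases p)
  have pz: "punit (k, c, r) x = 0" if "x \<notin> pt X k ` cball c r" for x
   using punit_support[OF p[unfolded pe]] that by blast
  show ?thesis
   unfolding pe by (rule gtop_punit_mint(1)[of k c r "%i y vs. complex_of_real (punit (k, c, r) (pt X i y)) * f i y vs", OF _ _ _ m])
    (use p pe gtop_punit[OF p f] pz in auto)
 qed
 have "set_integrable lborel (crd X (js ! m) ` Q m)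
   (%y. \<Sum>p\<in>pballs. complex_of_real (punit p (pt X (js ! m) y)) * f (js ! m) y std_frame)"
  unfolding set_integrable_def scaleR_sum_right
  by (rule Bochner_Integration.integrable_sum) (rule each[unfolded set_integrable_def])
 moreover have "(\<Sum>p\<in>pballs. complex_of_real (punit p x) * z) = z" for x z
  unfolding sum_distrib_right[symmetric] of_real_sum[symmetric] punit_sum by simp
 ultimately show ?thesis by simp
qed

lemma mint_add:
 assumes "gtop f" "gtop g" shows "mint X (%i y vs. f i y vs + g i y vs) = mint X f + mint X g"
 unfolding mint_eq sum.distrib[symmetric]
 by (intro sum.cong refl set_integral_add(2)) (use gtop_integrable assms in auto)

lemma mint_cmult: "mint X (%i y vs. c * f i y vs) = c * mint X f"
 unfolding mint_eq sum_distrib_left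
 by (intro sum.cong refl) (simp add: set_lebesgue_integral_def flip: mult_scaleR_right)

lemma mint_zero: "mint X (%i y vs. 0) = 0"
 unfolding mint_eq by (simp add: set_lebesgue_integral_def)

lemma gtop_sum: "finite K ==> (!!k. k \<in> K ==> gtop (f k)) ==> gtop (%i y vs. \<Sum>k\<in>K. f k i y vs)"
 by (induction K rule: finite_induct) (auto simp: gtop_zero intro: gtop_add)

lemma mint_sum:
 assumes "finite K" "!!k. k \<in> K ==> gtop (f k)"
 shows "mint X (%i y vs. \<Sum>k\<in>K. f k i y vs) = (\<Sum>k\<in>K. mint X (f k))"
 using assms by (induction K rule: finite_induct) (auto simp: mint_zero mint_add gtop_sum)

lemma mint_diff:
 assumes "gtop f" "gtop g" shows "mint X (%i y vs. f i y vs - g i y vs) = mint X f - mint X g"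
 using mint_add[OF assms(1) gtop_cmult[OF assms(2), of "-1"]] mint_cmult[of "-1" g] by simp

text \<open>Extended by zero, the coefficients of the form are continuously differentiable on the
  whole space and have compact support, so every term of the exterior derivative integrates to
  zero.\<close>

lemma chart_stokes:
 assumes i: "i \<in> idx X" and K: "compact K" "K \<subseteq> patch X i"
  and C1: "!!us. Ck_on 1 (patch X i) (%y. g y us)"
  and z: "!!y us. y \<in> patch X i ==> y \<notin> K ==> g y us = 0"
 shows "(LINT y:patch X i|lborel. ext_d g y vs) = (0 :: complex)"
proof -
 have oK: "open (- K)" using compact_imp_closed[OF K(1)] by blast
 have 1: "set_integrable lborel (patch X i) (%y. fd (%z. g z us) y v)"
  "(LINT y:patch X i|lborel. fd (%z. g z us) y v) = 0" for us v
 proof -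
  define G where "G y = (if y \<in> patch X i then g y us else 0)" for y
  have G0: "G y = 0" if "y \<notin> K" for y using z that by (auto simp: G_def)
  have ev1: "eventually (%z. G z = g z us) (nhds y)" if "y \<in> patch X i" for y
   by (rule eventually_mono[OF eventually_nhds_in_open[OF chart(2)[OF i] that]]) (simp add: G_def)
  have ev2: "eventually (%z. G z = 0) (nhds y)" if "y \<notin> K" for y
   by (rule eventually_mono[OF eventually_nhds_in_open[OF oK]]) (use that G0 in auto)
  have dG: "dfb G y" for y
  proof (cases "y \<in> K")
   case True
   then have "y \<in> patch X i" using K by blast
   then show ?thesis using diff_cong_nhds[OF ev1] C1 unfolding Ck_on_1 by blast
  next
   case False
   then show ?thesis using diff_cong_nhds[OF ev2] by simp
  qed
  have D1: "fd G y v = fd (%z. g z us) y v" if "y \<in> patch X i" for y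
   using fd_cong_nhds[OF ev1[OF that]] by simp
  have D2: "fd G y v = 0" if "y \<notin> K" for y
   using fd_cong_nhds[OF ev2[OF that]] by (simp add: frechet_derivative_const)
  have cG1: "continuous_on (patch X i) (%y. fd G y v)"
   by (rule continuous_on_eq[of _ "%y. fd (%z. g z us) y v"]) (use C1 D1 in \<open>auto simp: Ck_on_1\<close>)
  have cG2: "continuous_on (- K) (%y. fd G y v)"
   by (rule continuous_on_eq[of _ "%y. 0"]) (use D2 in auto)
  have "patch X i \<union> - K = UNIV" using K by auto
  then have cG: "continuous_on UNIV (%y. fd G y v)"
   using continuous_on_open_Un[OF chart(2)[OF i] oK cG1 cG2] by simp
  have ind: "(%y. indicator (patch X i) y *\<^sub>R fd (%z. g z us) y v) = (%y. fd G y v)"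
  proof
   fix y show "indicator (patch X i) y *\<^sub>R fd (%z. g z us) y v = fd G y v"
    using D1[of y] D2[of y] K(2) by (cases "y \<in> patch X i") auto
  qed
  show "(LINT y:patch X i|lborel. fd (%z. g z us) y v) = 0"
   unfolding set_lebesgue_integral_def ind
   by (rule integral_derivative_compact_support[OF dG cG K(1) G0])
  have "set_integrable lborel (patch X i) (%y. fd G y v)"
   by (rule compact_patch_integrable[OF i K cG1]) (use D2 in auto)
  then show "set_integrable lborel (patch X i) (%y. fd (%z. g z us) y v)"
   unfolding set_integrable_def ind
  proof -
   assume "integrable lborel (%x. indicator (patch X i) x *\<^sub>R fd G x v)"
   moreover have "(%x. indicator (patch X i) x *\<^sub>R fd G x v) = (%x. fd G x v)"
   proof
    fix y show "indicator (patch X i) y *\<^sub>R fd G y v = fd G y v"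
     using D2[of y] K(2) by (cases "y \<in> patch X i") auto
   qed
   ultimately show "integrable lborel (%y. fd G y v)" by simp
  qed
 qed
 let ?D = "%m y. fd (%z. g z (take m vs @ drop (Suc m) vs)) y (vs ! m)"
 have e: "indicator (patch X i) y *\<^sub>R ext_d g y vs = (\<Sum>m<length vs. (-1) ^ m *\<^sub>R (indicator (patch X i) y *\<^sub>R ?D m y))" for y
  by (simp add: ext_d_def scaleR_sum_right mult.commute)
 have "(LINT y|lborel. (\<Sum>m<length vs. (-1) ^ m *\<^sub>R (indicator (patch X i) y *\<^sub>R ?D m y)))
   = (\<Sum>m<length vs. LINT y|lborel. (-1) ^ m *\<^sub>R (indicator (patch X i) y *\<^sub>R ?D m y))"
  by (rule Bochner_Integration.integral_sum)
    (intro integrable_scaleR_right impI 1(1)[unfolded set_integrable_def])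
 also have "... = 0"
  by (simp only: integral_scaleR_right 1(2)[unfolded set_lebesgue_integral_def] scaleR_zero_right sum.neutral_const)
 finally show ?thesis unfolding set_lebesgue_integral_def e .
qed

text \<open>For a member p of the partition of unity, p \<eta> lives in one chart and d(p \<eta>) =
  dp \<and> \<eta> + p d\<eta>. In the sum over p the terms with dp cancel, since the functions p
  add up to 1. That d\<eta> is a global density is an assumption, which avoids commuting d with
  coordinate changes; in the application d\<eta> is already identified with a global form.\<close>

theorem stokes:
 assumes C1: "!!i us. i \<in> idx X ==> Ck_on 1 (patch X i) (%y. \<eta> i y us)"
  and alt: "!!i y. i \<in> idx X ==> y \<in> patch X i ==> AltF (\<eta> i y)"
  and tr: "!!i j y us. i \<in> idx X ==> j \<in> idx X ==> y \<in> overlap X i j ==> \<eta> i y us = pull X \<eta> i j y us"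
  and top: "gtop (%i. ext_d (\<eta> i))"
 shows "mint X (%i. ext_d (\<eta> i)) = 0"
proof -
 define h0 where "h0 p i y = (form0 (complex_of_real (punit p (pt X i y))) :: ('n, complex) alt)" for p i y
 define f where "f p i y = (%vs. complex_of_real (punit p (pt X i y)) * ext_d (\<eta> i) y vs)" for p i y
 define dh0 where "dh0 p i y = wedge_cc (ext_d (h0 p i) y) (\<eta> i y)" for p i y
 have pC: "Ck_on 1 (patch X i) (%y. complex_of_real (punit p (pt X i y)))" if "p \<in> pballs" "i \<in> idx X" for p i
  by (rule Ck_on_linear[OF chart(2)[OF that(2)] bounded_linear_of_real punit_C1[OF that]])
 have h0C: "Ck_on 1 (patch X i) (%y. h0 p i y us)" if "p \<in> pballs" "i \<in> idx X" for p i us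
  unfolding h0_def using pC[OF that] by (cases us) (auto simp: form0_def Ck_on_const simp del: Ck_on.simps One_nat_def)
 have h0d: "dfb (%z. h0 p i z us) y" if "p \<in> pballs" "i \<in> idx X" "y \<in> patch X i" for p i y us
  using h0C[OF that(1,2)] that(3) unfolding Ck_on_1 by blast
 have \<eta>d: "dfb (%z. \<eta> i z us) y" if "i \<in> idx X" "y \<in> patch X i" for i y us
  using C1[OF that(1)] that(2) unfolding Ck_on_1 by blast
 have h: "hatf (form0 c) = form0 c" for c :: complex by (auto simp: hatf_def form0_def)
 have prod: "ext_d (%z. wedge_cc (h0 p i z) (\<eta> i z)) y vs = dh0 p i y vs + f p i y vs"
  if "p \<in> pballs" "i \<in> idx X" "y \<in> patch X i" for p i y vs
 proof -
  have "ext_d (%z. wedge_cc (h0 p i z) (\<eta> i z)) y vs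
    = wedge_cc (ext_d (h0 p i) y) (\<eta> i y) vs + wedge_cc (hatf (h0 p i y)) (ext_d (\<eta> i) y) vs"
   by (rule ext_d_wedge[OF bb_cc]) (rule h0d[OF that], rule \<eta>d[OF that(2,3)])
  moreover have "wedge_cc (hatf (h0 p i y)) (ext_d (\<eta> i) y) vs = f p i y vs"
   by (simp add: f_def h0_def h form0_wedge[OF bb_cc])
  ultimately show ?thesis by (simp add: dh0_def)
 qed
 have gf: "gtop (f p)" if "p \<in> pballs" for p
  unfolding f_def by (rule gtop_punit[OF that top])
 have gd: "gtop (dh0 p)" if p: "p \<in> pballs" for p
 proof (rule gtopI)
  fix i assume i: "i \<in> idx X"
  have "continuous_on (patch X i) (%y. ext_d (h0 p i) y us)" for us
   unfolding ext_d_def using h0C[OF p i] unfolding Ck_on_1 by (intro continuous_intros) blast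
  moreover have "continuous_on (patch X i) (%y. \<eta> i y us)" for us
   by (rule Ck_on_1_continuous[OF C1[OF i]])
  ultimately show "continuous_on (patch X i) (%y. dh0 p i y std_frame)"
   unfolding dh0_def wedge_def by (intro continuous_intros)
  fix y assume y: "y \<in> patch X i"
  show "AltF (dh0 p i y)"
   unfolding dh0_def
  proof (rule AltF_wedge[OF bb_cc AltF_ext_d alt[OF i y]])
   show "\<forall>\<^sub>F z in nhds y. AltF (h0 p i z)" by (simp add: h0_def AltF_form0)
  qed (rule h0d[OF p i y])
 next
  fix i j y us assume ij: "i \<in> idx X" "j \<in> idx X" "y \<in> overlap X i j"
  have c: "chg X i j y \<in> patch X j" by (rule chg_props(4)[OF ij])
  \<comment> \<open>Here d does meet a coordinate change, but only on a function, where the chain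
    rule suffices.\<close>
  have 1: "ext_d (h0 p i) y vs = ext_d (h0 p j) (chg X i j y) (map (dchg i j y) vs)" for vs
  proof -
   have dj: "dfb (%z. complex_of_real (punit p (pt X j z))) (chg X i j y)"
    using pC[OF p ij(2)] c unfolding Ck_on_1 by blast
   have "fd (%z. complex_of_real (punit p (pt X i z))) y v
     = fd (%z. complex_of_real (punit p (pt X j (chg X i j z)))) y v" for v
    by (rule fun_cong[OF fd_cong_nhds],
      rule eventually_mono[OF eventually_nhds_in_open[OF open_overlap[OF ij(1,2)] ij(3)]])
      (simp add: chg_props(2)[OF ij(1,2)])
   then show ?thesis
    unfolding h0_def ext_d_form0
    using fd_compose(1)[OF chg_differentiable[OF ij] dj]
    by (cases vs; cases "tl vs") auto
  qed
  show "dh0 p i y us = pull X (dh0 p) i j y us"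
   unfolding dh0_def pull_def wedge_pullback[symmetric] 1[abs_def] tr[OF ij, unfolded pull_def, abs_def] ..
 qed
 have each: "mint X (%i y vs. dh0 p i y vs + f p i y vs) = 0" if p: "p \<in> pballs" for p
 proof -
  obtain k c r where pe: "p = (k, c, r)" by (cases p)
  have g: "k \<in> idx X" "cball c r \<subseteq> patch X k" using pballs(2)[OF p] by (auto simp: good_ball_def pe)
  have oC: "open (- pt X k ` cball c r)"
   using ball_compact(1)[of k c r] pballs(2)[OF p] compact_imp_closed by (auto simp: pe)
  have z: "dh0 p j y std_frame + f p j y std_frame = 0"
   if j: "j \<in> idx X" "y \<in> patch X j" "pt X j y \<notin> pt X k ` cball c r" for j y
  proof -
   have "ext_d (%z. wedge_cc (h0 p j z) (\<eta> j z)) y std_frame = ext_d (%z us. 0) y std_frame"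
   proof -
    have "frechet_derivative (%z. wedge_cc (h0 p j z) (\<eta> j z) us) (at y) = frechet_derivative (%z. 0) (at y)" for us
    proof (rule fd_cong_nhds, rule eventually_mono[OF eventually_nhds_in_open[OF open_pt_vimage[OF j(1) oC]]])
     show "y \<in> patch X j \<inter> pt X j -` (- pt X k ` cball c r)" using j by simp
     fix z assume "z \<in> patch X j \<inter> pt X j -` (- pt X k ` cball c r)"
     then have "punit p (pt X j z) = 0" using punit_support[of k c r] p pe by auto
     then show "wedge_cc (h0 p j z) (\<eta> j z) us = 0"
      by (simp add: h0_def form0_wedge[OF bb_cc])
    qed
    then show ?thesis by (simp add: ext_d_def)
   qed
   then show ?thesis using prod[OF p j(1,2)] by (simp add: ext_d_def frechet_derivative_const)
  qed
  have "mint X (%i y vs. dh0 p i y vs + f p i y vs) = (LINT y:patch X k|lborel. dh0 p k y std_frame + f p k y std_frame)"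
   by (rule gtop_punit_mint(2)[of k c r, OF _ gtop_add[OF gd[OF p] gf[OF p]] z]) (use p pe in auto)
  also have "... = (LINT y:patch X k|lborel. ext_d (%z. wedge_cc (h0 p k z) (\<eta> k z)) y std_frame)"
   unfolding set_lebesgue_integral_def
  proof (rule arg_cong[where f="integral\<^sup>L lborel"], rule ext)
   fix y show "indicator (patch X k) y *\<^sub>R (dh0 p k y std_frame + f p k y std_frame)
     = indicator (patch X k) y *\<^sub>R ext_d (%z. wedge_cc (h0 p k z) (\<eta> k z)) y std_frame"
    by (cases "y \<in> patch X k") (simp_all add: prod[OF p g(1)])
  qed
  also have "... = 0"
  proof (rule chart_stokes[OF g(1) compact_cball g(2)])
   show "Ck_on 1 (patch X k) (%y. wedge_cc (h0 p k y) (\<eta> k y) us)" for us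
    unfolding h0_def form0_wedge[OF bb_cc]
    by (rule Ck_on_bilinear[OF chart(2)[OF g(1)] bb_cc pC[OF p g(1)] C1[OF g(1)]])
   fix y us assume y: "y \<in> patch X k" "y \<notin> cball c r"
   have "pt X k y \<notin> pt X k ` cball c r" using y g crd_pt[OF g(1)] by auto (metis subsetD mem_cball)
   then have "punit p (pt X k y) = 0" using punit_support[of k c r] p pe by auto
   then show "wedge_cc (h0 p k y) (\<eta> k y) us = 0" by (simp add: h0_def form0_wedge[OF bb_cc])
  qed
  finally show ?thesis .
 qed
 have s1: "(\<Sum>p\<in>pballs. complex_of_real (punit p x)) = 1" for x
  unfolding of_real_sum[symmetric] punit_sum by simp
 have sd: "(\<Sum>p\<in>pballs. dh0 p i y vs) = 0" if iy: "i \<in> idx X" "y \<in> patch X i" for i y vs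
 proof -
  have "(\<Sum>p\<in>pballs. ext_d (h0 p i) y us) = 0" for us
  proof -
   have "(%z. \<Sum>p\<in>pballs. h0 p i z us) = (%z. form0 1 us)" for us
    by (auto simp: h0_def form0_def s1)
   then have "(\<Sum>p\<in>pballs. fd (%z. h0 p i z us) y v) = 0" for v us
    using fd_sum[of pballs "%p z. h0 p i z us" y v] h0d iy
    by (simp add: frechet_derivative_const)
   then show ?thesis unfolding ext_d_def
    by (subst sum.swap) (simp flip: scaleR_sum_right)
  qed
  moreover have "(\<Sum>p\<in>pballs. dh0 p i y vs) = wedge_cc (%us. \<Sum>p\<in>pballs. ext_d (h0 p i) y us) (\<eta> i y) vs"
   unfolding dh0_def by (rule wedge_sum_left[OF bb_cc, symmetric])
  ultimately show ?thesis by (simp add: wedge_zero_left[OF bb_cc])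
 qed
 have sf: "(\<Sum>p\<in>pballs. f p i y vs) = ext_d (\<eta> i) y vs" for i y vs
  unfolding f_def sum_distrib_right[symmetric] s1 by simp
 have "mint X (%i. ext_d (\<eta> i)) = mint X (%i y vs. \<Sum>p\<in>pballs. dh0 p i y vs + f p i y vs)"
  by (rule mint_cong) (simp add: sum.distrib sd sf)
 also have "... = (\<Sum>p\<in>pballs. mint X (%i y vs. dh0 p i y vs + f p i y vs))"
  by (rule mint_sum[OF pballs(1)]) (use gtop_add gd gf in blast)
 also have "... = 0" using each by simp
 finally show ?thesis .
qed

end

section \<open>Local covariant calculus\<close>

text \<open>By Cartan's formula the remaining terms are a directional derivative of d f, d of the
  directional derivative, and a contracted form covered by the induction. The former two agree by
  the symmetry of second derivatives, which also explains the inner product on the values.\<close>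

lemma ext_d_ext_d:
 fixes f :: "complex^'n::finite => ('n, 'a::real_inner) alt"
 assumes S: "open S" "y \<in> S" and sm: "!!us. smooth_fun_on S (%z. f z us)"
 shows "ext_d (ext_d f) y vs = 0"
 using sm
proof (induction vs arbitrary: f)
 case (Cons v ws)
 let ?D = "%z us. fd (%z. f z us) z v"
 have d: "dfb (%z. fd (%z. f z us) z w) y" for us w
  by (rule smooth_diff_at[OF smooth_deriv[OF Cons.prems] S(2)])
 have s: "smooth_fun_on S (%z. insf v (f z) us)" for us using Cons.prems by (simp add: insf_def)
 have d2: "dfb (%z. ext_d (%z. insf v (f z)) z us) y" for us
  by (rule smooth_diff_at[OF smooth_ext_d[OF S(1) s] S(2)])
 have i: "(%z. insf v (ext_d f z)) = (%z us. ?D z us + (-1) *\<^sub>R ext_d (%z. insf v (f z)) z us)"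
  by (intro ext) (simp add: insf_def[of v "ext_d f _"] ext_d_Cons)
 have "fd (%z. ext_d f z ws) y v
  = (\<Sum>m<length ws. (-1) ^ m *\<^sub>R fd (%z. fd (%z. f z (take m ws @ drop (Suc m) ws)) z (ws ! m)) y v)"
  unfolding ext_d_def
  by (simp add: fd_sum diff_linear[OF bounded_linear_scaleR_right] d
    fd_scaleR)
 also have "... = ext_d ?D y ws"
  unfolding ext_d_def
  by (intro sum.cong refl arg_cong2[where f=scaleR] symmetric_second_derivative[OF S])
    (use Cons.prems in \<open>simp add: smooth_fun_on_def\<close>)
 finally have 1: "fd (%z. ext_d f z ws) y v = ext_d ?D y ws" .
 have 2: "ext_d (%z. insf v (ext_d f z)) y ws = ext_d ?D y ws + ext_d (%z us. (-1) *\<^sub>R ext_d (%z. insf v (f z)) z us) y ws"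
  unfolding i by (rule ext_d_add) (use d d2 diff_linear[OF bounded_linear_scaleR_right] in blast)+
 have 3: "ext_d (%z us. (-1) *\<^sub>R ext_d (%z. insf v (f z)) z us) y ws = (-1) *\<^sub>R ext_d (ext_d (%z. insf v (f z))) y ws"
  by (rule ext_d_linear[OF d2 bounded_linear_scaleR_right])
 show ?case unfolding ext_d_Cons 1 2 3 Cons.IH[OF s] by simp
qed simp

lemma homog_ext_d:
 assumes "eventually (%z. homog k (f z)) (nhds y)" shows "homog (Suc k) (ext_d f y)"
 unfolding homog_def
proof (intro allI impI)
 fix vs :: "(complex^'a) list" assume l: "length vs ~= Suc k"
 have "frechet_derivative (%z. f z (take m vs @ drop (Suc m) vs)) (at y) = frechet_derivative (%z. 0) (at y)"
  if "m < length vs" for m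
 proof (rule fd_cong_nhds, rule eventually_mono[OF assms])
  have "length (take m vs @ drop (Suc m) vs) ~= k" using l that by auto
  then show "homog k (f z) ==> f z (take m vs @ drop (Suc m) vs) = 0" for z by (simp add: homog_def)
 qed
 then show "ext_d f y vs = 0" by (simp add: ext_d_def frechet_derivative_const)
qed

text \<open>The local form of \<open>cov_d\<close>, detached from the chart index.\<close>

definition cd :: "(complex^'n::finite => ('n, 'r::finite cmat) alt) => nat => (complex^'n => ('n, 'r cmat) alt) =>
  complex^'n => ('n, 'r cmat) alt" where
 "cd A k B y = (%vs. ext_d B y vs + wedge_mm (A y) (B y) vs - (-1) ^ k *\<^sub>R wedge_mm (B y) (A y) vs)"

abbreviation dif :: "(complex^'n::finite => ('n, 'a::real_normed_vector) alt) => complex^'n => bool" where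
 "dif B y \<equiv> \<forall>us. dfb (%z. B z us) y"

text \<open>The terms with the connection form between the two factors cancel by
  associativity.\<close>

lemma cd_wedge:
 assumes "dif B y" "dif C y" "homog p (B y)" "homog q (C y)"
 shows "cd A (p + q) (%z. wedge_mm (B z) (C z)) y vs =
  wedge_mm (cd A p B y) (C y) vs + (-1) ^ p *\<^sub>R wedge_mm (B y) (cd A q C y) vs"
proof -
 note bb = bb_mm
 have d: "ext_d (%z. wedge_mm (B z) (C z)) y vs = wedge_mm (ext_d B y) (C y) vs + (-1) ^ p *\<^sub>R wedge_mm (B y) (ext_d C y) vs"
  using ext_d_wedge[OF bb, of B y C vs] assms(1,2)
  by (simp add: homog_hatf[OF assms(3)] wedge_scale_left[OF bb])
 show ?thesis
  unfolding cd_def d wedge_diff_left[OF bb] wedge_diff_right[OF bb] wedge_add_left[OF bb] wedge_add_right[OF bb]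
   wedge_scale_left[OF bb] wedge_scale_right[OF bb] wedge_mm_assoc
  by (simp add: scaleR_add_right scaleR_diff_right power_add)
qed

lemma dif_wedge: "dif B y ==> dif C y ==> dif (%z. wedge_mm (B z) (C z)) y"
 using differentiable_wedge[OF bb_mm] by blast

lemma dif_mprod: "(!!B. B \<in> set Bs ==> dif B y) ==> dif (%z. mprod (map (%B. B z) Bs)) y"
 by (induction Bs) (auto intro!: dif_wedge[rule_format])

lemma dif_replicate: "dif F y ==> dif (%z. mprod (replicate s (F z))) y"
 using dif_mprod[of "replicate s F" y] by (simp add: map_replicate)

lemma cd_form0_1: "cd A 0 (%z. form0 (mat 1)) y vs = 0"
 by (simp add: cd_def ext_d_form0 frechet_derivative_const split: list.split)

lemma cd_power:
 assumes "dif F y" "homog 2 (F y)" "cd A 2 F y = (%us. 0)"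
 shows "cd A (2 * s) (%z. mprod (replicate s (F z))) y = (%us. 0)"
proof (induction s)
 case 0
 then show ?case by (auto simp: cd_form0_1)
next
 case (Suc s)
 have "cd A (2 + 2 * s) (%z. wedge_mm (F z) (mprod (replicate s (F z)))) y vs = 0" for vs
  by (subst cd_wedge[OF assms(1) dif_replicate[OF assms(1)] assms(2) homog_replicate[OF assms(2)]])
    (simp add: Suc assms(3) wedge_zero_left[OF bb_mm] wedge_zero_right[OF bb_mm])
 then show ?case by (auto simp: fun_eq_iff)
qed

text \<open>The connection enters through a graded commutator, whose trace is zero.\<close>

lemma ext_d_trace:
 assumes "dif B y" "homog 1 (A y)" "homog k (B y)"
 shows "ext_d (%z us. trace (B z us)) y vs = trace (cd A k B y vs)"
proof -
 have "trace (wedge_mm (A y) (B y) vs) = (-1) ^ k *\<^sub>R trace (wedge_mm (B y) (A y) vs)"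
  using trace_wedge_commute[OF assms(2,3)] by simp
 moreover have "ext_d (%z us. trace (B z us)) y vs = trace (ext_d B y vs)"
  by (rule ext_d_linear[OF _ bl_trace]) (use assms(1) in blast)
 ultimately show ?thesis by (simp add: cd_def trace_add_c trace_sub)
qed

text \<open>Since d d = 0, the derivative of the curvature is the graded commutator of dA with A;
  the cubic terms cancel by associativity.\<close>

lemma bianchi:
 assumes S: "open S" "y \<in> S" and sm: "!!us. smooth_fun_on S (%z. A z us)" and h: "!!z. z \<in> S ==> homog 1 (A z)"
 shows "cd A 2 (%z vs. ext_d A z vs + wedge_mm (A z) (A z) vs) y = (%us. 0)"
proof
 fix us
 note bb = bb_mm
 have dA: "dif A y" using smooth_diff_at[OF sm S(2)] by blast
 have ddA: "dif (ext_d A) y"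
  by (rule allI, rule smooth_diff_at[OF smooth_ext_d[OF S(1)] S(2)]) (rule sm)
 have hA: "homog 1 (A y)" using h S by blast
 have 1: "ext_d (%z vs. ext_d A z vs + wedge_mm (A z) (A z) vs) y us
   = wedge_mm (ext_d A y) (A y) us - wedge_mm (A y) (ext_d A y) us"
 proof -
  have "ext_d (%z vs. ext_d A z vs + wedge_mm (A z) (A z) vs) y us = ext_d (ext_d A) y us + ext_d (%z. wedge_mm (A z) (A z)) y us"
   by (rule ext_d_add) (use ddA dif_wedge[OF dA dA] in blast)+
  also have "ext_d (%z. wedge_mm (A z) (A z)) y us = wedge_mm (ext_d A y) (A y) us + wedge_mm (hatf (A y)) (ext_d A y) us"
   by (rule ext_d_wedge[OF bb]) (use dA in blast)+
  also have "hatf (A y) = (%us. - A y us)" using homog_hatf[OF hA] by simp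
  finally show ?thesis by (simp add: ext_d_ext_d[OF S sm] wedge_neg_left[OF bb])
 qed
 show "cd A 2 (%z vs. ext_d A z vs + wedge_mm (A z) (A z) vs) y us = 0"
  unfolding cd_def 1 by (simp add: wedge_add_left[OF bb] wedge_add_right[OF bb] wedge_mm_assoc)
qed

section \<open>Cyclic words in the curvature\<close>

text \<open>By \<open>trace_gsym_two\<close> this is \<open>m + 1\<close> times the traced
  symmetrisation of \<open>x\<close>, \<open>y\<close> and \<open>m\<close> curvature factors. It is
  left unnormalised because the factor 1 / (m + 1) is merged into the coefficients.\<close>

definition W2 :: "nat => ('n::finite, 'r::finite cmat) alt => ('n, 'r cmat) alt => ('n, 'r cmat) alt => ('n, complex) alt" where
 "W2 m F x y = (%us. \<Sum>s\<le>m. trace (mprod (x # replicate s F @ y # replicate (m - s) F) us))"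

text \<open>The words that arise when one curvature factor in \<open>W2 m\<close> is replaced by a
  third form, so that \<open>m - 1\<close> such factors remain. They occur as derivatives of the
  two-form and as potentials for them.\<close>

definition W3 :: "nat => ('n::finite, 'r::finite cmat) alt => ('n, 'r cmat) alt => ('n, 'r cmat) alt => ('n, 'r cmat) alt =>
  ('n, complex) alt" where
 "W3 m F x y z = (%us. \<Sum>(s, t, u)\<in>{(s, t, u). s + t + u + 1 = m}.
   trace (mprod (x # replicate s F @ y # replicate t F @ z # replicate u F) us))"

lemma finite_triples [simp]: "finite {(s, t, u). s + t + u + 1 = (m::nat)}"
 by (rule finite_subset[of _ "{..m} \<times> {..m} \<times> {..m}"]) auto

lemma W2_antisym:
 assumes "homog 1 x" "homog 1 y" "homog 2 F"
 shows "W2 m F x y us = - W2 m F y x us"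
proof -
 have "trace (mprod (x # replicate s F @ y # replicate (m - s) F) us)
   = - trace (mprod (y # replicate (m - s) F @ x # replicate s F) us)" for s
 proof -
  have h: "homog (1 + 2 * s) (mprod (x # replicate s F))" "homog (1 + 2 * (m - s)) (mprod (y # replicate (m - s) F))"
   unfolding mprod_Cons by (intro homog_wedge bb_mm assms homog_replicate)+
  from trace_mprod_rotate[OF h, of us] show ?thesis by (simp add: minus_one_power_iff)
 qed
 then have "W2 m F x y us = (\<Sum>s\<le>m. - trace (mprod (y # replicate (m - s) F @ x # replicate s F) us))"
  by (simp add: W2_def)
 also have "... = (\<Sum>s\<le>m. - trace (mprod (y # replicate s F @ x # replicate (m - s) F) us))"
  by (rule sum.reindex_bij_witness[of _ "%s. m - s" "%s. m - s"]) auto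
 finally show ?thesis by (simp add: W2_def sum_negf)
qed

text \<open>Cyclicity of the trace; the three gaps are rotated together with the marked factors, and
  the sum runs over all gaps.\<close>

lemma W3_rotate:
 assumes "homog p x" "homog q y" "homog r z" "homog 2 F"
 shows "W3 m F x y z us = (-1) ^ (p * (q + r)) *\<^sub>R W3 m F y z x us"
proof -
 have "trace (mprod (x # replicate s F @ y # replicate t F @ z # replicate u F) us)
   = (-1) ^ (p * (q + r)) *\<^sub>R trace (mprod (y # replicate t F @ z # replicate u F @ x # replicate s F) us)" for s t u
 proof -
  have h: "homog (p + 2 * s) (mprod (x # replicate s F))"
   "homog (q + (2 * t + (r + 2 * u))) (mprod (y # replicate t F @ z # replicate u F))"
   unfolding mprod_Cons mprod_append by (intro homog_wedge bb_mm assms homog_replicate)+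
  have "(-1::real) ^ ((p + 2 * s) * (q + (2 * t + (r + 2 * u)))) = (-1) ^ (p * (q + r))"
   by (simp add: minus_one_power_iff)
  then show ?thesis using trace_mprod_rotate[OF h, of us] by simp
 qed
 then have "W3 m F x y z us = (\<Sum>(s, t, u)\<in>{(s, t, u). s + t + u + 1 = m}.
   (-1) ^ (p * (q + r)) *\<^sub>R trace (mprod (y # replicate t F @ z # replicate u F @ x # replicate s F) us))"
  by (simp add: W3_def)
 also have "... = (\<Sum>(s, t, u)\<in>{(s, t, u). s + t + u + 1 = m}.
   (-1) ^ (p * (q + r)) *\<^sub>R trace (mprod (y # replicate s F @ z # replicate t F @ x # replicate u F) us))"
  by (rule sum.reindex_bij_witness[of _ "%(s, t, u). (u, s, t)" "%(s, t, u). (t, u, s)"]) auto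
 finally show ?thesis by (simp add: W3_def scaleR_sum_right case_prod_beta)
qed

lemma cd_block:
 assumes "dif x y" "homog p (x y)" "dif F y" "homog 2 (F y)" "cd A 2 F y = (%us. 0)"
 shows "cd A (p + 2 * s) (%z. mprod (x z # replicate s (F z))) y vs = mprod (cd A p x y # replicate s (F y)) vs"
  "dif (%z. mprod (x z # replicate s (F z))) y" "homog (p + 2 * s) (mprod (x y # replicate s (F y)))"
proof -
 note bb = bb_mm
 show "cd A (p + 2 * s) (%z. mprod (x z # replicate s (F z))) y vs = mprod (cd A p x y # replicate s (F y)) vs"
  unfolding mprod_Cons cd_wedge[OF assms(1) dif_replicate[OF assms(3)] assms(2) homog_replicate[OF assms(4)]]
  by (simp add: cd_power[OF assms(3-5)] wedge_zero_right[OF bb])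
 show "dif (%z. mprod (x z # replicate s (F z))) y"
  unfolding mprod_Cons by (rule dif_wedge[OF assms(1) dif_replicate[OF assms(3)]])
 show "homog (p + 2 * s) (mprod (x y # replicate s (F y)))"
  unfolding mprod_Cons by (intro homog_wedge bb assms homog_replicate)
qed

lemma ext_d_sum:
 assumes "!!k us. k \<in> K ==> dfb (%z. f k z us) y"
 shows "ext_d (%z us. \<Sum>k\<in>K. f k z us) y vs = (\<Sum>k\<in>K. ext_d (f k) y vs)"
proof -
 have "ext_d (%z us. \<Sum>k\<in>K. f k z us) y vs = (\<Sum>m<length vs. \<Sum>k\<in>K. (-1) ^ m *\<^sub>R
   fd (%z. f k z (take m vs @ drop (Suc m) vs)) y (vs ! m))"
  unfolding ext_d_def using assms by (simp add: fd_sum scaleR_sum_right)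
 then show ?thesis unfolding ext_d_def by (subst (asm) sum.swap)
qed

text \<open>Under the trace d may be replaced by the covariant derivative, and the curvature factors
  are covariantly constant; so only the marked factors are differentiated.\<close>

lemma ext_d_W2:
 assumes x: "dif x z0" "homog p (x z0)" and y: "dif y z0" "homog q (y z0)"
  and F: "dif F z0" "homog 2 (F z0)" "cd A 2 F z0 = (%us. 0)" and A: "homog 1 (A z0)"
 shows "ext_d (%z. W2 m (F z) (x z) (y z)) z0 vs =
  W2 m (F z0) (cd A p x z0) (y z0) vs + (-1) ^ p *\<^sub>R W2 m (F z0) (x z0) (cd A q y z0) vs"
proof -
 have w: "mprod (x z # replicate s (F z) @ y z # replicate t (F z))
   = wedge_mm (mprod (x z # replicate s (F z))) (mprod (y z # replicate t (F z)))" for z s t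
  using mprod_append[of "x z # replicate s (F z)"] by simp
 have dw: "dif (%z. mprod (x z # replicate s (F z) @ y z # replicate t (F z))) z0" for s t
  unfolding w by (rule dif_wedge[OF cd_block(2)[OF x F] cd_block(2)[OF y F]])
 have "ext_d (%z us. trace (mprod (x z # replicate s (F z) @ y z # replicate t (F z)) us)) z0 vs =
   trace (mprod (cd A p x z0 # replicate s (F z0) @ y z0 # replicate t (F z0)) vs) +
   (-1) ^ p *\<^sub>R trace (mprod (x z0 # replicate s (F z0) @ cd A q y z0 # replicate t (F z0)) vs)" for s t
 proof -
  have hm: "homog ((p + 2 * s) + (q + 2 * t)) (mprod (x z0 # replicate s (F z0) @ y z0 # replicate t (F z0)))"
   unfolding w by (intro homog_wedge bb_mm cd_block(3)[OF x F] cd_block(3)[OF y F])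
  have "cd A ((p + 2 * s) + (q + 2 * t)) (%z. mprod (x z # replicate s (F z) @ y z # replicate t (F z))) z0 vs
   = mprod (cd A p x z0 # replicate s (F z0) @ y z0 # replicate t (F z0)) vs
    + (-1) ^ p *\<^sub>R mprod (x z0 # replicate s (F z0) @ cd A q y z0 # replicate t (F z0)) vs"
   unfolding w cd_wedge[OF cd_block(2)[OF x F] cd_block(2)[OF y F] cd_block(3)[OF x F] cd_block(3)[OF y F]]
   using mprod_append[of "cd A p x z0 # replicate s (F z0)" "y z0 # replicate t (F z0)"]
    mprod_append[of "x z0 # replicate s (F z0)" "cd A q y z0 # replicate t (F z0)"]
   by (simp add: cd_block(1)[OF x F, abs_def] cd_block(1)[OF y F, abs_def] power_add power_mult del: mprod_Cons)
  then show ?thesis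
   unfolding ext_d_trace[where A=A and B="%z. mprod (x z # replicate s (F z) @ y z # replicate t (F z))", OF dw A hm]
   by (simp add: trace_add_c)
 qed
 moreover have "dfb (%z. trace (mprod (x z # replicate s (F z) @ y z # replicate t (F z)) us)) z0" for s t us
  by (rule diff_linear[OF bl_trace]) (use dw in blast)
 ultimately show ?thesis
  unfolding W2_def by (simp add: ext_d_sum sum.distrib scaleR_sum_right)
qed

lemma ext_d_W3:
 assumes x: "dif x z0" "homog 1 (x z0)" and y: "dif y z0" "homog 1 (y z0)" and w: "dif w z0" "homog 1 (w z0)"
  and F: "dif F z0" "homog 2 (F z0)" "cd A 2 F z0 = (%us. 0)" and A: "homog 1 (A z0)"
 shows "ext_d (%z. W3 m (F z) (x z) (y z) (w z)) z0 vs =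
  W3 m (F z0) (cd A 1 x z0) (y z0) (w z0) vs - W3 m (F z0) (x z0) (cd A 1 y z0) (w z0) vs
  + W3 m (F z0) (x z0) (y z0) (cd A 1 w z0) vs"
proof -
 note bb = bb_mm
 have ap: "mprod (a # replicate s f @ b # replicate t f @ c # replicate u f)
   = wedge_mm (mprod (a # replicate s f)) (wedge_mm (mprod (b # replicate t f)) (mprod (c # replicate u f)))" for a b c f s t u
  using mprod_append[of "a # replicate s f" "b # replicate t f @ c # replicate u f"] mprod_append[of "b # replicate t f" "c # replicate u f"] by simp
 note X = cd_block[OF x F] and Y = cd_block[OF y F] and V = cd_block[OF w F]
 let ?YV = "%t u z. wedge_mm (mprod (y z # replicate t (F z))) (mprod (w z # replicate u (F z)))"
 have dYV: "dif (?YV t u) z0" and hYV: "homog ((1 + 2 * t) + (1 + 2 * u)) (?YV t u z0)" for t u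
  by (rule dif_wedge[OF Y(2) V(2)], intro homog_wedge bb Y(3) V(3))
 have dw: "dif (%z. mprod (x z # replicate s (F z) @ y z # replicate t (F z) @ w z # replicate u (F z))) z0" for s t u
  unfolding ap by (rule dif_wedge[OF X(2) dYV])
 have "ext_d (%z us. trace (mprod (x z # replicate s (F z) @ y z # replicate t (F z) @ w z # replicate u (F z)) us)) z0 vs =
   trace (mprod (cd A 1 x z0 # replicate s (F z0) @ y z0 # replicate t (F z0) @ w z0 # replicate u (F z0)) vs) -
   trace (mprod (x z0 # replicate s (F z0) @ cd A 1 y z0 # replicate t (F z0) @ w z0 # replicate u (F z0)) vs) +
   trace (mprod (x z0 # replicate s (F z0) @ y z0 # replicate t (F z0) @ cd A 1 w z0 # replicate u (F z0)) vs)" for s t u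
 proof -
  have hm: "homog ((1 + 2 * s) + ((1 + 2 * t) + (1 + 2 * u))) (mprod (x z0 # replicate s (F z0) @ y z0 # replicate t (F z0) @ w z0 # replicate u (F z0)))"
   unfolding ap by (intro homog_wedge bb X(3) hYV)
  have 1: "cd A ((1 + 2 * t) + (1 + 2 * u)) (?YV t u) z0 = (%us. wedge_mm (mprod (cd A 1 y z0 # replicate t (F z0))) (mprod (w z0 # replicate u (F z0))) us
    - wedge_mm (mprod (y z0 # replicate t (F z0))) (mprod (cd A 1 w z0 # replicate u (F z0))) us)"
   unfolding cd_wedge[OF Y(2) V(2) Y(3) V(3), abs_def] Y(1)[abs_def] V(1)[abs_def] by (simp add: power_add power_mult del: mprod_Cons)
  have "cd A ((1 + 2 * s) + ((1 + 2 * t) + (1 + 2 * u))) (%z. mprod (x z # replicate s (F z) @ y z # replicate t (F z) @ w z # replicate u (F z))) z0 vs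
   = mprod (cd A 1 x z0 # replicate s (F z0) @ y z0 # replicate t (F z0) @ w z0 # replicate u (F z0)) vs
    - mprod (x z0 # replicate s (F z0) @ cd A 1 y z0 # replicate t (F z0) @ w z0 # replicate u (F z0)) vs
    + mprod (x z0 # replicate s (F z0) @ y z0 # replicate t (F z0) @ cd A 1 w z0 # replicate u (F z0)) vs"
   unfolding ap cd_wedge[OF X(2) dYV X(3) hYV] 1 X(1)[abs_def]
   by (simp add: power_add power_mult wedge_diff_right[OF bb] del: mprod_Cons)
  then show ?thesis
   unfolding ext_d_trace[where A=A and B="%z. mprod (x z # replicate s (F z) @ y z # replicate t (F z) @ w z # replicate u (F z))", OF dw A hm]
   by (simp add: trace_add_c trace_sub)
 qed
 moreover have "dfb (%z. trace (mprod (x z # replicate s (F z) @ y z # replicate t (F z) @ w z # replicate u (F z)) us)) z0" for s t u us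
  by (rule diff_linear[OF bl_trace]) (use dw in blast)
 ultimately show ?thesis
  unfolding W3_def case_prod_beta by (simp add: ext_d_sum sum.distrib sum_subtractf)
qed

section \<open>Derivatives of words along a path of curvatures\<close>

lemma wedge_hvd:
 assumes bb: "bounded_bilinear bm"
  and "!!us. hvd (%t. f t us) (f' us) t0" "!!us. hvd (%t. g t us) (g' us) t0"
 shows "hvd (%t. wedge bm (f t) (g t) vs) (wedge bm f' (g t0) vs + wedge bm (f t0) g' vs) t0"
proof -
 have "hvd (%t. wedge bm (f t) (g t) vs) (\<Sum>S\<in>Pow {..<length vs}. ((-1) ^ card {(a, b). a < b & b < length vs & b \<in> S & a \<notin> S}) *\<^sub>R
    (bm (f t0 (nths vs S)) (g' (nths vs (- S))) + bm (f' (nths vs S)) (g t0 (nths vs (- S))))) t0"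
  unfolding wedge_def
  by (intro has_vector_derivative_sum bounded_linear.has_vector_derivative[OF bounded_linear_scaleR_right]
    bounded_bilinear.has_vector_derivative[OF bb] assms)
 then show ?thesis
  by (simp add: wedge_def scaleR_add_right sum.distrib add.commute)
qed


lemma wedge_hvd_right:
 assumes bb: "bounded_bilinear bm" and "!!us. hvd (%t. g t us) (g' us) t0"
 shows "hvd (%t. wedge bm f (g t) vs) (wedge bm f g' vs) t0"
 using wedge_hvd[OF bb _ assms(2), where f="%t. f" and f'="%us. 0" and vs=vs] by (simp add: wedge_zero_left[OF bb])

lemma mprod_replicate_derivative:
 assumes "!!us. hvd (%t. F t us) (F' us) t0"
 shows "hvd (%t. mprod (replicate j (F t)) vs) (\<Sum>s<j. mprod (replicate s (F t0) @ F' # replicate (j - 1 - s) (F t0)) vs) t0"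
proof (induction j arbitrary: vs)
 case 0
 then show ?case by (simp add: has_vector_derivative_const)
next
 case (Suc j)
 note bb = bb_mm
 have "hvd (%t. wedge_mm (F t) (mprod (replicate j (F t))) vs) (wedge_mm F' (mprod (replicate j (F t0))) vs +
   wedge_mm (F t0) (%us. \<Sum>s<j. mprod (replicate s (F t0) @ F' # replicate (j - 1 - s) (F t0)) us) vs) t0"
  by (rule wedge_hvd[OF bb assms Suc])
 then show ?case
  by (simp only: sum.lessThan_Suc_shift wedge_sum_right[OF bb] replicate_Suc mprod_Cons append_Cons) simp
qed

text \<open>The differentiated curvature factor lies either between \<open>x\<close> and
  \<open>y\<close> or behind \<open>y\<close>, which gives the two cyclic orders.\<close>

lemma W2_derivative:
 assumes "!!us. hvd (%t. F t us) (F' us) t0"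
 shows "hvd (%t. W2 m (F t) x y us) (W3 m (F t0) x F' y us + W3 m (F t0) x y F' us) t0"
proof -
 note bb = bb_mm
 define dR where "dR j = (%vs. \<Sum>s<j. mprod (replicate s (F t0) @ F' # replicate (j - 1 - s) (F t0)) vs)" for j
 have dR: "hvd (%t. mprod (replicate j (F t)) vs) (dR j vs) t0" for j vs
  unfolding dR_def by (rule mprod_replicate_derivative[OF assms])
 let ?R = "%s. mprod (replicate s (F t0))"
 have wsr: "wedge_mm G (%us. \<Sum>k\<in>K. h k us) = (%us. \<Sum>k\<in>K. wedge_mm G (h k) us)"
  for G and h :: "nat => ('a, 'b cmat) alt" and K
  by (rule ext, rule wedge_sum_right[OF bb])
 have dRl: "wedge_mm (dR j) G = (%us. \<Sum>k<j. wedge_mm (mprod (replicate k (F t0) @ F' # replicate (j - 1 - k) (F t0))) G us)"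
  and dRr: "wedge_mm G (dR j) = (%us. \<Sum>k<j. wedge_mm G (mprod (replicate k (F t0) @ F' # replicate (j - 1 - k) (F t0))) us)" for j G
  unfolding dR_def by (rule ext, rule wedge_sum_left[OF bb], rule ext, rule wedge_sum_right[OF bb])
 have w: "hvd (%t. mprod (x # replicate s (F t) @ y # replicate u (F t)) vs) (wedge_mm x (wedge_mm (dR s) (wedge_mm y (?R u))) vs + wedge_mm x (wedge_mm (?R s) (wedge_mm y (dR u))) vs) t0" for s u vs
 proof -
  have 2: "hvd (%t. wedge_mm (mprod (replicate s (F t))) (wedge_mm y (mprod (replicate u (F t)))) vs) (wedge_mm (dR s) (wedge_mm y (?R u)) vs + wedge_mm (?R s) (wedge_mm y (dR u)) vs) t0" for vs
   by (rule wedge_hvd[OF bb dR wedge_hvd_right[OF bb dR]])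
  from wedge_hvd_right[OF bb 2]
  show ?thesis by (simp add: wedge_add_right[OF bb] mprod_append)
 qed
 have "hvd (%t. W2 m (F t) x y us) (\<Sum>s\<le>m. trace (wedge_mm x (wedge_mm (dR s) (wedge_mm y (?R (m - s)))) us + wedge_mm x (wedge_mm (?R s) (wedge_mm y (dR (m - s)))) us)) t0"
  unfolding W2_def by (intro has_vector_derivative_sum bounded_linear.has_vector_derivative[OF bl_trace] w)
 moreover have "(\<Sum>s\<le>m. trace (wedge_mm x (wedge_mm (dR s) (wedge_mm y (?R (m - s)))) us)) = W3 m (F t0) x F' y us"
 proof -
  have "(\<Sum>s\<le>m. trace (wedge_mm x (wedge_mm (dR s) (wedge_mm y (?R (m - s)))) us))
   = (\<Sum>s\<le>m. \<Sum>k<s. trace (mprod (x # replicate k (F t0) @ F' # replicate (s - 1 - k) (F t0) @ y # replicate (m - s) (F t0)) us))"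
   by (simp add: dRl dRr wsr trace_sum mprod_append wedge_mm_assoc)
  also have "... = (\<Sum>(s, k)\<in>(SIGMA s:{..m}. {..<s}). trace (mprod (x # replicate k (F t0) @ F' # replicate (s - 1 - k) (F t0) @ y # replicate (m - s) (F t0)) us))"
   by (subst sum.Sigma) auto
  also have "... = W3 m (F t0) x F' y us"
   unfolding W3_def
   by (rule sum.reindex_bij_witness[of _ "%(k, r, u). (k + r + 1, k)" "%(s, k). (k, s - 1 - k, m - s)"]) auto
  finally show ?thesis .
 qed
 moreover have "(\<Sum>s\<le>m. trace (wedge_mm x (wedge_mm (?R s) (wedge_mm y (dR (m - s)))) us)) = W3 m (F t0) x y F' us"
 proof -
  have "(\<Sum>s\<le>m. trace (wedge_mm x (wedge_mm (?R s) (wedge_mm y (dR (m - s)))) us))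
   = (\<Sum>s\<le>m. \<Sum>k<m - s. trace (mprod (x # replicate s (F t0) @ y # replicate k (F t0) @ F' # replicate (m - s - 1 - k) (F t0)) us))"
   by (simp add: dRl dRr wsr trace_sum mprod_append wedge_mm_assoc)
  also have "... = (\<Sum>(s, k)\<in>(SIGMA s:{..m}. {..<m - s}). trace (mprod (x # replicate s (F t0) @ y # replicate k (F t0) @ F' # replicate (m - s - 1 - k) (F t0)) us))"
   by (subst sum.Sigma) auto
  also have "... = W3 m (F t0) x y F' us"
   unfolding W3_def
   by (rule sum.reindex_bij_witness[of _ "%(s, k, u). (s, k)" "%(s, k). (s, k, m - s - 1 - k)"]) auto
  finally show ?thesis .
 qed
 ultimately show ?thesis by (simp add: trace_add_c sum.distrib)
qed

section \<open>Gauge transformations of local connection forms\<close>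

lemma ext_d_two: "ext_d f y [v, w] = fd (%z. f z [w]) y v - fd (%z. f z [v]) y w"
 by (simp add: ext_d_Cons insf_def)

lemma wedge_two:
 assumes "bounded_bilinear bm" "homog 1 f" "homog 1 g"
 shows "wedge bm f g [v, w] = bm (f [v]) (g [w]) - bm (f [w]) (g [v])"
 using assms(2,3) bb_zero[OF assms(1)] bb_scale(1)[OF assms(1), where r="-1"]
 by (simp add: wedge_Cons[OF assms(1)] wedge_Nil insf_def hatf_def homog_def)

lemma differentiable_matrix_inv_smooth:
 assumes "open S" "y \<in> S" "smooth_fun_on S T" "!!z. z \<in> S ==> invertible (T z :: 'r::finite cmat)"
 shows "dfb (%z. matrix_inv (T z)) y"
  "fd (%z. matrix_inv (T z)) y v = - (matrix_inv (T y) ** fd T y v ** matrix_inv (T y))"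
proof -
 have ev: "eventually (%z. invertible (T z)) (nhds y)"
  by (rule eventually_mono[OF eventually_nhds_in_open[OF assms(1,2)]]) (rule assms(4))
 note d = smooth_diff_at[OF assms(3,2)]
 show "dfb (%z. matrix_inv (T z)) y" by (rule differentiable_matrix_inv[OF d ev])
 show "fd (%z. matrix_inv (T z)) y v = - (matrix_inv (T y) ** fd T y v ** matrix_inv (T y))"
  by (rule fd_matrix_inv[OF d ev])
qed

lemma differentiable_mm:
 fixes f g :: "_ => 'r::finite cmat"
 shows "dfb f y ==> dfb g y ==> dfb (%z. f z ** g z) y"
 by (rule diff_bilinear[OF bb_mm])

lemma fd_mm:
 fixes f g :: "_ => 'r::finite cmat"
 shows "dfb f y ==> dfb g y ==>
  fd (%z. f z ** g z) y v =
   fd f y v ** g y + f y ** fd g y v"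
 by (rule fd_bilinear[OF bb_mm])

lemma fd_diff:
 assumes "dfb f y" "dfb g y"
 shows "fd (%z. f z - g z) y v = fd f y v - fd g y v"
 using fd_add[of f y "%z. - g z" v] fd_neg[of g y v] assms by simp

text \<open>The second derivatives of \<open>T\<close> are symmetric and cancel in the
  antisymmetrised derivative; the first derivatives cancel against the square of the connection
  form. It serves both for transition matrices and for gauge transformations.\<close>

lemma gauge_curvature:
 fixes A A' :: "complex^'n::finite => ('n, 'r::finite cmat) alt"
 assumes S: "open S" "y \<in> S" and T: "smooth_fun_on S T" and inv: "!!z. z \<in> S ==> invertible (T z)"
  and dA': "!!w. dfb (%z. A' z [w]) y"
  and A: "!!z w. z \<in> S ==> A z [w] = T z ** A' z [w] ** matrix_inv (T z) - fd T z w ** matrix_inv (T z)"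
  and h: "homog 1 (A y)" "homog 1 (A' y)"
 shows "ext_d A y [v, w] + wedge_mm (A y) (A y) [v, w] =
   T y ** (ext_d A' y [v, w] + wedge_mm (A' y) (A' y) [v, w]) ** matrix_inv (T y)"
proof -
 let ?Ti = "%z. matrix_inv (T z)"
 let ?D = "%v. fd T y v"
 let ?DD = "%v w. fd (%z. fd T z w) y v"
 have dT: "dfb T y" by (rule smooth_diff_at[OF T S(2)])
 have ddT: "dfb (%z. fd T z w) y" for w
  by (rule smooth_diff_at[OF smooth_deriv[OF T] S(2)])
 note iv = differentiable_matrix_inv_smooth[OF S T inv]
 have ev: "eventually (%z. A z [w] = T z ** A' z [w] ** ?Ti z - fd T z w ** ?Ti z) (nhds y)" for w
  by (rule eventually_mono[OF eventually_nhds_in_open[OF S]]) (rule A)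
 have D: "fd (%z. A z [w]) y v =
   ?D v ** A' y [w] ** ?Ti y + T y ** fd (%z. A' z [w]) y v ** ?Ti y
   - T y ** A' y [w] ** ?Ti y ** ?D v ** ?Ti y - ?DD v w ** ?Ti y + ?D w ** ?Ti y ** ?D v ** ?Ti y" for v w
  unfolding fd_cong_nhds[OF ev]
  by (simp add: fd_diff differentiable_mm dT ddT dA' iv fd_mm mm_add mm_minus matrix_mul_assoc)
 have sym: "?DD v w = ?DD w v"
  by (rule symmetric_second_derivative[OF S]) (use T in \<open>simp add: smooth_fun_on_def\<close>)
 have c: "M ** ?Ti y ** T y = M" for M :: "'r cmat" by (rule mm_cancel(2)[OF matrix_inv_works(2)[OF inv[OF S(2)]]])
 show ?thesis
  unfolding ext_d_two wedge_two[OF bb_mm h(1) h(1)] wedge_two[OF bb_mm h(2) h(2)] D A[OF S(2)]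
  by (simp add: mm_add mm_diff matrix_mul_assoc c sym)
qed

text \<open>Differentiating compatibility with the metric once more expresses the second derivatives
  of \<open>H\<close> through \<open>A\<close>. Their symmetry reads
  \<open>H ** F + ctransp F ** H = 0\<close>.\<close>

lemma hermitian_curvature:
 fixes A :: "complex^'n::finite => ('n, 'r::finite cmat) alt"
 assumes S: "open S" "y \<in> S" and H: "smooth_fun_on S H" and pd: "!!z. z \<in> S ==> pos_def_herm (H z)"
  and dA: "!!w. dfb (%z. A z [w]) y"
  and u: "!!z w. z \<in> S ==> fd H z w = H z ** A z [w] + ctransp (A z [w]) ** H z"
  and h: "homog 1 (A y)"
 shows "hadj (H y) (ext_d A y [v, w] + wedge_mm (A y) (A y) [v, w]) = - (ext_d A y [v, w] + wedge_mm (A y) (A y) [v, w])"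
proof -
 let ?H = "H y" and ?D = "%v w. fd (%z. A z [w]) y v"
 have dH: "dfb H y" by (rule smooth_diff_at[OF H S(2)])
 have dct: "dfb (%z. ctransp (A z [w])) y" for w
  by (rule diff_linear[OF bl_ctransp dA])
 have DH: "fd H y v = ?H ** A y [v] + ctransp (A y [v]) ** ?H" for v by (rule u[OF S(2)])
 have ev: "eventually (%z. fd H z w = H z ** A z [w] + ctransp (A z [w]) ** H z) (nhds y)" for w
  by (rule eventually_mono[OF eventually_nhds_in_open[OF S]]) (rule u)
 have DD: "fd (%z. fd H z w) y v =
   ?H ** A y [v] ** A y [w] + ctransp (A y [v]) ** ?H ** A y [w] + ?H ** ?D v w
   + (ctransp (?D v w) ** ?H + ctransp (A y [w]) ** ?H ** A y [v] + ctransp (A y [w]) ** ctransp (A y [v]) ** ?H)" for v w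
  unfolding fd_cong_nhds[OF ev]
  by (simp add: fd_add differentiable_mm dH dA dct fd_mm DH
    fd_linear[OF dA bl_ctransp] mm_add matrix_mul_assoc)
 have sym: "fd (%z. fd H z w) y v = fd (%z. fd H z v) y w"
  by (rule symmetric_second_derivative[OF S]) (use H in \<open>simp add: smooth_fun_on_def\<close>)
 define F where "F = ext_d A y [v, w] + wedge_mm (A y) (A y) [v, w]"
 have F: "F = ?D v w - ?D w v + A y [v] ** A y [w] - A y [w] ** A y [v]"
  by (simp add: F_def ext_d_two wedge_two[OF bb_mm h h])
 have "?H ** F + ctransp F ** ?H = 0"
  using sym unfolding DD F
  by (simp add: ctransp_add ctransp_diff ctransp_mm mm_add mm_diff matrix_mul_assoc algebra_simps)
 then have "matrix_inv ?H ** (?H ** F + ctransp F ** ?H) = 0" by simp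
 then have "F + hadj ?H F = 0"
  by (simp add: mm_add hadj_def matrix_mul_assoc pos_def_inv(2)[OF pd[OF S(2)]])
 then show ?thesis unfolding F_def[symmetric] by (simp add: add.commute eq_neg_iff_add_eq_0)
qed

lemma smooth_cmatI:
 fixes M :: "_ => 'r::finite cmat"
 assumes S: "open S" and M: "!!a b. smooth_fun_on S (%z. M z $ a $ b)" shows "smooth_fun_on S M"
proof -
 have "smooth_fun_on S (%z. \<Sum>a\<in>UNIV. \<Sum>b\<in>UNIV. csm (M z $ a $ b) (munit a b))"
  by (intro smooth_sum[OF S] smooth_bilinear[OF S bb_csm] M smooth_const)
 then show ?thesis unfolding mat_expand[symmetric] .
qed

lemma linear_Basis:
 assumes "linear L" shows "L u = (\<Sum>e\<in>Basis. (u \<bullet> e) *\<^sub>R L e)"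
proof -
 have "L (\<Sum>e\<in>Basis. (u \<bullet> e) *\<^sub>R e) = (\<Sum>e\<in>Basis. L ((u \<bullet> e) *\<^sub>R e))" by (rule linear_sum[OF assms])
 then show ?thesis by (simp add: linear_scale[OF assms] euclidean_representation)
qed

section \<open>Forms with values in endomorphisms of the bundle\<close>

locale hbdl =
 fixes E :: "('i, 'x::t2_space, 'n::finite, 'r::finite) herm_bundle"
 assumes hb: "hermitian_holomorphic_bundle E"
begin

sublocale cmfd E
 by unfold_locales (use hb in \<open>simp add: hermitian_holomorphic_bundle_def\<close>)

abbreviation "P i \<equiv> patch E i"
abbreviation "Tr i j y \<equiv> trn E i j (pt E i y)"

lemma open_P: "i \<in> idx E ==> open (P i)" by (rule chart(2))

lemma met_pos: "i \<in> idx E ==> y \<in> P i ==> pos_def_herm (met E i y)"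
 and met_smooth: "i \<in> idx E ==> smooth_fun_on (P i) (met E i)"
 using hb by (auto simp: hermitian_holomorphic_bundle_def hermitian_metric_def)

lemma Tr_inv:
 assumes "i \<in> idx E" "j \<in> idx E" "y \<in> overlap E i j"
 shows "invertible (Tr i j y)" "matrix_inv (Tr i j y) ** Tr i j y = mat 1" "Tr i j y ** matrix_inv (Tr i j y) = mat 1"
proof -
 have x: "pt E i y \<in> cdom E i \<inter> cdom E j \<inter> cdom E i" using assms pt_in by (auto simp: overlap_eq)
 have "trn E i j x ** trn E j k x = trn E i k x"
  if "i \<in> idx E" "j \<in> idx E" "k \<in> idx E" "x \<in> cdom E i \<inter> cdom E j \<inter> cdom E k" for i j k x
  using hb that unfolding hermitian_holomorphic_bundle_def holomorphic_cocycle_def by blast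
 then have "Tr i j y ** trn E j i (pt E i y) = trn E i i (pt E i y)" using assms x by blast
 moreover have "trn E i i (pt E i y) = mat 1"
  using hb assms x unfolding hermitian_holomorphic_bundle_def holomorphic_cocycle_def by blast
 ultimately show i: "invertible (Tr i j y)" using invertibleI_right by metis
 show "matrix_inv (Tr i j y) ** Tr i j y = mat 1" "Tr i j y ** matrix_inv (Tr i j y) = mat 1"
  using matrix_inv_works[OF i] by auto
qed

lemma Tr_smooth:
 assumes "i \<in> idx E" "j \<in> idx E" shows "smooth_fun_on (overlap E i j) (%y. Tr i j y)"
 by (rule smooth_cmatI[OF open_overlap[OF assms]])
   (use hb assms in \<open>auto simp: hermitian_holomorphic_bundle_def holomorphic_cocycle_def chol_on_def\<close>)

text \<open>One notion for scalar and for endomorphism-valued global forms, of arbitrary degree: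
  \<open>\<tau>\<close> is the action of the transition functions on the values, trivial in
  \<open>sform\<close> and a conjugation in \<open>eform\<close>.\<close>

definition bform :: "('i => 'i => complex^'n => 'a => 'a) => ('i, 'n, 'a::real_normed_vector) lform => bool" where
 "bform \<tau> f \<longleftrightarrow> (\<forall>i\<in>idx E. (\<forall>us. smooth_fun_on (P i) (%y. f i y us)) & (\<forall>y\<in>P i. AltF (f i y))) &
   (\<forall>i\<in>idx E. \<forall>j\<in>idx E. \<forall>y\<in>overlap E i j. \<forall>us. f i y us = \<tau> i j y (pull E f i j y us))"

abbreviation sform :: "('i, 'n, complex) lform => bool" where "sform \<equiv> bform (%i j y u. u)"

abbreviation eform :: "('i, 'n, 'r cmat) lform => bool" where
 "eform \<equiv> bform (%i j y M. Tr i j y ** M ** matrix_inv (Tr i j y))"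

lemma bformD:
 assumes "bform \<tau> f"
 shows "i \<in> idx E ==> smooth_fun_on (P i) (%y. f i y us)" "i \<in> idx E ==> y \<in> P i ==> AltF (f i y)"
  "i \<in> idx E ==> j \<in> idx E ==> y \<in> overlap E i j ==> f i y us = \<tau> i j y (pull E f i j y us)"
 using assms unfolding bform_def by blast+

lemma bformI:
 assumes "!!i us. i \<in> idx E ==> smooth_fun_on (P i) (%y. f i y us)" "!!i y. i \<in> idx E ==> y \<in> P i ==> AltF (f i y)"
  "!!i j y us. i \<in> idx E ==> j \<in> idx E ==> y \<in> overlap E i j ==> f i y us = \<tau> i j y (pull E f i j y us)"
 shows "bform \<tau> f"
 using assms unfolding bform_def by blast

lemma bform_dif: "bform \<tau> f ==> i \<in> idx E ==> y \<in> P i ==> dif (f i) y"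
 using smooth_diff_at[OF bformD(1)] by blast

lemma end_form_iff: "end_form E k B \<longleftrightarrow> eform B & (\<forall>i\<in>idx E. \<forall>y\<in>P i. homog k (B i y))"
 unfolding end_form_def bform_def altform_iff by blast

lemma sform_gtop: "sform f ==> gtop f"
 by (rule gtopI) (auto intro: smooth_continuous bformD)

lemma bform_cong:
 assumes "bform \<tau> f" "!!i y us. i \<in> idx E ==> y \<in> P i ==> g i y us = f i y us" shows "bform \<tau> g"
proof (rule bformI)
 show "smooth_fun_on (P i) (%y. g i y us)" if "i \<in> idx E" for i us
  by (rule smooth_cong[OF open_P[OF that] bformD(1)[OF assms(1) that]]) (use assms(2) that in auto)
 show "AltF (g i y)" if "i \<in> idx E" "y \<in> P i" for i y
 proof -
  have "g i y = f i y" using assms(2) that by auto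
  then show ?thesis using bformD(2)[OF assms(1) that] by simp
 qed
 show "g i y us = \<tau> i j y (pull E g i j y us)" if "i \<in> idx E" "j \<in> idx E" "y \<in> overlap E i j" for i j y us
  using bformD(3)[OF assms(1) that] assms(2) that overlap_patch[OF that(3)] overlap_patch[OF chg_props(1)[OF that]]
  by (simp add: pull_def)
qed

lemma bform_linear:
 assumes T: "bounded_linear T" and f: "bform \<tau> f"
  and c: "!!i j y u. i \<in> idx E ==> j \<in> idx E ==> y \<in> overlap E i j ==> T (\<tau> i j y u) = \<tau>' i j y (T u)"
 shows "bform \<tau>' (%i y us. T (f i y us))"
proof (rule bformI)
 show "i \<in> idx E ==> smooth_fun_on (P i) (%y. T (f i y us))" for i us
  by (rule smooth_linear[OF open_P T bformD(1)[OF f]])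
 show "i \<in> idx E ==> y \<in> P i ==> AltF (%us. T (f i y us))" for i y
  by (rule AltF_linear[OF bformD(2)[OF f] bounded_linear.linear[OF T]])
 show "T (f i y us) = \<tau>' i j y (pull E (%i y us. T (f i y us)) i j y us)" if "i \<in> idx E" "j \<in> idx E" "y \<in> overlap E i j" for i j y us
  using bformD(3)[OF f that] c[OF that] by (simp add: pull_def)
qed

lemma bform_add:
 assumes "bform \<tau> f" "bform \<tau> g" "!!i j y u v. \<tau> i j y (u + v) = \<tau> i j y u + \<tau> i j y v"
 shows "bform \<tau> (%i y us. f i y us + g i y us)"
proof (rule bformI)
 show "i \<in> idx E ==> smooth_fun_on (P i) (%y. f i y us + g i y us)" for i us
  by (rule smooth_add[OF open_P bformD(1)[OF assms(1)] bformD(1)[OF assms(2)]])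
 show "i \<in> idx E ==> y \<in> P i ==> AltF (%us. f i y us + g i y us)" for i y
  by (rule AltF_add[OF bformD(2)[OF assms(1)] bformD(2)[OF assms(2)]])
 show "f i y us + g i y us = \<tau> i j y (pull E (%i y us. f i y us + g i y us) i j y us)"
  if "i \<in> idx E" "j \<in> idx E" "y \<in> overlap E i j" for i j y us
  using bformD(3)[OF assms(1) that] bformD(3)[OF assms(2) that] by (simp add: pull_def assms(3))
qed

lemma bform_zero: "(!!i j y. \<tau> i j y 0 = 0) ==> bform \<tau> (%i y us. 0)"
 by (rule bformI) (simp_all add: smooth_const AltF_zero pull_def)

lemma pull_wedge: "pull E (%i y. wedge bm (f i y) (g i y)) i j y = wedge bm (pull E f i j y) (pull E g i j y)"
 unfolding pull_def wedge_pullback[symmetric] by (rule refl)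

lemma wedge_map:
 assumes "linear R" "!!x y. b1 (p x) (q y) = R (b2 x y)"
 shows "wedge b1 (%us. p (f us)) (%us. q (g us)) vs = R (wedge b2 f g vs)"
 unfolding wedge_linear_out[OF assms(1)] by (simp add: wedge_def assms(2))

lemma bform_wedge:
 assumes bb: "bounded_bilinear bm" and f: "bform \<tau>\<^sub>1 f" and g: "bform \<tau>\<^sub>2 g" and l: "!!i j y. linear (\<tau> i j y)"
  and m: "!!i j y u v. i \<in> idx E ==> j \<in> idx E ==> y \<in> overlap E i j ==> bm (\<tau>\<^sub>1 i j y u) (\<tau>\<^sub>2 i j y v) = \<tau> i j y (bm u v)"
 shows "bform \<tau> (%i y. wedge bm (f i y) (g i y))"
proof (rule bformI)
 show "i \<in> idx E ==> smooth_fun_on (P i) (%y. wedge bm (f i y) (g i y) us)" for i us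
  by (intro smooth_wedge open_P bb bformD(1)[OF f] bformD(1)[OF g])
 show "i \<in> idx E ==> y \<in> P i ==> AltF (wedge bm (f i y) (g i y))" for i y
  by (intro AltF_wedge bb bformD(2)[OF f] bformD(2)[OF g])
 fix i j y us assume ij: "i \<in> idx E" "j \<in> idx E" "y \<in> overlap E i j"
 have b: "f i y = (%us. \<tau>\<^sub>1 i j y (pull E f i j y us))" "g i y = (%us. \<tau>\<^sub>2 i j y (pull E g i j y us))"
  using bformD(3)[OF f ij] bformD(3)[OF g ij] by auto
 show "wedge bm (f i y) (g i y) us = \<tau> i j y (pull E (%i y. wedge bm (f i y) (g i y)) i j y us)"
  unfolding pull_wedge by (subst b)+ (rule wedge_map[where R="\<tau> i j y" and ?b1.0=bm and ?b2.0=bm and p="\<tau>\<^sub>1 i j y" and q="\<tau>\<^sub>2 i j y", OF l m[OF ij]])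
qed

lemma linear_conj: fixes T U :: "'r cmat" shows "linear (%M :: 'r cmat. T ** M ** U)"
 by (rule linearI) (simp_all add: mm_add mm_scaleR)

lemma sform_wedge: "sform f ==> sform g ==> sform (%i y. wedge_cc (f i y) (g i y))"
 by (rule bform_wedge[OF bb_cc]) (auto simp: linear_iff)

lemma eform_wedge: "eform B ==> eform C ==> eform (%i y. wedge_mm (B i y) (C i y))"
proof (erule (1) bform_wedge[OF bb_mm _ _ linear_conj])
 fix i j y and u v :: "'r cmat" assume ij: "i \<in> idx E" "j \<in> idx E" "y \<in> overlap E i j"
 show "(Tr i j y ** u ** matrix_inv (Tr i j y)) ** (Tr i j y ** v ** matrix_inv (Tr i j y))
  = Tr i j y ** (u ** v) ** matrix_inv (Tr i j y)"
  by (simp add: matrix_mul_assoc mm_cancel(2)[OF Tr_inv(2)[OF ij]])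
qed

lemma sform_trace: "eform B ==> sform (%i y us. trace (B i y us))"
 by (erule bform_linear[OF bl_trace], subst trace_mul_sym) (simp add: matrix_mul_assoc Tr_inv(2))

lemmas sform_add = bform_add[where \<tau>="%i j y u. u", OF _ _ refl]
 and sform_zero = bform_zero[where \<tau>="%i j y u. u", OF refl]
 and sform_scaleR = bform_linear[where \<tau>="%i j y u. u" and \<tau>'="%i j y u. u", OF bounded_linear_scaleR_right _ refl]
 and sform_cmult = bform_linear[where \<tau>="%i j y u. u" and \<tau>'="%i j y u. u", OF bounded_linear_mult_right _ refl]

lemma sform_sum: "finite K ==> (!!k. k \<in> K ==> sform (f k)) ==> sform (%i y us. \<Sum>k\<in>K. f k i y us)"
 by (induction K rule: finite_induct) (auto simp: sform_zero intro: sform_add)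

lemma eform_add: "eform f ==> eform g ==> eform (%i y us. f i y us + g i y us)"
 by (rule bform_add) (auto simp: mm_add)

lemma eform_csm: "eform f ==> eform (%i y us. csm r (f i y us))"
 by (erule bform_linear[OF bl_csm]) (simp add: csm_mm)

lemma eform_minus: "eform f ==> eform (%i y us. - f i y us)"
 using eform_csm[of f "of_real (-1)"] by (simp add: scaleR_csm[symmetric])

lemma eform_zero: "eform (%i y us. 0)"
 by (rule bform_zero) simp

lemma eform_one: "eform (%i y. form0 (mat 1))"
proof (rule bformI)
 show "AltF (form0 (mat 1))" by (rule AltF_form0)
qed (simp_all add: smooth_const pull_def form0_def Tr_inv)

lemma eform_mprod: "(!!B. B \<in> set Bs ==> eform B) ==> eform (%i y. mprod (map (%B. B i y) Bs))"
 by (induction Bs) (auto simp: eform_one intro: eform_wedge)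

subsection \<open>Connections and curvature\<close>

lemma connD:
 assumes "connection E A" "i \<in> idx E"
 shows "smooth_fun_on (P i) (%y. A i y us)" "y \<in> P i ==> AltF (A i y)" "y \<in> P i ==> homog 1 (A i y)"
  "y \<in> P i ==> dif (A i) y"
proof -
 show s: "smooth_fun_on (P i) (%y. A i y us)" for us using assms by (auto simp: connection_def)
 show "y \<in> P i ==> AltF (A i y)" "y \<in> P i ==> homog 1 (A i y)"
  using assms unfolding connection_def altform_iff by blast+
 show "y \<in> P i ==> dif (A i) y" using smooth_diff_at[OF s] by blast
qed

lemma conn_trans:
 assumes "connection E A" "i \<in> idx E" "j \<in> idx E" "y \<in> overlap E i j"
 shows "A i y [w] = Tr i j y ** pull E A i j y [w] ** matrix_inv (Tr i j y)
   - fd (%z. Tr i j z) y w ** matrix_inv (Tr i j y)"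
 using assms unfolding connection_def by (simp add: ext_d_form0)

text \<open>The vector to which the pulled-back form is applied moves with the point, so its
  derivative contains a second derivative of the coordinate change. That term is symmetric in
  \<open>v\<close> and \<open>w\<close> and leaves the exterior derivative.\<close>

lemma pull_dif1:
 assumes "connection E A" "i \<in> idx E" "j \<in> idx E" "y \<in> overlap E i j"
 shows "dfb (%z. pull E A i j z [w]) y"
  "fd (%z. pull E A i j z [w]) y v =
    fd (%z. A j z [dchg i j y w]) (chg E i j y) (dchg i j y v)
    + A j (chg E i j y) [fd (%z. dchg i j z w) y v]"
proof -
 let ?\<phi> = "chg E i j"
 note ij = assms(2-4)
 have lin: "linear (%v. A j x [v])" if "x \<in> P j" for x
  using AltFD(1)[OF connD(2)[OF assms(1,3) that], of "[]" "[]"] by simp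
 have bexp: "A j (?\<phi> z) [dchg i j z w] = (\<Sum>e\<in>Basis. (dchg i j z w \<bullet> e) *\<^sub>R A j (?\<phi> z) [e])" if "z \<in> overlap E i j" for z
  by (rule linear_Basis[OF lin[OF chg_props(4)[OF ij(1,2) that]]])
 have ev: "eventually (%z. pull E A i j z [w] = (\<Sum>e\<in>Basis. (dchg i j z w \<bullet> e) *\<^sub>R A j (?\<phi> z) [e])) (nhds y)"
  by (rule eventually_mono[OF eventually_nhds_in_open[OF open_overlap[OF ij(1,2)] ij(3)]])
    (simp add: pull_def bexp)
 have dA: "dfb (%z. A j z [e]) (?\<phi> y)" for e
  using connD(4)[OF assms(1,3) chg_props(4)[OF ij]] by blast
 note d\<phi> = chg_differentiable[OF ij]
 note cA = fd_compose[OF d\<phi> dA]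
 have dd: "dfb (%z. dchg i j z w) y"
  by (rule smooth_diff_at[OF smooth_deriv[OF chg_smooth[OF ij(1,2)]] ij(3)])
 have di: "dfb (%z. dchg i j z w \<bullet> e) y" for e
  by (rule diff_linear[OF bounded_linear_inner_left dd])
 have tmd: "dfb (%z. (dchg i j z w \<bullet> e) *\<^sub>R A j (?\<phi> z) [e]) y" for e
  by (rule diff_bilinear[OF bounded_bilinear_scaleR di cA(2)])
 show "dfb (%z. pull E A i j z [w]) y"
  unfolding diff_cong_nhds[OF ev] by (intro differentiable_sum ballI tmd) auto
 have la: "linear (frechet_derivative (%z. A j z [e]) (at (?\<phi> y)))" for e
  by (rule linear_frechet_derivative[OF dA])
 have "fd (%z. pull E A i j z [w]) y v =
   (\<Sum>e\<in>Basis. (fd (%z. dchg i j z w) y v \<bullet> e) *\<^sub>R A j (?\<phi> y) [e]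
    + (dchg i j y w \<bullet> e) *\<^sub>R fd (%z. A j z [e]) (?\<phi> y) (dchg i j y v))"
  unfolding fd_cong_nhds[OF ev]
  by (simp add: fd_sum tmd fd_bilinear[OF bounded_bilinear_scaleR di cA(2)] cA(1)
    fd_linear[OF dd bounded_linear_inner_left])
 also have "... = (\<Sum>e\<in>Basis. (fd (%z. dchg i j z w) y v \<bullet> e) *\<^sub>R A j (?\<phi> y) [e])
   + (\<Sum>e\<in>Basis. (dchg i j y w \<bullet> e) *\<^sub>R fd (%z. A j z [e]) (?\<phi> y) (dchg i j y v))"
  by (rule sum.distrib)
 also have "(\<Sum>e\<in>Basis. (u \<bullet> e) *\<^sub>R A j (?\<phi> y) [e]) = A j (?\<phi> y) [u]" for u
  by (rule linear_Basis[OF lin[OF chg_props(4)[OF ij]], symmetric])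
 also have "(\<Sum>e\<in>Basis. (dchg i j y w \<bullet> e) *\<^sub>R fd (%z. A j z [e]) (?\<phi> y) (dchg i j y v))
   = fd (%z. A j z [dchg i j y w]) (?\<phi> y) (dchg i j y v)"
 proof -
  let ?u = "dchg i j y w"
  have "frechet_derivative (%z. A j z [?u]) (at (?\<phi> y)) = frechet_derivative (%z. \<Sum>e\<in>Basis. (?u \<bullet> e) *\<^sub>R A j z [e]) (at (?\<phi> y))"
  proof (rule fd_cong_nhds, rule eventually_mono[OF eventually_nhds_in_open[OF open_P[OF ij(2)] chg_props(4)[OF ij]]])
   fix z assume z: "z \<in> P j"
   show "A j z [?u] = (\<Sum>e\<in>Basis. (?u \<bullet> e) *\<^sub>R A j z [e])" by (rule linear_Basis[OF lin[OF z]])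
  qed
  then show ?thesis
   by (simp add: fd_sum diff_linear[OF bounded_linear_scaleR_right] dA fd_scaleR)
 qed
 finally show "fd (%z. pull E A i j z [w]) y v =
    fd (%z. A j z [dchg i j y w]) (chg E i j y) (dchg i j y v)
    + A j (chg E i j y) [fd (%z. dchg i j z w) y v]" by simp
qed

lemma dchg_symmetric:
 assumes "i \<in> idx E" "j \<in> idx E" "y \<in> overlap E i j"
 shows "fd (%z. dchg i j z w) y v = fd (%z. dchg i j z v) y w"
 by (rule symmetric_second_derivative[OF open_overlap[OF assms(1,2)] assms(3)])
  (use chg_smooth[OF assms(1,2)] in \<open>simp add: smooth_fun_on_def\<close>)

lemma curv_homog: "connection E A ==> i \<in> idx E ==> y \<in> P i ==> homog 2 (curv A i y)"
proof -
 assume a: "connection E A" "i \<in> idx E" "y \<in> P i"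
 have "homog (Suc 1) (ext_d (A i) y)"
  by (rule homog_ext_d, rule eventually_mono[OF eventually_nhds_in_open[OF open_P[OF a(2)] a(3)]]) (rule connD(3)[OF a(1,2)])
 moreover have "homog (1 + 1) (wedge_mm (A i y) (A i y))" by (intro homog_wedge bb_mm connD(3)[OF a])
 ultimately show "homog 2 (curv A i y)" by (simp add: homog_def curv_def)
qed

text \<open>On an overlap the connection is the gauge transform, by the transition matrix, of the
  pulled-back connection; \<open>gauge_curvature\<close> then leaves a pure conjugation.\<close>

theorem eform_curv: assumes A: "connection E A" shows "eform (curv A)"
 unfolding bform_def
proof (intro conjI ballI allI)
 fix i us assume i: "i \<in> idx E"
 show "smooth_fun_on (P i) (%y. curv A i y us)"
  unfolding curv_def
  by (intro smooth_add smooth_ext_d smooth_wedge bb_mm open_P i connD(1)[OF A])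
next
 fix i y assume iy: "i \<in> idx E" "y \<in> P i"
 have "AltF (ext_d (A i) y)"
  by (rule AltF_ext_d[OF _ eventually_mono[OF eventually_nhds_in_open[OF open_P[OF iy(1)] iy(2)]]])
    (use connD[OF A iy(1)] iy in auto)
 moreover have "AltF (wedge_mm (A i y) (A i y))" by (intro AltF_wedge bb_mm connD(2)[OF A iy])
 ultimately show "AltF (curv A i y)" unfolding curv_def by (rule AltF_add)
next
 fix i j y us assume ij: "i \<in> idx E" "j \<in> idx E" "y \<in> overlap E i j"
 let ?T = "Tr i j y"
 have yj: "chg E i j y \<in> P j" by (rule chg_props(4)[OF ij])
 show "curv A i y us = ?T ** pull E (curv A) i j y us ** matrix_inv ?T"
 proof (cases "length us = 2")
  case False
  then show ?thesis
   using curv_homog[OF A ij(1) overlap_patch[OF ij(3)]] curv_homog[OF A ij(2) yj] by (simp add: homog_def pull_def)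
 next
  case True
  then obtain v w where us: "us = [v, w]" by (metis One_nat_def Suc_1 length_0_conv length_Suc_conv)
  have h: "homog 1 (pull E A i j y)" using connD(3)[OF A ij(2) yj] by (simp add: homog_def pull_def)
  have "curv A i y [v, w] = ?T ** (ext_d (pull E A i j) y [v, w] + wedge_mm (pull E A i j y) (pull E A i j y) [v, w]) ** matrix_inv ?T"
   unfolding curv_def
   by (rule gauge_curvature[OF open_overlap[OF ij(1,2)] ij(3) Tr_smooth[OF ij(1,2)] Tr_inv(1)[OF ij(1,2)] pull_dif1(1)[OF A ij]
      conn_trans[OF A ij(1,2)] connD(3)[OF A ij(1) overlap_patch[OF ij(3)]] h])
  moreover have "ext_d (pull E A i j) y [v, w] = ext_d (A j) (chg E i j y) [dchg i j y v, dchg i j y w]"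
   unfolding ext_d_two pull_dif1(2)[OF A ij] by (simp add: dchg_symmetric[OF ij, of v w])
  moreover have "wedge_mm (pull E A i j y) (pull E A i j y) [v, w] = wedge_mm (A j (chg E i j y)) (A j (chg E i j y)) [dchg i j y v, dchg i j y w]"
   unfolding pull_def[abs_def] wedge_pullback by simp
  ultimately show ?thesis unfolding us by (simp add: pull_def curv_def)
 qed
qed

end

section \<open>Expansion of the critical operator and its derivative into words in the
  curvature\<close>

lemma sum_list_triples:
 fixes h :: "'a => 'b::comm_monoid_add"
 shows "(\<Sum>x\<leftarrow>[T d j l. d \<leftarrow> [0..<Suc n], j \<leftarrow> [a..<Suc n], l \<leftarrow> [0..<Suc n], d + j + l = n]. h x)
  = (\<Sum>(d, j, l)\<in>{(d, j, l). d + j + l = n & a <= j}. h (T d j l))"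
proof -
 have c: "sum_list (map h (concat xss)) = (\<Sum>xs\<leftarrow>xss. sum_list (map h xs))" for xss
  by (induction xss) auto
 have "(\<Sum>x\<leftarrow>[T d j l. d \<leftarrow> [0..<Suc n], j \<leftarrow> [a..<Suc n], l \<leftarrow> [0..<Suc n], d + j + l = n]. h x)
  = (\<Sum>d\<in>{0..<Suc n}. \<Sum>j\<in>{a..<Suc n}. \<Sum>l\<in>{0..<Suc n}. if d + j + l = n then h (T d j l) else 0)"
  by (simp add: c o_def interv_sum_list_conv_sum_set_nat if_distrib[of "%xs. sum_list (map h xs)"]
    del: upt_Suc sum.op_ivl_Suc cong: if_cong)
 also have "... = (\<Sum>(d, j, l)\<in>{0..<Suc n} \<times> {a..<Suc n} \<times> {0..<Suc n}. if d + j + l = n then h (T d j l) else 0)"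
  unfolding sum.cartesian_product by (simp only: case_prod_beta)
 also have "... = (\<Sum>(d, j, l)\<in>{(d, j, l). d + j + l = n & a <= j}. h (T d j l))"
  by (rule sum.mono_neutral_cong_right) (auto split: if_splits)
 finally show ?thesis .
qed

text \<open>Curvature factors have degree 2, so the reversal of a word in the formal adjoint costs
  no sign.\<close>

lemma grsgn_even: "even (grsgn (replicate m 2) \<sigma>)" if "!!q. q < m ==> \<sigma> q < m"
 unfolding grsgn_def by (rule dvd_sum) (use that in auto)

lemma adj_wedge:
 fixes H :: "'r::finite cmat" and f g :: "('n::finite, 'r cmat) alt"
 assumes H: "pos_def_herm H" and h: "homog p f" "homog q g"
 shows "hadj H (wedge_mm f g us) = (-1) ^ (p * q) *\<^sub>R wedge_mm (adj_form H g) (adj_form H f) us"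
proof -
 have l: "linear (hadj H)" using bl_hadj bounded_linear.linear by blast
 have bb: "bounded_bilinear (%(x :: 'r cmat) (y :: 'r cmat). y ** x)"
  unfolding bilinear_conv_bounded_bilinear[symmetric] bilinear_def
  by (auto intro!: linearI simp: mm_add mm_scaleR)
 have "hadj H (wedge_mm f g us) = wedge (%x y. y ** x) (adj_form H f) (adj_form H g) us"
  unfolding wedge_linear_out[OF l] by (simp add: wedge_def hadj_mm[OF H] adj_form_def)
 also have "... = (-1) ^ (p * q) *\<^sub>R wedge_mm (adj_form H g) (adj_form H f) us"
  by (rule wedge_commute[OF bb bb_mm]) (use h in \<open>auto simp: homog_def adj_form_def\<close>)
 finally show ?thesis .
qed

lemma adj_power:
 assumes H: "pos_def_herm H" and F: "homog 2 F" "adj_form H F = F"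
 shows "adj_form H (mprod (replicate s F)) = mprod (replicate s F)"
proof (induction s)
 case 0
 then show ?case by (auto simp: adj_form_def form0_def hadj_mat1[OF H])
next
 case (Suc s)
 have "adj_form H (mprod (replicate (Suc s) F)) us = wedge_mm (mprod (replicate s F)) F us" for us
  using adj_wedge[OF H F(1) homog_replicate[OF F(1)], of s us] by (simp add: adj_form_def[of H "wedge_mm _ _"] Suc F(2))
 moreover have "wedge_mm (mprod (replicate s F)) F = mprod (replicate s F @ [F])" by (simp add: mprod_append)
 ultimately show ?case by (simp add: replicate_append_same fun_eq_iff)
qed

lemma hadj_wedge_cm: "hadj H (wedge_cm c f us) = wedge_cm (%us. cnj (c us)) (adj_form H f) us"
proof -
 have l: "linear (hadj H)" using bl_hadj bounded_linear.linear by blast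
 show ?thesis unfolding wedge_linear_out[OF l] by (simp add: wedge_def hadj_csm adj_form_def)
qed

lemma wedge_cc_scale: "wedge_cc (%us. z * c us) f us = z * wedge_cc c f us"
 by (simp add: wedge_def sum_distrib_left mult.left_commute mult.assoc scaleR_conv_of_real)

lemma wedge_cc_scale_right: "wedge_cc c (%us. z * f us) us = z * wedge_cc c f us"
 by (simp add: wedge_def sum_distrib_left mult.left_commute scaleR_conv_of_real)

lemma wedge_cm_scale: "wedge_cm (%us. z * c us) f us = csm z (wedge_cm c f us)"
 by (simp add: wedge_def csm_sum scaleR_csm mult.left_commute mult.assoc)

lemma im_quot: "(w - cnj w) / (2 * \<i>) = complex_of_real (Im w)"
 by (rule complex_eqI) (simp_all add: Re_divide Im_divide power2_eq_square)

definition imh :: "'r::finite cmat => 'r cmat => 'r cmat" where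
 "imh H M = csm (1 / (2 * \<i>)) (M - hadj H M)"

lemma im_form_imh: "im_form H f vs = imh H (f vs)" by (simp add: im_form_def imh_def adj_form_def)

lemma bounded_linear_imh: "bounded_linear (imh H)"
 unfolding imh_def[abs_def]
 by (intro bounded_linear_compose[OF bl_csm] bounded_linear_sub bounded_linear_ident bl_hadj)

lemma imh_herm:
 assumes "hadj H Y = Y"
 shows "imh H (csm z (csm (r / fact j) Y)) = (Im (z * r) / fact j) *\<^sub>R Y"
proof -
 let ?z = "z * (r / fact j)"
 have "imh H (csm z (csm (r / fact j) Y)) = csm (1 / (2 * \<i>)) (csm ?z Y - csm (cnj ?z) Y)"
  by (simp add: imh_def hadj_csm assms)
 also have "... = csm ((?z - cnj ?z) / (2 * \<i>)) Y"
  by (simp add: csm_diff(2)[symmetric] diff_divide_distrib)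
 also have "(?z - cnj ?z) / (2 * \<i>) = complex_of_real (Im ?z)" by (rule im_quot)
 also have "Im ?z = Im (z * r) / fact j"
 proof -
  have "?z = complex_of_real (1 / fact j) * (z * r)" by simp
  then show ?thesis by (simp only: Im_complex_of_real Re_complex_of_real mult_zero_left add_0_right times_complex.sel) simp
 qed
 finally show ?thesis by (simp add: scaleR_csm)
qed

locale zbdl = hbdl E for E :: "('i, 'x::t2_space, 'n::finite, 'r::finite) herm_bundle" +
 fixes Z :: "('i, 'n) pcharge"
 assumes pc: "polynomial_charge E Z"
begin

lemma kfm_props: "real_form E (kfm Z)" "closed_form E (kfm Z)" "i \<in> idx E ==> y \<in> P i ==> altform 2 (kfm Z i y)"
 and ufm_props: "real_form E (ufm Z)" "closed_form E (ufm Z)"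
 using pc unfolding polynomial_charge_def kaehler_form_def by blast+

lemma sform_real:
 assumes "real_form E f" shows "sform (%i y us. complex_of_real (comp_deg k (f i y) us))"
proof (rule bform_linear[where \<tau>="%i j y u. u" and \<tau>'="%i j y u. u", OF bounded_linear_of_real _ refl], rule bformI)
 show "smooth_fun_on (P i) (%y. comp_deg k (f i y) us)" if "i \<in> idx E" for i us
  using assms that by (cases "length us = k") (simp_all add: real_form_def comp_deg_def smooth_const)
 show "AltF (comp_deg k (f i y))" if "i \<in> idx E" "y \<in> P i" for i y
  using assms that altform_iff unfolding real_form_def by blast
 show "comp_deg k (f i y) us = pull E (%i y. comp_deg k (f i y)) i j y us" if "i \<in> idx E" "j \<in> idx E" "y \<in> overlap E i j" for i j y us
  using assms that unfolding real_form_def by (simp add: pull_def comp_deg_def)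
qed

lemma sform_kfm: "sform (kfm_c Z)"
 by (rule bform_cong[OF sform_real[OF kfm_props(1), of 2]])
  (use kfm_props(3) in \<open>auto simp: kfm_c_def comp_deg_def altform_def\<close>)

lemma sform_ufm: "sform (%i y. comp_deg k (ufm_c Z i y))"
 by (rule bform_cong[OF sform_real[OF ufm_props(1), of k]]) (simp add: ufm_c_def comp_deg_def)

lemma sform_one: "sform (%i y. form0 1)"
proof (rule bformI)
 show "AltF (form0 1)" by (rule AltF_form0)
qed (simp_all add: smooth_const pull_def form0_def)

lemma sform_wpow: "sform (%i y. wpow (kfm_c Z i y) d)"
 by (induction d) (auto intro: sform_one sform_wedge sform_kfm)

text \<open>The scalar form \<omega>^d \<and> U_l of a term without its complex coefficient. Being
  real, closed and of even degree, it passes through adjoints and exterior derivatives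
  unchanged.\<close>

definition cw :: "nat => nat => ('i, 'n, complex) lform" where
 "cw d l i y = wedge_cc (wpow (kfm_c Z i y) d) (comp_deg (2 * l) (ufm_c Z i y))"

lemma sform_cw: "sform (cw d l)"
 unfolding cw_def[abs_def] by (rule sform_wedge[OF sform_wpow sform_ufm])

lemma ext_d_of_real:
 assumes "!!us. dfb (%z. f z us) y"
 shows "ext_d (%z us. complex_of_real (f z us)) y vs = complex_of_real (ext_d f y vs)"
 by (rule ext_d_linear[OF assms bounded_linear_of_real])

lemma real_form_dif:
 assumes "real_form E f" "i \<in> idx E" "y \<in> P i" shows "dfb (%z. f i z us) y"
 using assms smooth_diff_at unfolding real_form_def by blast

lemma kfm_homog: "i \<in> idx E ==> y \<in> P i ==> homog 2 (kfm_c Z i y)"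
 using kfm_props(3)[of i y] by (simp add: altform_iff homog_def kfm_c_def)

lemma wpow_homog: "i \<in> idx E ==> y \<in> P i ==> homog (2 * d) (wpow (kfm_c Z i y) d)"
proof (induction d)
 case 0 then show ?case by (simp add: homog_form0)
next
 case (Suc d)
 then have "homog (2 + 2 * d) (wedge_cc (kfm_c Z i y) (wpow (kfm_c Z i y) d))"
  by (intro homog_wedge bb_cc kfm_homog) auto
 then show ?case by simp
qed

lemma cw_homog:
 assumes "i \<in> idx E" "y \<in> P i" shows "homog (2 * (d + l)) (cw d l i y)"
proof -
 have "homog (2 * l) (comp_deg (2 * l) (ufm_c Z i y))" by (simp add: homog_def comp_deg_def)
 then have "homog (2 * d + 2 * l) (cw d l i y)"
  unfolding cw_def by (intro homog_wedge bb_cc wpow_homog assms)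
 then show ?thesis by (simp add: algebra_simps)
qed

lemma cw_hat: "i \<in> idx E ==> y \<in> P i ==> hatf (cw d l i y) = cw d l i y"
 using homog_hatf[OF cw_homog, of i y d l] by (simp add: power_mult)

text \<open>Closedness holds degree by degree: on lists of length \<open>m + 1\<close> the component
  of degree \<open>m\<close> has the same exterior derivative as the whole form.\<close>

lemma cw_closed:
 assumes "i \<in> idx E" "y \<in> P i" shows "ext_d (cw d l i) y = (%us. 0)"
proof
 fix vs
 have k: "ext_d (kfm_c Z i) y us = 0" for us
  unfolding kfm_c_def[abs_def] using ext_d_of_real[of "kfm Z i" y us] real_form_dif[OF kfm_props(1) assms] kfm_props(2) assms
  by (simp add: closed_form_def)
 have u0: "ext_d (ufm_c Z i) y us = 0" for us
  unfolding ufm_c_def[abs_def] using ext_d_of_real[of "ufm Z i" y us] real_form_dif[OF ufm_props(1) assms] ufm_props(2) assms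
  by (simp add: closed_form_def)
 have u: "ext_d (%z. comp_deg m (ufm_c Z i z)) y us = 0" for m us
 proof (cases "length us = Suc m")
  case True
  then have "ext_d (%z. comp_deg m (ufm_c Z i z)) y us = ext_d (ufm_c Z i) y us"
   unfolding ext_d_def by (intro sum.cong refl) (simp add: comp_deg_def)
  then show ?thesis using u0 by simp
 next
  case False
  then have "length (take k us @ drop (Suc k) us) ~= m" if "k < length us" for k using that by auto
  then show ?thesis unfolding ext_d_def
   by (intro sum.neutral) (auto simp: comp_deg_def frechet_derivative_const)
 qed
 have w: "ext_d (%z. wpow (kfm_c Z i z) d) y us = 0" for d us
 proof (induction d arbitrary: us)
  case 0 then show ?case by (simp add: ext_d_form0 frechet_derivative_const split: list.split)
 next
  case (Suc d)
  have "ext_d (%z. wedge_cc (kfm_c Z i z) (wpow (kfm_c Z i z) d)) y us =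
   wedge_cc (ext_d (kfm_c Z i) y) (wpow (kfm_c Z i y) d) us + wedge_cc (hatf (kfm_c Z i y)) (ext_d (%z. wpow (kfm_c Z i z) d) y) us"
   by (rule ext_d_wedge[OF bb_cc]) (use bform_dif[OF sform_kfm assms] bform_dif[OF sform_wpow assms] in blast)+
  then show ?case using k Suc
   by (simp add: wedge_zero_left[OF bb_cc] wedge_zero_right[OF bb_cc] fun_eq_iff[symmetric] cong: wedge_cong)
 qed
 have "ext_d (cw d l i) y vs = wedge_cc (ext_d (%z. wpow (kfm_c Z i z) d) y) (comp_deg (2 * l) (ufm_c Z i y)) vs
   + wedge_cc (hatf (wpow (kfm_c Z i y) d)) (ext_d (%z. comp_deg (2 * l) (ufm_c Z i z)) y) vs"
  unfolding cw_def[abs_def]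
  by (rule ext_d_wedge[OF bb_cc]) (use bform_dif[OF sform_ufm assms] bform_dif[OF sform_wpow assms] in blast)+
 then show "ext_d (cw d l i) y vs = 0" using w u
  by (simp add: wedge_zero_left[OF bb_cc] wedge_zero_right[OF bb_cc] cong: wedge_cong)
qed

lemma cw_real: "cnj (cw d l i y us) = cw d l i y us"
proof -
 have w: "cnj (wedge_cc f g us) = wedge_cc f g us" if "!!us. cnj (f us) = f us" "!!us. cnj (g us) = g us" for f g :: "('n, complex) alt" and us
  by (simp add: wedge_def that)
 have "cnj (wpow (kfm_c Z i y) d us) = wpow (kfm_c Z i y) d us" for us
  by (induction d arbitrary: us) (auto simp: form0_def kfm_c_def intro!: w)
 then show ?thesis unfolding cw_def by (intro w) (auto simp: comp_deg_def ufm_c_def)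
qed

lemma ext_d_cw_wedge:
 assumes "i \<in> idx E" "y \<in> P i" "dif f y"
 shows "ext_d (%z. wedge_cc (cw d l i z) (f z)) y vs = wedge_cc (cw d l i y) (ext_d f y) vs"
proof -
 have "ext_d (%z. wedge_cc (cw d l i z) (f z)) y vs =
  wedge_cc (ext_d (cw d l i) y) (f y) vs + wedge_cc (hatf (cw d l i y)) (ext_d f y) vs"
  by (rule ext_d_wedge[OF bb_cc]) (use bform_dif[OF sform_cw assms(1,2)] assms(3) in blast)+
 then show ?thesis by (simp add: cw_closed[OF assms(1,2)] cw_hat[OF assms(1,2)] wedge_zero_left[OF bb_cc])
qed

text \<open>The common real coefficient. In the operator it is the imaginary part of the rotated
  \<open>rho Z d / fact j\<close>; in the derivative, 1/(j-1)! becomes 1/j! because the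
  symmetrisation averages over \<open>j\<close> cyclic words.\<close>

definition kap :: "nat => nat => real" where
 "kap d j = Im (phase_factor E Z * rho Z d) / fact j"

definition I0 :: "(nat \<times> nat \<times> nat) set" where "I0 = {(d, j, l). d + j + l = CARD('n) & 0 <= j}"
definition I1 :: "(nat \<times> nat \<times> nat) set" where "I1 = {(d, j, l). d + j + l = CARD('n) & 1 <= j}"

lemma finite_I [simp]: "finite I0" "finite I1" unfolding I0_def I1_def
 by (rule finite_subset[of _ "{..CARD('n)} \<times> {..CARD('n)} \<times> {..CARD('n)}"]; auto)+

subsection \<open>Unitary connections\<close>

lemma unitaryD:
 assumes "unitary_connection E A"
 shows "connection E A" "i \<in> idx E ==> y \<in> P i ==>
   fd (met E i) y v = met E i y ** A i y [v] + ctransp (A i y [v]) ** met E i y"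
 using assms unfolding unitary_connection_def by (auto simp: ext_d_form0)

lemma curv_skew:
 assumes A: "unitary_connection E A" and iy: "i \<in> idx E" "y \<in> P i"
 shows "adj_form (met E i y) (curv A i y) us = - curv A i y us"
proof (cases "length us = 2")
 case False
 then show ?thesis using curv_homog[OF unitaryD(1)[OF A] iy] by (simp add: homog_def adj_form_def)
next
 case True
 then obtain v w where us: "us = [v, w]" by (metis One_nat_def Suc_1 length_0_conv length_Suc_conv)
 note c = connD[OF unitaryD(1)[OF A] iy(1)]
 show ?thesis unfolding us adj_form_def curv_def
  by (rule hermitian_curvature[OF open_P[OF iy(1)] iy(2) met_smooth[OF iy(1)] met_pos[OF iy(1)] _ unitaryD(2)[OF A iy(1)] c(3)[OF iy(2)]])
    (assumption | rule c(4)[OF iy(2), rule_format])+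
qed

lemma curvN_herm:
 assumes "unitary_connection E A" "i \<in> idx E" "y \<in> P i"
 shows "adj_form (met E i y) (curvN A i y) = curvN A i y"
 using curv_skew[OF assms] by (auto simp: adj_form_def curvN_def hadj_csm)

lemma cd_cov: "cd (A i) k (B i) y = cov_d A k B i y"
 by (simp add: cd_def cov_d_def fun_eq_iff)

lemma cov_d_csm:
 assumes "i \<in> idx E" "y \<in> P i" "dif (B i) y" and C: "!!z us. z \<in> P i ==> C i z us = csm c (B i z us)"
 shows "cov_d A k C i y us = csm c (cov_d A k B i y us)"
proof -
 have "ext_d (C i) y us = ext_d (%z us. csm c (B i z us)) y us"
  unfolding ext_d_def
  by (intro sum.cong refl arg_cong2[where f=scaleR] fd_cong_open[OF open_P[OF assms(1)] assms(2)] C)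
 also have "... = csm c (ext_d (B i) y us)"
  by (rule ext_d_linear[OF _ bl_csm]) (use assms(3) in blast)
 finally have "ext_d (C i) y us = ..." .
 moreover have "C i y = (%us. csm c (B i y us))" using C[OF assms(2)] by auto
 ultimately show ?thesis
  by (simp add: cov_d_def wedge_mm_csm csm_add csm_diff scaleR_csm mult.commute)
qed

lemma curvN_props:
 assumes "connection E A"
 shows "eform (curvN A)" "i \<in> idx E ==> y \<in> P i ==> homog 2 (curvN A i y)"
  "i \<in> idx E ==> y \<in> P i ==> cd (A i) 2 (curvN A i) y = (%us. 0)"
proof -
 show "eform (curvN A)" unfolding curvN_def[abs_def] by (rule eform_csm[OF eform_curv[OF assms]])
 show "i \<in> idx E ==> y \<in> P i ==> homog 2 (curvN A i y)"
  using curv_homog[OF assms] by (simp add: homog_def curvN_def)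
 assume iy: "i \<in> idx E" "y \<in> P i"
 have b: "cd (A i) 2 (curv A i) y = (%us. 0)"
  unfolding curv_def[abs_def] by (rule bianchi[OF open_P[OF iy(1)] iy(2) connD(1)[OF assms iy(1)] connD(3)[OF assms iy(1)]])
 have "cd (A i) 2 (curvN A i) y us = csm (\<i> / (2 * pi)) (cd (A i) 2 (curv A i) y us)" for us
  unfolding cd_cov by (rule cov_d_csm[where B="curv A" and C="curvN A", OF iy bform_dif[OF eform_curv[OF assms] iy]]) (simp add: curvN_def)
 then show "cd (A i) 2 (curvN A i) y = (%us. 0)" using b by auto
qed

lemma fval_Ztilde: "fval (Ztilde_terms Z B i y) vs =
  (\<Sum>(d, j, l)\<in>I0. csm (rho Z d / fact j) (wedge_cm (cw d l i y) (mprod (replicate j (curvN B i y))) vs))"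
 unfolding fval_def Ztilde_terms_def
 by (subst sum_list_triples[where h="%(c, Bs). wedge_cm c (mprod (map snd Bs)) vs"])
   (simp only: I0_def wedge_cm_scale map_replicate snd_conv cw_def case_prod_beta fst_conv)


text \<open>For a unitary connection the normalised curvature is Hermitian, so its powers are
  self-adjoint and the imaginary part falls on the scalar coefficient.\<close>

lemma D_Z_expand:
 assumes A: "unitary_connection E A" and iy: "i \<in> idx E" "y \<in> P i"
 shows "D_Z E Z A i y vs = (\<Sum>(d, j, l)\<in>I0. kap d j *\<^sub>R wedge_cm (cw d l i y) (mprod (replicate j (curvN A i y))) vs)"
proof -
 let ?H = "met E i y"
 have herm: "hadj ?H (wedge_cm (cw d l i y) (mprod (replicate j (curvN A i y))) vs) = wedge_cm (cw d l i y) (mprod (replicate j (curvN A i y))) vs" for d j l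
  unfolding hadj_wedge_cm cw_real adj_power[OF met_pos[OF iy] curvN_props(2)[OF unitaryD(1)[OF A] iy] curvN_herm[OF A iy]] ..
 show ?thesis
  unfolding D_Z_def im_form_imh fval_Ztilde csm_sum linear_sum[OF bounded_linear.linear[OF bounded_linear_imh]] case_prod_beta imh_herm[OF herm] kap_def ..
qed

text \<open>The function \<open>e\<close> tells where the two marked one-forms are inserted: in
  front for the two-form, behind for the subsolution condition. Each term meets its formal adjoint,
  which carries the same curvature word and the conjugate coefficient, so the imaginary part of the
  coefficient remains.\<close>

lemma Im_Zprime_expand:
 fixes e :: "(nat \<times> ('n, 'r cmat) alt) list => (nat \<times> ('n, 'r cmat) alt) list"
 assumes A: "unitary_connection E A" and iy: "i \<in> idx E" "y \<in> P i"
  and g: "!!m vs. trace (gsym (e (replicate m (2, curvN A i y))) vs) = (1 / real (m + 1)) *\<^sub>R W2 m (curvN A i y) B1 B2 vs"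
 shows "trace (fsym (map (%(c, Bs). (c, e Bs)) (Im_Zprime E Z A i y)) vs)
  = (\<Sum>(d, j, l)\<in>I1. kap d j *\<^sub>R wedge_cc (cw d l i y) (W2 (j - 1) (curvN A i y) B1 B2) vs)"
proof -
 let ?F = "curvN A i y" and ?H = "met E i y"
 let ?ph = "phase_factor E Z"
 let ?G = "%m. %us. (1 / real (m + 1)) *\<^sub>R W2 m ?F B1 B2 us"
 let ?w = "%d j l. wedge_cc (cw d l i y) (W2 (j - 1) ?F B1 B2) vs"
 have gs: "(%us. trace (gsym (e (replicate m (2, ?F))) us)) = ?G m" for m using g by auto
 have F: "adj_form ?H ?F = ?F" by (rule curvN_herm[OF A iy])
 have rv: "rev (map (%(p, B). (p, adj_form ?H B)) (replicate m (2, ?F))) = replicate m (2, ?F)" for m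
  by (simp add: F)
 have sg: "(-1::complex) ^ grsgn (map fst (replicate m (2, ?F))) (%q. length (replicate m (2, ?F)) - 1 - q) = 1" for m
 proof -
  have "even (grsgn (replicate m 2) (%q. m - 1 - q))" by (rule grsgn_even) auto
  then show ?thesis by (simp add: map_replicate)
 qed
 have term1: "trace (wedge_cm c (gsym (e (replicate m (2, ?F)))) vs)
   = k * (1 / real (m + 1)) * wedge_cc (cw d l i y) (W2 m ?F B1 B2) vs" if "!!us. c us = k * cw d l i y us" for c k d l m
 proof -
  have c: "c = (%us. k * cw d l i y us)" using that by auto
  show ?thesis unfolding c trace_wedge_cm gs wedge_cc_scale wedge_scale_right[OF bb_cc]
   by (simp add: scaleR_conv_of_real mult.assoc)
 qed
 let ?t = "%d j l. (%vs. rho Z d / fact (j - 1) * wedge_cc (wpow (kfm_c Z i y) d) (comp_deg (2 * l) (ufm_c Z i y)) vs, replicate (j - 1) (2, ?F))"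
 let ?h1 = "%(c, Bs). trace (wedge_cm (%vs. 1 / (2 * \<i>) * (?ph * c vs)) (gsym (e Bs)) vs)"
 let ?h2 = "%(c, Bs). trace (wedge_cm (%vs. - 1 / (2 * \<i>) * ((-1) ^ grsgn (map fst Bs) (%q. length Bs - 1 - q) * cnj (?ph * c vs)))
   (gsym (e (rev (map (%(p, B). (p, adj_form ?H B)) Bs)))) vs)"
 have "trace (fsym (map (%(c, Bs). (c, e Bs)) (Im_Zprime E Z A i y)) vs)
   = (\<Sum>x\<leftarrow>Zprime_terms Z A i y. ?h1 x) + (\<Sum>x\<leftarrow>Zprime_terms Z A i y. ?h2 x)"
 proof -
  have trs: "trace (sum_list (map f xs)) = (\<Sum>x\<leftarrow>xs. trace (f x))" for f :: "('n, 'r) fterm => 'r cmat" and xs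
   by (induction xs) (auto simp: trace_add_c)
  show ?thesis
   unfolding Im_Zprime_def fim_def fscale_def fadj_def fsym_def
   by (simp only: map_append map_map o_def case_prod_beta sum_list_append trace_add_c trs fst_conv snd_conv)
 qed
 also have "... = (\<Sum>(d, j, l)\<in>I1. ?h1 (?t d j l)) + (\<Sum>(d, j, l)\<in>I1. ?h2 (?t d j l))"
  unfolding Zprime_terms_def I1_def by (simp only: sum_list_triples)
 also have "... = (\<Sum>(d, j, l)\<in>I1. kap d j *\<^sub>R ?w d j l)"
  unfolding sum.distrib[symmetric]
 proof (intro sum.cong refl)
  fix x assume "x \<in> I1"
  then obtain d j l where x: "x = (d, j, l)" and j: "j >= 1" by (auto simp: I1_def)
  then obtain m where m: "j = Suc m" by (cases j) auto
  let ?z = "?ph * rho Z d"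
  have h1: "?h1 (?t d j l) = (1 / (2 * \<i>) * (?z / fact m)) * (1 / real (m + 1)) * ?w d j l"
   unfolding m diff_Suc_1 prod.case by (rule term1) (simp add: cw_def mult.assoc)
  have cr: "cnj (wedge_cc (wpow (kfm_c Z i y) d) (comp_deg (2 * l) (ufm_c Z i y)) us) = cw d l i y us" for us
   using cw_real[of d l i y us] by (simp add: cw_def)
  have h2: "?h2 (?t d j l) = (- 1 / (2 * \<i>) * (cnj ?z / fact m)) * (1 / real (m + 1)) * ?w d j l"
   unfolding m diff_Suc_1 prod.case rv sg by (rule term1) (simp add: cr mult.assoc)
  have "(1 / (2 * \<i>) * (?z / fact m)) * (1 / real (m + 1)) + (- 1 / (2 * \<i>) * (cnj ?z / fact m)) * (1 / real (m + 1))
    = ((?z - cnj ?z) / (2 * \<i>)) / (fact m * of_nat (m + 1))"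
  proof -
   have "(1 / (2 * \<i>) * (x / p)) * (1 / q) + (- 1 / (2 * \<i>) * (w / p)) * (1 / q) = ((x - w) / (2 * \<i>)) / (p * q)" for x w p q :: complex
    by (simp add: diff_divide_distrib right_diff_distrib mult.assoc)
   from this[of ?z "fact m" "of_nat (m + 1)" "cnj ?z"] show ?thesis by simp
  qed
  also have "(?z - cnj ?z) / (2 * \<i>) = complex_of_real (Im ?z)"
   by (rule im_quot)
  also have "complex_of_real (Im ?z) / (fact m * of_nat (m + 1)) = complex_of_real (kap d j)"
   by (simp add: kap_def m mult.commute)
  finally have k: "(1 / (2 * \<i>) * (?z / fact m)) * (1 / real (m + 1)) + (- 1 / (2 * \<i>) * (cnj ?z / fact m)) * (1 / real (m + 1))
    = complex_of_real (kap d j)" .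
  have "?h1 (?t d j l) + ?h2 (?t d j l) = kap d j *\<^sub>R ?w d j l"
   unfolding h1 h2 scaleR_conv_of_real k[symmetric] by (rule distrib_right[symmetric])
  then show "(case x of (d, j, l) => ?h1 (?t d j l)) + (case x of (d, j, l) => ?h2 (?t d j l))
    = (case x of (d, j, l) => kap d j *\<^sub>R ?w d j l)" by (simp only: x prod.case)
 qed
 finally show ?thesis .
qed

lemma trace_fpre:
 assumes A: "unitary_connection E A" and iy: "i \<in> idx E" "y \<in> P i" and h: "homog 1 a" "homog 1 b"
 shows "trace (fsym (fpre [(1, a), (1, b)] (Im_Zprime E Z A i y)) vs)
  = (\<Sum>(d, j, l)\<in>I1. kap d j *\<^sub>R wedge_cc (cw d l i y) (W2 (j - 1) (curvN A i y) a b) vs)"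
 unfolding fpre_def
proof (rule Im_Zprime_expand[OF A iy])
 fix m vs
 note F = curvN_props(2)[OF unitaryD(1)[OF A] iy]
 show "trace (gsym ([(1, a), (1, b)] @ replicate m (2, curvN A i y)) vs) = (1 / real (m + 1)) *\<^sub>R W2 m (curvN A i y) a b vs"
  unfolding W2_def
  by (rule trace_gsym_two[of _ m 0 1 1 a 1 b "curvN A i y", OF _ _ _ _ _ _ h F]) (auto simp: nth_Cons' nth_append)
qed

lemma trace_fpost:
 assumes A: "unitary_connection E A" and iy: "i \<in> idx E" "y \<in> P i" and h: "homog 1 a" "homog 1 b"
 shows "trace (fsym (fpost (Im_Zprime E Z A i y) [(1, a), (1, b)]) vs)
  = (\<Sum>(d, j, l)\<in>I1. kap d j *\<^sub>R wedge_cc (cw d l i y) (W2 (j - 1) (curvN A i y) a b) vs)"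
 unfolding fpost_def
proof (rule Im_Zprime_expand[OF A iy, where e="%Bs. Bs @ [(1, a), (1, b)]"])
 fix m vs
 note F = curvN_props(2)[OF unitaryD(1)[OF A] iy]
 show "trace (gsym (replicate m (2, curvN A i y) @ [(1, a), (1, b)]) vs) = (1 / real (m + 1)) *\<^sub>R W2 m (curvN A i y) a b vs"
  unfolding W2_def
  by (rule trace_gsym_two[of _ m m "m + 1" 1 a 1 b "curvN A i y", OF _ _ _ _ _ _ h F]) (auto simp: nth_Cons' nth_append)
qed

end

section \<open>Polynomial families of forms and differentiation under the integral\<close>

inductive pfam :: "(('i => complex^'n => ('n::finite, 'a::real_vector) alt) => bool) =>
  (real => 'i => complex^'n => ('n, 'a) alt) => bool" for S where
 pfam_const: "S g ==> pfam S (%t. g)"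
| pfam_step: "S g ==> pfam S f ==> pfam S (%t i y us. g i y us + t *\<^sub>R f t i y us)"

lemma pfam_map:
 assumes f: "pfam S f" and R: "!!g. S g ==> S' (R g)"
  and lin: "!!t g h. R (%i y us. g i y us + t *\<^sub>R h i y us) = (%i y us. R g i y us + t *\<^sub>R R h i y us)"
 shows "pfam S' (%t. R (f t))"
 using f
proof induction
 case (pfam_const g)
 show ?case by (rule pfam.pfam_const) (rule R[OF pfam_const])
next
 case (pfam_step g f)
 show ?case unfolding lin by (rule pfam.pfam_step[OF R[OF pfam_step(1)] pfam_step(3)])
qed

lemma pfam_add:
 assumes f: "pfam S f" and g: "pfam S g" and S: "!!g h. S g ==> S h ==> S (%i y us. g i y us + h i y us)"
 shows "pfam S (%t i y us. f t i y us + g t i y us)"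
 using f g
proof (induction arbitrary: g)
 case (pfam_const f0)
 show ?case using pfam_const(2)
 proof cases
  case (pfam_const g0)
  have "pfam S (%t i y us. f0 i y us + g0 i y us)" by (rule pfam.pfam_const) (rule S[OF \<open>S f0\<close> pfam_const(2)])
  then show ?thesis unfolding pfam_const(1) .
 next
  case (pfam_step g0 g1)
  have "pfam S (%t i y us. (f0 i y us + g0 i y us) + t *\<^sub>R g1 t i y us)"
   by (rule pfam.pfam_step[OF S[OF \<open>S f0\<close> pfam_step(2)] pfam_step(3)])
  then show ?thesis unfolding pfam_step(1) by (simp add: add.assoc)
 qed
next
 case (pfam_step f0 f1)
 show ?case using pfam_step(4)
 proof cases
  case (pfam_const g0)
  have "pfam S (%t i y us. (f0 i y us + g0 i y us) + t *\<^sub>R f1 t i y us)"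
   by (rule pfam.pfam_step[OF S[OF \<open>S f0\<close> pfam_const(2)] \<open>pfam S f1\<close>])
  then show ?thesis unfolding pfam_const(1) by (simp add: algebra_simps)
 next
  case (pfam_step g0 g1)
  have "pfam S (%t i y us. (f0 i y us + g0 i y us) + t *\<^sub>R (f1 t i y us + g1 t i y us))"
   by (rule pfam.pfam_step[OF S[OF \<open>S f0\<close> pfam_step(2)] pfam_step.IH[OF pfam_step(3)]])
  then show ?thesis unfolding pfam_step(1) by (simp add: algebra_simps)
 qed
qed

lemma mprod_csm:
 fixes z :: "('n::finite, 'r::finite cmat) alt"
 shows
 "mprod (xs @ (%us. csm k (z us)) # ys) us = csm k (mprod (xs @ z # ys) us)"
proof -
 have z: "mprod ((%us. csm k (z us)) # ys) = (%us. csm k (mprod (z # ys) us))" by (rule ext) (simp add: wedge_mm_csm)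
 show ?thesis unfolding mprod_append z wedge_mm_csm ..
qed

lemma W2_csm: "W2 m F x (%us. csm k (y us)) us = k * W2 m F x y us"
 "W2 m F (%us. csm k (x us)) y us = k * W2 m F x y us"
proof -
 show "W2 m F x (%us. csm k (y us)) us = k * W2 m F x y us"
  unfolding W2_def sum_distrib_left using mprod_csm[of "x # replicate s F" k y for s] by (simp del: mprod_Cons)
 show "W2 m F (%us. csm k (x us)) y us = k * W2 m F x y us"
  unfolding W2_def sum_distrib_left using mprod_csm[of "[]" k x] by (simp del: mprod_Cons)
qed

lemma W3_csm: "W3 m F (%us. csm k (x us)) y z us = k * W3 m F x y z us"
 "W3 m F x (%us. csm k (y us)) z us = k * W3 m F x y z us"
 "W3 m F x y (%us. csm k (z us)) us = k * W3 m F x y z us"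
proof -
 show "W3 m F (%us. csm k (x us)) y z us = k * W3 m F x y z us"
  unfolding W3_def sum_distrib_left using mprod_csm[of "[]" k x] by (simp add: case_prod_beta del: mprod_Cons)
 show "W3 m F x (%us. csm k (y us)) z us = k * W3 m F x y z us"
  unfolding W3_def sum_distrib_left using mprod_csm[of "x # replicate s F" k y for s] by (simp add: case_prod_beta del: mprod_Cons)
 show "W3 m F x y (%us. csm k (z us)) us = k * W3 m F x y z us"
  unfolding W3_def sum_distrib_left using mprod_csm[of "x # replicate s F @ y # replicate t F" k z for s t] by (simp add: case_prod_beta del: mprod_Cons)
qed

context hbdl begin

lemma pfam_at: "pfam sform f ==> sform (f t)"
 by (induction rule: pfam.induct) (auto intro: sform_add sform_scaleR)

lemma pfam_e: "eform x ==> pfam eform (%t. x)" by (rule pfam_const)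

lemma pfam_mprod:
 "(!!B. B \<in> set Bs ==> pfam eform B) ==> pfam eform (%t i y. mprod (map (%B. B t i y) Bs))"
proof (induction Bs)
 case Nil
 have "pfam eform (%t i y. form0 (mat 1))" by (rule pfam_const) (rule eform_one)
 then show ?case by simp
next
 case (Cons B Bs)
 have w: "pfam eform (%t i y. wedge_mm (f t i y) (g t i y))" if "pfam eform f" "pfam eform g" for f g
  using that
 proof (induction arbitrary: g)
  case (pfam_const f)
  have "pfam eform (%t. (%g i y. wedge_mm (f i y) (g i y)) (g t))"
   by (rule pfam_map[OF pfam_const(2)])
     (auto intro: eform_wedge[OF pfam_const(1)]
      simp: wedge_add_right[OF bb_mm] wedge_scale_right[OF bb_mm])
  then show ?case .
 next
  case (pfam_step f0 f)
  have a: "pfam eform (%t. (%g i y. wedge_mm (f0 i y) (g i y)) (g t))"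
   by (rule pfam_map[OF pfam_step(4)])
     (auto intro: eform_wedge[OF pfam_step(1)]
      simp: wedge_add_right[OF bb_mm] wedge_scale_right[OF bb_mm])
  have b: "pfam eform (%t i y us. 0 + t *\<^sub>R wedge_mm (f t i y) (g t i y) us)"
   using pfam.pfam_step[OF eform_zero pfam_step(3)[OF pfam_step(4)]] .
  show ?case using pfam_add[OF a b eform_add]
   by (simp add: wedge_add_left[OF bb_mm] wedge_scale_left[OF bb_mm] fun_eq_iff[symmetric])
 qed
 show ?case using w[OF Cons(2) Cons(1)] Cons(2) by simp
qed

lemma pfam_trace: "pfam eform f ==> pfam sform (%t i y us. trace (f t i y us))"
 by (rule pfam_map[where R="%f i y us. trace (f i y us)" and S=eform and S'=sform]) (auto intro: sform_trace simp: trace_add_c)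

lemma pfam_wedge_cc: "sform c ==> pfam sform f ==> pfam sform (%t i y. wedge_cc (c i y) (f t i y))"
 by (rule pfam_map[where R="%f i y. wedge_cc (c i y) (f i y)" and S=sform])
   (auto intro: sform_wedge simp: fun_eq_iff wedge_add_right[OF bb_cc] wedge_scale_right[OF bb_cc])

lemma pfam_cmult: "pfam sform f ==> pfam sform (%t i y us. c * f t i y us)"
 by (rule pfam_map[where R="%f i y us. c * f i y us" and S=sform]) (auto intro: sform_cmult simp: algebra_simps)

lemma pfam_scaleR: "pfam sform f ==> pfam sform (%t i y us. (c::real) *\<^sub>R f t i y us)"
 using pfam_cmult[of f "complex_of_real c"] by (simp add: scaleR_conv_of_real)

lemma pfam_sum: "finite K ==> (!!k. k \<in> K ==> pfam sform (f k)) ==> pfam sform (%t i y us. \<Sum>k\<in>K. f k t i y us)"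
proof (induction K rule: finite_induct)
 case empty
 have "pfam sform (%t i y us. 0)" by (rule pfam_const) (rule sform_zero)
 then show ?case by simp
next
 case (insert k K)
 have "pfam sform (%t i y us. f k t i y us + (\<Sum>k\<in>K. f k t i y us))"
  by (rule pfam_add[where S=sform]) (use insert sform_add in auto)
 then show ?case using insert by simp
qed

text \<open>Members of \<open>pfam\<close> are polynomials in t in Horner form with global forms as
  coefficients. The derivative of g + t f_t at 0 is f_0, and linearity of the integral suffices to
  pull it out.\<close>

lemma pfam_mint:
 assumes "pfam sform f"
 shows "\<exists>f'. sform f' & (\<forall>i y us. hvd (%t. f t i y us) (f' i y us) 0) &
  hvd (%t. mint E (f t)) (mint E f') 0"
 using assms
proof induction
 case (pfam_const g)
 show ?case using mint_zero sform_zero by (intro exI[of _ "%i y us. 0"]) simp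
next
 case (pfam_step g f)
 then obtain f' where f': "!!i y us. hvd (%t. f t i y us) (f' i y us) 0"
  "hvd (%t. mint E (f t)) (mint E f') 0" by blast
 have d: "hvd (%t. c + t *\<^sub>R h t) (h 0) 0"
  if "hvd h h' 0" for h :: "real => complex" and c h'
  using that by (auto intro!: derivative_eq_intros)
 have s: "mint E (%i y us. g i y us + t *\<^sub>R f t i y us) = mint E g + t *\<^sub>R mint E (f t)" for t
  using mint_add[OF sform_gtop[OF pfam_step(1)] gtop_cmult[OF sform_gtop[OF pfam_at[OF pfam_step(2)]]], of "complex_of_real t" t]
  by (simp add: mint_cmult scaleR_conv_of_real)
 show ?case
  by (intro exI[of _ "f 0"] conjI allI) (use pfam_at[OF pfam_step(2)] d[OF f'(1)] d[OF f'(2)] in \<open>simp_all add: s\<close>)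
qed

text \<open>The pointwise derivative is known from the rules for words; uniqueness of derivatives
  identifies it with the coefficient that passes through the integral.\<close>

lemma pfam_mint_derivative:
 assumes f: "pfam sform f"
  and g: "!!i y. i \<in> idx E ==> y \<in> P i ==> hvd (%t. f t i y std_frame) (g i y std_frame) 0"
 shows "hvd (%t. mint E (f t)) (mint E g) 0"
proof -
 obtain f' where f': "!!i y us. hvd (%t. f t i y us) (f' i y us) 0"
  "hvd (%t. mint E (f t)) (mint E f') 0" using pfam_mint[OF f] by blast
 have "mint E f' = mint E g"
  by (rule mint_cong) (rule vector_derivative_unique_at[OF f'(1) g])
 then show ?thesis using f'(2) by simp
qed

text \<open>The global form \<open>g\<close> certifies that the exterior derivative of
  \<open>\<eta>\<close> transforms as a form, which is the density assumption of
  \<open>stokes\<close>.\<close>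

lemma sform_stokes:
 assumes "sform \<eta>" "sform g" "!!i y us. i \<in> idx E ==> y \<in> P i ==> g i y us = ext_d (\<eta> i) y us"
 shows "mint E g = 0"
proof -
 have d: "sform (%i. ext_d (\<eta> i))" by (rule bform_cong[OF assms(2)]) (simp add: assms(3))
 have "mint E g = mint E (%i. ext_d (\<eta> i))" by (rule mint_cong) (rule assms(3))
 also have "... = 0"
  by (rule stokes[OF smooth_C1[OF bformD(1)[OF assms(1)]] bformD(2)[OF assms(1)] bformD(3)[OF assms(1)] sform_gtop[OF d]])
 finally show ?thesis .
qed

lemma sform_W2:
 assumes "eform F" "eform x" "eform y" shows "sform (%i z. W2 m (F i z) (x i z) (y i z))"
proof -
 have "sform (%i z us. trace (mprod (x i z # replicate s (F i z) @ y i z # replicate (m - s) (F i z)) us))" for s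
 proof -
  have "eform (%i z. mprod (map (%B. B i z) (x # replicate s F @ y # replicate (m - s) F)))"
   by (rule eform_mprod) (use assms in auto)
  from sform_trace[OF this] show ?thesis by (simp add: map_replicate)
 qed
 then show ?thesis unfolding W2_def by (intro sform_sum) auto
qed

lemma finite_W3: "finite {(s, t, u). s + t + u + 1 = (m::nat)}"
 by (rule finite_subset[of _ "{..m} \<times> {..m} \<times> {..m}"]) auto

lemma sform_W3:
 assumes "eform F" "eform x" "eform y" "eform w" shows "sform (%i z. W3 m (F i z) (x i z) (y i z) (w i z))"
proof -
 have s: "sform (%i z us. trace (mprod (x i z # replicate s (F i z) @ y i z # replicate t (F i z) @ w i z # replicate u (F i z)) us))" for s t u
 proof -
  have "eform (%i z. mprod (map (%B. B i z) (x # replicate s F @ y # replicate t F @ w # replicate u F)))"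
   by (rule eform_mprod) (use assms in auto)
  from sform_trace[OF this] show ?thesis by (simp add: map_replicate)
 qed
 show ?thesis unfolding W3_def case_prod_beta by (intro sform_sum finite_W3[unfolded case_prod_beta] s)
qed

text \<open>The directions tangent to the unitary connections, that is, tangent vectors before the
  linearised integrability condition is imposed.\<close>

definition skew :: "('i, 'n, 'r cmat) lform => bool" where
 "skew a \<longleftrightarrow> end_form E 1 a & (\<forall>i\<in>idx E. \<forall>y\<in>P i. \<forall>v. adj_form (met E i y) (a i y) [v] = - a i y [v])"

lemma skewD:
 assumes "skew a"
 shows "eform a" "i \<in> idx E ==> y \<in> P i ==> homog 1 (a i y)" "i \<in> idx E ==> y \<in> P i ==> dif (a i) y"
  "i \<in> idx E ==> y \<in> P i ==> hadj (met E i y) (a i y [v]) = - a i y [v]"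
proof -
 show e: "eform a" using assms unfolding skew_def end_form_iff by blast
 show "i \<in> idx E ==> y \<in> P i ==> homog 1 (a i y)" using assms unfolding skew_def end_form_iff by blast
 show "i \<in> idx E ==> y \<in> P i ==> dif (a i) y" by (rule bform_dif[OF e])
 show "i \<in> idx E ==> y \<in> P i ==> hadj (met E i y) (a i y [v]) = - a i y [v]"
  using assms unfolding skew_def adj_form_def by blast
qed

lemma tangent_skew: "a \<in> tangent_space E A ==> skew a"
 unfolding tangent_space_def skew_def by blast

lemma hadj_skewD:
 assumes "pos_def_herm H" "hadj H M = - M" shows "ctransp M ** H = - (H ** M)"
proof -
 have "H ** hadj H M = ctransp M ** H"
  unfolding hadj_def using pos_def_inv[OF assms(1)] by (simp add: matrix_mul_assoc)
 then show ?thesis using assms(2) by (simp add: mm_minus)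
qed

lemma ctransp_scaleR: "ctransp (r *\<^sub>R M) = r *\<^sub>R ctransp M" by (simp add: scaleR_csm ctransp_csm)

lemma connection_conn_add:
 assumes A: "connection E A" and a: "end_form E 1 a" shows "connection E (conn_add A t a)"
 unfolding connection_def
proof (intro conjI ballI allI)
 fix i us assume i: "i \<in> idx E"
 have e: "eform a" using a end_form_iff by blast
 show "smooth_fun_on (P i) (%y. conn_add A t a i y us)"
  unfolding conn_add_def by (intro smooth_add smooth_scaleR open_P[OF i] connD(1)[OF A i] bformD(1)[OF e i])
next
 fix i y assume iy: "i \<in> idx E" "y \<in> P i"
 have e: "eform a" "homog 1 (a i y)" using a iy end_form_iff by blast+
 have "AltF (conn_add A t a i y)"
  unfolding conn_add_def by (intro AltF_add AltF_scale connD(2)[OF A iy] bformD(2)[OF e(1) iy])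
 moreover have "homog 1 (conn_add A t a i y)"
  using connD(3)[OF A iy] e(2) by (simp add: homog_def conn_add_def)
 ultimately show "altform 1 (conn_add A t a i y)" by (simp add: altform_iff)
next
 fix i j y us assume ij: "i \<in> idx E" "j \<in> idx E" "y \<in> overlap E i j"
 have e: "eform a" using a end_form_iff by blast
 have "A i y us = Tr i j y ** pull E A i j y us ** matrix_inv (Tr i j y)
   - ext_d (%z. form0 (Tr i j z)) y us ** matrix_inv (Tr i j y)"
  using A ij unfolding connection_def by blast
 then show "conn_add A t a i y us = Tr i j y ** pull E (conn_add A t a) i j y us ** matrix_inv (Tr i j y)
   - ext_d (%z. form0 (Tr i j z)) y us ** matrix_inv (Tr i j y)"
  using bformD(3)[OF e ij, of us] by (simp add: conn_add_def pull_def mm_add mm_scaleR)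
qed

lemma unitary_conn_add:
 assumes A: "unitary_connection E A" and a: "skew a" shows "unitary_connection E (conn_add A t a)"
 unfolding unitary_connection_def
proof (intro conjI ballI allI)
 show "connection E (conn_add A t a)"
  by (rule connection_conn_add) (use A a in \<open>auto simp: unitary_connection_def skew_def\<close>)
next
 fix i y v assume iy: "i \<in> idx E" "y \<in> P i"
 have "ctransp (a i y [v]) ** met E i y = - (met E i y ** a i y [v])"
  by (rule hadj_skewD[OF met_pos[OF iy] skewD(4)[OF a iy]])
 moreover have "ext_d (%z. form0 (met E i z)) y [v] = met E i y ** A i y [v] + ctransp (A i y [v]) ** met E i y"
  using A iy unfolding unitary_connection_def by blast
 ultimately show "ext_d (%z. form0 (met E i z)) y [v]
   = met E i y ** conn_add A t a i y [v] + ctransp (conn_add A t a i y [v]) ** met E i y"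
  by (simp add: conn_add_def mm_add mm_scaleR ctransp_add ctransp_scaleR)
qed

lemma curv_conn_add:
 assumes A: "connection E A" and a: "end_form E 1 a" and iy: "i \<in> idx E" "y \<in> P i"
 shows "curv (conn_add A t a) i y us =
  curv A i y us + t *\<^sub>R (cov_d A 1 a i y us + t *\<^sub>R wedge_mm (a i y) (a i y) us)"
proof -
 have e: "eform a" using a end_form_iff by blast
 note da = bform_dif[OF e iy]
 have "ext_d (%z us. A i z us + t *\<^sub>R a i z us) y us = ext_d (A i) y us + t *\<^sub>R ext_d (a i) y us"
 proof -
  have ds: "dfb (%z. t *\<^sub>R a i z us) y" for us using da by simp
  have e2: "ext_d (%z us. t *\<^sub>R a i z us) y us = t *\<^sub>R ext_d (a i) y us"
   by (rule ext_d_linear[OF da[rule_format] bounded_linear_scaleR_right])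
  show ?thesis
   using ext_d_add[of "A i" y "%z us. t *\<^sub>R a i z us" us] connD(4)[OF A iy] ds
    e2 by simp
 qed
 then show ?thesis
  unfolding curv_def conn_add_def[abs_def] cov_d_def
  by (simp add: wedge_add_left[OF bb_mm] wedge_add_right[OF bb_mm]
    wedge_scale_left[OF bb_mm] wedge_scale_right[OF bb_mm] algebra_simps scaleR_add_right)
qed

text \<open>Read off from the curvatures of \<open>A\<close> and \<open>A + a\<close>, which are
  known to be global forms; this saves a second computation with coordinate changes.\<close>

lemma eform_cov_d1:
 assumes A: "connection E A" and a: "end_form E 1 a" shows "eform (cov_d A 1 a)"
proof (rule bform_cong)
 have e: "eform a" using a end_form_iff by blast
 show "eform (%i y us. (curv (conn_add A 1 a) i y us + - curv A i y us) + - wedge_mm (a i y) (a i y) us)"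
  by (intro eform_add eform_minus eform_curv A connection_conn_add[OF A a] eform_wedge e)
 show "cov_d A 1 a i y us = (curv (conn_add A 1 a) i y us + - curv A i y us) + - wedge_mm (a i y) (a i y) us"
  if "i \<in> idx E" "y \<in> P i" for i y us
  by (simp add: curv_conn_add[OF A a that])
qed

lemma curvN_conn_add:
 assumes A: "connection E A" and a: "end_form E 1 a" and iy: "i \<in> idx E" "y \<in> P i"
 shows "curvN (conn_add A t a) i y = (%us. curvN A i y us + t *\<^sub>R (csm (\<i> / (2 * pi)) (cov_d A 1 a i y us)
   + t *\<^sub>R csm (\<i> / (2 * pi)) (wedge_mm (a i y) (a i y) us)))"
 unfolding curvN_def curv_conn_add[OF A a iy] by (simp add: csm_add scaleR_csm mult.commute mult.left_commute)

lemma cov_d_0: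
 "cov_d A 0 (%i y. form0 (\<phi> i y)) i y us =
   (case us of [v] => fd (\<phi> i) y v | _ => 0) + A i y us ** \<phi> i y - \<phi> i y ** A i y us"
 by (simp add: cov_d_def ext_d_form0 form0_wedge[OF bb_mm] wedge_form0[OF bb_mm])

lemma endsecD:
 assumes "end_section E \<phi>"
 shows "eform (%i y. form0 (\<phi> i y))" "i \<in> idx E ==> smooth_fun_on (P i) (\<phi> i)"
  "i \<in> idx E ==> j \<in> idx E ==> y \<in> overlap E i j ==> \<phi> i y = Tr i j y ** \<phi> j (chg E i j y) ** matrix_inv (Tr i j y)"
proof -
 show e: "eform (%i y. form0 (\<phi> i y))" using assms unfolding end_section_def end_form_iff by blast
 show "i \<in> idx E ==> smooth_fun_on (P i) (\<phi> i)" using bformD(1)[OF e, of i "[]"] by (simp add: form0_def eta_contract_eq)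
 show "i \<in> idx E ==> j \<in> idx E ==> y \<in> overlap E i j ==> \<phi> i y = Tr i j y ** \<phi> j (chg E i j y) ** matrix_inv (Tr i j y)"
  using bformD(3)[OF e, of i j y "[]"] by (simp add: form0_def pull_def)
qed

text \<open>In the transformation law the derivatives of the transition matrix coming from
  \<open>\<phi>\<close> cancel against the inhomogeneous term of the connection.\<close>

lemma eform_cov_d0:
 assumes A: "connection E A" and \<phi>: "end_section E \<phi>"
 shows "eform (cov_d A 0 (%i y. form0 (\<phi> i y)))"
  and "i \<in> idx E ==> y \<in> P i ==> homog 1 (cov_d A 0 (%i y. form0 (\<phi> i y)) i y)"
proof -
 note e = endsecD(1)[OF \<phi>]
 show h: "homog 1 (cov_d A 0 (%i y. form0 (\<phi> i y)) i y)" if "i \<in> idx E" "y \<in> P i" for i y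
  using connD(3)[OF A that] unfolding cov_d_0 homog_def by (auto split: list.split)
 show "eform (cov_d A 0 (%i y. form0 (\<phi> i y)))"
 proof (rule bformI)
  show "smooth_fun_on (P i) (%y. cov_d A 0 (%i y. form0 (\<phi> i y)) i y us)" if i: "i \<in> idx E" for i us
   unfolding cov_d_def
   by (intro smooth_add smooth_diff smooth_scaleR smooth_ext_d smooth_wedge open_P[OF i] bb_mm
     connD(1)[OF A i] bformD(1)[OF e i])
  show "AltF (cov_d A 0 (%i y. form0 (\<phi> i y)) i y)" if iy: "i \<in> idx E" "y \<in> P i" for i y
  proof -
   have "AltF (ext_d (%z. form0 (\<phi> i z)) y)"
    by (rule AltF_ext_d[OF bform_dif[OF e iy, rule_format]]) (simp add: AltF_form0)
   moreover have "AltF (wedge_mm (A i y) (form0 (\<phi> i y)))" "AltF (wedge_mm (form0 (\<phi> i y)) (A i y))"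
    by (intro AltF_wedge bb_mm AltF_form0 connD(2)[OF A iy])+
   ultimately have "AltF (%us. (ext_d (%z. form0 (\<phi> i z)) y us + wedge_mm (A i y) (form0 (\<phi> i y)) us)
     + (-1) *\<^sub>R wedge_mm (form0 (\<phi> i y)) (A i y) us)"
    by (intro AltF_add AltF_scale)
   then show ?thesis unfolding cov_d_def by simp
  qed
  fix i j y us assume ij: "i \<in> idx E" "j \<in> idx E" "y \<in> overlap E i j"
  let ?D = "cov_d A 0 (%i y. form0 (\<phi> i y))" and ?T = "Tr i j" and ?c = "chg E i j"
  have iy: "i \<in> idx E" "y \<in> P i" and jy: "j \<in> idx E" "?c y \<in> P j"
   using ij overlap_patch chg_props(1)[OF ij] by blast+
  show "?D i y us = ?T y ** pull E ?D i j y us ** matrix_inv (?T y)"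
  proof (cases "length us = 1")
   case False
   then show ?thesis using h[OF iy] h[OF jy] by (simp add: homog_def pull_def)
  next
   case True
   then obtain v where us: "us = [v]" by (auto simp: length_Suc_conv)
   let ?w = "dchg i j y v"
   have o: "open (overlap E i j)" by (rule open_overlap[OF ij(1,2)])
   have dT: "dfb ?T y" by (rule smooth_diff_at[OF Tr_smooth[OF ij(1,2)] ij(3)])
   have ev: "eventually (%z. invertible (?T z)) (nhds y)"
    unfolding eventually_nhds using o ij Tr_inv(1) by blast
   have di: "dfb (%z. matrix_inv (?T z)) y" by (rule differentiable_matrix_inv[OF dT ev])
   have dj: "dfb (\<phi> j) (?c y)" by (rule smooth_diff_at[OF endsecD(2)[OF \<phi> jy(1)] jy(2)])
   have dc: "dfb ?c y" by (rule chg_differentiable[OF ij])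
   note fcj = fd_compose[OF dc dj]
   have dTp: "dfb (%z. ?T z ** \<phi> j (?c z)) y" by (rule differentiable_mm[OF dT fcj(2)])
   have "eventually (%z. \<phi> i z = ?T z ** \<phi> j (?c z) ** matrix_inv (?T z)) (nhds y)"
    unfolding eventually_nhds using o ij endsecD(3)[OF \<phi>] by blast
   then have "fd (\<phi> i) y v = fd (%z. ?T z ** \<phi> j (?c z) ** matrix_inv (?T z)) y v"
    by (simp add: fd_cong_nhds)
   also have "... = (fd ?T y v ** \<phi> j (?c y) + ?T y ** fd (\<phi> j) (?c y) ?w) ** matrix_inv (?T y)
     - ?T y ** \<phi> j (?c y) ** (matrix_inv (?T y) ** fd ?T y v ** matrix_inv (?T y))"
    unfolding fd_mm[OF dTp di] fd_mm[OF dT fcj(2)] fd_matrix_inv[OF dT ev] fcj(1)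
    by (simp add: mm_minus)
   finally have df: "fd (\<phi> i) y v = ..." .
   have A1: "A i y [v] = ?T y ** A j (?c y) [?w] ** matrix_inv (?T y) - fd ?T y v ** matrix_inv (?T y)"
    using conn_trans[OF A ij, of v] by (simp add: pull_def)
   have c1: "matrix_inv (?T y) ** (?T y ** M) = M" for M using Tr_inv[OF ij] by (simp add: matrix_mul_assoc)
   show ?thesis unfolding us pull_def cov_d_0 list.map list.case df A1 endsecD(3)[OF \<phi> ij]
    by (simp add: mm_add mm_diff matrix_mul_assoc[symmetric] c1)
  qed
 qed
qed

lemma pfam_W2:
 assumes "pfam eform F" "pfam eform x" "pfam eform y"
 shows "pfam sform (%t i z. W2 m (F t i z) (x t i z) (y t i z))"
proof -
 have "pfam sform (%t i z us. trace (mprod (x t i z # replicate s (F t i z) @ y t i z # replicate (m - s) (F t i z)) us))" for s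
 proof -
  have "pfam eform (%t i z. mprod (map (%B. B t i z) (x # replicate s F @ y # replicate (m - s) F)))"
   by (rule pfam_mprod) (use assms in auto)
  from pfam_trace[OF this] show ?thesis by (simp add: map_replicate)
 qed
 then show ?thesis unfolding W2_def by (intro pfam_sum) auto
qed

lemma skew_end: "skew a ==> end_form E 1 a" by (simp add: skew_def)

end

section \<open>The two-form and the moment map as integrals of cyclic words\<close>

context zbdl begin

definition wsum :: "(nat \<times> nat \<times> nat) set => (nat => ('i, 'n, complex) lform) => ('i, 'n, complex) lform" where
 "wsum I w i y us = (\<Sum>(d, j, l)\<in>I. kap d j *\<^sub>R wedge_cc (cw d l i y) (w j i y) us)"

lemma sform_wsum: assumes "finite I" "!!j. sform (w j)" shows "sform (wsum I w)"
 unfolding wsum_def[abs_def] case_prod_beta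
 by (intro sform_sum sform_scaleR sform_wedge sform_cw assms)

lemma pfam_wsum: assumes "finite I" "!!j. pfam sform (w j)" shows "pfam sform (%t. wsum I (%j. w j t))"
 unfolding wsum_def[abs_def] case_prod_beta
 by (intro pfam_sum pfam_scaleR pfam_wedge_cc sform_cw assms)

lemma wsum_cong: assumes "!!d j l us. (d, j, l) \<in> I ==> w j i y us = w' j i y us" shows "wsum I w i y us = wsum I w' i y us"
 unfolding wsum_def
proof (intro sum.cong refl)
 fix x assume x: "x \<in> I"
 obtain d j l where "x = (d, j, l)" by (cases x) auto
 then show "(case x of (d, j, l) => kap d j *\<^sub>R wedge_cc (cw d l i y) (w j i y) us)
   = (case x of (d, j, l) => kap d j *\<^sub>R wedge_cc (cw d l i y) (w' j i y) us)"
  using assms[of d j l] x by (simp cong: wedge_cong)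
qed

lemma wsum_add: "wsum I (%j i y us. w j i y us + w' j i y us) i y us = wsum I w i y us + wsum I w' i y us"
 unfolding wsum_def sum.distrib[symmetric] case_prod_beta
 by (intro sum.cong refl) (simp add: wedge_add_right[OF bb_cc] scaleR_add_right)

lemma wsum_cmult: "wsum I (%j i y us. c * w j i y us) i y us = c * wsum I w i y us"
 unfolding wsum_def sum_distrib_left case_prod_beta
 by (intro sum.cong refl) (simp add: wedge_cc_scale_right scaleR_conv_of_real mult.left_commute)

lemma wsum_diff: "wsum I (%j i y us. w j i y us - w' j i y us) i y us = wsum I w i y us - wsum I w' i y us"
 using wsum_add[of I w "%j i y us. -1 * w' j i y us" i y us] wsum_cmult[of I "-1" w' i y us] by simp

lemma wsum_derivative:
 assumes "!!j us. hvd (%t. w j t i y us) (w' j i y us) 0"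
 shows "hvd (%t. wsum I (%j. w j t) i y us) (wsum I w' i y us) 0"
 unfolding wsum_def case_prod_beta
 by (intro has_vector_derivative_sum bounded_linear.has_vector_derivative[OF bounded_linear_scaleR_right] wedge_hvd_right bb_cc assms)

lemma ext_d_wsum:
 assumes w: "!!j. sform (w j)" and iy: "i \<in> idx E" "y \<in> P i"
 shows "ext_d (wsum I w i) y us = wsum I (%j i. ext_d (w j i)) i y us"
proof -
 have d: "dfb (%z. wedge_cc (cw d l i z) (w j i z) us) y" for d j l us
  using bform_dif[OF sform_wedge[OF sform_cw w] iy] by blast
 have t: "dfb (%z. case x of (d, j, l) => kap d j *\<^sub>R wedge_cc (cw d l i z) (w j i z) us) y" for x us
  by (cases x) (simp add: diff_linear[OF bounded_linear_scaleR_right d])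
 have e: "ext_d (%z us. case x of (d, j, l) => kap d j *\<^sub>R wedge_cc (cw d l i z) (w j i z) us) y us
  = (case x of (d, j, l) => kap d j *\<^sub>R wedge_cc (cw d l i y) (ext_d (w j i) y) us)" for x
  by (cases x) (simp add: ext_d_linear[OF d bounded_linear_scaleR_right] ext_d_cw_wedge[OF iy bform_dif[OF w iy]])
 show ?thesis unfolding wsum_def[abs_def] by (simp only: ext_d_sum[OF t] e)
qed

lemma Omega_eq:
 assumes A: "unitary_connection E A" and a: "!!i y. i \<in> idx E ==> y \<in> P i ==> homog 1 (a i y)"
  and b: "!!i y. i \<in> idx E ==> y \<in> P i ==> homog 1 (b i y)"
  and F: "!!i y. i \<in> idx E ==> y \<in> P i ==> curvN A i y = F i y"
 shows "Omega_Z E Z A a b = mint E (wsum I1 (%j i y. W2 (j - 1) (F i y) (a i y) (b i y)))"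
 unfolding Omega_Z_def
 by (rule mint_cong) (simp only: trace_fpre[OF A _ _ a b] wsum_def F)

abbreviation "kk \<equiv> \<i> / (2 * pi)"
abbreviation "dA A a \<equiv> %i y us. csm kk (cov_d A 1 a i y us)"

text \<open>The curvature along \<open>A + t a\<close>, written as a polynomial in t at every point.
  On the patches it is the curvature of \<open>conn_add A t a\<close>; off them the connection
  matrices are arbitrary, and only the explicit polynomial is a polynomial family.\<close>

definition cfam :: "('i, 'n, 'r cmat) lform => ('i, 'n, 'r cmat) lform => real => ('i, 'n, 'r cmat) lform" where
 "cfam A a t i y us = curvN A i y us + t *\<^sub>R (dA A a i y us + t *\<^sub>R csm kk (wedge_mm (a i y) (a i y) us))"

lemma cfam_props:
 "hvd (%t. cfam A a t i y us) (dA A a i y us) 0" "cfam A a 0 i y = curvN A i y"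
 "connection E A ==> end_form E 1 a ==> i \<in> idx E ==> y \<in> P i ==> curvN (conn_add A t a) i y = cfam A a t i y"
 unfolding cfam_def[abs_def] by (auto intro!: derivative_eq_intros simp: curvN_conn_add)

lemma pfam_curv:
 assumes "unitary_connection E A" "skew a" shows "pfam eform (cfam A a)"
proof -
 note c = unitaryD(1)[OF assms(1)] and a = skewD(1)[OF assms(2)]
 show ?thesis unfolding cfam_def[abs_def]
  by (intro pfam_step pfam_const curvN_props(1)[OF c] eform_csm eform_cov_d1[OF c skew_end[OF assms(2)]] eform_wedge a)
qed

lemma Omega_derivative:
 assumes A: "unitary_connection E A" and a: "skew a" and b: "skew b" and c: "skew c"
 shows "hvd (%t. Omega_Z E Z (conn_add A t a) b c) (mint E (wsum I1 (%j i y us. W3 (j - 1) (curvN A i y) (b i y) (dA A a i y) (c i y) us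
    + W3 (j - 1) (curvN A i y) (b i y) (c i y) (dA A a i y) us))) 0"
proof -
 note cA = unitaryD(1)[OF A]
 have e: "Omega_Z E Z (conn_add A t a) b c = mint E (wsum I1 (%j i y. W2 (j - 1) (cfam A a t i y) (b i y) (c i y)))" for t
  by (intro Omega_eq unitary_conn_add A a skewD(2)[OF b] skewD(2)[OF c] cfam_props(3) cA skew_end)
 show ?thesis unfolding e
  by (rule pfam_mint_derivative[OF pfam_wsum[OF finite_I(2) pfam_W2[OF pfam_curv[OF A a] pfam_e[OF skewD(1)[OF b]] pfam_e[OF skewD(1)[OF c]]]]])
    (rule wsum_derivative, rule W2_derivative[OF cfam_props(1), unfolded cfam_props(2)])
qed

text \<open>The potential is antisymmetrised in the last two arguments. By the Leibniz rule each of
  the three covariant derivatives appears in both cyclic orders, as it does in the corresponding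
  derivative of the two-form; cyclicity of the trace matches the terms.\<close>

lemma closed_identity:
 assumes A: "unitary_connection E A" and a: "skew a" and b: "skew b" and c: "skew c" and iy: "i \<in> idx E" "y \<in> P i"
 shows "ext_d (%z us. W3 m (curvN A i z) (a i z) (b i z) (c i z) us - W3 m (curvN A i z) (a i z) (c i z) (b i z) us) y us =
   (W3 m (curvN A i y) (b i y) (cov_d A 1 a i y) (c i y) us + W3 m (curvN A i y) (b i y) (c i y) (cov_d A 1 a i y) us)
  - (W3 m (curvN A i y) (a i y) (cov_d A 1 b i y) (c i y) us + W3 m (curvN A i y) (a i y) (c i y) (cov_d A 1 b i y) us)
  + (W3 m (curvN A i y) (a i y) (cov_d A 1 c i y) (b i y) us + W3 m (curvN A i y) (a i y) (b i y) (cov_d A 1 c i y) us)"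
proof -
 note con = unitaryD(1)[OF A]
 note F = bform_dif[OF curvN_props(1)[OF con] iy] curvN_props(2)[OF con iy] curvN_props(3)[OF con iy]
 note ha = skewD(3)[OF a iy] skewD(2)[OF a iy] and hb = skewD(3)[OF b iy] skewD(2)[OF b iy] and hc = skewD(3)[OF c iy] skewD(2)[OF c iy]
 have h2: "homog 2 (cov_d A 1 a i y)"
 proof -
  have "homog (Suc 1) (ext_d (a i) y)"
  proof (rule homog_ext_d)
   show "eventually (%z. homog 1 (a i z)) (nhds y)"
    unfolding eventually_nhds using open_P[OF iy(1)] iy(2) skewD(2)[OF a iy(1)] by blast
  qed
  moreover have "homog (1 + 1) (wedge_mm (A i y) (a i y))" "homog (1 + 1) (wedge_mm (a i y) (A i y))"
   by (intro homog_wedge bb_mm connD(3)[OF con iy] ha(2))+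
  ultimately show ?thesis by (simp add: homog_def cov_d_def)
 qed
 \<comment> \<open>Rotating \<open>b\<close> past the two-form \<open>cov_d A 1 a\<close> and the
   one-form \<open>c\<close> costs a sign, since their total degree is odd.\<close>
 have r1: "W3 m (curvN A i y) (b i y) (cov_d A 1 a i y) (c i y) us = - W3 m (curvN A i y) (cov_d A 1 a i y) (c i y) (b i y) us"
  using W3_rotate[OF hb(2) h2 hc(2) F(2), of m us] by simp
 have r2: "W3 m (curvN A i y) (b i y) (c i y) (cov_d A 1 a i y) us = W3 m (curvN A i y) (cov_d A 1 a i y) (b i y) (c i y) us"
  using W3_rotate[OF hb(2) hc(2) h2 F(2), of m us] W3_rotate[OF hc(2) h2 hb(2) F(2), of m us] by simp
 have d1: "ext_d (%z. W3 m (curvN A i z) (a i z) (b i z) (c i z)) y us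
  = W3 m (curvN A i y) (cov_d A 1 a i y) (b i y) (c i y) us - W3 m (curvN A i y) (a i y) (cov_d A 1 b i y) (c i y) us
   + W3 m (curvN A i y) (a i y) (b i y) (cov_d A 1 c i y) us"
  using ext_d_W3[OF ha hb hc F connD(3)[OF con iy], of m us] unfolding cd_cov .
 have d2: "ext_d (%z. W3 m (curvN A i z) (a i z) (c i z) (b i z)) y us
  = W3 m (curvN A i y) (cov_d A 1 a i y) (c i y) (b i y) us - W3 m (curvN A i y) (a i y) (cov_d A 1 c i y) (b i y) us
   + W3 m (curvN A i y) (a i y) (c i y) (cov_d A 1 b i y) us"
  using ext_d_W3[OF ha hc hb F connD(3)[OF con iy], of m us] unfolding cd_cov .
 have s: "sform (%i z. W3 m (curvN A i z) (a i z) (b i z) (c i z))" "sform (%i z. W3 m (curvN A i z) (a i z) (c i z) (b i z))"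
  by (intro sform_W3 curvN_props(1)[OF con] skewD(1) a b c)+
 have n: "ext_d (%z us. - 1 *\<^sub>R W3 m (curvN A i z) (a i z) (c i z) (b i z) us) y us = - 1 *\<^sub>R ext_d (%z. W3 m (curvN A i z) (a i z) (c i z) (b i z)) y us"
  by (rule ext_d_linear[OF _ bounded_linear_scaleR_right]) (use bform_dif[OF s(2) iy] in blast)
 have "ext_d (%z us. W3 m (curvN A i z) (a i z) (b i z) (c i z) us + - 1 *\<^sub>R W3 m (curvN A i z) (a i z) (c i z) (b i z) us) y us =
   ext_d (%z us. W3 m (curvN A i z) (a i z) (b i z) (c i z) us) y us + ext_d (%z us. - 1 *\<^sub>R W3 m (curvN A i z) (a i z) (c i z) (b i z) us) y us"
  by (rule ext_d_add) (use bform_dif[OF s(1) iy] bform_dif[OF sform_scaleR[OF s(2)] iy] in blast)+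
 then show ?thesis unfolding n d1 d2 r1 r2 by simp
qed

text \<open>Multiplying \<open>closed_identity\<close> by closed scalar forms keeps it exact, so the
  alternating sum of the three derivatives is the integral of an exact form.\<close>

theorem Omega_closed:
 assumes A: "unitary_connection E A" and a: "skew a" and b: "skew b" and c: "skew c"
 shows "\<exists>p q r. hvd (%t. Omega_Z E Z (conn_add A t a) b c) p 0 &
   hvd (%t. Omega_Z E Z (conn_add A t b) a c) q 0 &
   hvd (%t. Omega_Z E Z (conn_add A t c) a b) r 0 & p - q + r = 0"
proof -
 note con = unitaryD(1)[OF A]
 define g where "g a b c = (%j i y us. W3 (j - 1) (curvN A i y) (b i y) (dA A a i y) (c i y) us
    + W3 (j - 1) (curvN A i y) (b i y) (c i y) (dA A a i y) us)" for a b c :: "('i, 'n, 'r cmat) lform" and j :: nat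
 have ed: "eform (dA A x)" if "skew x" for x
  by (intro eform_csm eform_cov_d1[OF con]) (use that in \<open>simp add: skew_def\<close>)
 have sg: "sform (g a b c j)" if "skew a" "skew b" "skew c" for a b c j
  unfolding g_def by (intro sform_add sform_W3 curvN_props(1)[OF con] skewD(1) ed that)
 have sw: "sform (wsum I1 (g a b c))" if "skew a" "skew b" "skew c" for a b c
  by (rule sform_wsum[OF finite_I(2) sg[OF that]])
 note gt = sform_gtop[OF sw]
 define \<eta> where "\<eta> = (%j i y us. W3 (j - 1) (curvN A i y) (a i y) (b i y) (c i y) us - W3 (j - 1) (curvN A i y) (a i y) (c i y) (b i y) us)" for j :: nat
 have s\<eta>: "sform (\<eta> j)" for j
 proof -
  have "sform (%i y us. W3 (j - 1) (curvN A i y) (a i y) (b i y) (c i y) us + -1 *\<^sub>R W3 (j - 1) (curvN A i y) (a i y) (c i y) (b i y) us)"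
   by (intro sform_add sform_scaleR sform_W3 curvN_props(1)[OF con] skewD(1) a b c)
  then show ?thesis unfolding \<eta>_def by simp
 qed
 let ?G = "%i y us. (wsum I1 (g a b c) i y us - wsum I1 (g b a c) i y us) + wsum I1 (g c a b) i y us"
 have "mint E ?G = 0"
 proof (rule sform_stokes)
  show "sform (wsum I1 (%j i y us. kk * \<eta> j i y us))"
   by (rule sform_wsum[OF finite_I(2) sform_cmult[OF s\<eta>]])
  have "sform (%i y us. (wsum I1 (g a b c) i y us + -1 * wsum I1 (g b a c) i y us) + wsum I1 (g c a b) i y us)"
   by (intro sform_add sform_cmult sw a b c)
  then show "sform ?G" by simp
  fix i y us assume iy: "i \<in> idx E" "y \<in> P i"
  have "ext_d (wsum I1 (%j i y us. kk * \<eta> j i y us) i) y us = wsum I1 (%j i. ext_d (%y us. kk * \<eta> j i y us)) i y us"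
   by (rule ext_d_wsum[OF sform_cmult[OF s\<eta>] iy])
  also have "... = wsum I1 (%j i y us. (g a b c j i y us - g b a c j i y us) + g c a b j i y us) i y us"
  proof (rule wsum_cong)
   fix d j l us
   have "ext_d (%y us. kk * \<eta> j i y us) y us = kk * ext_d (\<eta> j i) y us"
    by (rule ext_d_linear[OF _ bounded_linear_mult_right]) (use bform_dif[OF s\<eta> iy] in blast)
   then show "ext_d (%y us. kk * \<eta> j i y us) y us = (g a b c j i y us - g b a c j i y us) + g c a b j i y us"
    unfolding \<eta>_def closed_identity[OF A a b c iy] g_def W3_csm by (simp add: algebra_simps)
  qed
  also have "... = ?G i y us" unfolding wsum_add wsum_diff ..
  finally show "?G i y us = ext_d (wsum I1 (%j i y us. kk * \<eta> j i y us) i) y us" by simp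
 qed
 moreover have "mint E ?G = (mint E (wsum I1 (g a b c)) - mint E (wsum I1 (g b a c))) + mint E (wsum I1 (g c a b))"
 proof -
  have g1: "gtop (%i y us. wsum I1 (g a b c) i y us - wsum I1 (g b a c) i y us)"
   using gtop_add[OF gt[OF a b c] gtop_cmult[OF gt[OF b a c], of "-1"]] by simp
  show ?thesis unfolding mint_add[OF g1 gt[OF c a b]] mint_diff[OF gt[OF a b c] gt[OF b a c]] ..
 qed
 ultimately have "mint E (wsum I1 (g a b c)) - mint E (wsum I1 (g b a c)) + mint E (wsum I1 (g c a b)) = 0" by simp
 then show ?thesis
  using Omega_derivative[OF A a b c, folded g_def] Omega_derivative[OF A b a c, folded g_def] Omega_derivative[OF A c a b, folded g_def]
  by (intro exI conjI)
qed

lemma pairing_eq: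
 assumes A: "unitary_connection E A" and F: "!!i y. i \<in> idx E ==> y \<in> P i ==> curvN A i y = F i y"
 shows "pairing E (moment_map E Z A) \<phi>
  = mint E (wsum I0 (%j i y us. (- (2 * pi * \<i>)) * trace (mprod (form0 (\<phi> i y) # replicate j (F i y)) us)))"
proof -
 have "- trace (\<phi> i y ** moment_map E Z A i y us) =
   wsum I0 (%j i y us. (- (2 * pi * \<i>)) * trace (mprod (form0 (\<phi> i y) # replicate j (F i y)) us)) i y us"
  if iy: "i \<in> idx E" "y \<in> P i" for i y us
 proof -
  have l: "linear (%M :: 'r cmat. trace (\<phi> i y ** M))"
   by (rule linearI) (simp_all add: mm_add mm_scaleR trace_add_c)
  have f0: "wedge_mm (form0 (\<phi> i y)) f = (%us. \<phi> i y ** f us)" for f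
   by (rule ext) (rule form0_wedge[OF bb_mm])
  have t: "trace (\<phi> i y ** wedge_cm c f us) = wedge_cc c (%us. trace (wedge_mm (form0 (\<phi> i y)) f us)) us" for c f us
   unfolding wedge_linear_out[OF l] f0 by (simp add: wedge_def csm_mm)
  have "trace (\<phi> i y ** D_Z E Z A i y us) = (\<Sum>(d, j, l)\<in>I0. kap d j *\<^sub>R
    wedge_cc (cw d l i y) (%us. trace (wedge_mm (form0 (\<phi> i y)) (mprod (replicate j (F i y))) us)) us)"
   unfolding D_Z_expand[OF A iy] linear_sum[OF l] F[OF iy] case_prod_beta linear_scale[OF l] t ..
  then have "trace (\<phi> i y ** D_Z E Z A i y us) = wsum I0 (%j i y us. trace (mprod (form0 (\<phi> i y) # replicate j (F i y)) us)) i y us"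
   unfolding wsum_def by simp
  then show ?thesis unfolding wsum_cmult moment_map_def by (simp add: csm_mm)
 qed
 note pw = this
 have "pairing E (moment_map E Z A) \<phi> = mint E (%i y us. - 1 * trace (\<phi> i y ** moment_map E Z A i y us))"
  unfolding pairing_def mint_cmult by simp
 also have "... = mint E (wsum I0 (%j i y us. (- (2 * pi * \<i>)) * trace (mprod (form0 (\<phi> i y) # replicate j (F i y)) us)))"
  by (rule mint_cong) (use pw in simp)
 finally show ?thesis .
qed

lemma wsum_I0: assumes "!!us. w 0 i y us = 0" shows "wsum I0 w i y us = wsum I1 w i y us"
 unfolding wsum_def
proof (rule sum.mono_neutral_right)
 have w0: "w 0 i y = (%us. 0)" using assms by (intro ext)
 show "\<forall>x\<in>I0 - I1. (case x of (d, j, l) => kap d j *\<^sub>R wedge_cc (cw d l i y) (w j i y) us) = 0"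
 proof clarify
  fix d j l assume "(d, j, l) \<in> I0" "(d, j, l) \<notin> I1"
  then have j: "j = 0" by (simp add: I0_def I1_def)
  show "kap d j *\<^sub>R wedge_cc (cw d l i y) (w j i y) us = 0"
   unfolding j w0 wedge_zero_right[OF bb_cc] by simp
 qed
qed (rule finite_I, auto simp: I0_def I1_def)

text \<open>The derivative of the pairing consists of the words in \<open>\<phi>\<close> and d_A b,
  with coefficient 1 because -2\<pi>i times i/(2\<pi>) is 1. The exterior derivative of the words in
  \<open>\<phi>\<close> and \<open>b\<close> adds to them the words in d_A \<open>\<phi>\<close> and
  \<open>b\<close>, which form the two-form; Stokes therefore produces the minus sign.\<close>

theorem moment_map_derivative:
 assumes A: "unitary_connection E A" and b: "skew b" and \<phi>: "end_section E \<phi>"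
 shows "hvd (%t. pairing E (moment_map E Z (conn_add A t b)) \<phi>) (- Omega_Z E Z A (cov_d A 0 (%i y. form0 (\<phi> i y))) b) 0"
proof -
 note con = unitaryD(1)[OF A]
 have b1: "end_form E 1 b" using b by (simp add: skew_def)
 note e\<phi> = endsecD(1)[OF \<phi>] and e1 = eform_cov_d0[OF con \<phi>]
 have ed: "eform (cov_d A 1 b)" by (rule eform_cov_d1[OF con b1])
 let ?w = "%j t i y us. (- (2 * pi * \<i>)) * trace (mprod (form0 (\<phi> i y) # replicate j (cfam A b t i y)) us)"
 \<comment> \<open>The term with j = 0 contains no curvature, so its derivative is 0; this later
   moves the sum from \<open>I0\<close> to \<open>I1\<close>.\<close>
 let ?w' = "%j i y us. (if j = 0 then 0 else W2 (j - 1) (curvN A i y) (form0 (\<phi> i y)) (cov_d A 1 b i y) us)"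
 have e: "pairing E (moment_map E Z (conn_add A t b)) \<phi> = mint E (wsum I0 (%j. ?w j t))" for t
  by (intro pairing_eq unitary_conn_add A b cfam_props(3) con b1)
 have pf: "pfam sform (?w j)" for j
 proof -
  have "pfam eform (%t i y. mprod (map (%B. B t i y) ((%t i y. form0 (\<phi> i y)) # replicate j (cfam A b))))"
   by (rule pfam_mprod) (use pfam_curv[OF A b] pfam_e[OF e\<phi>] in auto)
  from pfam_cmult[OF pfam_trace[OF this], of "- (2 * pi * \<i>)"] show ?thesis by (simp add: map_replicate)
 qed
 have dw: "hvd (%t. ?w j t i y us) (?w' j i y us) 0" for j i y us
 proof -
  let ?S = "%us. \<Sum>s<j. mprod (replicate s (cfam A b 0 i y) @ dA A b i y # replicate (j - 1 - s) (cfam A b 0 i y)) us"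
  have "hvd (%t. wedge_mm (form0 (\<phi> i y)) (mprod (replicate j (cfam A b t i y))) us) (wedge_mm (form0 (\<phi> i y)) ?S us) 0"
   by (rule wedge_hvd_right[OF bb_mm mprod_replicate_derivative[OF cfam_props(1)]])
  from bounded_linear.has_vector_derivative[OF bl_trace this]
  have tr: "hvd (%t. trace (wedge_mm (form0 (\<phi> i y)) (mprod (replicate j (cfam A b t i y))) us)) (trace (wedge_mm (form0 (\<phi> i y)) ?S us)) 0" .
  have d: "hvd (%t. ?w j t i y us) ((- (2 * pi * \<i>)) * trace (wedge_mm (form0 (\<phi> i y)) ?S us)) 0"
   unfolding mprod_Cons by (rule bounded_linear.has_vector_derivative[OF bounded_linear_mult_right tr])
  have "(- (2 * pi * \<i>)) * trace (wedge_mm (form0 (\<phi> i y)) ?S us) = ?w' j i y us"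
  proof (cases j)
   case 0 then show ?thesis by (simp add: wedge_zero_right[OF bb_mm])
  next
   case (Suc n)
   have "trace (wedge_mm (form0 (\<phi> i y)) ?S us) = W2 n (curvN A i y) (form0 (\<phi> i y)) (dA A b i y) us"
    unfolding W2_def wedge_sum_right[OF bb_mm] trace_sum Suc lessThan_Suc_atMost cfam_props(2)
    by simp
   then show ?thesis unfolding W2_csm by (simp add: Suc)
  qed
  then show ?thesis using d by simp
 qed
 have der: "hvd (%t. pairing E (moment_map E Z (conn_add A t b)) \<phi>) (mint E (wsum I0 ?w')) 0"
  unfolding e by (rule pfam_mint_derivative[OF pfam_wsum[OF finite_I(1) pf]]) (rule wsum_derivative, rule dw)
 let ?u = "%j i y. W2 (j - 1) (curvN A i y) (form0 (\<phi> i y)) (cov_d A 1 b i y)"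
 let ?v = "%j i y. W2 (j - 1) (curvN A i y) (cov_d A 0 (%i y. form0 (\<phi> i y)) i y) (b i y)"
 let ?\<eta> = "%j i y. W2 (j - 1) (curvN A i y) (form0 (\<phi> i y)) (b i y)"
 have w0: "wsum I0 ?w' i y us = wsum I1 ?u i y us" for i y us
  by (subst wsum_I0, simp, rule wsum_cong) (auto simp: I1_def)
 have s: "sform (?u j)" "sform (?v j)" "sform (?\<eta> j)" for j
  by (intro sform_W2 curvN_props(1)[OF con] e\<phi> ed e1 skewD(1)[OF b])+
 have "mint E (%i y us. wsum I1 ?u i y us + wsum I1 ?v i y us) = 0"
 proof (rule sform_stokes)
  show "sform (wsum I1 ?\<eta>)" by (rule sform_wsum[OF finite_I(2) s(3)])
  show "sform (%i y us. wsum I1 ?u i y us + wsum I1 ?v i y us)" by (intro sform_add sform_wsum finite_I s)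
  fix i y us assume iy: "i \<in> idx E" "y \<in> P i"
  have "ext_d (wsum I1 ?\<eta> i) y us = wsum I1 (%j i. ext_d (?\<eta> j i)) i y us"
   by (rule ext_d_wsum[OF s(3) iy])
  also have "... = wsum I1 (%j i y us. ?u j i y us + ?v j i y us) i y us"
  proof (rule wsum_cong)
   fix d j l us
   have "ext_d (?\<eta> j i) y us = W2 (j - 1) (curvN A i y) (cd (A i) 0 (%y. form0 (\<phi> i y)) y) (b i y) us
     + (-1) ^ 0 *\<^sub>R W2 (j - 1) (curvN A i y) (form0 (\<phi> i y)) (cd (A i) 1 (b i) y) us"
    by (rule ext_d_W2[OF bform_dif[OF e\<phi> iy] homog_form0 skewD(3)[OF b iy] skewD(2)[OF b iy]
       bform_dif[OF curvN_props(1)[OF con] iy] curvN_props(2)[OF con iy] curvN_props(3)[OF con iy] connD(3)[OF con iy]])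
   then show "ext_d (?\<eta> j i) y us = ?u j i y us + ?v j i y us"
    unfolding cd_cov[of A i 1 b] cd_cov[of A i 0 "%i y. form0 (\<phi> i y)"] by simp
  qed
  finally show "wsum I1 ?u i y us + wsum I1 ?v i y us = ext_d (wsum I1 ?\<eta> i) y us" unfolding wsum_add by simp
 qed
 moreover have "mint E (%i y us. wsum I1 ?u i y us + wsum I1 ?v i y us) = mint E (wsum I1 ?u) + mint E (wsum I1 ?v)"
  by (intro mint_add sform_gtop sform_wsum finite_I s)
 moreover have "Omega_Z E Z A (cov_d A 0 (%i y. form0 (\<phi> i y))) b = mint E (wsum I1 ?v)"
  by (rule Omega_eq[OF A e1(2) skewD(2)[OF b] refl])
 moreover have "wsum I0 ?w' = wsum I1 ?u" using w0 by (intro ext)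
 ultimately have "mint E (wsum I0 ?w') = - Omega_Z E Z A (cov_d A 0 (%i y. form0 (\<phi> i y))) b"
  by (simp add: eq_neg_iff_add_eq_0)
 then show ?thesis using der by simp
qed

end

section \<open>Positivity and non-degeneracy\<close>

lemma continuous_integral_zero:
 fixes h :: "'a::euclidean_space => real"
 assumes S: "open S" and c: "continuous_on S h" and pos: "!!y. y \<in> S ==> h y >= 0"
  and int: "set_integrable lborel S h" and z: "(LINT y:S|lborel. h y) = 0" and y: "y \<in> S"
 shows "h y = 0"
proof (rule ccontr)
 assume ne: "h y ~= 0"
 let ?T = "{y \<in> S. h y > 0}"
 have "?T = S \<inter> h -` {0<..}" by auto
 then have T: "open ?T" using continuous_open_preimage[OF c S open_greaterThan, of 0] by simp
 have "AE y in lborel. indicat_real S y *\<^sub>R h y = 0"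
  by (subst integral_nonneg_eq_0_iff_AE[symmetric])
    (use int z pos in \<open>auto simp: set_integrable_def set_lebesgue_integral_def indicator_def\<close>)
 then have "AE y in lborel. y \<notin> ?T" by eventually_elim (auto simp: indicator_def split: if_splits)
 then have "?T \<in> null_sets lborel" using T by (subst AE_iff_null_sets) auto
 then have "negligible ?T" by (simp add: negligible_iff_null_sets null_sets_completionI)
 moreover have "?T ~= {}" using y ne pos[OF y] by force
 ultimately show False using open_not_negligible[OF T] by blast
qed

context cmfd begin

text \<open>The partition of unity splits the integral into non-negative parts, each of which has to
  vanish. At a given point some member is non-zero; in its chart continuity forces the density to be
  zero, and the transformation law carries this back to chart \<open>i\<close>.\<close>

lemma mint_nonneg_zero:
 assumes f: "gtop f" and r: "!!i y. i \<in> idx X ==> y \<in> patch X i ==> f i y std_frame \<in> \<real> & Re (f i y std_frame) >= 0"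
  and z: "mint X f = 0" and iy: "i \<in> idx X" "y \<in> patch X i"
 shows "f i y std_frame = 0"
proof -
 let ?g = "%p i y vs. complex_of_real (punit p (pt X i y)) * f i y vs"
 let ?h = "%p k y. punit p (pt X k y) * Re (f k y std_frame)"
 have pn: "punit p x >= 0" for p x using pbump_nonneg[of p x] pbump_sum_pos[of x] by (simp add: punit_def)
 have fr: "f k y std_frame = complex_of_real (Re (f k y std_frame))" if "k \<in> idx X" "y \<in> patch X k" for k y
  using r[OF that] by (simp add: complex_is_Real_iff complex_eq_iff)
 have gt: "gtop (?g p)" if "p \<in> pballs" for p by (rule gtop_punit[OF that f])
 have "mint X f = mint X (%i y vs. \<Sum>p\<in>pballs. ?g p i y vs)"
  by (rule mint_cong) (simp add: sum_distrib_right[symmetric] punit_sum flip: of_real_sum)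
 also have "... = (\<Sum>p\<in>pballs. mint X (?g p))" by (rule mint_sum[OF pballs(1) gt])
 finally have sum0: "(\<Sum>p\<in>pballs. mint X (?g p)) = 0" using z by simp
 have key: "set_integrable lborel (patch X k) (?h (k, c, e) k) &
   mint X (?g (k, c, e)) = complex_of_real (LINT y:patch X k|lborel. ?h (k, c, e) k y) &
   continuous_on (patch X k) (?h (k, c, e) k) & k \<in> idx X" if p: "(k, c, e) \<in> pballs" for k c e
 proof -
  have g: "k \<in> idx X" "cball c e \<subseteq> patch X k" using pballs(2)[OF p] by (auto simp: good_ball_def)
  have sup: "?g (k, c, e) j y std_frame = 0" if "pt X j y \<notin> pt X k ` cball c e" for j y
   using punit_support[OF p] that by force
  have cg: "continuous_on (patch X k) (%y. ?g (k, c, e) k y std_frame)" using gt[OF p] g by (simp add: gtop_def)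
  have eq: "?g (k, c, e) k y std_frame = complex_of_real (?h (k, c, e) k y)" if "y \<in> patch X k" for y
   using fr[OF g(1) that] by simp
  have ch: "continuous_on (patch X k) (?h (k, c, e) k)"
   by (rule continuous_on_eq[OF continuous_on_Re[OF cg]]) (simp only: eq Re_complex_of_real)
  have sup': "?g (k, c, e) k y std_frame = 0" if "y \<in> patch X k" "y \<notin> cball c e" for y
  proof (rule sup)
   show "pt X k y \<notin> pt X k ` cball c e" using that g crd_pt[OF g(1)] by (auto) (metis subsetD mem_cball)
  qed
  have ih: "set_integrable lborel (patch X k) (?h (k, c, e) k)"
  proof -
   have "set_integrable lborel (patch X k) (%y. ?g (k, c, e) k y std_frame)"
    by (rule compact_patch_integrable[OF g(1) compact_cball g(2) cg sup'])
   then have "integrable lborel (%y. Re (indicat_real (patch X k) y *\<^sub>R ?g (k, c, e) k y std_frame))"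
    unfolding set_integrable_def by (rule integrable_Re)
   moreover have "(%y. Re (indicat_real (patch X k) y *\<^sub>R ?g (k, c, e) k y std_frame)) = (%y. indicat_real (patch X k) y *\<^sub>R ?h (k, c, e) k y)"
    by (auto simp: fun_eq_iff indicator_def)
   ultimately show ?thesis unfolding set_integrable_def by simp
  qed
  have "mint X (?g (k, c, e)) = (LINT y:patch X k|lborel. ?g (k, c, e) k y std_frame)"
   by (rule mint_supported(2)[OF g(1) compact_cball g(2) gt[OF p] sup])
  also have "... = (LINT y:patch X k|lborel. complex_of_real (?h (k, c, e) k y))"
   by (rule set_lebesgue_integral_cong) (use chart(2)[OF g(1)] eq in auto)
  also have "... = complex_of_real (LINT y:patch X k|lborel. ?h (k, c, e) k y)"
   unfolding set_lebesgue_integral_def by (simp flip: of_real_mult add: scaleR_conv_of_real)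
  finally show ?thesis using ih ch g by blast
 qed
 have nn: "?h p k y >= 0" if "k \<in> idx X" "y \<in> patch X k" for p k y using pn r[OF that] by simp
 have m0: "mint X (?g p) = 0" if "p \<in> pballs" for p
 proof -
  have re: "Re (mint X (?g p)) >= 0 & Im (mint X (?g p)) = 0" if "p \<in> pballs" for p
  proof -
   obtain k c e where p: "p = (k, c, e)" by (cases p)
   have "(LINT y:patch X k|lborel. ?h (k, c, e) k y) >= 0"
    unfolding set_lebesgue_integral_def
    by (rule integral_nonneg_AE, rule AE_I2) (use nn key that p in \<open>auto simp: indicator_def\<close>)
   then show ?thesis using key that unfolding p by simp
  qed
  have s0: "(\<Sum>p\<in>pballs. Re (mint X (?g p))) = 0" unfolding Re_sum[symmetric] sum0 by simp
  have "Re (mint X (?g p)) = 0"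
   by (rule sum_nonneg_0[where f="%p. Re (mint X (?g p))", OF pballs(1) conjunct1[OF re] s0 that])
  then show ?thesis using re[OF that] by (simp add: complex_eq_iff)
 qed
 obtain p where p: "p \<in> pballs" "punit p (pt X i y) ~= 0"
  using punit_sum[of "pt X i y"] by (metis sum.neutral zero_neq_one)
 obtain k c e where pe: "p = (k, c, e)" by (cases p)
 note kp = key[OF p(1)[unfolded pe]]
 have k: "k \<in> idx X" using kp by blast
 let ?x = "pt X i y" and ?y = "chg X i k y"
 have "?x \<in> pt X k ` cball c e" using punit_support[of k c e] p pe by blast
 then have "?x \<in> cdom X k" using pballs(2)[OF p(1)] ball_compact(2) pe by blast
 then have o: "y \<in> overlap X i k" using iy by (simp add: overlap_eq)
 have "?h (k, c, e) k ?y = 0"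
 proof (rule continuous_integral_zero[where S="patch X k" and h="?h (k, c, e) k"])
  show "(LINT y:patch X k|lborel. ?h (k, c, e) k y) = 0" using kp m0[OF p(1)] unfolding pe by simp
 qed (use kp chart(2)[OF k] nn[OF k] chg_props(4)[OF iy(1) k o] in blast)+
 then have "f k ?y std_frame = 0" using p(2) pe chg_props(2)[OF iy(1) k o] fr[OF k chg_props(4)[OF iy(1) k o]] by simp
 then show ?thesis using f iy k o unfolding gtop_def by simp
qed

end

lemma mprod_add:
 fixes f g :: "('n::finite, 'r::finite cmat) alt"
 shows "mprod (xs @ (%us. f us + g us) # ys) us = mprod (xs @ f # ys) us + mprod (xs @ g # ys) us"
proof -
 have z: "mprod ((%us. f us + g us) # ys) = (%us. mprod (f # ys) us + mprod (g # ys) us)"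
  by (rule ext) (simp add: wedge_add_left[OF bb_mm])
 show ?thesis unfolding mprod_append z wedge_add_right[OF bb_mm] ..
qed

lemma W2_add: "W2 m F x (%us. f us + g us) us = W2 m F x f us + W2 m F x g us"
 "W2 m F (%us. f us + g us) y us = W2 m F f y us + W2 m F g y us"
proof -
 show "W2 m F x (%us. f us + g us) us = W2 m F x f us + W2 m F x g us"
  unfolding W2_def sum.distrib[symmetric] using mprod_add[of "x # replicate s F" for s] by (simp add: trace_add_c del: mprod_Cons)
 show "W2 m F (%us. f us + g us) y us = W2 m F f y us + W2 m F g y us"
  unfolding W2_def sum.distrib[symmetric] using mprod_add[of "[]" f g] by (simp add: trace_add_c del: mprod_Cons)
qed

text \<open>The pull-back by the complex structure.\<close>

definition Jf :: "('n::finite, 'a) alt => ('n, 'a) alt" where "Jf f vs = f (map (%v. \<i> *s v) vs)"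

lemma part01_Jf: "part01 f = (%vs. csm (1/2) (f vs + csm \<i> (Jf f vs)))" by (simp add: part01_def Jf_def)

lemma linear_i: "linear (%v :: complex^'n. \<i> *s v)"
 by (rule linearI) (auto simp: vec_eq_iff algebra_simps)

lemma ii_vec: "\<i> *s (\<i> *s v) = - (v :: complex^'n)" by (simp add: vec_eq_iff)

lemma homog_Jf: "homog k f ==> homog k (Jf f)" by (simp add: homog_def Jf_def)
lemma AltF_Jf: "AltF f ==> AltF (Jf f)" unfolding Jf_def[abs_def] by (rule AltF_pullback[OF _ linear_i])

lemma homog1_zero: "homog 1 f ==> (!!v. f [v] = 0) ==> f us = 0"
 by (cases us; cases "tl us") (auto simp: homog_def)

lemma AltF_neg_single: "AltF f ==> f [- v] = - f [v]"
 using AltF_scaleR[of f "[]" "-1" v "[]"] by simp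

context zbdl begin

text \<open>On the (0,1)-part J is multiplication by -i, and the integrability condition is complex
  linear in the (0,1)-part. Holomorphic coordinate changes commute with the complex structure, so
  the form stays global.\<close>

lemma tangent_J:
 assumes a: "a \<in> tangent_space E A" shows "(%i y. Jf (a i y)) \<in> tangent_space E A"
proof -
 note sk = tangent_skew[OF a]
 have e: "eform (%i y. Jf (a i y))"
 proof (rule bformI)
  show "smooth_fun_on (P i) (%y. Jf (a i y) us)" if "i \<in> idx E" for i us
   unfolding Jf_def by (rule bformD(1)[OF skewD(1)[OF sk] that])
  show "AltF (Jf (a i y))" if "i \<in> idx E" "y \<in> P i" for i y
   by (rule AltF_Jf[OF bformD(2)[OF skewD(1)[OF sk] that]])
  show "Jf (a i y) us = Tr i j y ** pull E (%i y. Jf (a i y)) i j y us ** matrix_inv (Tr i j y)"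
   if "i \<in> idx E" "j \<in> idx E" "y \<in> overlap E i j" for i j y us
   using bformD(3)[OF skewD(1)[OF sk] that] by (simp add: Jf_def pull_def o_def dchg_linear(2)[OF that])
 qed
 show ?thesis unfolding tangent_space_def
 proof (intro CollectI conjI ballI allI)
  show "end_form E 1 (%i y. Jf (a i y))" unfolding end_form_iff using e skewD(2)[OF sk] homog_Jf by blast
  show "adj_form (met E i y) (Jf (a i y)) [v] = - Jf (a i y) [v]" if "i \<in> idx E" "y \<in> P i" for i y v
   using skewD(4)[OF sk that] by (simp add: adj_form_def Jf_def)
  fix i y v w assume iy: "i \<in> idx E" "y \<in> P i"
  define k where "k = - \<i>"
  let ?B = "%j z. part01 (a j z)" and ?C = "%j z. part01 (Jf (a j z))"
  have C: "?C i z us = csm k (?B i z us)" if "z \<in> P i" for z us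
  proof (cases "length us = 1")
   case True
   then obtain v where "us = [v]" by (auto simp: length_Suc_conv)
   then show ?thesis using AltF_neg_single[OF bformD(2)[OF skewD(1)[OF sk] iy(1) that]]
    by (simp add: k_def part01_def Jf_def ii_vec csm_add csm_diff csm_minus)
  next
   case False
   then show ?thesis using skewD(2)[OF sk iy(1) that] by (simp add: part01_def Jf_def homog_def)
  qed
  have dB: "dif (?B i) y"
  proof -
   have "smooth_fun_on (P i) (%z. ?B i z us)" for us
    unfolding part01_Jf Jf_def
    by (intro smooth_csm smooth_add open_P[OF iy(1)] bformD(1)[OF skewD(1)[OF sk] iy(1)])
   then show ?thesis using smooth_diff_at iy(2) by blast
  qed
  have "cov_d A 1 ?C i y us = csm k (cov_d A 1 ?B i y us)" for us
   by (rule cov_d_csm[where B="?B" and C="?C", OF iy dB C])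
  then have "part02 (cov_d A 1 ?C i y) v w = csm k (part02 (cov_d A 1 ?B i y) v w)"
   unfolding part02_def by (simp add: csm_add csm_diff mult.commute mult.left_commute)
  also have "part02 (cov_d A 1 ?B i y) v w = 0" using a iy unfolding tangent_space_def by blast
  finally show "part02 (cov_d A 1 ?C i y) v w = 0" by simp
 qed
qed

theorem Omega_nondegenerate:
 assumes A: "A \<in> subsolution_space E Z" and a: "a \<in> tangent_space E A"
  and z: "!!b. b \<in> tangent_space E A ==> Omega_Z E Z A a b = 0"
 shows "form_eq E a (%i y vs. 0)"
proof -
 have U: "unitary_connection E A" and sub: "subsolution E Z A"
  using A by (auto simp: subsolution_space_def chern_space_def)
 note con = unitaryD(1)[OF U]
 note sk = tangent_skew[OF a]
 let ?J = "%i y. Jf (a i y)"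
 note skJ = tangent_skew[OF tangent_J[OF a]]
 let ?W = "wsum I1 (%j i y. W2 (j - 1) (curvN A i y) (a i y) (?J i y))"
 define u where "u i y = part01 (a i y)" for i y
 define s where "s i y = adj_form (met E i y) (u i y)" for i y
 \<comment> \<open>Since \<open>a\<close> is skew-Hermitian, its (1,0)-part is minus the adjoint
   \<open>s\<close> of its (0,1)-part \<open>u\<close>. Hence a = u - s and J a = -i (u +
   s).\<close>
 have val: "s i y [v] = csm (1/2) (csm \<i> (Jf (a i y) [v]) - a i y [v])" "homog 1 (u i y)" "homog 1 (s i y)"
  "a i y us = u i y us + csm (-1) (s i y us)" "Jf (a i y) us = csm (- \<i>) (u i y us + s i y us)"
  "u i y [\<i> *s v] = csm (- \<i>) (u i y [v])" "altform 1 (u i y)"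
  if iy: "i \<in> idx E" "y \<in> P i" for i y v us
 proof -
  have j: "hadj (met E i y) (Jf (a i y) [v]) = - Jf (a i y) [v]" for v using skewD(4)[OF sk iy] by (simp add: Jf_def)
  show s1: "s i y [v] = csm (1/2) (csm \<i> (Jf (a i y) [v]) - a i y [v])" for v
   unfolding s_def u_def part01_Jf adj_form_def hadj_csm hadj_add j skewD(4)[OF sk iy] by (simp add: csm_minus)
  show h: "homog 1 (u i y)" using skewD(2)[OF sk iy] by (simp add: u_def homog_def part01_def)
  show hs: "homog 1 (s i y)" using h by (simp add: s_def homog_def adj_form_def)
  show "u i y [\<i> *s v] = csm (- \<i>) (u i y [v])"
   using AltF_neg_single[OF bformD(2)[OF skewD(1)[OF sk] iy]]
   by (simp add: u_def part01_def ii_vec csm_add csm_diff csm_minus)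
  have "AltF (%vs. csm (1/2) (a i y vs + csm \<i> (Jf (a i y) vs)))"
   by (intro AltF_linear[OF _ bounded_linear.linear[OF bl_csm]] AltF_add AltF_Jf bformD(2)[OF skewD(1)[OF sk] iy])
  then show "altform 1 (u i y)" using h by (simp add: altform_iff u_def part01_Jf)
  show "a i y us = u i y us + csm (-1) (s i y us)" "Jf (a i y) us = csm (- \<i>) (u i y us + s i y us)"
  proof -
   consider v where "us = [v]" | "length us ~= 1" by (auto simp: length_Suc_conv)
   then have "a i y us = u i y us + csm (-1) (s i y us) & Jf (a i y) us = csm (- \<i>) (u i y us + s i y us)"
   proof cases
    case 1
    have "csm (1/2) (p + csm \<i> q) + csm (-1) (csm (1/2) (csm \<i> q - p)) = p"
     "csm (- \<i>) (csm (1/2) (p + csm \<i> q) + csm (1/2) (csm \<i> q - p)) = q" for p q :: "'r cmat"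
     by (auto intro!: mat_eqI simp: csm_def field_simps)
    from this(1)[of "a i y us" "Jf (a i y) us"] this(2)[of "a i y us" "Jf (a i y) us"]
    show ?thesis unfolding 1 s1 u_def part01_Jf by simp
   next
    case 2
    then show ?thesis using h hs skewD(2)[OF sk iy] homog_Jf[OF skewD(2)[OF sk iy]] by (simp add: homog_def)
   qed
   then show "a i y us = u i y us + csm (-1) (s i y us)" "Jf (a i y) us = csm (- \<i>) (u i y us + s i y us)" by auto
  qed
 qed
 have pos: "?W i y std_frame \<in> \<real> & Re (?W i y std_frame) >= 0 & ((\<exists>v. u i y [v] ~= 0) --> Re (?W i y std_frame) > 0)"
  if iy: "i \<in> idx E" "y \<in> P i" for i y
 proof -
  let ?F = "curvN A i y"
  note hu = val(2)[OF iy] and hs = val(3)[OF iy] and hF = curvN_props(2)[OF con iy]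
  \<comment> \<open>Antisymmetry annihilates the contributions with \<open>u\<close> twice or
    \<open>s\<close> twice and identifies the two mixed ones, whence the factor 2 i.\<close>
  have "W2 m ?F (a i y) (Jf (a i y)) us = 2 * \<i> * W2 m ?F (s i y) (u i y) us" for m us
  proof -
   have ea: "a i y = (%us. u i y us + csm (-1) (s i y us))" and eJ: "Jf (a i y) = (%us. csm (- \<i>) (u i y us + s i y us))"
    using val(4,5)[OF iy] by auto
   have z: "W2 m ?F (u i y) (u i y) us = 0" "W2 m ?F (s i y) (s i y) us = 0"
    using W2_antisym[OF hu hu hF, of m us] W2_antisym[OF hs hs hF, of m us] by (simp_all add: eq_neg_iff_add_eq_0)
   have "W2 m ?F (%us. u i y us + csm (-1) (s i y us)) (%us. csm (- \<i>) (u i y us + s i y us)) us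
     = - \<i> * (W2 m ?F (u i y) (s i y) us - W2 m ?F (s i y) (u i y) us)"
    unfolding W2_csm W2_add z by simp
   then show ?thesis unfolding ea[symmetric] eJ[symmetric] W2_antisym[OF hu hs hF, of m us] by simp
  qed
  then have "?W i y std_frame = wsum I1 (%j i y us. 2 * \<i> * W2 (j - 1) (curvN A i y) (s i y) (u i y) us) i y std_frame"
   by (intro wsum_cong) simp
  also have "... = 2 * (\<i> * wsum I1 (%j i y us. W2 (j - 1) (curvN A i y) (s i y) (u i y) us) i y std_frame)"
   unfolding wsum_cmult by simp
  also have "\<i> * wsum I1 (%j i y us. W2 (j - 1) (curvN A i y) (s i y) (u i y) us) i y std_frame
    = trace (csm \<i> (fsym (fpost (Im_Zprime E Z A i y) [(1, adj_form (met E i y) (u i y)), (1, u i y)]) std_frame))"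
   unfolding trace_csm trace_fpost[OF U iy hs[unfolded s_def] hu] wsum_def s_def ..
  finally have W: "?W i y std_frame = 2 * trace (csm \<i> (fsym (fpost (Im_Zprime E Z A i y) [(1, adj_form (met E i y) (u i y)), (1, u i y)]) std_frame))" .
  show ?thesis
  proof (cases "\<exists>v. u i y [v] ~= 0")
   case True
   then have "trace (csm \<i> (fsym (fpost (Im_Zprime E Z A i y) [(1, adj_form (met E i y) (u i y)), (1, u i y)]) std_frame)) \<in> \<real> &
    Re (trace (csm \<i> (fsym (fpost (Im_Zprime E Z A i y) [(1, adj_form (met E i y) (u i y)), (1, u i y)]) std_frame))) > 0"
    using sub iy val(6,7)[OF iy] unfolding subsolution_def Let_def by blast
   then show ?thesis unfolding W by auto
  next
   case False
   then have u0: "u i y = (%us. 0)" using hu by (intro ext) (rule homog1_zero, auto)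
   then have "s i y = (%us. 0)" by (simp add: s_def adj_form_def fun_eq_iff)
   then have "a i y = (%us. csm 0 (u i y us))" using val(4)[OF iy] u0 by (simp add: fun_eq_iff)
   then have "?W i y std_frame = wsum I1 (%j i y us. 0 * W2 (j - 1) (curvN A i y) (u i y) (?J i y) us) i y std_frame"
    by (intro wsum_cong) (simp only: W2_csm)
   then show ?thesis using False unfolding wsum_cmult by simp
  qed
 qed
 have sf: "sform ?W"
  by (rule sform_wsum[OF finite_I(2) sform_W2[OF curvN_props(1)[OF con] skewD(1)[OF sk] skewD(1)[OF skJ]]])
 have mz: "mint E ?W = 0"
  using z[OF tangent_J[OF a]] Omega_eq[OF U skewD(2)[OF sk] skewD(2)[OF skJ] refl] by simp
 have W0: "?W i y std_frame = 0" if "i \<in> idx E" "y \<in> P i" for i y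
  by (rule mint_nonneg_zero[where f="?W", OF sform_gtop[OF sf] _ mz that]) (use pos in blast)
 show ?thesis unfolding form_eq_def
 proof (intro ballI allI)
  fix i y vs assume iy: "i \<in> idx E" "y \<in> P i"
  have "u i y [v] = 0" for v
  proof (rule ccontr)
   assume "u i y [v] ~= 0"
   then have "Re (?W i y std_frame) > 0" using pos[OF iy] by blast
   then show False unfolding W0[OF iy] by simp
  qed
  then have u0: "u i y us = 0" for us by (rule homog1_zero[OF val(2)[OF iy]])
  then have "s i y us = 0" for us by (simp add: s_def adj_form_def)
  then show "a i y vs = 0" using val(4)[OF iy] u0 by simp
 qed
qed

end

section \<open>Invariance under unitary gauge transformations\<close>

lemma wedge_conj:
 fixes f h :: "('n::finite, 'r::finite cmat) alt" and g gi :: "'r cmat"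
 assumes "gi ** g = mat 1"
 shows "wedge_mm (%us. g ** f us ** gi) (%us. g ** h us ** gi) us = g ** wedge_mm f h us ** gi"
proof -
 have l: "linear (%M :: 'r cmat. g ** M ** gi)" by (rule linearI) (simp_all add: mm_add mm_scaleR)
 have "gi ** (g ** M) = M" for M :: "'r cmat" using assms by (simp add: matrix_mul_assoc)
 then show ?thesis unfolding wedge_linear_out[OF l] by (simp add: wedge_def matrix_mul_assoc[symmetric])
qed

lemma mprod_conj:
 fixes g gi :: "'r::finite cmat" and Bs :: "('n::finite, 'r cmat) alt list"
 assumes "gi ** g = mat 1" "g ** gi = mat 1"
 shows "mprod (map (%B us. g ** B us ** gi) Bs) us = g ** mprod Bs us ** gi"
proof (induction Bs arbitrary: us)
 case Nil then show ?case by (simp add: form0_def assms)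
next
 case (Cons B Bs)
 then have "mprod (map (%B us. g ** B us ** gi) Bs) = (%us. g ** mprod Bs us ** gi)" by auto
 then show ?case by (simp add: wedge_conj[OF assms(1)])
qed

lemma trace_conj:
 fixes g gi :: "'r::finite cmat" assumes "gi ** g = mat 1" shows "trace (g ** M ** gi) = trace M"
 by (subst trace_mul_sym) (simp add: matrix_mul_assoc assms)

lemma W2_conj:
 fixes g gi :: "'r::finite cmat"
 assumes "gi ** g = mat 1" "g ** gi = mat 1"
 shows "W2 m (%us. g ** F us ** gi) (%us. g ** x us ** gi) (%us. g ** y us ** gi) us = W2 m F x y us"
 unfolding W2_def
proof (intro sum.cong refl)
 fix s
 show "trace (mprod ((%us. g ** x us ** gi) # replicate s (%us. g ** F us ** gi) @ (%us. g ** y us ** gi) # replicate (m - s) (%us. g ** F us ** gi)) us)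
  = trace (mprod (x # replicate s F @ y # replicate (m - s) F) us)"
  using mprod_conj[OF assms, of "x # replicate s F @ y # replicate (m - s) F" us] trace_conj[OF assms(1)]
  by (simp add: map_replicate del: mprod_Cons)
qed

context zbdl begin

lemma gaugeD:
 assumes G: "g \<in> gauge_group E"
 shows "end_section E g"
  and "i \<in> idx E ==> y \<in> P i ==> invertible (g i y)"
  and "i \<in> idx E ==> y \<in> P i ==> matrix_inv (g i y) ** g i y = mat 1"
  and "i \<in> idx E ==> y \<in> P i ==> g i y ** matrix_inv (g i y) = mat 1"
  and "i \<in> idx E ==> y \<in> P i ==> hadj (met E i y) (g i y) = matrix_inv (g i y)"
  and "i \<in> idx E ==> y \<in> P i ==> ctransp (g i y) ** met E i y ** g i y = met E i y"
  and "i \<in> idx E ==> y \<in> P i ==>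
   hadj (met E i y) (g i y ** M ** matrix_inv (g i y)) = g i y ** hadj (met E i y) M ** matrix_inv (g i y)"
proof -
 show e: "end_section E g" using G by (simp add: gauge_group_def)
 assume iy: "i \<in> idx E" "y \<in> P i"
 let ?H = "met E i y"
 have H: "pos_def_herm ?H" by (rule met_pos[OF iy])
 have h: "hadj ?H (g i y) ** g i y = mat 1" using G iy by (simp add: gauge_group_def)
 then have h2: "g i y ** hadj ?H (g i y) = mat 1" using matrix_left_right_inverse by metis
 show inv: "invertible (g i y)" unfolding invertible_def using h h2 by blast
 note iw = matrix_inv_works[OF inv]
 show "matrix_inv (g i y) ** g i y = mat 1" "g i y ** matrix_inv (g i y) = mat 1" by (rule iw)+
 have "matrix_inv (g i y) = hadj ?H (g i y) ** (g i y ** matrix_inv (g i y))"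
  unfolding matrix_mul_assoc h by simp
 then show hg: "hadj ?H (g i y) = matrix_inv (g i y)" unfolding iw by simp
 have "?H ** (hadj ?H (g i y) ** g i y) = ctransp (g i y) ** ?H ** g i y"
  unfolding hadj_def using pos_def_inv[OF H] by (simp add: matrix_mul_assoc)
 then show "ctransp (g i y) ** ?H ** g i y = ?H" unfolding h by simp
 have "hadj ?H (matrix_inv (g i y)) = g i y" unfolding hg[symmetric] by (rule hadj_hadj[OF H])
 then show "hadj ?H (g i y ** M ** matrix_inv (g i y)) = g i y ** hadj ?H M ** matrix_inv (g i y)"
  by (simp add: hadj_mm[OF H] hg matrix_mul_assoc)
qed

lemma end_section_inv:
 assumes G: "g \<in> gauge_group E" shows "end_section E (%i y. matrix_inv (g i y))"
 unfolding end_section_def end_form_iff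
proof (intro conjI ballI bformI homog_form0 AltF_form0)
 note gs = endsecD[OF gaugeD(1)[OF G]]
 show "smooth_fun_on (P i) (%y. form0 (matrix_inv (g i y)) us)" if i: "i \<in> idx E" for i us
  by (rule smooth_form0[OF smooth_matrix_inv[OF open_P[OF i] gs(2)[OF i] gaugeD(2)[OF G i]]])
 fix i j y us assume ij: "i \<in> idx E" "j \<in> idx E" "y \<in> overlap E i j"
 let ?y = "chg E i j y"
 have jy: "?y \<in> P j" using chg_props(4)[OF ij] .
 have "matrix_inv (g i y) = Tr i j y ** matrix_inv (g j ?y) ** matrix_inv (Tr i j y)"
 proof (rule matrix_inv_eqI)
  have c: "matrix_inv (Tr i j y) ** (Tr i j y ** M) = M" "g j ?y ** (matrix_inv (g j ?y) ** M) = M"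
   for M using Tr_inv[OF ij] gaugeD(4)[OF G ij(2) jy] by (simp_all add: matrix_mul_assoc)
  show "g i y ** (Tr i j y ** matrix_inv (g j ?y) ** matrix_inv (Tr i j y)) = mat 1"
   unfolding gs(3)[OF ij] by (simp add: matrix_mul_assoc[symmetric] c Tr_inv[OF ij])
 qed
 then show "form0 (matrix_inv (g i y)) us = Tr i j y ** pull E (%i y. form0 (matrix_inv (g i y))) i j y us ** matrix_inv (Tr i j y)"
  by (simp add: pull_def form0_def)
qed

lemma eform_conj:
 assumes G: "g \<in> gauge_group E" and B: "eform B" shows "eform (conj_form g B)"
proof (rule bform_cong)
 show "eform (%i y. wedge_mm (form0 (g i y)) (wedge_mm (B i y) (form0 (matrix_inv (g i y)))))"
  by (intro eform_wedge B endsecD(1) gaugeD(1)[OF G] end_section_inv[OF G])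
qed (simp add: conj_form_def form0_wedge[OF bb_mm] wedge_form0[OF bb_mm] matrix_mul_assoc)

text \<open>In the form A - (d_A g) g^-1 the action is a translation by a global one-form, so
  smoothness and the transformation law follow from \<open>connection_conn_add\<close>.\<close>

lemma gauge_act_eq:
 assumes G: "g \<in> gauge_group E" and A: "connection E A" and iy: "i \<in> idx E" "y \<in> P i"
 shows "gauge_act g A i y us = conn_add A (-1) (%i y. wedge_mm (cov_d A 0 (%i y. form0 (g i y)) i y) (form0 (matrix_inv (g i y)))) i y us"
  and "gauge_act g A i y [w] = g i y ** A i y [w] ** matrix_inv (g i y) - fd (g i) y w ** matrix_inv (g i y)"
proof -
 note gs = endsecD[OF gaugeD(1)[OF G]]
 have dg: "dfb (g i) y" by (rule smooth_diff_at[OF gs(2)[OF iy(1)] iy(2)])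
 have ev: "eventually (%z. invertible (g i z)) (nhds y)"
  unfolding eventually_nhds using open_P[OF iy(1)] iy(2) gaugeD(2)[OF G iy(1)] by blast
 have c: "g i y ** (matrix_inv (g i y) ** M) = M" for M
  using gaugeD(4)[OF G iy] by (simp add: matrix_mul_assoc)
 show one: "gauge_act g A i y [w] = g i y ** A i y [w] ** matrix_inv (g i y) - fd (g i) y w ** matrix_inv (g i y)" for w
  unfolding gauge_act_def conj_form_def ext_d_form0 list.case fd_matrix_inv[OF dg ev]
  by (simp add: mm_minus matrix_mul_assoc[symmetric] c)
 show "gauge_act g A i y us = conn_add A (-1) (%i y. wedge_mm (cov_d A 0 (%i y. form0 (g i y)) i y) (form0 (matrix_inv (g i y)))) i y us"
 proof (cases "length us = 1")
  case True
  then obtain w where us: "us = [w]" by (auto simp: length_Suc_conv)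
  show ?thesis unfolding us one conn_add_def wedge_form0[OF bb_mm] cov_d_0
   by (simp add: mm_add mm_diff matrix_mul_assoc[symmetric] gaugeD(4)[OF G iy])
 next
  case False
  have a: "A i y us = 0" using connD(3)[OF A iy] False by (simp add: homog_def)
  have e: "ext_d (%z. form0 (matrix_inv (g i z))) y us = 0" "(case us of [v] => fd (g i) y v | _ => 0) = 0"
   using False by (auto simp: ext_d_form0 split: list.split)
  show ?thesis unfolding gauge_act_def conj_form_def conn_add_def wedge_form0[OF bb_mm] cov_d_0 a e by simp
 qed
qed

lemma connection_cong:
 assumes "connection E B" "!!i y us. i \<in> idx E ==> y \<in> P i ==> A i y us = B i y us" shows "connection E A"
 unfolding connection_def
proof (intro conjI ballI allI)
 fix i us assume i: "i \<in> idx E"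
 show "smooth_fun_on (P i) (%y. A i y us)"
  by (rule smooth_cong[OF open_P[OF i] connD(1)[OF assms(1) i]]) (use assms(2)[OF i] in simp)
next
 fix i y assume iy: "i \<in> idx E" "y \<in> P i"
 have "A i y = B i y" using assms(2)[OF iy] by auto
 then show "altform 1 (A i y)" using assms(1) iy unfolding connection_def by auto
next
 fix i j y us assume ij: "i \<in> idx E" "j \<in> idx E" "y \<in> overlap E i j"
 have "B i y us = Tr i j y ** pull E B i j y us ** matrix_inv (Tr i j y)
   - ext_d (%z. form0 (Tr i j z)) y us ** matrix_inv (Tr i j y)"
  using assms(1) ij unfolding connection_def by blast
 then show "A i y us = Tr i j y ** pull E A i j y us ** matrix_inv (Tr i j y)
   - ext_d (%z. form0 (Tr i j z)) y us ** matrix_inv (Tr i j y)"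
  using assms(2) ij overlap_patch chg_props(4)[OF ij] by (simp add: pull_def)
qed

lemma end_form_gauge_diff:
 assumes G: "g \<in> gauge_group E" and A: "connection E A"
 shows "end_form E 1 (%i y. wedge_mm (cov_d A 0 (%i y. form0 (g i y)) i y) (form0 (matrix_inv (g i y))))"
 unfolding end_form_iff
proof (intro conjI ballI)
 note e0 = eform_cov_d0[OF A gaugeD(1)[OF G]]
 show "eform (%i y. wedge_mm (cov_d A 0 (%i y. form0 (g i y)) i y) (form0 (matrix_inv (g i y))))"
  by (rule eform_wedge[OF e0(1) endsecD(1)[OF end_section_inv[OF G]]])
 show "homog 1 (wedge_mm (cov_d A 0 (%i y. form0 (g i y)) i y) (form0 (matrix_inv (g i y))))" if "i \<in> idx E" "y \<in> P i" for i y
  using homog_wedge[OF bb_mm e0(2)[OF that] homog_form0] by simp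
qed

lemma gauge_connection:
 assumes G: "g \<in> gauge_group E" and A: "connection E A" shows "connection E (gauge_act g A)"
 by (rule connection_cong[OF connection_conn_add[OF A end_form_gauge_diff[OF G A]] gauge_act_eq(1)[OF G A]])

text \<open>Differentiating \<open>ctransp g ** H ** g = H\<close> with the help of metric
  compatibility shows that (d_A g) g^-1 is skew-Hermitian, and translations by such forms keep a
  connection unitary.\<close>

lemma gauge_unitary:
 assumes G: "g \<in> gauge_group E" and A: "unitary_connection E A" shows "unitary_connection E (gauge_act g A)"
proof -
 let ?B = "%i y. wedge_mm (cov_d A 0 (%i y. form0 (g i y)) i y) (form0 (matrix_inv (g i y)))"
 note con = unitaryD(1)[OF A]
 have sk: "skew ?B"
  unfolding skew_def
 proof (intro conjI ballI allI end_form_gauge_diff[OF G con])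
  fix i y v assume iy: "i \<in> idx E" "y \<in> P i"
  note gs = endsecD[OF gaugeD(1)[OF G]]
  let ?H = "met E i y" and ?g = "g i y" and ?a = "A i y [v]"
  let ?D = "%f. fd f y v"
  let ?X = "?D (g i) + ?a ** ?g - ?g ** ?a"
  have H: "pos_def_herm ?H" by (rule met_pos[OF iy])
  have B: "?B i y [v] = ?X ** matrix_inv ?g"
   unfolding wedge_form0[OF bb_mm] cov_d_0 by simp
  have dg: "dfb (g i) y" by (rule smooth_diff_at[OF gs(2)[OF iy(1)] iy(2)])
  have dH: "dfb (met E i) y" by (rule smooth_diff_at[OF met_smooth[OF iy(1)] iy(2)])
  have dc: "dfb (%z. ctransp (g i z)) y" by (rule diff_linear[OF bl_ctransp dg])
  have dcH: "dfb (%z. ctransp (g i z) ** met E i z) y" by (rule differentiable_mm[OF dc dH])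
  have "eventually (%z. met E i z = ctransp (g i z) ** met E i z ** g i z) (nhds y)"
   unfolding eventually_nhds using open_P[OF iy(1)] iy gaugeD(6)[OF G iy(1)] by (metis (no_types))
  then have "?D (met E i) = ?D (%z. ctransp (g i z) ** met E i z ** g i z)"
   by (simp add: fd_cong_nhds)
  also have "... = (ctransp (?D (g i)) ** ?H + ctransp ?g ** ?D (met E i)) ** ?g + ctransp ?g ** ?H ** ?D (g i)"
   unfolding fd_mm[OF dcH dg] fd_mm[OF dc dH]
    fd_linear[OF dg bl_ctransp] ..
  finally have "?H ** ?a + ctransp ?a ** ?H = (ctransp (?D (g i)) ** ?H + ctransp ?g ** (?H ** ?a + ctransp ?a ** ?H)) ** ?g + ctransp ?g ** ?H ** ?D (g i)"
   unfolding unitaryD(2)[OF A iy] .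
  moreover have "ctransp ?X ** ?H ** ?g + ctransp ?g ** ?H ** ?X =
    (ctransp (?D (g i)) ** ?H + ctransp ?g ** (?H ** ?a + ctransp ?a ** ?H)) ** ?g + ctransp ?g ** ?H ** ?D (g i)
    - ctransp ?a ** (ctransp ?g ** ?H ** ?g) - (ctransp ?g ** ?H ** ?g) ** ?a"
   by (simp add: ctransp_add ctransp_diff ctransp_mm mm_add mm_diff matrix_mul_assoc)
  ultimately have X: "ctransp ?X ** ?H ** ?g + ctransp ?g ** ?H ** ?X = 0"
   unfolding gaugeD(6)[OF G iy] by (simp add: algebra_simps)
  have "ctransp ?X ** ?H ** ?g = - (ctransp ?g ** ?H ** ?X)" using X by (simp add: eq_neg_iff_add_eq_0)
  then have X2: "matrix_inv ?H ** (ctransp (matrix_inv ?g) ** (ctransp ?X ** ?H ** ?g) ** matrix_inv ?g)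
   = - (matrix_inv ?H ** (ctransp (matrix_inv ?g) ** (ctransp ?g ** ?H ** ?X) ** matrix_inv ?g))"
   by (simp add: mm_minus)
  have cg: "ctransp (matrix_inv ?g) ** ctransp ?g = mat 1"
   unfolding ctransp_mm[symmetric] gaugeD(4)[OF G iy] by simp
  have "hadj ?H (?X ** matrix_inv ?g) = matrix_inv ?H ** (ctransp (matrix_inv ?g) ** (ctransp ?X ** ?H ** ?g) ** matrix_inv ?g)"
   unfolding hadj_def ctransp_mm
   by (simp add: matrix_mul_assoc[symmetric] gaugeD(4)[OF G iy])
  also have "... = - (matrix_inv ?H ** (ctransp (matrix_inv ?g) ** (ctransp ?g ** ?H ** ?X) ** matrix_inv ?g))" by (rule X2)
  also have "... = - (?X ** matrix_inv ?g)"
  proof -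
   have "matrix_inv ?H ** (ctransp (matrix_inv ?g) ** (ctransp ?g ** ?H ** ?X) ** matrix_inv ?g)
    = (matrix_inv ?H ** ((ctransp (matrix_inv ?g) ** ctransp ?g) ** ?H)) ** (?X ** matrix_inv ?g)"
    by (simp only: matrix_mul_assoc)
   then show ?thesis unfolding cg using pos_def_inv[OF H] by simp
  qed
  finally show "adj_form (met E i y) (?B i y) [v] = - ?B i y [v]" unfolding adj_form_def B .
 qed
 have u: "unitary_connection E (conn_add A (-1) ?B)" by (rule unitary_conn_add[OF A sk])
 show ?thesis unfolding unitary_connection_def
 proof (intro conjI ballI allI gauge_connection[OF G con])
  fix i y v assume iy: "i \<in> idx E" "y \<in> P i"
  show "ext_d (%z. form0 (met E i z)) y [v] = met E i y ** gauge_act g A i y [v] + ctransp (gauge_act g A i y [v]) ** met E i y"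
   using u iy unfolding unitary_connection_def gauge_act_eq(1)[OF G con iy] by blast
 qed
qed

lemma gauge_curv:
 assumes G: "g \<in> gauge_group E" and A: "connection E A" and iy: "i \<in> idx E" "y \<in> P i"
 shows "curv (gauge_act g A) i y us = g i y ** curv A i y us ** matrix_inv (g i y)"
  "curvN (gauge_act g A) i y = (%us. g i y ** curvN A i y us ** matrix_inv (g i y))"
proof -
 note gc = gauge_connection[OF G A]
 show c: "curv (gauge_act g A) i y us = g i y ** curv A i y us ** matrix_inv (g i y)" for us
 proof (cases "length us = 2")
  case False
  then show ?thesis using curv_homog[OF gc iy] curv_homog[OF A iy] by (simp add: homog_def)
 next
  case True
  then obtain v w where us: "us = [v, w]" by (metis One_nat_def Suc_1 length_0_conv length_Suc_conv)
  show ?thesis unfolding us curv_def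
   by (rule gauge_curvature[OF open_P[OF iy(1)] iy(2) endsecD(2)[OF gaugeD(1)[OF G] iy(1)] gaugeD(2)[OF G iy(1)]
      connD(4)[OF A iy, rule_format] gauge_act_eq(2)[OF G A iy(1)] connD(3)[OF gc iy] connD(3)[OF A iy]])
 qed
 show "curvN (gauge_act g A) i y = (%us. g i y ** curvN A i y us ** matrix_inv (g i y))"
  unfolding curvN_def c by (simp add: csm_mm)
qed

text \<open>The action sends A + B to the transform of A plus the conjugate of B. Curvatures are
  conjugated, and so are the quadratic terms; the part linear in B is the covariant
  derivative.\<close>

lemma gauge_cov_d1:
 assumes G: "g \<in> gauge_group E" and A: "connection E A" and B: "end_form E 1 B" and iy: "i \<in> idx E" "y \<in> P i"
 shows "cov_d (gauge_act g A) 1 (conj_form g B) i y us = g i y ** cov_d A 1 B i y us ** matrix_inv (g i y)"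
proof -
 note gc = gauge_connection[OF G A] and cB = connection_conn_add[OF A B, of 1]
 have cf: "end_form E 1 (conj_form g B)"
  using B eform_conj[OF G] unfolding end_form_iff by (auto simp: homog_def conj_form_def)
 have e: "gauge_act g (conn_add A 1 B) i = conn_add (gauge_act g A) 1 (conj_form g B) i" for i
  by (auto simp: fun_eq_iff gauge_act_def conj_form_def conn_add_def mm_add)
 have c1: "curv (conn_add (gauge_act g A) 1 (conj_form g B)) i y us = g i y ** curv (conn_add A 1 B) i y us ** matrix_inv (g i y)"
  using gauge_curv(1)[OF G cB iy, of us] unfolding curv_def e .
 have w: "wedge_mm (conj_form g B i y) (conj_form g B i y) us = g i y ** wedge_mm (B i y) (B i y) us ** matrix_inv (g i y)"
  unfolding conj_form_def by (rule wedge_conj[OF gaugeD(3)[OF G iy]])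
 show ?thesis using c1
  unfolding curv_conn_add[OF A B iy] curv_conn_add[OF gc cf iy] gauge_curv(1)[OF G A iy] w
  by (simp add: mm_add)
qed

lemma part01_conj:
 fixes g gi :: "'r cmat" and f :: "('n, 'r cmat) alt"
 shows "part01 (%us. g ** f us ** gi) = (%us. g ** part01 f us ** gi)"
 by (simp add: part01_def csm_mm mm_add)

lemma end_form_part01:
 assumes "a \<in> tangent_space E A" shows "end_form E 1 (%i y. part01 (a i y))"
 unfolding end_form_iff part01_Jf
proof (intro conjI ballI)
 show "eform (%i y vs. csm (1 / 2) (a i y vs + csm \<i> (Jf (a i y) vs)))"
  by (intro eform_csm eform_add skewD(1)[OF tangent_skew[OF assms]] skewD(1)[OF tangent_skew[OF tangent_J[OF assms]]])
 show "homog 1 (%vs. csm (1 / 2) (a i y vs + csm \<i> (Jf (a i y) vs)))" if "i \<in> idx E" "y \<in> P i" for i y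
  using skewD(2)[OF tangent_skew[OF assms] that] by (simp add: homog_def Jf_def)
qed

text \<open>Conjugation by \<open>g\<close> matches the test vectors of the two connections. As
  \<open>g\<close> is unitary it commutes with the adjoint, and it disappears under the
  trace.\<close>

theorem gauge_subsolution:
 assumes G: "g \<in> gauge_group E" and A: "A \<in> subsolution_space E Z"
 shows "gauge_act g A \<in> subsolution_space E Z"
proof -
 have U: "unitary_connection E A" and sub: "subsolution E Z A"
  and c02: "!!i y v w. i \<in> idx E ==> y \<in> P i ==> part02 (curv A i y) v w = 0"
  using A by (auto simp: subsolution_space_def chern_space_def)
 note con = unitaryD(1)[OF U] and U' = gauge_unitary[OF G U]
 have "part02 (curv (gauge_act g A) i y) v w = 0" if iy: "i \<in> idx E" "y \<in> P i" for i y v w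
 proof -
  have "part02 (curv (gauge_act g A) i y) v w = g i y ** part02 (curv A i y) v w ** matrix_inv (g i y)"
   unfolding part02_def gauge_curv(1)[OF G con iy] by (simp add: csm_mm mm_add mm_diff)
  then show ?thesis using c02[OF iy] by simp
 qed
 moreover have "subsolution E Z (gauge_act g A)"
  unfolding subsolution_def
 proof (intro ballI allI impI)
  fix i y and u :: "('n, 'r cmat) alt"
  assume iy: "i \<in> idx E" "y \<in> P i" and u: "altform 1 u & (\<forall>v. u [\<i> *s v] = csm (- \<i>) (u [v])) & (\<exists>v. u [v] ~= 0)"
  let ?g = "g i y" and ?gi = "matrix_inv (g i y)" and ?H = "met E i y"
  let ?u = "%us. ?gi ** u us ** ?g"
  have ig: "?gi ** ?g = mat 1" "?g ** ?gi = mat 1" using gaugeD(3,4)[OF G iy] by auto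
  have c: "?gi ** (?g ** M) = M" "?g ** (?gi ** M) = M" for M using ig by (simp_all add: matrix_mul_assoc)
  have uu: "u = (%us. ?g ** ?u us ** ?gi)" by (simp add: matrix_mul_assoc[symmetric] c ig)
  have hu: "homog 1 u" "AltF u" using u altform_iff by blast+
  have hu': "homog 1 ?u" using hu by (simp add: homog_def)
  have "AltF ?u" by (rule AltF_linear[OF hu(2)]) (rule linear_conj)
  then have alt: "altform 1 ?u" using hu' altform_iff by blast
  have i1: "?u [\<i> *s v] = csm (- \<i>) (?u [v])" for v
  proof -
   have "u [\<i> *s v] = csm (- \<i>) (u [v])" using u by blast
   then show ?thesis by (simp add: csm_mm mm_minus)
  qed
  have nz: "\<exists>v. ?u [v] ~= 0"
  proof -
   obtain v where "u [v] ~= 0" using u by blast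
   then have "?u [v] ~= 0" using fun_cong[OF uu, of "[v]"] by auto
   then show ?thesis by blast
  qed
  have adj: "adj_form ?H u = (%us. ?g ** adj_form ?H ?u us ** ?gi)"
  proof
   fix us
   have "adj_form ?H u us = hadj ?H (?g ** ?u us ** ?gi)" unfolding adj_form_def using fun_cong[OF uu, of us] by simp
   also have "... = ?g ** hadj ?H (?u us) ** ?gi" by (rule gaugeD(7)[OF G iy])
   finally show "adj_form ?H u us = ?g ** adj_form ?H ?u us ** ?gi" unfolding adj_form_def .
  qed
  have ha: "homog 1 (adj_form ?H w)" if "homog 1 w" for w using that by (simp add: homog_def adj_form_def)
  have W: "W2 m (curvN (gauge_act g A) i y) (adj_form ?H u) u us = W2 m (curvN A i y) (adj_form ?H ?u) ?u us" for m us
  proof -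
   have "W2 m (curvN (gauge_act g A) i y) (adj_form ?H u) u us
    = W2 m (%us. ?g ** curvN A i y us ** ?gi) (%us. ?g ** adj_form ?H ?u us ** ?gi) (%us. ?g ** ?u us ** ?gi) us"
    unfolding adj[symmetric] uu[symmetric] gauge_curv(2)[OF G con iy] ..
   then show ?thesis unfolding W2_conj[OF ig] .
  qed
  have W': "W2 m (curvN (gauge_act g A) i y) (adj_form ?H u) u = W2 m (curvN A i y) (adj_form ?H ?u) ?u" for m
   using W by (intro ext)
  have "trace (fsym (fpost (Im_Zprime E Z (gauge_act g A) i y) [(1, adj_form ?H u), (1, u)]) std_frame)
   = trace (fsym (fpost (Im_Zprime E Z A i y) [(1, adj_form ?H ?u), (1, ?u)]) std_frame)"
   unfolding trace_fpost[OF U' iy ha[OF hu(1)] hu(1)] trace_fpost[OF U iy ha[OF hu'] hu'] W' ..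
  moreover have "let T = trace (csm \<i> (fsym (fpost (Im_Zprime E Z A i y) [(1, adj_form ?H ?u), (1, ?u)]) std_frame)) in T \<in> \<real> & 0 < Re T"
   using sub iy alt i1 nz unfolding subsolution_def by blast
  ultimately show "let T = trace (csm \<i> (fsym (fpost (Im_Zprime E Z (gauge_act g A) i y) [(1, adj_form ?H u), (1, u)]) std_frame)) in T \<in> \<real> & 0 < Re T"
   by simp
 qed
 ultimately show ?thesis using U' by (simp add: subsolution_space_def chern_space_def)
qed

theorem gauge_tangent:
 assumes G: "g \<in> gauge_group E" and A: "unitary_connection E A" and a: "a \<in> tangent_space E A"
 shows "conj_form g a \<in> tangent_space E (gauge_act g A)"
 unfolding tangent_space_def
proof (intro CollectI conjI ballI allI)
 note con = unitaryD(1)[OF A] and sk = tangent_skew[OF a]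
 show "end_form E 1 (conj_form g a)"
  using skew_end[OF sk] eform_conj[OF G] unfolding end_form_iff by (auto simp: homog_def conj_form_def)
 show "adj_form (met E i y) (conj_form g a i y) [v] = - conj_form g a i y [v]" if iy: "i \<in> idx E" "y \<in> P i" for i y v
  unfolding adj_form_def conj_form_def gaugeD(7)[OF G iy] skewD(4)[OF sk iy] by (simp add: mm_minus)
 fix i y v w assume iy: "i \<in> idx E" "y \<in> P i"
 have e: "(%j z. part01 (conj_form g a j z)) = conj_form g (%j z. part01 (a j z))"
  unfolding conj_form_def part01_conj by (rule refl)
 have "part02 (cov_d (gauge_act g A) 1 (%j z. part01 (conj_form g a j z)) i y) v w
  = g i y ** part02 (cov_d A 1 (%j z. part01 (a j z)) i y) v w ** matrix_inv (g i y)"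
  unfolding e part02_def gauge_cov_d1[OF G con end_form_part01[OF a] iy] by (simp add: csm_mm mm_add mm_diff)
 also have "part02 (cov_d A 1 (%j z. part01 (a j z)) i y) v w = 0"
  using a iy unfolding tangent_space_def by blast
 finally show "part02 (cov_d (gauge_act g A) 1 (%j z. part01 (conj_form g a j z)) i y) v w = 0" by simp
qed

theorem gauge_Omega:
 assumes G: "g \<in> gauge_group E" and A: "unitary_connection E A" and a: "skew a" and b: "skew b"
 shows "Omega_Z E Z (gauge_act g A) (conj_form g a) (conj_form g b) = Omega_Z E Z A a b"
proof -
 note con = unitaryD(1)[OF A]
 have h: "homog 1 (conj_form g x i y)" if "skew x" "i \<in> idx E" "y \<in> P i" for x i y
  using skewD(2)[OF that] by (simp add: homog_def conj_form_def)
 have "Omega_Z E Z (gauge_act g A) (conj_form g a) (conj_form g b)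
  = mint E (wsum I1 (%j i y. W2 (j - 1) (%us. g i y ** curvN A i y us ** matrix_inv (g i y)) (conj_form g a i y) (conj_form g b i y)))"
  by (rule Omega_eq[OF gauge_unitary[OF G A] h[OF a] h[OF b] gauge_curv(2)[OF G con]])
 also have "... = mint E (wsum I1 (%j i y. W2 (j - 1) (curvN A i y) (a i y) (b i y)))"
 proof (intro mint_cong wsum_cong)
  fix i y us and d j l :: nat assume iy: "i \<in> idx E" "y \<in> P i"
  show "W2 (j - 1) (%us. g i y ** curvN A i y us ** matrix_inv (g i y)) (conj_form g a i y) (conj_form g b i y) us
    = W2 (j - 1) (curvN A i y) (a i y) (b i y) us"
   unfolding conj_form_def by (rule W2_conj[OF gaugeD(3,4)[OF G iy]])
 qed
 also have "... = Omega_Z E Z A a b"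
  by (rule Omega_eq[OF A skewD(2)[OF a] skewD(2)[OF b] refl, symmetric])
 finally show ?thesis .
qed

theorem gauge_moment_map:
 assumes G: "g \<in> gauge_group E" and A: "unitary_connection E A"
 shows "form_eq E (moment_map E Z (gauge_act g A)) (conj_form g (moment_map E Z A))"
 unfolding form_eq_def
proof (intro ballI allI)
 fix i y us assume iy: "i \<in> idx E" "y \<in> P i"
 let ?g = "g i y" and ?gi = "matrix_inv (g i y)"
 note con = unitaryD(1)[OF A]
 have ig: "?gi ** ?g = mat 1" "?g ** ?gi = mat 1" using gaugeD(3,4)[OF G iy] by auto
 have l: "linear (%M :: 'r cmat. ?g ** M ** ?gi)" by (rule linear_conj)
 have m: "mprod (replicate j (%us. ?g ** curvN A i y us ** ?gi)) = (%us. ?g ** mprod (replicate j (curvN A i y)) us ** ?gi)" for j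
  using mprod_conj[OF ig, of "replicate j (curvN A i y)"] by (auto simp: map_replicate)
 have w: "wedge_cm c (%us. ?g ** f us ** ?gi) us = ?g ** wedge_cm c f us ** ?gi" for c f us
  unfolding wedge_linear_out[OF l] by (simp add: wedge_def csm_mm)
 have "D_Z E Z (gauge_act g A) i y us = ?g ** D_Z E Z A i y us ** ?gi"
  unfolding D_Z_expand[OF gauge_unitary[OF G A] iy] D_Z_expand[OF A iy] gauge_curv(2)[OF G con iy] m w
   linear_sum[OF l] by (intro sum.cong refl) (auto simp: mm_scaleR)
 then show "moment_map E Z (gauge_act g A) i y us = conj_form g (moment_map E Z A) i y us"
  by (simp add: moment_map_def conj_form_def csm_mm)
qed

end

section \<open>Termwise differentiation of series\<close>

lemma series_has_derivative:
 fixes f :: "nat => 'a::real_normed_vector => 'b::banach"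
 assumes S: "open S" "convex S" and d: "!!k y. y \<in> S ==> (f k has_derivative f' k y) (at y)"
  and b: "!!k y h. y \<in> S ==> norm (f' k y h) <= B k * norm h" and B: "summable B"
  and s: "!!y. y \<in> S ==> summable (%k. f k y)" and y: "y \<in> S"
 shows "((%y. \<Sum>k. f k y) has_derivative (%h. \<Sum>k. f' k y h)) (at y)"
proof -
 have "\<exists>g. \<forall>x\<in>S. (%n. f n x) sums g x & (g has_derivative (%h. \<Sum>k. f' k x h)) (at x within S)"
 proof (rule has_derivative_series[where S=S and f=f and f'=f' and g'="%x h. \<Sum>k. f' k x h" and x=y, OF S(2) _ _ y])
  show "(f n has_derivative f' n x) (at x within S)" if "x \<in> S" for n x
   by (rule has_derivative_at_withinI[OF d[OF that]])
  show "(%n. f n y) sums (\<Sum>n. f n y)" by (rule summable_sums[OF s[OF y]])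
  fix e :: real assume "e > 0"
  then obtain N where N: "!!n. n >= N ==> norm (\<Sum>i. B (i + n)) < e" using suminf_exist_split[OF _ B] by blast
  have "norm ((\<Sum>i<n. f' i x h) - (\<Sum>i. f' i x h)) <= e * norm h" if n: "n >= N" and x: "x \<in> S" for n x h
  proof -
   have sB: "summable (%i. B i * norm h)" by (rule summable_mult2[OF B])
   have sf: "summable (%i. f' i x h)" by (rule summable_comparison_test'[OF sB]) (rule b[OF x])
   have "norm ((\<Sum>i<n. f' i x h) - (\<Sum>i. f' i x h)) = norm (\<Sum>i. f' (i + n) x h)"
    unfolding suminf_minus_initial_segment[OF sf] by (rule norm_minus_commute)
   also have "... <= (\<Sum>i. B (i + n) * norm h)"
    by (rule norm_suminf_le[OF b[OF x] summable_ignore_initial_segment[OF sB]])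
   also have "... = (\<Sum>i. B (i + n)) * norm h"
    by (rule suminf_mult2[symmetric, OF summable_ignore_initial_segment[OF B]])
   also have "... <= e * norm h" using N[OF n] by (intro mult_right_mono) auto
   finally show ?thesis .
  qed
  then show "\<forall>\<^sub>F n in sequentially. \<forall>x\<in>S. \<forall>h. norm ((\<Sum>i<n. f' i x h) - (\<Sum>k. f' k x h)) <= e * norm h"
   unfolding eventually_sequentially by blast
 qed
 then obtain g where g: "!!x. x \<in> S ==> (%n. f n x) sums g x" "(g has_derivative (%h. \<Sum>k. f' k y h)) (at y within S)"
  using y by blast
 have "(g has_derivative (%h. \<Sum>k. f' k y h)) (at y)" using g(2) at_within_open[OF y S(1)] by simp
 moreover have "eventually (%z. (\<Sum>k. f k z) = g z) (nhds y)"
  unfolding eventually_nhds using S(1) y g(1) sums_unique by metis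
 ultimately show ?thesis by (simp add: has_derivative_cong_nhds)
qed

lemma power_series_derivative:
 fixes c :: "nat => 'b::banach"
 assumes c: "!!T. T >= 0 ==> summable (%k. norm (c k) * T ^ k)"
 shows "hvd (%t. \<Sum>k. t ^ k *\<^sub>R c k) (\<Sum>k. (real k * t ^ (k - 1)) *\<^sub>R c k) t"
  "summable (%k. (t::real) ^ k *\<^sub>R c k)" "summable (%k. (real k * t ^ (k - 1)) *\<^sub>R c k)"
proof -
 \<comment> \<open>The margin 1 makes \<open>t\<close> interior to the ball of radius
   \<open>T\<close>, and \<open>T >= 1\<close> gives k x^(k-1) <= (2 T)^k by way of k <=
   2^k.\<close>
 define T where "T = \<bar>t\<bar> + 1"
 have T: "T >= 1" by (simp add: T_def)
 have k2: "real k * x ^ (k - 1) <= (2 * T) ^ k" if "0 <= x" "x <= T" for x k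
 proof -
  have "real k <= 2 ^ k" by (metis less_exp of_nat_less_iff less_imp_le of_nat_numeral of_nat_power)
  moreover have "x ^ (k - 1) <= T ^ k"
   using power_mono[OF that(2,1), of "k - 1"] power_increasing[of "k - 1" k T] T by simp
  ultimately show ?thesis unfolding power_mult_distrib using that by (intro mult_mono) auto
 qed
 have b: "norm ((real k * x ^ (k - 1)) *\<^sub>R c k) <= norm (c k) * (2 * T) ^ k" if "\<bar>x\<bar> <= T" for x k
  using mult_left_mono[OF k2[of "\<bar>x\<bar>" k], of "norm (c k)"] that by (simp add: abs_mult power_abs mult.commute)
 have B: "summable (%k. norm (c k) * (2 * T) ^ k)" by (rule c) (use T in simp)
 have s: "summable (%k. x ^ k *\<^sub>R c k)" for x :: real
  by (rule summable_comparison_test'[OF c[of "\<bar>x\<bar>"]]) (simp_all add: power_abs mult.commute)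
 show "summable (%k. t ^ k *\<^sub>R c k)" by (rule s)
 show sd: "summable (%k. (real k * t ^ (k - 1)) *\<^sub>R c k)"
  by (rule summable_comparison_test'[OF B b]) (simp add: T_def)
 have "((%t. \<Sum>k. t ^ k *\<^sub>R c k) has_derivative (%h. \<Sum>k. h *\<^sub>R (real k * t ^ (k - 1)) *\<^sub>R c k)) (at t)"
 proof (rule series_has_derivative[where S="ball 0 T" and B="%k. norm (c k) * (2 * T) ^ k"
    and f="%k t. t ^ k *\<^sub>R c k" and f'="%k t h. h *\<^sub>R (real k * t ^ (k - 1)) *\<^sub>R c k"])
  show "((%t. t ^ k *\<^sub>R c k) has_derivative (%h. h *\<^sub>R (real k * y ^ (k - 1)) *\<^sub>R c k)) (at y)" for k and y :: real
   by (auto intro!: derivative_eq_intros simp: algebra_simps)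
  show "norm (h *\<^sub>R (real k * y ^ (k - 1)) *\<^sub>R c k) <= norm (c k) * (2 * T) ^ k * norm h" if "y \<in> ball 0 T" for k y h
   using mult_right_mono[OF b[of y k], of "norm h"] that by (simp add: abs_mult mult.commute mult.left_commute)
  show "t \<in> ball 0 T" by (simp add: T_def)
 qed (use s B in auto)
 moreover have "(\<Sum>k. h *\<^sub>R (real k * t ^ (k - 1)) *\<^sub>R c k) = h *\<^sub>R (\<Sum>k. (real k * t ^ (k - 1)) *\<^sub>R c k)" for h
  by (rule suminf_scaleR_right[OF sd, symmetric])
 ultimately show "hvd (%t. \<Sum>k. t ^ k *\<^sub>R c k) (\<Sum>k. (real k * t ^ (k - 1)) *\<^sub>R c k) t"
  unfolding has_vector_derivative_def by simp
qed

section \<open>The matrix exponential\<close>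

lemma mm_norm: obtains K where "K > 0" "!!(A :: 'r::finite cmat) (B :: 'r cmat). norm (A ** B) <= K * norm A * norm B"
proof -
 obtain K where K: "K > 0" "!!(A :: 'r cmat) (B :: 'r cmat). norm (A ** B) <= norm A * norm B * K"
  using bounded_bilinear.pos_bounded[OF bb_mm] by blast
 then show ?thesis using that[of K] by (simp add: mult.commute mult.left_commute)
qed

lemma mpow_comm: "mpow M k ** M = M ** mpow M k"
 by (induction k) (simp_all add: matrix_mul_assoc[symmetric])

lemma mpow_scaleR: "mpow (t *\<^sub>R M) k = t ^ k *\<^sub>R mpow M k"
 by (induction k) (simp_all add: mm_scaleR)

lemma mexp_coeff_summable:
 fixes M :: "'r::finite cmat"
 shows "T >= 0 ==> summable (%k. norm ((1 / fact k) *\<^sub>R mpow M k) * T ^ k)"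
proof -
 assume T: "T >= 0"
 obtain K where K: "K > 0" "!!(A :: 'r cmat) (B :: 'r cmat). norm (A ** B) <= K * norm A * norm B" using mm_norm by blast
 have p: "norm (mpow M k) <= norm (mat 1 :: 'r cmat) * (K * norm M) ^ k" for k
 proof (induction k)
  case (Suc k)
  have "norm (mpow M (Suc k)) <= K * norm M * norm (mpow M k)" unfolding mpow.simps by (rule K(2))
  also have "... <= K * norm M * (norm (mat 1 :: 'r cmat) * (K * norm M) ^ k)"
   using K(1) Suc by (intro mult_left_mono) auto
  finally show ?case by (simp add: mult.commute mult.left_commute)
 qed simp
 have "summable (%k. norm (mat 1 :: 'r cmat) * (inverse (fact k) * (K * norm M * T) ^ k))"
  by (intro summable_mult summable_exp)
 then show ?thesis
 proof (rule summable_comparison_test')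
  fix k
  have "norm (mpow M k) * (T ^ k / fact k) <= norm (mat 1 :: 'r cmat) * (K * norm M) ^ k * (T ^ k / fact k)"
   by (rule mult_right_mono[OF p]) (use T in auto)
  then show "norm (norm ((1 / fact k) *\<^sub>R mpow M k) * T ^ k) <= norm (mat 1 :: 'r cmat) * (inverse (fact k) * (K * norm M * T) ^ k)"
   using T by (simp add: power_mult_distrib field_simps)
 qed
qed

lemma mexp_series: "mexp (t *\<^sub>R M) = (\<Sum>k. t ^ k *\<^sub>R ((1 / fact k) *\<^sub>R mpow M k))"
 unfolding mexp_def mpow_scaleR by (simp add: mult.commute)

lemma mexp_derivative:
 fixes M :: "'r::finite cmat"
 shows
 "hvd (%t. mexp (t *\<^sub>R M)) (M ** mexp (t *\<^sub>R M)) t" "M ** mexp (t *\<^sub>R M) = mexp (t *\<^sub>R M) ** M"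
proof -
 let ?c = "%k. (1 / fact k) *\<^sub>R mpow M k"
 note ps = power_series_derivative[of ?c t, OF mexp_coeff_summable]
 have "(\<Sum>k. (real (Suc k) * t ^ (Suc k - 1)) *\<^sub>R ?c (Suc k)) = (\<Sum>k. (real k * t ^ (k - 1)) *\<^sub>R ?c k)"
  using suminf_split_head[OF ps(3)] by simp
 moreover have "(real (Suc k) * t ^ (Suc k - 1)) *\<^sub>R ?c (Suc k) = M ** (t ^ k *\<^sub>R ?c k)" for k
  by (simp add: mm_scaleR)
 moreover have bl: "bounded_linear (%N :: 'r cmat. M ** N)" "bounded_linear (%N :: 'r cmat. N ** M)"
  by (rule bounded_bilinear.bounded_linear_right[OF bb_mm] bounded_bilinear.bounded_linear_left[OF bb_mm])+
 moreover have "(\<Sum>k. M ** (t ^ k *\<^sub>R ?c k)) = M ** mexp (t *\<^sub>R M)"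
  unfolding mexp_series by (rule bounded_linear.suminf[OF bl(1) ps(2), symmetric])
 ultimately show "hvd (%t. mexp (t *\<^sub>R M)) (M ** mexp (t *\<^sub>R M)) t"
  using ps(1) unfolding mexp_series by simp
 have mc: "M ** (t ^ k *\<^sub>R ?c k) = (t ^ k *\<^sub>R ?c k) ** M" for k by (simp add: mm_scaleR mpow_comm)
 show "M ** mexp (t *\<^sub>R M) = mexp (t *\<^sub>R M) ** M"
 proof -
  have a: "M ** mexp (t *\<^sub>R M) = (\<Sum>k. M ** (t ^ k *\<^sub>R ?c k))"
   unfolding mexp_series by (rule bounded_linear.suminf[OF bl(1) ps(2)])
  have b: "mexp (t *\<^sub>R M) ** M = (\<Sum>k. (t ^ k *\<^sub>R ?c k) ** M)"
   unfolding mexp_series by (rule bounded_linear.suminf[OF bl(2) ps(2)])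
  show ?thesis unfolding a b mc ..
 qed
qed

lemma mexp_0 [simp]: "mexp 0 = mat 1"
proof -
 have "(\<Sum>k. (1 / fact k) *\<^sub>R mpow (0 :: 'a cmat) k) = (\<Sum>k\<in>{0}. (1 / fact k) *\<^sub>R mpow (0 :: 'a cmat) k)"
  by (rule suminf_finite) (auto simp: gr0_conv_Suc neq0_conv[symmetric])
 then show ?thesis by (simp add: mexp_def)
qed

text \<open>Along \<open>t *\<^sub>R M\<close> the product of the two exponentials has derivative
  zero, and at t = 0 it is the identity.\<close>

lemma mexp_inverse: "mexp M ** mexp (- M) = mat 1"
proof -
 let ?f = "%t. mexp (t *\<^sub>R M) ** mexp (t *\<^sub>R (- M))"
 have "hvd ?f 0 t" for t
 proof -
  have "hvd ?f (mexp (t *\<^sub>R M) ** (- M ** mexp (t *\<^sub>R (- M))) + (M ** mexp (t *\<^sub>R M)) ** mexp (t *\<^sub>R (- M))) t"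
   by (rule bounded_bilinear.has_vector_derivative[OF bb_mm mexp_derivative(1) mexp_derivative(1)])
  then show ?thesis unfolding mexp_derivative(2)[of M] by (simp add: mm_minus matrix_mul_assoc)
 qed
 then obtain c where c: "!!t. ?f t = c"
  using has_vector_derivative_zero_constant[OF convex_UNIV, of ?f] by (metis UNIV_I)
 show ?thesis using c[of 1] c[of 0] by simp
qed

lemma matrix_inv_mexp: "matrix_inv (mexp M) = mexp (- M)"
 by (rule matrix_inv_eqI[OF mexp_inverse])

section \<open>Uniform bounds for iterated derivatives\<close>

text \<open>All iterated directional derivatives up to order \<open>m\<close> are bounded on
  \<open>S\<close> by \<open>B\<close> times the product of the lengths of the directions. The
  scaling keeps a single constant for all directions, as termwise differentiation requires.\<close>

fun bnd :: "nat => 'a::euclidean_space set => ('a => 'b::real_normed_vector) => real => bool" where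
 "bnd 0 S f B \<longleftrightarrow> (\<forall>y\<in>S. norm (f y) <= B)"
| "bnd (Suc m) S f B \<longleftrightarrow> (\<forall>y\<in>S. dfb f y & norm (f y) <= B) & (\<forall>v. bnd m S (%y. fd f y v) (B * norm v))"

lemma bnd_norm: "bnd m S f B ==> y \<in> S ==> norm (f y) <= B" by (cases m) auto

lemma bnd_cong: "open S ==> (!!y. y \<in> S ==> f y = g y) ==> bnd m S f B ==> bnd m S g B"
proof (induction m arbitrary: f g B)
 case (Suc m)
 have "bnd m S (%y. fd g y v) (B * norm v)" for v
  by (rule Suc.IH[OF Suc.prems(1), of "%y. fd f y v"])
    (use Suc.prems fd_cong_open[OF Suc.prems(1) _ Suc.prems(2)] in auto)
 moreover have "dfb g y" if "y \<in> S" for y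
  using differentiable_cong_open[OF Suc.prems(1) that Suc.prems(2)] Suc.prems(3) that by auto
 ultimately show ?case using Suc.prems by auto
qed auto

lemma bnd_mono: "B <= C ==> bnd m S f B ==> bnd m S f C"
proof (induction m arbitrary: f B C)
 case (Suc m)
 have "bnd m S (%y. fd f y v) (C * norm v)" for v
  by (rule Suc.IH[of "B * norm v"]) (use Suc.prems in \<open>auto intro: mult_right_mono\<close>)
 then show ?case using Suc.prems by force
qed force

lemma bnd_Suc: "bnd (Suc m) S f B ==> bnd m S f B"
proof (induction m arbitrary: f B)
 case (Suc m)
 have "bnd m S (%y. fd f y v) (B * norm v)" for v by (rule Suc.IH) (use Suc.prems in auto)
 then show ?case using Suc.prems by auto
qed auto

lemma bnd_add: "open S ==> bnd m S f B ==> bnd m S g C ==> bnd m S (%y. f y + g y) (B + C)"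
proof (induction m arbitrary: f g B C)
 case 0 then show ?case by (auto intro: norm_triangle_mono)
next
 case (Suc m)
 have "bnd m S (%y. fd (%y. f y + g y) y v) ((B + C) * norm v)" for v
  unfolding distrib_right
  by (rule bnd_cong[OF Suc.prems(1) _ Suc.IH[OF Suc.prems(1), of "%y. fd f y v" _ "%y. fd g y v"]])
    (use Suc.prems in \<open>auto simp: fd_add\<close>)
 then show ?case using Suc.prems by (auto intro: norm_triangle_mono)
qed

lemma bnd_scaleR: "open S ==> bnd m S f B ==> bnd m S (%y. r *\<^sub>R f y) (\<bar>r\<bar> * B)"
proof (induction m arbitrary: f B)
 case 0 then show ?case by (auto intro: mult_left_mono)
next
 case (Suc m)
 have "bnd m S (%y. fd (%y. r *\<^sub>R f y) y v) (\<bar>r\<bar> * (B * norm v))" for v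
  by (rule bnd_cong[OF Suc.prems(1) _ Suc.IH[OF Suc.prems(1), of "%y. fd f y v"]])
    (use Suc.prems in \<open>auto simp: fd_scaleR\<close>)
 then show ?case using Suc.prems by (auto intro: mult_left_mono simp: mult.assoc)
qed

lemma bnd_const: "bnd m S (%y. c :: 'b::real_normed_vector) (norm c)"
proof (induction m arbitrary: c)
 case (Suc m)
 have "bnd m S (%y. 0 :: 'b) (norm c * norm v)" for v :: 'a
  by (rule bnd_mono[OF _ Suc.IH[of 0]]) simp
 then show ?case by (simp add: frechet_derivative_const)
qed simp

text \<open>The factor \<open>2 ^ m\<close> counts the terms of the iterated product rule.\<close>

lemma bnd_bilinear:
 assumes S: "open S" and bb: "bounded_bilinear bm" and K: "K >= 0" "!!a b. norm (bm a b) <= K * norm a * norm b"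
 shows "bnd m S f B ==> bnd m S g C ==> B >= 0 ==> C >= 0 ==> bnd m S (%y. bm (f y) (g y)) (2 ^ m * K * B * C)"
proof (induction m arbitrary: f g B C)
 case 0
 have "norm (bm (f y) (g y)) <= K * B * C" if "y \<in> S" for y
 proof -
  have "norm (bm (f y) (g y)) <= K * norm (f y) * norm (g y)" by (rule K(2))
  also have "... <= K * B * C" using 0 that K(1) by (intro mult_mono mult_left_mono) auto
  finally show ?thesis .
 qed
 then show ?case by simp
next
 case (Suc m)
 have n: "norm (bm (f y) (g y)) <= 2 ^ Suc m * K * B * C" if "y \<in> S" for y
 proof -
  have "norm (bm (f y) (g y)) <= 2 ^ m * K * B * C"
   by (rule bnd_norm[OF Suc.IH[OF bnd_Suc[OF Suc.prems(1)] bnd_Suc[OF Suc.prems(2)] Suc.prems(3,4)] that])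
  also have "... <= 2 ^ Suc m * K * B * C" using Suc.prems K(1) by simp
  finally show ?thesis .
 qed
 have "bnd m S (%y. fd (%y. bm (f y) (g y)) y v) (2 ^ Suc m * K * B * C * norm v)" for v
 proof -
  have "bnd m S (%y. bm (fd f y v) (g y) + bm (f y) (fd g y v)) (2 ^ m * K * (B * norm v) * C + 2 ^ m * K * B * (C * norm v))"
   by (intro bnd_add[OF S] Suc.IH bnd_Suc[OF Suc.prems(1)] bnd_Suc[OF Suc.prems(2)]) (use Suc.prems in auto)
  then have "bnd m S (%y. bm (fd f y v) (g y) + bm (f y) (fd g y v)) (2 ^ Suc m * K * B * C * norm v)"
   by (rule bnd_mono[rotated]) simp
  then show ?thesis
   by (rule bnd_cong[OF S, rotated]) (use Suc.prems(1,2) in \<open>simp add: fd_bilinear[OF bb]\<close>)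
 qed
 then show ?case using n Suc.prems by (simp add: diff_bilinear[OF bb])
qed

lemma bnd_mpow:
 assumes S: "open S" and K: "K >= 0" "!!(a :: 'r::finite cmat) (b :: 'r cmat). norm (a ** b) <= K * norm a * norm b"
  and V: "bnd m S V B" "B >= 0"
 shows "bnd m S (%y. mpow (V y :: 'r cmat) k) (norm (mat 1 :: 'r cmat) * (2 ^ m * K * B) ^ k)"
proof (induction k)
 case 0
 show ?case using bnd_const[of m S "mat 1 :: 'r cmat"] by simp
next
 case (Suc k)
 have "bnd m S (%y. V y ** mpow (V y) k) (2 ^ m * K * B * (norm (mat 1 :: 'r cmat) * (2 ^ m * K * B) ^ k))"
  by (rule bnd_bilinear[OF S bb_mm K V(1) Suc V(2)]) (use K V in auto)
 then show ?case by (simp add: mult.commute mult.left_commute)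
qed

lemma fd_Basis:
 fixes f :: "'a::euclidean_space => 'b::real_normed_vector"
 assumes "dfb f y" shows "fd f y v = (\<Sum>b\<in>Basis. (v \<bullet> b) *\<^sub>R fd f y b)"
proof -
 note l = linear_frechet_derivative[OF assms]
 have "fd f y v = fd f y (\<Sum>b\<in>Basis. (v \<bullet> b) *\<^sub>R b)" by (simp add: euclidean_representation)
 then show ?thesis unfolding linear_sum[OF l] linear_scale[OF l] .
qed

text \<open>Compactness bounds the function and its derivatives along basis vectors; linearity in
  the direction extends the bound to all directions.\<close>

lemma bnd_smooth:
 assumes P: "open P" and C: "compact C" "S \<subseteq> C" "C \<subseteq> P" and S: "open S" and f: "smooth_fun_on P (f :: 'a::euclidean_space => 'b::real_normed_vector)"
 shows "\<exists>B\<ge>0. bnd m S f B"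
 using f
proof (induction m arbitrary: f)
 case 0
 have "bounded (f ` C)"
  by (rule compact_imp_bounded[OF compact_continuous_image[OF continuous_on_subset[OF smooth_continuous[OF 0] C(3)] C(1)]])
 then obtain B where "!!y. y \<in> C ==> norm (f y) <= B" unfolding bounded_iff by blast
 then have "bnd 0 S f (max B 0)" using C(2) by (auto simp: le_max_iff_disj)
 then show ?case by (intro exI[of _ "max B 0"]) simp
next
 case (Suc m)
 have "\<exists>B. B >= 0 & bnd m S (%y. fd f y b) B" for b using Suc.IH[OF smooth_deriv[OF Suc.prems]] by blast
 then obtain D where D: "!!b. D b >= 0" "!!b. bnd m S (%y. fd f y b) (D b)" by metis
 obtain B where B: "B >= 0" "bnd m S f B" using Suc.IH[OF Suc.prems] by blast
 define R where "R = max B (\<Sum>b\<in>Basis. D b)"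
 have d: "dfb f y" if "y \<in> S" for y
  by (rule smooth_diff_at[OF Suc.prems]) (use that C in blast)
 have "bnd m S (%y. fd f y v) (R * norm v)" for v
 proof -
  have sums: "bnd m S (%y. \<Sum>b\<in>F. (v \<bullet> b) *\<^sub>R fd f y b) (\<Sum>b\<in>F. \<bar>v \<bullet> b\<bar> * D b)" if "finite F" for F
   using that
  proof (induction F rule: finite_induct)
   case empty
   show ?case using bnd_const[of m S "0::'b"] by simp
  next
   case (insert b F)
   show ?case unfolding sum.insert[OF insert.hyps] by (rule bnd_add[OF S bnd_scaleR[OF S D(2)] insert.IH])
  qed
  have "fd f y v = (\<Sum>b\<in>Basis. (v \<bullet> b) *\<^sub>R fd f y b)" if "y \<in> S" for y
   by (rule fd_Basis[OF d[OF that]])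
  then have "bnd m S (%y. fd f y v) (\<Sum>b\<in>Basis. \<bar>v \<bullet> b\<bar> * D b)"
   by (intro bnd_cong[OF S _ sums[OF finite_Basis]]) simp
  moreover have "(\<Sum>b\<in>Basis. \<bar>v \<bullet> b\<bar> * D b) <= R * norm v"
  proof -
   have "(\<Sum>b\<in>Basis. \<bar>v \<bullet> b\<bar> * D b) <= (\<Sum>b\<in>Basis. norm v * D b)"
    by (intro sum_mono mult_right_mono D(1)) (simp add: Basis_le_norm)
   also have "... = (\<Sum>b\<in>Basis. D b) * norm v" by (simp add: sum_distrib_left mult.commute)
   also have "... <= R * norm v" by (intro mult_right_mono) (auto simp: R_def)
   finally show ?thesis .
  qed
  ultimately show ?thesis using bnd_mono by blast
 qed
 moreover have "norm (f y) <= R" if "y \<in> S" for y using bnd_norm[OF B(2) that] by (simp add: R_def)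
 ultimately have "bnd (Suc m) S f R" using d by simp
 moreover have "R >= 0" using B by (simp add: R_def)
 ultimately show ?case by blast
qed

section \<open>Families with derivative in the parameter\<close>

text \<open>\<open>f'\<close> is the derivative in t at 0, and this differentiation commutes with up
  to \<open>m\<close> derivatives in space. Differentiability in space is required for every t,
  which makes the class stable under sums and products.\<close>

fun fam :: "nat => 'a::euclidean_space set => (real => 'a => 'b::real_normed_vector) => ('a => 'b) => bool" where
 "fam 0 S f f' \<longleftrightarrow> (\<forall>y\<in>S. hvd (%t. f t y) (f' y) 0)"
| "fam (Suc m) S f f' \<longleftrightarrow> (\<forall>y\<in>S. hvd (%t. f t y) (f' y) 0 & (\<forall>t. dfb (f t) y) & dfb f' y) &
   (\<forall>v. fam m S (%t y. fd (f t) y v) (%y. fd f' y v))"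

lemma fam_0: "fam m S f f' ==> y \<in> S ==> hvd (%t. f t y) (f' y) 0" by (cases m) auto

lemma fam_cong:
 assumes S: "open S"
 shows "fam m S f f' ==> (!!t y. y \<in> S ==> f t y = g t y) ==> (!!y. y \<in> S ==> f' y = g' y) ==> fam m S g g'"
proof (induction m arbitrary: f f' g g')
 case (Suc m)
 have "fam m S (%t y. fd (g t) y v) (%y. fd g' y v)" for v
  by (rule Suc.IH[of "%t y. fd (f t) y v" "%y. fd f' y v"])
    (use Suc.prems(1) fd_cong_open[OF S _ Suc.prems(2)] fd_cong_open[OF S _ Suc.prems(3)] in auto)
 moreover have "dfb (g t) y" "dfb g' y" if "y \<in> S" for t y
  using differentiable_cong_open[OF S that Suc.prems(2)] differentiable_cong_open[OF S that Suc.prems(3)] Suc.prems(1) that by auto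
 ultimately show ?case using Suc.prems by simp
qed simp

lemma fam_Suc: "fam (Suc m) S f f' ==> fam m S f f'"
proof (induction m arbitrary: f f')
 case (Suc m)
 have "fam m S (%t y. fd (f t) y v) (%y. fd f' y v)" for v by (rule Suc.IH) (use Suc.prems in auto)
 then show ?case using Suc.prems by auto
qed auto

lemma fam_const: assumes "open S" shows "smooth_fun_on S f ==> fam m S (%t. f) (%y. 0)"
proof (induction m arbitrary: f)
 case (Suc m)
 have "fam m S (%t y. fd f y v) (%y. 0)" for v by (rule Suc.IH[OF smooth_deriv[OF Suc.prems]])
 then show ?case using smooth_diff_at[OF Suc.prems] by (simp add: frechet_derivative_const)
qed simp

lemma fam_add:
 assumes S: "open S"
 shows "fam m S f f' ==> fam m S g g' ==> fam m S (%t y. f t y + g t y) (%y. f' y + g' y)"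
proof (induction m arbitrary: f f' g g')
 case 0 then show ?case by (auto intro: has_vector_derivative_add)
next
 case (Suc m)
 have "fam m S (%t y. fd (f t) y v + fd (g t) y v) (%y. fd f' y v + fd g' y v)" for v
  by (rule Suc.IH) (use Suc.prems in auto)
 then have "fam m S (%t y. fd (%y. f t y + g t y) y v) (%y. fd (%y. f' y + g' y) y v)" for v
  by (rule fam_cong[OF S]) (use Suc.prems in \<open>auto simp: fd_add\<close>)
 then show ?case using Suc.prems by (auto intro: has_vector_derivative_add)
qed

lemma fam_linear:
 assumes S: "open S" and T: "bounded_linear T"
 shows "fam m S f f' ==> fam m S (%t y. T (f t y)) (%y. T (f' y))"
proof (induction m arbitrary: f f')
 case 0 then show ?case using bounded_linear.has_vector_derivative[OF T] by auto
next
 case (Suc m)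
 have "fam m S (%t y. T (fd (f t) y v)) (%y. T (fd f' y v))" for v
  by (rule Suc.IH) (use Suc.prems in auto)
 then have "fam m S (%t y. fd (%y. T (f t y)) y v) (%y. fd (%y. T (f' y)) y v)" for v
  by (rule fam_cong[OF S]) (use Suc.prems in \<open>auto simp: fd_linear[OF _ T]\<close>)
 then show ?case using Suc.prems bounded_linear.has_vector_derivative[OF T] by (auto simp: diff_linear[OF T])
qed

lemma fam_bilinear:
 assumes S: "open S" and bb: "bounded_bilinear bm"
 shows "fam m S f f' ==> fam m S g g' ==>
  fam m S (%t y. bm (f t y) (g t y)) (%y. bm (f' y) (g 0 y) + bm (f 0 y) (g' y))"
proof (induction m arbitrary: f f' g g')
 case 0
 show ?case unfolding fam.simps
 proof
  fix y assume y: "y \<in> S"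
  show "hvd (%t. bm (f t y) (g t y)) (bm (f' y) (g 0 y) + bm (f 0 y) (g' y)) 0"
   using bounded_bilinear.has_vector_derivative[OF bb fam_0[OF 0(1) y] fam_0[OF 0(2) y]] by (simp add: add.commute)
 qed
next
 case (Suc m)
 have f: "dfb (f t) y" "dfb f' y" and g: "dfb (g t) y" "dfb g' y"
  if "y \<in> S" for t y using Suc.prems that by auto
 have "fam m S (%t y. bm (fd (f t) y v) (g t y) + bm (f t y) (fd (g t) y v))
   (%y. (bm (fd f' y v) (g 0 y) + bm (fd (f 0) y v) (g' y)) + (bm (f' y) (fd (g 0) y v) + bm (f 0 y) (fd g' y v)))" for v
  by (intro fam_add[OF S] Suc.IH) (use Suc.prems fam_Suc in auto)
 then have "fam m S (%t y. fd (%y. bm (f t y) (g t y)) y v) (%y. fd (%y. bm (f' y) (g 0 y) + bm (f 0 y) (g' y)) y v)" for v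
  by (rule fam_cong[OF S])
    (simp_all add: f g fd_add fd_bilinear[OF bb] diff_bilinear[OF bb] add_ac)
 moreover have "hvd (%t. bm (f t y) (g t y)) (bm (f' y) (g 0 y) + bm (f 0 y) (g' y)) 0" if "y \<in> S" for y
  using bounded_bilinear.has_vector_derivative[OF bb fam_0[OF Suc.prems(1) that] fam_0[OF Suc.prems(2) that]] by (simp add: add.commute)
 ultimately show ?case using f g by (simp add: diff_bilinear[OF bb])
qed

text \<open>The bounds allow termwise differentiation in space, and at t = 0 the derivative in t
  keeps only the coefficient of index 1. In the induction the coefficients are replaced by their
  directional derivatives and the constants are scaled by the length of the direction.\<close>

lemma fam_series:
 fixes c :: "nat => 'a::euclidean_space => 'b::banach"
 assumes S: "open S" "convex S"
 shows "(!!k. bnd m S (c k) (B k)) ==> (!!k. B k >= 0) ==> (!!T. T >= 0 ==> summable (%k. B k * T ^ k)) ==>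
  fam m S (%t y. \<Sum>k. t ^ k *\<^sub>R c k y) (c 1)"
proof (induction m arbitrary: c B)
 case 0
 show ?case unfolding fam.simps
 proof
  fix y assume y: "y \<in> S"
  have "summable (%k. norm (c k y) * T ^ k)" if T: "T >= 0" for T
   by (rule summable_comparison_test'[OF 0(3)[OF T]]) (use 0(1) y T in \<open>auto simp: abs_mult intro!: mult_right_mono\<close>)
  note ps = power_series_derivative(1)[of "%k. c k y" 0, OF this]
  have "(\<Sum>k. (real k * 0 ^ (k - 1)) *\<^sub>R c k y) = (\<Sum>k\<in>{1}. (real k * 0 ^ (k - 1)) *\<^sub>R c k y)"
   by (rule suminf_finite) (auto simp: power_0_left)
  then show "hvd (%t. \<Sum>k. t ^ k *\<^sub>R c k y) (c 1 y) 0" using ps by simp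
 qed
next
 case (Suc m)
 have d: "((%y. \<Sum>k. t ^ k *\<^sub>R c k y) has_derivative (%h. \<Sum>k. t ^ k *\<^sub>R fd (c k) y h)) (at y)" if y: "y \<in> S" for t y
 proof (rule series_has_derivative[OF S, where f="%k y. t ^ k *\<^sub>R c k y" and f'="%k y h. t ^ k *\<^sub>R fd (c k) y h" and B="%k. B k * \<bar>t\<bar> ^ k"])
  show sB: "summable (%k. B k * \<bar>t\<bar> ^ k)" by (rule Suc.prems(3)) simp
  show "((%y. t ^ k *\<^sub>R c k y) has_derivative (%h. t ^ k *\<^sub>R fd (c k) y h)) (at y)" if "y \<in> S" for k y
   by (rule has_derivative_scaleR_right) (use Suc.prems(1)[of k] that frechet_derivative_works in auto)
  show "norm (t ^ k *\<^sub>R fd (c k) y h) <= B k * \<bar>t\<bar> ^ k * norm h" if "y \<in> S" for k y h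
  proof -
   have "norm (fd (c k) y h) <= B k * norm h" by (rule bnd_norm[where m=m and f="%y. fd (c k) y h", OF _ that]) (use Suc.prems(1)[of k] in simp)
   from mult_left_mono[OF this, of "\<bar>t\<bar> ^ k"] show ?thesis by (simp add: power_abs mult.commute mult.left_commute)
  qed
  show "summable (%k. t ^ k *\<^sub>R c k y)" if "y \<in> S" for y
   by (rule summable_comparison_test'[OF sB])
     (use mult_left_mono[OF bnd_norm[OF Suc.prems(1) that], of "\<bar>t\<bar> ^ _"] in \<open>simp add: power_abs mult.commute[of "B _"]\<close>)
 qed (rule y)
 have fdd: "fd (%y. \<Sum>k. t ^ k *\<^sub>R c k y) y v = (\<Sum>k. t ^ k *\<^sub>R fd (c k) y v)" if "y \<in> S" for t y v
  using frechet_derivative_at[OF d[OF that, of t]] by metis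
 have "fam m S (%t y. \<Sum>k. t ^ k *\<^sub>R fd (c k) y v) (%y. fd (c 1) y v)" for v
 proof (rule Suc.IH[of "%k y. fd (c k) y v" "%k. B k * norm v"])
  show "bnd m S (%y. fd (c k) y v) (B k * norm v)" for k using Suc.prems(1)[of k] by simp
  show "B k * norm v >= 0" for k using Suc.prems(2) by simp
  show "summable (%k. B k * norm v * T ^ k)" if "T >= 0" for T
   using summable_mult2[OF Suc.prems(3)[OF that], of "norm v"] by (simp add: mult.commute mult.left_commute)
 qed
 then have dv: "fam m S (%t y. fd (%y. \<Sum>k. t ^ k *\<^sub>R c k y) y v) (%y. fd (c 1) y v)" for v
  by (rule fam_cong[OF S(1)]) (simp_all add: fdd)
 have f0: "fam m S (%t y. \<Sum>k. t ^ k *\<^sub>R c k y) (c 1)"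
  by (rule Suc.IH[OF bnd_Suc[OF Suc.prems(1)] Suc.prems(2,3)])
 show ?case unfolding fam.simps
 proof (intro conjI ballI allI)
  fix y t assume y: "y \<in> S"
  show "hvd (%t. \<Sum>k. t ^ k *\<^sub>R c k y) (c 1 y) 0" by (rule fam_0[OF f0 y])
  show "dfb (%y. \<Sum>k. t ^ k *\<^sub>R c k y) y" by (rule differentiableI[OF d[OF y]])
  show "c 1 differentiable (at y)" using Suc.prems(1)[of 1] y by simp
 qed (rule dv)
qed

text \<open>The compact closed ball yields uniform bounds for \<open>V\<close> and hence for its
  powers; the open ball inside it is convex, as the differentiation of series needs.\<close>

lemma fam_mexp:
 fixes V :: "'a::euclidean_space => 'r::finite cmat"
 assumes P: "open P" and V: "smooth_fun_on P V" and S: "cball y r \<subseteq> P"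
 shows "fam m (ball y r) (%t z. mexp (t *\<^sub>R V z)) V"
proof -
 obtain K where K: "K > 0" "!!(A :: 'r cmat) (B :: 'r cmat). norm (A ** B) <= K * norm A * norm B" using mm_norm by blast
 obtain B where B: "B >= 0" "bnd m (ball y r) V B"
  using bnd_smooth[OF P compact_cball ball_subset_cball S open_ball V] by blast
 let ?c = "%k z. (1 / fact k) *\<^sub>R mpow (V z) k"
 let ?B = "%k. \<bar>1 / fact k\<bar> * (norm (mat 1 :: 'r cmat) * (2 ^ m * K * B) ^ k)"
 have "fam m (ball y r) (%t z. \<Sum>k. t ^ k *\<^sub>R ?c k z) (?c 1)"
 proof (rule fam_series[OF open_ball convex_ball, where B="?B"])
  show "bnd m (ball y r) (?c k) (?B k)" for k
   by (rule bnd_scaleR[OF open_ball bnd_mpow[OF open_ball less_imp_le[OF K(1)] K(2) B(2,1)]])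
  show "?B k >= 0" for k using K B by simp
  show "summable (%k. ?B k * T ^ k)" if "T >= 0" for T
  proof -
   have "summable (%k. norm (mat 1 :: 'r cmat) * (inverse (fact k) * (2 ^ m * K * B * T) ^ k))"
    by (intro summable_mult summable_exp)
   then show ?thesis by (simp add: power_mult_distrib field_simps)
  qed
 qed
 then show ?thesis unfolding mexp_series by simp
qed

lemma ext_d_fam:
 assumes S: "open S" "y \<in> S" and f: "!!us. fam 1 S (%t z. f t z us) (%z. f' z us)"
 shows "hvd (%t. ext_d (f t) y us) (ext_d f' y us) 0"
 unfolding ext_d_def
proof (rule has_vector_derivative_sum)
 fix m
 let ?us = "take m us @ drop (Suc m) us"
 have "fam 0 S (%t z. fd (%z. f t z ?us) z (us ! m)) (%z. fd (%z. f' z ?us) z (us ! m))"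
  using f[of ?us] by (simp add: One_nat_def del: fam.simps(1))
 then have "hvd (%t. fd (%z. f t z ?us) y (us ! m)) (fd (%z. f' z ?us) y (us ! m)) 0"
  using S(2) by simp
 then show "hvd (%t. (-1) ^ m *\<^sub>R fd (%z. f t z ?us) y (us ! m)) ((-1) ^ m *\<^sub>R fd (%z. f' z ?us) y (us ! m)) 0"
  by (rule bounded_linear.has_vector_derivative[OF bounded_linear_scaleR_right])
qed

section \<open>Linearisation along the exponential\<close>

context zbdl begin

text \<open>The velocity at t = 0 of the path of connections given by exp(tV). On one-forms -i J is
  1 on type (1,0) and -1 on type (0,1), so this is the (1,0)-part of d_A V minus its
  (0,1)-part.\<close>

definition alph :: "('i, 'n, 'r cmat) lform => ('i, 'n, 'r) endsec => ('i, 'n, 'r cmat) lform" where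
 "alph A V i y us = csm (- \<i>) (Jf (cov_d A 0 (%i y. form0 (V i y)) i y) us)"

lemma alph_one: "alph A V i y [w] = csm (- \<i>) (fd (V i) y (\<i> *s w) + A i y [\<i> *s w] ** V i y - V i y ** A i y [\<i> *s w])"
 unfolding alph_def Jf_def cov_d_0 by simp

lemma alph_other:
 assumes "connection E A" "i \<in> idx E" "y \<in> P i" "length us ~= 1" shows "alph A V i y us = 0"
 using connD(3)[OF assms(1-3)] assms(4) unfolding alph_def Jf_def cov_d_0 homog_def by (auto split: list.split)

text \<open>The action contains first derivatives of the exponential and the curvature takes one
  more; so the exponential is used as a family of order 2 and the connection as one of order
  1.\<close>

lemma herm_act_fam:
 assumes A: "connection E A" and V: "end_section E V" and i: "i \<in> idx E" and r: "cball y r \<subseteq> P i"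
 shows "fam 1 (ball y r) (%t z. herm_act (sec_exp t V) A i z us) (%z. alph A V i z us)"
proof (cases "length us = 1")
 case False
 have z: "herm_act (sec_exp t V) A i z us = 0" if "z \<in> ball y r" for t z
 proof -
  have "z \<in> P i" using that r ball_subset_cball by blast
  then have "A i z vs = 0" if "length vs ~= 1" for vs using connD(3)[OF A i] that by (simp add: homog_def)
  then show ?thesis using False unfolding herm_act_def part01_def part10_def ext_d_form0
   by (auto split: list.split)
 qed
 have "fam 1 (ball y r) (%t z. 0 :: 'r cmat) (%z. 0)" by (rule fam_const[OF open_ball smooth_const])
 then show ?thesis
 proof (rule fam_cong[OF open_ball])
  show "0 = alph A V i z us" if "z \<in> ball y r" for z
   using alph_other[OF A i _ False, of z V] that r ball_subset_cball by force
 qed (simp add: z)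
next
 case True
 then obtain w where us: "us = [w]" by (auto simp: length_Suc_conv)
 let ?S = "ball y r"
 note S = open_ball[of y r]
 let ?g = "%t z. mexp (t *\<^sub>R V i z)" and ?h = "%t z. mexp (t *\<^sub>R (- V i z))"
 note sV = endsecD(2)[OF V i]
 have g2: "fam 2 ?S ?g (V i)" by (rule fam_mexp[OF open_P[OF i] sV r])
 have h2: "fam 2 ?S ?h (%z. - V i z)" by (rule fam_mexp[OF open_P[OF i] smooth_minus[OF open_P[OF i] sV] r])
 have g1: "fam 1 ?S ?g (V i)" and h1: "fam 1 ?S ?h (%z. - V i z)"
  by (rule fam_Suc, use g2 h2 in \<open>simp add: numeral_2_eq_2\<close>)+
 have dg: "fam 1 ?S (%t z. fd (?g t) z v) (%z. fd (V i) z v)"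
  and dh: "fam 1 ?S (%t z. fd (?h t) z v) (%z. fd (%z. - V i z) z v)" for v
  using g2 h2 unfolding numeral_2_eq_2 fam.simps(2)[of "Suc 0"] by simp_all
 have sub: "?S \<subseteq> P i" using r ball_subset_cball by blast
 have cA: "fam 1 ?S (%t z. A i z [v]) (%z. 0)" for v
  by (rule fam_const[OF S smooth_subset[OF connD(1)[OF A i] sub]])
 have c01: "fam 1 ?S (%t z. csm (1/2) (A i z [w] + csm \<i> (A i z [\<i> *s w]))) (%z. csm (1/2) (0 + csm \<i> 0))"
  by (intro fam_linear[OF S bl_csm] fam_add[OF S] cA)
 have c10: "fam 1 ?S (%t z. csm (1/2) (A i z [w] + csm (- \<i>) (A i z [\<i> *s w]))) (%z. csm (1/2) (0 + csm (- \<i>) 0))"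
  by (intro fam_linear[OF S bl_csm] fam_add[OF S] cA)
 have dh01: "fam 1 ?S (%t z. csm (1/2) (fd (?h t) z w + csm \<i> (fd (?h t) z (\<i> *s w))))
   (%z. csm (1/2) (fd (%z. - V i z) z w + csm \<i> (fd (%z. - V i z) z (\<i> *s w))))"
  by (intro fam_linear[OF S bl_csm] fam_add[OF S] dh)
 have dg10: "fam 1 ?S (%t z. csm (1/2) (fd (?g t) z w + csm (- \<i>) (fd (?g t) z (\<i> *s w))))
   (%z. csm (1/2) (fd (V i) z w + csm (- \<i>) (fd (V i) z (\<i> *s w))))"
  by (intro fam_linear[OF S bl_csm] fam_add[OF S] dg)
 note bil = fam_bilinear[OF S bb_mm]
 note F = fam_add[OF S fam_add[OF S fam_add[OF S bil[OF bil[OF g1 c01] h1] bil[OF g1 dh01]] bil[OF bil[OF h1 c10] g1]] bil[OF h1 dg10]]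
 show ?thesis unfolding us
 proof (rule fam_cong[OF S F])
  fix z assume z: "z \<in> ?S"
  have inv: "matrix_inv (sec_exp t V i z) = ?h t z" for t z
   unfolding sec_exp_def matrix_inv_mexp by simp
  show "?g t z ** csm (1/2) (A i z [w] + csm \<i> (A i z [\<i> *s w])) ** ?h t z
    + ?g t z ** csm (1/2) (fd (?h t) z w + csm \<i> (fd (?h t) z (\<i> *s w)))
    + ?h t z ** csm (1/2) (A i z [w] + csm (- \<i>) (A i z [\<i> *s w])) ** ?g t z
    + ?h t z ** csm (1/2) (fd (?g t) z w + csm (- \<i>) (fd (?g t) z (\<i> *s w)))
   = herm_act (sec_exp t V) A i z [w]" for t
   unfolding herm_act_def inv part01_def part10_def ext_d_form0
   by (simp add: sec_exp_def[abs_def] csm_minus)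
  have dV: "dfb (V i) z" by (rule smooth_diff_at[OF sV]) (use z sub in blast)
  have n: "fd (%z. - V i z) z v = - fd (V i) z v" for v by (rule fd_neg[OF dV])
  define a b p q X where "a = A i z [w]" and "b = A i z [\<i> *s w]" and "p = fd (V i) z w" and "q = fd (V i) z (\<i> *s w)" and "X = V i z"
  have alg: "X ** csm (1/2) (a + csm \<i> b) + csm (1/2) (a + csm \<i> b) ** (- X) + csm (1/2) (- p + csm \<i> (- q))
    + ((- X) ** csm (1/2) (a + csm (- \<i>) b) + csm (1/2) (a + csm (- \<i>) b) ** X) + csm (1/2) (p + csm (- \<i>) q)
    = csm (- \<i>) (q + b ** X - X ** b)"
   by (rule mat_eqI) (simp add: mm_add mm_diff mm_minus csm_mm csm_add csm_diff csm_minus)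
  show "((V i z ** csm (1/2) (A i z [w] + csm \<i> (A i z [\<i> *s w])) + ?g 0 z ** csm (1/2) (0 + csm \<i> 0)) ** ?h 0 z
     + ?g 0 z ** csm (1/2) (A i z [w] + csm \<i> (A i z [\<i> *s w])) ** (- V i z))
    + (V i z ** csm (1/2) (fd (?h 0) z w + csm \<i> (fd (?h 0) z (\<i> *s w)))
     + ?g 0 z ** csm (1/2) (fd (%z. - V i z) z w + csm \<i> (fd (%z. - V i z) z (\<i> *s w))))
    + (((- V i z) ** csm (1/2) (A i z [w] + csm (- \<i>) (A i z [\<i> *s w])) + ?h 0 z ** csm (1/2) (0 + csm (- \<i>) 0)) ** ?g 0 z
     + ?h 0 z ** csm (1/2) (A i z [w] + csm (- \<i>) (A i z [\<i> *s w])) ** V i z)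
    + ((- V i z) ** csm (1/2) (fd (?g 0) z w + csm (- \<i>) (fd (?g 0) z (\<i> *s w)))
     + ?h 0 z ** csm (1/2) (fd (V i) z w + csm (- \<i>) (fd (V i) z (\<i> *s w))))
   = alph A V i z [w]"
   unfolding alph_one n a_def[symmetric] b_def[symmetric] p_def[symmetric] q_def[symmetric] X_def[symmetric] alg[symmetric]
   by (simp add: frechet_derivative_const)
 qed
qed

lemma herm_act_0:
 assumes A: "connection E A" and V: "end_section E V" and iy: "i \<in> idx E" "y \<in> P i"
 shows "herm_act (sec_exp 0 V) A i y = A i y"
proof
 fix us
 have "part01 (A i y) us + part10 (A i y) us = A i y us"
  unfolding part01_def part10_def by (rule mat_eqI) (simp add: csm_def field_simps)
 moreover have "part01 (%vs. 0) us = (0 :: 'r cmat)" "part10 (%vs. 0) us = (0 :: 'r cmat)"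
  by (simp_all add: part01_def part10_def)
 moreover have "matrix_inv (mat 1 :: 'r cmat) = mat 1" by (rule matrix_inv_eqI) simp
 moreover have "ext_d (%z. form0 (mat 1 :: 'r cmat)) y = (%vs. 0)"
  by (auto simp: ext_d_form0 frechet_derivative_const fun_eq_iff split: list.split)
 ultimately show "herm_act (sec_exp 0 V) A i y us = A i y us"
  unfolding herm_act_def by (simp add: sec_exp_def)
qed

lemma curv_herm_act_derivative:
 assumes A: "connection E A" and V: "end_section E V" and iy: "i \<in> idx E" "y \<in> P i"
 shows "hvd (%t. curvN (herm_act (sec_exp t V) A) i y us) (dA A (alph A V) i y us) 0"
proof -
 obtain r where r: "r > 0" "cball y r \<subseteq> P i" using open_P[OF iy(1)] iy(2) open_contains_cball by blast
 let ?B = "%t. herm_act (sec_exp t V) A"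
 note fm = herm_act_fam[OF A V iy(1) r(2)]
 have yr: "y \<in> ball y r" using r by simp
 have e: "hvd (%t. ext_d (?B t i) y us) (ext_d (alph A V i) y us) 0"
  by (rule ext_d_fam[OF open_ball yr fm])
 have "hvd (%t. wedge_mm (?B t i y) (?B t i y) us) (wedge_mm (alph A V i y) (?B 0 i y) us + wedge_mm (?B 0 i y) (alph A V i y) us) 0"
  by (rule wedge_hvd[OF bb_mm fam_0[OF fm yr] fam_0[OF fm yr]])
 from has_vector_derivative_add[OF e this[unfolded herm_act_0[OF A V iy]]]
 have "hvd (%t. curv (?B t) i y us) (cov_d A 1 (alph A V) i y us) 0"
  unfolding curv_def cov_d_def by (simp add: add_ac)
 then show ?thesis unfolding curvN_def
  by (rule bounded_linear.has_vector_derivative[OF bl_csm])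
qed

text \<open>The derivative of the critical operator, as a function of the curvature
  \<open>F\<close>, in the direction \<open>G\<close>. The imaginary part is kept because the
  coefficients of the differential operator are applied to all matrices, for which \<open>G\<close>
  need not be Hermitian.\<close>

definition Dcrit :: "'i => complex^'n => ('n, 'r cmat) alt => ('n, 'r cmat) alt => ('n, 'r cmat) alt" where
 "Dcrit i y F G vs = imh (met E i y) (csm (phase_factor E Z) (\<Sum>(d, j, l)\<in>I0. csm (rho Z d / fact j)
   (wedge_cm (cw d l i y) (%us. \<Sum>s<j. mprod (replicate s F @ G # replicate (j - 1 - s) F) us) vs)))"

definition lin :: "('i, 'n, 'r cmat) lform => ('i, 'n, 'r) endsec => ('i, 'n, 'r cmat) lform" where
 "lin A V i y = Dcrit i y (curvN A i y) (dA A (alph A V) i y)"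

theorem linearise:
 assumes A: "connection E A" shows "linearisation_D_Z E Z A (lin A)"
 unfolding linearisation_D_Z_def
proof (intro allI impI ballI)
 fix V i y vs assume V: "herm_section E V" and iy: "i \<in> idx E" "y \<in> P i"
 have eV: "end_section E V" using V by (simp add: herm_section_def)
 let ?F = "%t. curvN (herm_act (sec_exp t V) A) i y" and ?G = "dA A (alph A V) i y"
 have F0: "?F 0 = curvN A i y"
 proof -
  obtain r where r: "r > 0" "cball y r \<subseteq> P i" using open_P[OF iy(1)] iy(2) open_contains_cball by blast
  have "ext_d (herm_act (sec_exp 0 V) A i) y us = ext_d (A i) y us" for us
   unfolding ext_d_def
  proof (intro sum.cong refl arg_cong2[where f=scaleR])
   show "fd (%z. herm_act (sec_exp 0 V) A i z us) y v = fd (%z. A i z us) y v" for us v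
    by (rule fd_cong_open[OF open_P[OF iy(1)] iy(2)]) (simp add: herm_act_0[OF A eV iy(1)])
  qed
  then show ?thesis by (simp add: curvN_def curv_def herm_act_0[OF A eV iy] fun_eq_iff)
 qed
 have m: "hvd (%t. mprod (replicate j (?F t)) us) (\<Sum>s<j. mprod (replicate s (curvN A i y) @ ?G # replicate (j - 1 - s) (curvN A i y)) us) 0" for j us
  by (rule mprod_replicate_derivative[where F="?F" and ?t0.0=0, OF curv_herm_act_derivative[OF A eV iy], unfolded F0])
 show "hvd (%t. D_Z E Z (herm_act (sec_exp t V) A) i y vs) (lin A V i y vs) 0"
  unfolding D_Z_def im_form_imh fval_Ztilde lin_def Dcrit_def case_prod_beta
  by (intro bounded_linear.has_vector_derivative[OF bounded_linear_imh] bounded_linear.has_vector_derivative[OF bl_csm]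
    has_vector_derivative_sum wedge_hvd_right bb_csm m)
qed

end

section \<open>Differential operators of order two and their symbols\<close>

definition coeffs :: "(complex^'n::finite) set => (complex^'n => (complex^'n) list => 'r::finite cmat => 'r cmat) =>
  ((complex^'n => 'r cmat) => complex^'n => 'r cmat) => (complex^'n => complex^'n => 'r cmat => 'r cmat) => bool" where
 "coeffs S c L \<sigma> \<longleftrightarrow> (\<forall>ks M. smooth_fun_on S (%y. c y ks M)) & (\<forall>y\<in>S. (\<forall>ks. linear (c y ks)) &
  (\<forall>f. smooth_fun_on S f --> L f y = (\<Sum>ks\<in>{ks. set ks \<subseteq> Basis & length ks <= 2}. c y ks (iter_deriv ks f y))) &
  (\<forall>\<xi> M. symbol 2 (c y) \<xi> M = \<sigma> y \<xi> M))"

text \<open>An operator of order at most 2 on one patch together with its symbol. Transporting the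
  symbol along closure rules yields it for the linearisation without writing out the
  coefficients.\<close>

definition "dop S L \<sigma> \<longleftrightarrow> (\<exists>c. coeffs S c L \<sigma>)"

lemma coeffsD:
 assumes "coeffs S c L \<sigma>"
 shows "smooth_fun_on S (%y. c y ks M)" "y \<in> S ==> linear (c y ks)"
  "y \<in> S ==> smooth_fun_on S f ==> L f y = (\<Sum>ks\<in>{ks. set ks \<subseteq> Basis & length ks <= 2}. c y ks (iter_deriv ks f y))"
  "y \<in> S ==> symbol 2 (c y) \<xi> M = \<sigma> y \<xi> M"
 using assms unfolding coeffs_def by blast+

lemma dopI:
 assumes "!!ks M. smooth_fun_on S (%y. c y ks M)" "!!y ks. y \<in> S ==> linear (c y ks)"
  "!!y f. y \<in> S ==> smooth_fun_on S f ==> L f y = (\<Sum>ks\<in>{ks. set ks \<subseteq> Basis & length ks <= 2}. c y ks (iter_deriv ks f y))"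
  "!!y \<xi> M. y \<in> S ==> symbol 2 (c y) \<xi> M = \<sigma> y \<xi> M"
 shows "dop S L \<sigma>"
 unfolding dop_def coeffs_def by (intro exI[of _ c] conjI allI ballI impI assms)

lemma linear_0_fun: "linear (%M. 0 :: 'b::real_vector)" by (rule linearI) simp_all

lemma dop_cong:
 assumes "dop S L \<sigma>" "!!f y. smooth_fun_on S f ==> y \<in> S ==> L' f y = L f y" "!!y \<xi> M. y \<in> S ==> \<sigma>' y \<xi> M = \<sigma> y \<xi> M"
 shows "dop S L' \<sigma>'"
proof -
 obtain c where "coeffs S c L \<sigma>" using assms(1) unfolding dop_def ..
 note c = coeffsD[OF this]
 show ?thesis
 proof (rule dopI[OF c(1,2)])
  show "symbol 2 (c y) \<xi> M = \<sigma>' y \<xi> M" if "y \<in> S" for y \<xi> M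
   by (rule trans[OF c(4)[OF that] assms(3)[OF that, symmetric]])
 qed (simp_all add: assms(2) c(3))
qed

lemma dop_zero: "dop S (%f y. 0) (%y \<xi> M. 0)"
 by (rule dopI[where c="%y ks M. 0"]) (simp_all add: smooth_const linear_0_fun symbol_def)

lemma dop_jet:
 assumes "set ks \<subseteq> Basis" "length ks <= 2"
 shows "dop S (iter_deriv ks) (%y \<xi> M. if length ks = 2 then (\<Prod>k\<leftarrow>ks. \<xi> \<bullet> k) *\<^sub>R M else 0)"
proof (rule dopI[where c="%y ls M. if ls = ks then M else 0"])
 note fin = finite_lists_length_le[OF finite_Basis] finite_lists_length_eq[OF finite_Basis]
 show "smooth_fun_on S (%y. if ls = ks then M else 0)" for ls and M :: "'b cmat" by (rule smooth_const)
 show "linear (%M :: 'b cmat. if ls = ks then M else 0)" for ls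
  by (cases "ls = ks") (simp_all add: linear_0_fun linear_ident)
 show "iter_deriv ks f y = (\<Sum>ls\<in>{ls. set ls \<subseteq> Basis & length ls <= 2}. if ls = ks then iter_deriv ls f y else 0)"
  for f :: "complex^'a => 'b cmat" and y
  by (simp add: sum.delta[OF fin(1)] assms)
 show "symbol 2 (%ls M. if ls = ks then M else 0) \<xi> M = (if length ks = 2 then (\<Prod>k\<leftarrow>ks. \<xi> \<bullet> k) *\<^sub>R M else 0)" for \<xi> and M :: "'b cmat"
  by (simp add: symbol_def if_distrib[of "scaleR _"] sum.delta[OF fin(2)] assms cong: if_cong)
qed

lemma dop_add:
 assumes S: "open S" and a: "dop S L \<sigma>" and b: "dop S L' \<sigma>'"
 shows "dop S (%f y. L f y + L' f y) (%y \<xi> M. \<sigma> y \<xi> M + \<sigma>' y \<xi> M)"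
proof -
 obtain c where "coeffs S c L \<sigma>" using a unfolding dop_def ..
 note c = coeffsD[OF this]
 obtain c' where "coeffs S c' L' \<sigma>'" using b unfolding dop_def ..
 note c' = coeffsD[OF this]
 show ?thesis
  by (rule dopI[where c="%y ks M. c y ks M + c' y ks M"])
   (simp_all add: smooth_add[OF S] c(1-3) c'(1-3) linear_compose_add c(4)[symmetric] c'(4)[symmetric] symbol_def sum.distrib scaleR_add_right)
qed

text \<open>Expanding the argument in a real basis reduces the claim to constant arguments and
  scalar coefficient functions.\<close>

lemma smooth_bundle_map:
 fixes R :: "'a::euclidean_space => 'b::euclidean_space => 'c::real_normed_vector"
 assumes S: "open S" and R: "!!M. smooth_fun_on S (%y. R y M)" "!!y. y \<in> S ==> linear (R y)" and f: "smooth_fun_on S f"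
 shows "smooth_fun_on S (%y. R y (f y))"
proof -
 have "smooth_fun_on S (%y. \<Sum>b\<in>Basis. (f y \<bullet> b) *\<^sub>R R y b)"
  by (intro smooth_sum[OF S] smooth_bilinear[OF S bounded_bilinear_scaleR] R(1) smooth_linear[OF S bounded_linear_inner_left f])
 then show ?thesis
 proof (rule smooth_cong[OF S])
  fix y assume y: "y \<in> S"
  have "R y (f y) = R y (\<Sum>b\<in>Basis. (f y \<bullet> b) *\<^sub>R b)" by (simp add: euclidean_representation)
  then show "(\<Sum>b\<in>Basis. (f y \<bullet> b) *\<^sub>R R y b) = R y (f y)"
   by (simp only: linear_sum[OF R(2)[OF y]] linear_scale[OF R(2)[OF y]])
 qed
qed

lemma dop_map:
 assumes S: "open S" and R: "!!M. smooth_fun_on S (%y. R y M)" "!!y. y \<in> S ==> linear (R y)" and a: "dop S L \<sigma>"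
 shows "dop S (%f y. R y (L f y)) (%y \<xi> M. R y (\<sigma> y \<xi> M))"
proof -
 obtain c where "coeffs S c L \<sigma>" using a unfolding dop_def ..
 note c = coeffsD[OF this]
 show ?thesis
 proof (rule dopI[where c="%y ks M. R y (c y ks M)"])
  show "smooth_fun_on S (%y. R y (c y ks M))" for ks M by (rule smooth_bundle_map[OF S R c(1)])
  fix y assume y: "y \<in> S"
  note lr = linear_sum[OF R(2)[OF y]] linear_scale[OF R(2)[OF y]]
  show "linear (%M. R y (c y ks M))" for ks
   using linear_compose[OF c(2)[OF y] R(2)[OF y]] by (simp add: o_def)
  show "R y (L f y) = (\<Sum>ks\<in>{ks. set ks \<subseteq> Basis & length ks <= 2}. R y (c y ks (iter_deriv ks f y)))" if "smooth_fun_on S f" for f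
   unfolding c(3)[OF y that] lr ..
  show "symbol 2 (%ks M. R y (c y ks M)) \<xi> M = R y (\<sigma> y \<xi> M)" for \<xi> M
   unfolding c(4)[OF y, symmetric] symbol_def lr ..
 qed
qed

lemma dop_sum:
 assumes S: "open S" and K: "finite K"
 shows "(!!k. k \<in> K ==> dop S (L k) (\<sigma> k)) ==> dop S (%f y. \<Sum>k\<in>K. L k f y) (%y \<xi> M. \<Sum>k\<in>K. \<sigma> k y \<xi> M)"
 using K
proof (induction K rule: finite_induct)
 case empty then show ?case by (simp add: dop_zero)
next
 case (insert k K)
 have "dop S (%f y. L k f y + (\<Sum>k\<in>K. L k f y)) (%y \<xi> M. \<sigma> k y \<xi> M + (\<Sum>k\<in>K. \<sigma> k y \<xi> M))"
  by (rule dop_add[OF S]) (use insert in auto)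
 then show ?case using insert.hyps by simp
qed

lemma dop_linear:
 assumes S: "open S" and T: "bounded_linear T" and a: "dop S L \<sigma>"
 shows "dop S (%f y. T (L f y)) (%y \<xi> M. T (\<sigma> y \<xi> M))"
 by (rule dop_map[OF S _ bounded_linear.linear[OF T] a]) (rule smooth_const)


lemma dop_0: "dop S (%f y. f y) (%y \<xi> M. 0)"
 by (rule dop_cong[OF dop_jet[of "[]"]]) simp_all

text \<open>The symbol is taken in order 2, so a first derivative contributes nothing to it.\<close>

lemma dop_1:
 assumes S: "open S" shows "dop S (%f y. fd f y u) (%y \<xi> M. 0)"
proof (rule dop_cong)
 show "dop S (%f y. \<Sum>b\<in>Basis. (u \<bullet> b) *\<^sub>R iter_deriv [b] f y) (%y \<xi> M. \<Sum>b\<in>Basis. (u \<bullet> b) *\<^sub>R (if length [b] = 2 then (\<Prod>k\<leftarrow>[b]. \<xi> \<bullet> k) *\<^sub>R M else 0))"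
  by (intro dop_sum[OF S finite_Basis] dop_linear[OF S bounded_linear_scaleR_right] dop_jet) auto
qed (simp_all add: fd_Basis[OF smooth_diff_at, of S _ _ u])

lemma dop_2:
 assumes S: "open S"
 shows "dop S (%f y. fd (%z. fd f z u') y u) (%y \<xi> M. ((\<xi> \<bullet> u) * (\<xi> \<bullet> u')) *\<^sub>R M)"
proof (rule dop_cong)
 show "dop S (%f y. \<Sum>b'\<in>Basis. \<Sum>b\<in>Basis. ((u \<bullet> b) * (u' \<bullet> b')) *\<^sub>R iter_deriv [b, b'] f y)
  (%y \<xi> M. \<Sum>b'\<in>Basis. \<Sum>b\<in>Basis. ((u \<bullet> b) * (u' \<bullet> b')) *\<^sub>R (if length [b, b'] = 2 then (\<Prod>k\<leftarrow>[b, b']. \<xi> \<bullet> k) *\<^sub>R M else 0))"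
  by (intro dop_sum[OF S finite_Basis] dop_linear[OF S bounded_linear_scaleR_right] dop_jet) auto
next
 fix f :: "complex^'a => 'b cmat" and y assume f: "smooth_fun_on S f" and y: "y \<in> S"
 have d: "dfb (%z. fd f z b) y" for b by (rule smooth_diff_at[OF smooth_deriv[OF f] y])
 have ds: "dfb (%z. (u' \<bullet> b') *\<^sub>R fd f z b') y" for b'
  by (rule diff_linear[OF bounded_linear_scaleR_right d])
 have "fd (%z. fd f z u') y u = fd (%z. \<Sum>b'\<in>Basis. (u' \<bullet> b') *\<^sub>R fd f z b') y u"
  by (rule fd_cong_open[OF S y]) (rule fd_Basis[OF smooth_diff_at[OF f]])
 also have "... = (\<Sum>b'\<in>Basis. (u' \<bullet> b') *\<^sub>R fd (%z. fd f z b') y u)"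
  by (simp only: fd_sum[OF ds] fd_scaleR[OF d])
 also have "... = (\<Sum>b'\<in>Basis. \<Sum>b\<in>Basis. ((u \<bullet> b) * (u' \<bullet> b')) *\<^sub>R fd (%z. fd f z b') y b)"
  by (subst fd_Basis[OF d]) (simp add: scaleR_sum_right mult.commute)
 finally show "fd (%z. fd f z u') y u = (\<Sum>b'\<in>Basis. \<Sum>b\<in>Basis. ((u \<bullet> b) * (u' \<bullet> b')) *\<^sub>R iter_deriv [b, b'] f y)" by simp
next
 fix \<xi> :: "complex^'a" and M :: "'b cmat"
 have "(\<xi> \<bullet> u') * (\<xi> \<bullet> u) = (\<Sum>b'\<in>Basis. \<Sum>b\<in>Basis. ((\<xi> \<bullet> b') * (u' \<bullet> b')) * ((\<xi> \<bullet> b) * (u \<bullet> b)))"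
  unfolding euclidean_inner[of \<xi> u] euclidean_inner[of \<xi> u'] by (rule sum_product)
 then show "((\<xi> \<bullet> u) * (\<xi> \<bullet> u')) *\<^sub>R M
  = (\<Sum>b'\<in>Basis. \<Sum>b\<in>Basis. ((u \<bullet> b) * (u' \<bullet> b')) *\<^sub>R (if length [b, b'] = 2 then (\<Prod>k\<leftarrow>[b, b']. \<xi> \<bullet> k) *\<^sub>R M else 0))"
  by (simp add: scaleR_sum_left mult_ac)
qed

lemma dop_wedge_right:
 assumes S: "open S" and F: "!!us. smooth_fun_on S (%y. F y us)" and G: "!!us. dop S (%f y. G f y us) (%y \<xi> M. \<tau> y \<xi> M us)"
  and bb: "bounded_bilinear (bm :: 'c::real_normed_vector => _)"
 shows "dop S (%f y. wedge bm (F y) (G f y) us) (%y \<xi> M. wedge bm (F y) (\<tau> y \<xi> M) us)"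
 unfolding wedge_def
proof (intro dop_sum[OF S] dop_linear[OF S bounded_linear_scaleR_right])
 fix T
 show "dop S (%f y. bm (F y (nths us T)) (G f y (nths us (- T)))) (%y \<xi> M. bm (F y (nths us T)) (\<tau> y \<xi> M (nths us (- T))))"
  by (rule dop_map[OF S, where R="%y. bm (F y (nths us T))"])
    (intro smooth_linear[OF S bounded_bilinear.bounded_linear_left[OF bb] F] bounded_linear.linear[OF bounded_bilinear.bounded_linear_right[OF bb]] G)+
qed simp

lemma dop_wedge_left:
 assumes S: "open S" and F: "!!us. smooth_fun_on S (%y. F y us)" and G: "!!us. dop S (%f y. G f y us) (%y \<xi> M. \<tau> y \<xi> M us)"
 shows "dop S (%f y. wedge_mm (G f y) (F y) us) (%y \<xi> M. wedge_mm (\<tau> y \<xi> M) (F y) us)"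
 unfolding wedge_def
proof (intro dop_sum[OF S] dop_linear[OF S bounded_linear_scaleR_right])
 fix T
 show "dop S (%f y. G f y (nths us T) ** F y (nths us (- T))) (%y \<xi> M. \<tau> y \<xi> M (nths us T) ** F y (nths us (- T)))"
  by (rule dop_map[OF S, where R="%y M. M ** F y (nths us (- T))"])
    (intro smooth_linear[OF S bounded_bilinear.bounded_linear_right[OF bb_mm] F]
     bounded_linear.linear[OF bounded_bilinear.bounded_linear_left[OF bb_mm]] G)+
qed simp

lemma linear_bij_betw_subspace:
 fixes f :: "'a::euclidean_space => 'a"
 assumes f: "linear f" and S: "subspace S" and im: "f ` S \<subseteq> S" and inj: "!!x. x \<in> S ==> f x = 0 ==> x = 0"
 shows "bij_betw f S S"
proof -
 have i: "inj_on f S"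
 proof (rule inj_onI)
  fix x y assume "x \<in> S" "y \<in> S" "f x = f y"
  then have "x - y \<in> S" "f (x - y) = 0" using S by (auto simp: subspace_diff linear_diff[OF f])
  then show "x = y" using inj by fastforce
 qed
 have sp: "span S = S" using S by (simp add: span_eq_iff)
 have "f ` S = S"
 proof (rule subspace_dim_equal[OF _ S im])
  show "subspace (f ` S)" by (rule linear_subspace_image[OF f S])
  show "dim S <= dim (f ` S)" using dim_image_eq[OF f, of S] i sp by simp
 qed
 then show ?thesis using i by (simp add: bij_betw_def)
qed

text \<open>A scalar one-form acts as a form with values in scalar matrices, and these commute with
  all matrices; only the graded sign remains.\<close>

lemma wedge_mm_scalar:
 fixes B C :: "('n::finite, 'r::finite cmat) alt"
 assumes "homog k B" "homog 1 p"
 shows "wedge_mm B (wedge_cm p C) us = (-1) ^ k *\<^sub>R wedge_cm p (wedge_mm B C) us"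
proof -
 let ?P = "%us. csm (p us) (mat 1) :: 'r cmat"
 have PC: "wedge_cm p D = wedge_mm ?P D" for D :: "('n, 'r cmat) alt" by (rule ext) (simp add: wedge_def csm_mm)
 have hP: "homog 1 ?P" using assms(2) by (simp add: homog_def)
 have bb: "bounded_bilinear (%(M :: 'r cmat) c. csm c M)"
  using bounded_bilinear.flip[OF bb_csm] .
 have "wedge_mm B ?P vs = (-1) ^ k *\<^sub>R wedge_mm ?P B vs" for vs
 proof -
  have "wedge_mm B ?P vs = wedge (%M c. csm c M) B p vs" by (simp add: wedge_def csm_mm)
  also have "... = (-1) ^ (k * 1) *\<^sub>R wedge csm p B vs"
   by (rule wedge_commute[OF bb bb_csm refl assms])
  finally show ?thesis unfolding PC by simp
 qed
 then have "wedge_mm B ?P = (%vs. (-1) ^ k *\<^sub>R wedge_mm ?P B vs)" by auto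
 then have "wedge_mm (wedge_mm B ?P) C us = (-1) ^ k *\<^sub>R wedge_mm (wedge_mm ?P B) C us"
  by (simp add: wedge_scale_left[OF bb_mm])
 then show ?thesis unfolding PC wedge_mm_assoc .
qed

lemma hadj_imh: assumes "pos_def_herm H" shows "hadj H (imh H M) = imh H M"
proof -
 have "hadj H (imh H M) = csm (cnj (1 / (2 * \<i>))) (hadj H M - M)"
  by (simp only: imh_def hadj_csm hadj_diff hadj_hadj[OF assms])
 also have "cnj (1 / (2 * \<i>)) = - (1 / (2 * \<i>))" by simp
 finally show ?thesis unfolding imh_def csm_minus(2) by (simp add: csm_diff)
qed

lemma linear_mm:
 fixes B :: "'r::finite cmat"
 shows "linear (%M. B ** M :: 'r cmat)" "linear (%M :: 'r cmat. - (M ** B))"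
 by (auto intro!: linearI simp: mm_add mm_scaleR)

section \<open>Ellipticity\<close>

context zbdl begin

lemma smooth_imh:
 assumes i: "i \<in> idx E" shows "smooth_fun_on (P i) (%y. imh (met E i y) M)"
proof -
 note o = open_P[OF i]
 have inv: "invertible (met E i y)" if "y \<in> P i" for y
  using invertibleI_right[OF pos_def_inv(1)[OF met_pos[OF i that]]] .
 have "smooth_fun_on (P i) (%y. hadj (met E i y) M)"
  unfolding hadj_def
  by (intro smooth_mm[OF o] smooth_matrix_inv[OF o met_smooth[OF i] inv] smooth_const met_smooth[OF i])
 then show ?thesis unfolding imh_def
  by (intro smooth_csm[OF o] smooth_diff[OF o] smooth_const)
qed

text \<open>The symbol of the derivative of \<open>alph\<close> in the direction \<open>v\<close>:
  both differentiations of the section are replaced by pairings with \<open>\<xi>\<close>.\<close>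

definition sym1 :: "complex^'n => 'r cmat => complex^'n => (complex^'n) list => 'r cmat" where
 "sym1 \<xi> M v us = (case us of [w] => csm (- \<i>) (((\<xi> \<bullet> v) * (\<xi> \<bullet> (\<i> *s w))) *\<^sub>R M) | _ => 0)"

lemma sym1_other: "length us ~= 1 ==> sym1 \<xi> M v us = 0"
 by (auto simp: sym1_def split: list.split)

text \<open>The symbol of the variation of the normalised curvature; only the exterior derivative of
  \<open>alph\<close> is of second order in the section.\<close>

definition symG :: "complex^'n => 'r cmat => ('n, 'r cmat) alt" where
 "symG \<xi> M us = csm kk (\<Sum>m<length us. (-1) ^ m *\<^sub>R sym1 \<xi> M (us ! m) (take m us @ drop (Suc m) us))"

text \<open>Lets a function on one patch stand for a section, because an operator in a chart is
  tested on all smooth functions there and not merely on global sections.\<close>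

definition loc :: "(complex^'n => 'r cmat) => ('i, 'n, 'r) endsec" where "loc f = (%i. f)"

lemma list_one_cases: obtains w where "us = [w]" | "length us ~= 1"
 by (auto simp: length_Suc_conv)

lemma dop_alph:
 assumes A: "connection E A" and i: "i \<in> idx E"
 shows "dop (P i) (%f y. alph A (loc f) i y us) (%y \<xi> M. 0)"
proof (cases us rule: list_one_cases)
 case (1 w)
 note o = open_P[OF i]
 have sA: "smooth_fun_on (P i) (%y. A i y v)" for v by (rule connD(1)[OF A i])
 note bm = bb_mm
 let ?R1 = "%y (M :: 'r cmat). A i y [\<i> *s w] ** M" and ?R2 = "%y (M :: 'r cmat). - (M ** A i y [\<i> *s w])"
 have R: "smooth_fun_on (P i) (%y. ?R1 y M)" "smooth_fun_on (P i) (%y. ?R2 y M)" "linear (?R1 y)" "linear (?R2 y)" for y and M :: "'r cmat"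
  by (rule smooth_mm[OF o sA smooth_const] smooth_minus[OF o smooth_mm[OF o smooth_const sA]] linear_mm)+
 have "dop (P i) (%f y. csm (- \<i>) ((fd f y (\<i> *s w) + ?R1 y (f y)) + ?R2 y (f y)))
   (%y \<xi> M. csm (- \<i>) ((0 + ?R1 y 0) + ?R2 y 0))"
  by (intro dop_linear[OF o bl_csm] dop_add[OF o] dop_1[OF o] dop_map[OF o R(1,3) dop_0] dop_map[OF o R(2,4) dop_0])
 then show ?thesis
  by (rule dop_cong) (simp_all add: 1 alph_one loc_def)
next
 case 2
 show ?thesis by (rule dop_cong[OF dop_zero]) (simp_all add: alph_other[OF A i _ 2])
qed

lemma dop_fd_alph:
 assumes A: "connection E A" and i: "i \<in> idx E"
 shows "dop (P i) (%f y. fd (%z. alph A (loc f) i z us) y v) (%y \<xi> M. sym1 \<xi> M v us)"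
proof (cases us rule: list_one_cases)
 case (1 w)
 note o = open_P[OF i]
 have sA: "smooth_fun_on (P i) (%y. A i y v)" for v by (rule connD(1)[OF A i])
 let ?a = "%y. A i y [\<i> *s w]"
 let ?R1 = "%y (M :: 'r cmat). ?a y ** M" and ?R2 = "%y (M :: 'r cmat). - (M ** ?a y)" and ?R3 = "%y (M :: 'r cmat). fd ?a y v ** M" and ?R4 = "%y (M :: 'r cmat). - (M ** fd ?a y v)"
 have R: "smooth_fun_on (P i) (%y. ?R1 y M)" "smooth_fun_on (P i) (%y. ?R2 y M)" "linear (?R1 y)" "linear (?R2 y)"
   "smooth_fun_on (P i) (%y. ?R3 y M)" "smooth_fun_on (P i) (%y. ?R4 y M)" "linear (?R3 y)" "linear (?R4 y)" for y and M :: "'r cmat"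
  by (rule smooth_mm[OF o sA smooth_const] smooth_minus[OF o smooth_mm[OF o smooth_const sA]] linear_mm
    smooth_mm[OF o smooth_deriv[OF sA] smooth_const] smooth_minus[OF o smooth_mm[OF o smooth_const smooth_deriv[OF sA]]])+
 have "dop (P i) (%f y. csm (- \<i>) ((((fd (%z. fd f z (\<i> *s w)) y v + ?R1 y (fd f y v)) + ?R2 y (fd f y v)) + ?R3 y (f y)) + ?R4 y (f y)))
   (%y \<xi> M. csm (- \<i>) (((((\<xi> \<bullet> v) * (\<xi> \<bullet> (\<i> *s w))) *\<^sub>R M + ?R1 y 0) + ?R2 y 0 + ?R3 y 0) + ?R4 y 0))"
  by (intro dop_linear[OF o bl_csm] dop_add[OF o] dop_2[OF o] dop_map[OF o R(1,3) dop_1[OF o]] dop_map[OF o R(2,4) dop_1[OF o]]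
    dop_map[OF o R(5,7) dop_0] dop_map[OF o R(6,8) dop_0])
 then show ?thesis
 proof (rule dop_cong)
  show "sym1 \<xi> M v us = csm (- \<i>) (((((\<xi> \<bullet> v) * (\<xi> \<bullet> (\<i> *s w))) *\<^sub>R M + ?R1 y 0) + ?R2 y 0 + ?R3 y 0) + ?R4 y 0)" for y \<xi> M
   by (simp add: 1 sym1_def)
  fix f :: "complex^'n => 'r cmat" and y assume f: "smooth_fun_on (P i) f" and y: "y \<in> P i"
  have da: "dfb ?a y" by (rule smooth_diff_at[OF sA y])
  have df: "dfb f y" by (rule smooth_diff_at[OF f y])
  have dd: "dfb (%z. fd f z (\<i> *s w)) y" by (rule smooth_diff_at[OF smooth_deriv[OF f] y])
  have e1: "dfb (%z. fd f z (\<i> *s w) + ?a z ** f z) y"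
   by (rule differentiable_add[OF dd differentiable_mm[OF da df]])
  have "fd (%z. alph A (loc f) i z us) y v = fd (%z. csm (- \<i>) ((fd f z (\<i> *s w) + ?a z ** f z) - f z ** ?a z)) y v"
   unfolding 1 alph_one by (simp add: loc_def)
  also have "... = csm (- \<i>) (fd (%z. (fd f z (\<i> *s w) + ?a z ** f z) - f z ** ?a z) y v)"
   by (rule fd_linear[OF differentiable_diff[OF e1 differentiable_mm[OF df da]] bl_csm])
  also have "fd (%z. (fd f z (\<i> *s w) + ?a z ** f z) - f z ** ?a z) y v
   = (fd (%z. fd f z (\<i> *s w)) y v + (fd ?a y v ** f y + ?a y ** fd f y v)) - (fd f y v ** ?a y + f y ** fd ?a y v)"
   unfolding fd_diff[OF e1 differentiable_mm[OF df da]] fd_add[OF dd differentiable_mm[OF da df]]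
    fd_mm[OF da df] fd_mm[OF df da] ..
  finally show "fd (%z. alph A (loc f) i z us) y v
   = csm (- \<i>) ((((fd (%z. fd f z (\<i> *s w)) y v + ?R1 y (fd f y v)) + ?R2 y (fd f y v)) + ?R3 y (f y)) + ?R4 y (f y))"
   by (simp add: algebra_simps)
 qed
next
 case 2
 have s: "sym1 \<xi> M v us = 0" for \<xi> M using 2 by (auto simp: sym1_def split: list.split)
 show ?thesis
 proof (rule dop_cong[OF dop_zero])
  fix f :: "complex^'n => 'r cmat" and y assume y: "y \<in> P i"
  have "fd (%z. alph A (loc f) i z us) y v = fd (%z. 0) y v"
   by (rule fd_cong_open[OF open_P[OF i] y]) (simp add: alph_other[OF A i _ 2])
  then show "fd (%z. alph A (loc f) i z us) y v = 0" by (simp add: frechet_derivative_const)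
 qed (rule s)
qed

lemma dop_G:
 assumes A: "connection E A" and i: "i \<in> idx E"
 shows "dop (P i) (%f y. dA A (alph A (loc f)) i y us) (%y \<xi> M. symG \<xi> M us)"
proof -
 note o = open_P[OF i]
 have z: "wedge_mm f (%us. 0) us = 0" "wedge_mm (%us. 0) f us = 0" for f :: "('n, 'r cmat) alt"
  by (simp_all add: wedge_zero_left[OF bb_mm] wedge_zero_right[OF bb_mm])
 have "dop (P i) (%f y. csm kk ((\<Sum>m<length us. (-1) ^ m *\<^sub>R fd (%z. alph A (loc f) i z (take m us @ drop (Suc m) us)) y (us ! m))
    + wedge_mm (A i y) (alph A (loc f) i y) us + wedge_mm (alph A (loc f) i y) (A i y) us))
   (%y \<xi> M. csm kk ((\<Sum>m<length us. (-1) ^ m *\<^sub>R sym1 \<xi> M (us ! m) (take m us @ drop (Suc m) us))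
    + wedge_mm (A i y) (%us. 0) us + wedge_mm (%us. 0) (A i y) us))"
  by (intro dop_linear[OF o bl_csm] dop_add[OF o] dop_sum[OF o] dop_linear[OF o bounded_linear_scaleR_right]
    dop_fd_alph[OF A i] dop_wedge_right[OF o connD(1)[OF A i] dop_alph[OF A i] bb_mm]
    dop_wedge_left[OF o connD(1)[OF A i] dop_alph[OF A i]] finite_lessThan)
 then show ?thesis
  by (rule dop_cong) (simp_all add: cov_d_def ext_d_def symG_def z)
qed

lemma dop_lin:
 assumes A: "connection E A" and i: "i \<in> idx E"
 shows "dop (P i) (%f y. lin A (loc f) i y vs) (%y \<xi> M. Dcrit i y (curvN A i y) (symG \<xi> M) vs)"
proof -
 note o = open_P[OF i]
 have sF: "smooth_fun_on (P i) (%y. mprod (replicate s (curvN A i y)) us)" for s us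
 proof -
  have "eform (%i y. mprod (map (%B. B i y) (replicate s (curvN A))))"
   by (rule eform_mprod) (use curvN_props(1)[OF A] in auto)
  from bformD(1)[OF this i, of us] show ?thesis by (simp add: map_replicate)
 qed
 have m: "mprod (replicate s F @ G # replicate t F) = wedge_mm (mprod (replicate s F)) (wedge_mm G (mprod (replicate t F)))"
  for s t and F G :: "('n, 'r cmat) alt" by (simp add: mprod_append)
 show ?thesis
  unfolding lin_def Dcrit_def m case_prod_beta
  by (intro dop_map[OF o smooth_imh[OF i] bounded_linear.linear[OF bounded_linear_imh]] dop_linear[OF o bl_csm]
    dop_sum[OF o finite_I(1)] dop_wedge_right[OF o bformD(1)[OF sform_cw i] _ bb_csm]
    dop_sum[OF o finite_lessThan] dop_wedge_right[OF o sF _ bb_mm] dop_wedge_left[OF o sF dop_G[OF A i]])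
qed

text \<open>The adjoint reverses each word, without sign since all degrees are even, and the sum
  over the position of \<open>G\<close> is invariant under reversal. So the imaginary part again
  falls on the coefficients.\<close>

lemma Dcrit_herm:
 assumes iy: "i \<in> idx E" "y \<in> P i" and F: "homog 2 F" "adj_form (met E i y) F = F" and G: "homog 2 G" "adj_form (met E i y) G = G"
 shows "Dcrit i y F G vs = (\<Sum>(d, j, l)\<in>I0. kap d j *\<^sub>R
  wedge_cm (cw d l i y) (%us. \<Sum>s<j. mprod (replicate s F @ G # replicate (j - 1 - s) F) us) vs)"
proof -
 let ?H = "met E i y"
 have H: "pos_def_herm ?H" by (rule met_pos[OF iy])
 note aF = adj_power[OF H F] and hF = homog_replicate[OF F(1)]
 have m: "mprod (replicate s F @ G # replicate t F) = wedge_mm (mprod (replicate s F)) (wedge_mm G (mprod (replicate t F)))" for s t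
  by (simp add: mprod_append)
 have adj: "hadj ?H (mprod (replicate s F @ G # replicate t F) us) = mprod (replicate t F @ G # replicate s F) us" for s t us
 proof -
  have hGF: "homog (2 + 2 * t) (wedge_mm G (mprod (replicate t F)))"
   using homog_wedge[OF bb_mm G(1) hF[of t]] by (simp add: mult.commute)
  have 1: "adj_form ?H (wedge_mm G (mprod (replicate t F))) = wedge_mm (mprod (replicate t F)) G"
  proof
   fix us
   show "adj_form ?H (wedge_mm G (mprod (replicate t F))) us = wedge_mm (mprod (replicate t F)) G us"
    using adj_wedge[OF H G(1) hF[of t], of us] by (simp add: adj_form_def[of _ "wedge_mm _ _"] aF G(2))
  qed
  have "hadj ?H (mprod (replicate s F @ G # replicate t F) us) = wedge_mm (wedge_mm (mprod (replicate t F)) G) (mprod (replicate s F)) us"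
   unfolding m using adj_wedge[OF H hF[of s] hGF, of us] by (simp add: 1 aF)
  then show ?thesis unfolding m wedge_mm_assoc .
 qed
 let ?X = "%j us. \<Sum>s<j. mprod (replicate s F @ G # replicate (j - 1 - s) F) us"
 have X: "adj_form ?H (?X j) = ?X j" for j
 proof
  fix us
  have "adj_form ?H (?X j) us = (\<Sum>s<j. mprod (replicate (j - 1 - s) F @ G # replicate s F) us)"
   unfolding adj_form_def hadj_sum adj ..
  also have "... = (\<Sum>s<j. mprod (replicate (j - Suc s) F @ G # replicate (j - 1 - (j - Suc s)) F) us)"
   by (intro sum.cong refl) auto
  also have "... = ?X j us" by (rule sum.nat_diff_reindex)
  finally show "adj_form ?H (?X j) us = ?X j us" .
 qed
 have Y: "hadj ?H (wedge_cm (cw d l i y) (?X j) vs) = wedge_cm (cw d l i y) (?X j) vs" for d j l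
  unfolding hadj_wedge_cm cw_real X ..
 note li = bounded_linear.linear[OF bounded_linear_imh[of ?H]]
 show ?thesis
  unfolding Dcrit_def csm_sum linear_sum[OF li] case_prod_beta imh_herm[OF Y] kap_def ..
qed

text \<open>\<open>q \<xi>\<close> is the (0,1)-part of the covector \<open>\<xi>\<close>, and its
  conjugate is the (1,0)-part. To leading order the curvature varies by minus twice the
  (1,0)-derivative of the (0,1)-derivative of the section; the factor i/(2\<pi>) makes this
  -i/\<pi>.\<close>

lemma symG_eq:
 defines "q \<equiv> %\<xi> us. case us of [v] => (complex_of_real (\<xi> \<bullet> v) + \<i> * complex_of_real (\<xi> \<bullet> (\<i> *s v))) / 2 | _ => 0"
 shows "symG \<xi> M us = csm (- \<i> / pi) (wedge_cm (%us. cnj (q \<xi> us)) (wedge_cm (q \<xi>) (form0 M)) us)"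
proof -
 have hq: "homog 1 (q \<xi>)" "homog 1 (%us. cnj (q \<xi> us))" by (auto simp: homog_def q_def split: list.split)
 have w: "wedge_cm (q \<xi>) (form0 M) us = csm (q \<xi> us) M" for us by (rule wedge_form0[OF bb_csm])
 have hw: "homog 1 (wedge_cm (q \<xi>) (form0 M))" using hq(1) by (simp add: homog_def w)
 show ?thesis
 proof (cases "length us = 2")
  case True
  then obtain v u where us: "us = [v, u]" by (metis One_nat_def Suc_1 length_0_conv length_Suc_conv)
  have "wedge_cm (%us. cnj (q \<xi> us)) (wedge_cm (q \<xi>) (form0 M)) us
    = csm (cnj (q \<xi> [v]) * q \<xi> [u] - cnj (q \<xi> [u]) * q \<xi> [v]) M"
   unfolding us wedge_two[OF bb_csm hq(2) hw] w by (simp add: csm_diff)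
  also have "cnj (q \<xi> [v]) * q \<xi> [u] - cnj (q \<xi> [u]) * q \<xi> [v]
    = complex_of_real ((\<xi> \<bullet> v) * (\<xi> \<bullet> (\<i> *s u)) - (\<xi> \<bullet> u) * (\<xi> \<bullet> (\<i> *s v))) * \<i> / 2"
   by (simp add: q_def field_simps)
  finally have R: "wedge_cm (%us. cnj (q \<xi> us)) (wedge_cm (q \<xi>) (form0 M)) us =
    csm (complex_of_real ((\<xi> \<bullet> v) * (\<xi> \<bullet> (\<i> *s u)) - (\<xi> \<bullet> u) * (\<xi> \<bullet> (\<i> *s v))) * \<i> / 2) M" .
  have "symG \<xi> M us = csm (kk * (- \<i>) * complex_of_real ((\<xi> \<bullet> v) * (\<xi> \<bullet> (\<i> *s u)) - (\<xi> \<bullet> u) * (\<xi> \<bullet> (\<i> *s v)))) M"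
  proof -
   have "symG \<xi> M us = csm kk (csm (- \<i>) (((\<xi> \<bullet> v) * (\<xi> \<bullet> (\<i> *s u))) *\<^sub>R M) - csm (- \<i>) (((\<xi> \<bullet> u) * (\<xi> \<bullet> (\<i> *s v))) *\<^sub>R M))"
    unfolding symG_def us by (simp add: sym1_def numeral_2_eq_2 lessThan_Suc)
   then show ?thesis by (simp add: scaleR_csm csm_diff(2)[symmetric] right_diff_distrib mult.assoc del: csm_minus)
  qed
  moreover have "kk * (- \<i>) * x = (- \<i> / pi) * (x * \<i> / 2)" for x by (simp add: field_simps)
  ultimately show ?thesis by (simp only: R csm_csm)
 next
  case False
  have "homog (1 + 1) (wedge_cm (%us. cnj (q \<xi> us)) (wedge_cm (q \<xi>) (form0 M)))"
   by (rule homog_wedge[OF bb_csm hq(2) hw])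
  moreover have "sym1 \<xi> M (us ! m) (take m us @ drop (Suc m) us) = 0" if "m < length us" for m
  proof -
   have "length (take m us @ drop (Suc m) us) ~= 1" using False that by auto
   then show ?thesis by (rule sym1_other)
  qed
  ultimately show ?thesis using False by (simp add: homog_def symG_def)
 qed
qed

text \<open>The symbol is a real-linear endomorphism of the fibre of Hermitian endomorphisms, since
  imaginary parts are Hermitian. A Hermitian \<open>M\<close> in its kernel makes the subsolution
  expression vanish at a test vector that is non-zero unless \<open>M\<close> is.\<close>

theorem lin_elliptic:
 assumes A: "A \<in> subsolution_space E Z" shows "linear_elliptic_operator E (lin A)"
proof -
 have U: "unitary_connection E A" and sub: "subsolution E Z A"
  using A by (auto simp: subsolution_space_def chern_space_def)
 note con = unitaryD(1)[OF U]
 have "\<forall>i\<in>idx E. \<exists>c. coeffs (P i) c (%f y. lin A (loc f) i y std_frame) (%y \<xi> M. Dcrit i y (curvN A i y) (symG \<xi> M) std_frame)"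
  by (intro ballI dop_lin[OF con, unfolded dop_def])
 from bchoice[OF this] obtain c where
  "\<forall>i\<in>idx E. coeffs (P i) (c i) (%f y. lin A (loc f) i y std_frame) (%y \<xi> M. Dcrit i y (curvN A i y) (symG \<xi> M) std_frame)" by blast
 note c = coeffsD[OF this[rule_format]]
 have bij: "bij_betw (symbol 2 (c i y) \<xi>) {M. hadj (met E i y) M = M} {M. hadj (met E i y) M = M}"
  if iy: "i \<in> idx E" "y \<in> P i" and \<xi>: "\<xi> ~= 0" for i y \<xi>
 proof (rule linear_bij_betw_subspace)
  let ?H = "met E i y" and ?F = "curvN A i y"
  have H: "pos_def_herm ?H" by (rule met_pos[OF iy])
  have sym: "symbol 2 (c i y) \<xi> M = Dcrit i y ?F (symG \<xi> M) std_frame" for M by (rule c(4)[OF iy])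
  have lc: "linear (c i y ks)" for ks by (rule c(2)[OF iy])
  show "linear (symbol 2 (c i y) \<xi>)"
   unfolding symbol_def[abs_def]
   by (rule linearI) (simp_all add: linear_add[OF lc] linear_scale[OF lc] scaleR_add_right sum.distrib scaleR_sum_right mult.commute)
  show "subspace {M. hadj ?H M = M}"
   unfolding subspace_def by (simp add: hadj_add hadj_scaleR)
  show "symbol 2 (c i y) \<xi> ` {M. hadj ?H M = M} \<subseteq> {M. hadj ?H M = M}"
   unfolding sym Dcrit_def using hadj_imh[OF H] by auto
  fix M assume "M \<in> {M. hadj ?H M = M}" and S0: "symbol 2 (c i y) \<xi> M = 0"
  then have M: "hadj ?H M = M" by simp
  define q where "q us = (case us of [v] => (complex_of_real (\<xi> \<bullet> v) + \<i> * complex_of_real (\<xi> \<bullet> (\<i> *s v))) / 2 | _ => 0)" for us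
  \<comment> \<open>The test vector built from the (0,1)-part of \<open>\<xi>\<close> and
    \<open>M\<close>; as \<open>M\<close> is Hermitian, its adjoint is built from the conjugate
    covector and \<open>M\<close>.\<close>
  define u where "u = wedge_cm q (form0 M)"
  define us' where "us' = wedge_cm (%us. cnj (q us)) (form0 M)"
  have hq: "homog 1 q" "homog 1 (%us. cnj (q us))" by (auto simp: homog_def q_def split: list.split)
  have uv: "u vs = csm (q vs) M" "us' vs = csm (cnj (q vs)) M" for vs
   unfolding u_def us'_def by (rule wedge_form0[OF bb_csm])+
  have hu: "homog 1 u" "homog 1 us'" using hq by (simp_all add: homog_def uv)
  have au: "adj_form ?H u = us'" by (rule ext) (simp add: adj_form_def uv hadj_csm M)
  have G: "symG \<xi> M = (%vs. csm (- \<i> / pi) (wedge_cm (%us. cnj (q us)) u vs))"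
   unfolding u_def q_def by (rule ext) (rule symG_eq)
  note hF = curvN_props(2)[OF con iy] and aF = curvN_herm[OF U iy]
  have hw: "homog 2 (wedge_cm (%us. cnj (q us)) u)"
   using homog_wedge[OF bb_csm hq(2) hu(1)] by (simp add: numeral_2_eq_2)
  have hG: "homog 2 (symG \<xi> M)" unfolding G using hw by (simp add: homog_def)
  have aG: "adj_form ?H (symG \<xi> M) = symG \<xi> M"
  proof
   fix vs
   show "adj_form ?H (symG \<xi> M) vs = symG \<xi> M vs"
   proof -
    have s: "sym1 \<xi> M v ws = csm (- \<i>) (csm (case ws of [w] => complex_of_real ((\<xi> \<bullet> v) * (\<xi> \<bullet> (\<i> *s w))) | _ => 0) M)" for v ws
     by (simp add: sym1_def scaleR_csm split: list.split)
    have r: "hadj ?H (csm kk (sym1 \<xi> M v ws)) = csm kk (sym1 \<xi> M v ws)" for v ws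
     unfolding s by (simp add: hadj_csm M split: list.split)
    show ?thesis unfolding adj_form_def symG_def csm_sum hadj_sum
    proof (intro sum.cong refl)
     fix m
     have "csm kk ((-1) ^ m *\<^sub>R sym1 \<xi> M v ws) = (-1) ^ m *\<^sub>R csm kk (sym1 \<xi> M v ws)" for v ws
      by (simp add: scaleR_csm mult.commute)
     then show "hadj ?H (csm kk ((- 1) ^ m *\<^sub>R sym1 \<xi> M (vs ! m) (take m vs @ drop (Suc m) vs))) =
       csm kk ((- 1) ^ m *\<^sub>R sym1 \<xi> M (vs ! m) (take m vs @ drop (Suc m) vs))"
      using r by (simp add: hadj_scaleR)
    qed
   qed
  qed
  \<comment> \<open>The conjugate covector is a scalar one-form. It moves past the curvature
    factors, whose degrees are even, to the matrix \<open>M\<close> in front, and the word of the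
    symbol becomes a word in the adjoint of \<open>u\<close> and \<open>u\<close>.\<close>
  have word: "trace (mprod (form0 M # replicate s ?F @ symG \<xi> M # replicate t ?F) vs)
    = (- \<i> / pi) * trace (mprod (us' # replicate s ?F @ u # replicate t ?F) vs)" for s t vs
  proof -
   let ?Fs = "mprod (replicate s ?F)" and ?Ft = "mprod (replicate t ?F)"
   have comm: "wedge_mm (mprod (replicate s ?F)) (wedge_cm p C) = wedge_cm p (wedge_mm (mprod (replicate s ?F)) C)" if "homog 1 p" for p C
    using wedge_mm_scalar[OF homog_replicate[OF hF, of s] that] by (intro ext) simp
   have comm0: "wedge_mm (form0 M) (wedge_cm p C) = wedge_cm p (wedge_mm (form0 M) C)" if "homog 1 p" for p C
    using wedge_mm_scalar[OF homog_form0 that, of M C] by (intro ext) simp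
   have "mprod (form0 M # replicate s ?F @ symG \<xi> M # replicate t ?F) vs
    = csm (- \<i> / pi) (mprod (form0 M # replicate s ?F @ wedge_cm (%us. cnj (q us)) u # replicate t ?F) vs)"
    unfolding G using mprod_csm[of "form0 M # replicate s ?F" "- \<i> / pi" "wedge_cm (%us. cnj (q us)) u" "replicate t ?F" vs]
    by (simp only: append_Cons)
   moreover have "mprod (form0 M # replicate s ?F @ wedge_cm (%us. cnj (q us)) u # replicate t ?F)
    = mprod (us' # replicate s ?F @ u # replicate t ?F)"
    unfolding u_def us'_def mprod_Cons mprod_append wedge_cm_mm comm[OF hq(1)] comm[OF hq(2)] comm0[OF hq(1)] comm0[OF hq(2)] ..
   ultimately show ?thesis by simp
  qed
  have D: "Dcrit i y ?F (symG \<xi> M) std_frame = 0" using S0 sym by simp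
  have l: "linear (%N :: 'r cmat. trace (M ** N))"
   by (rule linearI) (simp_all add: mm_add mm_scaleR trace_add_c)
  have tw: "trace (M ** wedge_cm c f vs) = wedge_cc c (%us. trace (M ** f us)) vs" for c f vs
   unfolding wedge_linear_out[OF l] by (simp add: wedge_def csm_mm)
  have tX: "(\<Sum>s<j. trace (M ** mprod (replicate s ?F @ symG \<xi> M # replicate (j - 1 - s) ?F) us))
    = (- \<i> / pi) * (if j = 0 then 0 else W2 (j - 1) ?F us' u us)" for j us
  proof -
   have f0: "M ** mprod Bs us = mprod (form0 M # Bs) us" for Bs by (simp add: form0_wedge[OF bb_mm])
   have "(\<Sum>s<j. trace (M ** mprod (replicate s ?F @ symG \<xi> M # replicate (j - 1 - s) ?F) us))
    = (\<Sum>s<j. (- \<i> / pi) * trace (mprod (us' # replicate s ?F @ u # replicate (j - 1 - s) ?F) us))"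
    unfolding f0 word ..
   then show ?thesis unfolding sum_distrib_left[symmetric] by (cases j) (simp_all add: W2_def lessThan_Suc_atMost del: mprod_Cons)
  qed
  \<comment> \<open>Multiplying by \<open>M\<close> under the trace supplies the second marked
    factor of each word, so the sum over positions is \<open>W2\<close>, and the whole is a multiple
    of the subsolution expression.\<close>
  have "0 = trace (M ** Dcrit i y ?F (symG \<xi> M) std_frame)" unfolding D by simp
  also have "... = wsum I0 (%j i y us. (- \<i> / pi) * (if j = 0 then 0 else W2 (j - 1) ?F us' u us)) i y std_frame"
   unfolding Dcrit_herm[OF iy hF aF hG aG] linear_sum[OF l] case_prod_beta linear_scale[OF l] tw tX wsum_def ..
  also have "... = wsum I1 (%j i y us. (- \<i> / pi) * (if j = 0 then 0 else W2 (j - 1) ?F us' u us)) i y std_frame"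
   by (rule wsum_I0) simp
  also have "... = wsum I1 (%j i y us. (- \<i> / pi) * W2 (j - 1) ?F us' u us) i y std_frame"
   by (rule wsum_cong) (auto simp: I1_def)
  also have "... = (- \<i> / pi) * trace (fsym (fpost (Im_Zprime E Z A i y) [(1, us'), (1, u)]) std_frame)"
   unfolding wsum_cmult trace_fpost[OF U iy hu(2) hu(1)] wsum_def ..
  finally have T0: "trace (fsym (fpost (Im_Zprime E Z A i y) [(1, us'), (1, u)]) std_frame) = 0" by simp
  show "M = 0"
  proof (rule ccontr)
   assume M0: "M ~= 0"
   have iv: "q [\<i> *s v] = - \<i> * q [v]" for v
    by (simp add: q_def ii_vec algebra_simps)
   have "altform 1 u"
   proof -
    have lq: "linear (%v. csm (q [v]) M)"
    proof (rule linearI)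
     have "q [v + w] = q [v] + q [w]" for v w
      by (simp add: q_def linear_add[OF linear_i] inner_add_right add_divide_distrib distrib_left)
     then show "csm (q [v + w]) M = csm (q [v]) M + csm (q [w]) M" for v w by (simp add: csm_add)
     have "q [r *\<^sub>R v] = complex_of_real r * q [v]" for r v
      by (simp add: q_def linear_scale[OF linear_i] inner_scaleR_right distrib_left mult.left_commute)
     then show "csm (q [r *\<^sub>R v]) M = r *\<^sub>R csm (q [v]) M" for r v by (simp add: scaleR_csm)
    qed
    show ?thesis unfolding altform_def
    proof (intro conjI allI impI)
     show "u vs = 0" if "length vs ~= 1" for vs using hu(1) that by (simp add: homog_def)
     show "linear (%v. u (vs[m := v]))" if h: "length vs = 1 & m < 1" for vs m
     proof -
      obtain w where "vs = [w]" "m = 0" using h by (auto simp: length_Suc_conv)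
      then show ?thesis using lq by (simp add: uv)
     qed
     show "u vs = 0" if h: "length vs = 1 & \<not> distinct vs" for vs using h by (auto simp: length_Suc_conv)
    qed
   qed
   moreover have "u [\<i> *s v] = csm (- \<i>) (u [v])" for v unfolding uv iv by simp
   \<comment> \<open>Evaluation at \<open>\<xi>\<close> itself: the real part of
     \<open>q [\<xi>]\<close> is half the squared length of \<open>\<xi>\<close>.\<close>
   moreover have "u [\<xi>] ~= 0"
   proof
    assume u0: "u [\<xi>] = 0"
    have "Re (q [\<xi>]) = (\<xi> \<bullet> \<xi>) / 2" by (simp add: q_def)
    then have "q [\<xi>] ~= 0" using \<xi> by (metis divide_eq_0_iff inner_eq_zero_iff zero_complex.sel(1) zero_neq_numeral)
    then have "M = csm (1 / q [\<xi>]) (u [\<xi>])" unfolding uv by simp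
    then show False using u0 M0 by simp
   qed
   ultimately have "Re (trace (csm \<i> (fsym (fpost (Im_Zprime E Z A i y) [(1, adj_form ?H u), (1, u)]) std_frame))) > 0"
    using sub iy unfolding subsolution_def Let_def by blast
   then show False unfolding au trace_csm T0 by simp
  qed
 qed
 show ?thesis
  unfolding linear_elliptic_operator_def
 proof (intro exI[of _ 2] exI[of _ c] ballI conjI allI impI)
  fix i assume i: "i \<in> idx E"
  show "smooth_fun_on (P i) (%y. c i y ks M)" for ks M by (rule c(1)[OF i])
  fix y assume y: "y \<in> P i"
  show "linear (c i y ks)" for ks by (rule c(2)[OF i y])
  show "bij_betw (symbol 2 (c i y) \<xi>) {M. hadj (met E i y) M = M} {M. hadj (met E i y) M = M}" if "\<xi> ~= 0" for \<xi>
   by (rule bij[OF i y that])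
  fix V assume V: "herm_section E V"
  then have "smooth_fun_on (P i) (V i)" using endsecD(2)[OF _ i] by (simp add: herm_section_def)
  then have "lin A (loc (V i)) i y std_frame = (\<Sum>ks\<in>{ks. set ks \<subseteq> Basis & length ks <= 2}. c i y ks (iter_deriv ks (V i) y))"
   by (rule c(3)[OF i y])
  moreover have "lin A (loc (V i)) i y = lin A V i y"
  proof -
   have "alph A (loc (V i)) i = alph A V i" by (intro ext) (simp add: alph_def Jf_def cov_d_0 loc_def)
   then show ?thesis by (simp add: lin_def cov_d_def)
  qed
  ultimately show "lin A V i y std_frame = (\<Sum>ks\<in>{ks. set ks \<subseteq> Basis & length ks <= 2}. c i y ks (iter_deriv ks (V i) y))" by simp
 qed
qed

end

theorem theorem1p4:
 fixes E :: "('i, 'x::t2_space, 'n::finite, 'r::finite) herm_bundle"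
  and Z :: "('i, 'n) pcharge"
 assumes "hermitian_holomorphic_bundle E"
  and "polynomial_charge E Z"
  and "central_charge E Z \<noteq> 0"
 shows
  "(\<forall>A\<in>subsolution_space E Z. \<exists>L. linearisation_D_Z E Z A L \<and> linear_elliptic_operator E L)
   \<and>
   (\<forall>A\<in>subsolution_space E Z. closed_two_form_at (Omega_Z E Z) A (tangent_space E A))
   \<and>
   (\<forall>A\<in>subsolution_space E Z. \<forall>a\<in>tangent_space E A.
    (\<forall>b\<in>tangent_space E A. Omega_Z E Z A a b = 0) \<longrightarrow> form_eq E a (\<lambda>i y vs. 0))
   \<and>
   (\<forall>g\<in>gauge_group E. \<forall>A\<in>subsolution_space E Z.
    gauge_act g A \<in> subsolution_space E Z \<and>
    (\<forall>a\<in>tangent_space E A. \<forall>b\<in>tangent_space E A.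
      conj_form g a \<in> tangent_space E (gauge_act g A) \<and>
      Omega_Z E Z (gauge_act g A) (conj_form g a) (conj_form g b) = Omega_Z E Z A a b))
   \<and>
   (\<forall>g\<in>gauge_group E. \<forall>A\<in>subsolution_space E Z.
    form_eq E (moment_map E Z (gauge_act g A)) (conj_form g (moment_map E Z A)))
   \<and>
   (\<forall>A\<in>subsolution_space E Z. \<forall>\<phi>. skew_section E \<phi> \<longrightarrow> (\<forall>b\<in>tangent_space E A.
    ((\<lambda>t. pairing E (moment_map E Z (conn_add A t b)) \<phi>) has_vector_derivative
      - Omega_Z E Z A (cov_d A 0 (\<lambda>i y. form0 (\<phi> i y))) b) (at 0)))"
proof -
 interpret zbdl E Z by unfold_locales (rule assms)+
 have U: "unitary_connection E A" if "A \<in> subsolution_space E Z" for A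
  using that by (simp add: subsolution_space_def chern_space_def)
 show ?thesis
 proof (intro conjI ballI allI impI)
  fix A assume A: "A \<in> subsolution_space E Z"
  note uA = U[OF A]
  show "\<exists>L. linearisation_D_Z E Z A L & linear_elliptic_operator E L"
   using linearise[OF unitaryD(1)[OF uA]] lin_elliptic[OF A] by blast
  show "closed_two_form_at (Omega_Z E Z) A (tangent_space E A)"
   unfolding closed_two_form_at_def by (intro ballI Omega_closed uA tangent_skew)
  show "form_eq E a (%i y vs. 0)" if "a \<in> tangent_space E A" "\<forall>b\<in>tangent_space E A. Omega_Z E Z A a b = 0" for a
   by (rule Omega_nondegenerate[OF A that(1)]) (use that(2) in blast)
  show "((%t. pairing E (moment_map E Z (conn_add A t b)) \<phi>) has_vector_derivative
      - Omega_Z E Z A (cov_d A 0 (%i y. form0 (\<phi> i y))) b) (at 0)"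
   if "skew_section E \<phi>" "b \<in> tangent_space E A" for \<phi> b
   using that by (intro moment_map_derivative uA tangent_skew) (simp_all add: skew_section_def)
  fix g assume G: "g \<in> gauge_group E"
  show "gauge_act g A \<in> subsolution_space E Z" by (rule gauge_subsolution[OF G A])
  show "form_eq E (moment_map E Z (gauge_act g A)) (conj_form g (moment_map E Z A))"
   by (rule gauge_moment_map[OF G uA])
  fix a b assume a: "a \<in> tangent_space E A" and b: "b \<in> tangent_space E A"
  show "conj_form g a \<in> tangent_space E (gauge_act g A)" by (rule gauge_tangent[OF G uA a])
  show "Omega_Z E Z (gauge_act g A) (conj_form g a) (conj_form g b) = Omega_Z E Z A a b"
   by (rule gauge_Omega[OF G uA tangent_skew[OF a] tangent_skew[OF b]])
 qed
qed

end
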